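(* Let $\Omega\subset\mathbb{R}^d$ be convex and compact and $\vartheta>0$. Then for every $p>2$ there exists a constant $C$, depending only on $d$, $\operatorname{diam}\Omega$, $\vartheta$ and $p$ and growing linearly in $p$, such that for all $\mu,\nu\in\mathcal{K}_\vartheta$, $$\operatorname{dist}_{W_2}(\mathcal{M}_\mu,\mathcal{M}_\nu)\le C\,W_2(\mu,\nu)^{\frac{p-2}{6p-4}}.$$
   Context: $\Theta(\mu)=\inf_{\theta\in\mathbb{S}^{d-1}}\int_{\mathbb{R}^d}|y\cdot\theta|\,d\mu(y)$ and $\mathcal{K}_\vartheta=\{\mu\in\mathscr{P}(\Omega):\ \mu\text{ has barycenter at the origin and }\Theta(\mu)\ge\vartheta\}$. For $\mu\in\mathscr{P}_1(\mathbb{R}^d)$, $\mathscr{E}_\mu(\varrho)=H(\varrho)+\mathcal{T}(\varrho,\mu)$ with $H(\varrho)=\int\varrho\log\varrho$ if $\varrho\ll$ Lebesgue ($+\infty$ otherwise) and $\mathcal{T}(\varrho,\mu)=\sup_{\gamma\in\Pi(\varrho,\mu)}\int\langle x,y\rangle d\gamma$; $\mathcal{M}_\mu=\operatorname{argmin}_{\mathscr{P}_1(\mathbb{R}^d)}\mathscr{E}_\mu$ (the set of Gibbs measures $e^{-\psi}$ of moment measure representations $\mu=(\nabla\psi)_\sharp e^{-\psi}$, unique up to translation). $W_2$ is the quadratic Wasserstein distance and $\operatorname{dist}_{W_2}(A,B)=\inf_{a\in A,b\in B}W_2(a,b)$. *)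

theory Defs
  imports "HOL-Probability.Probability"
begin

text \<open>Dimension d is fixed by the euclidean_space type 'a (d = DIM('a)).\<close>

definition prob_measures :: "'a::euclidean_space measure set" where
  "prob_measures = {\<mu>. sets \<mu> = sets borel \<and> prob_space \<mu>}"

definition prob_on :: "'a::euclidean_space set \<Rightarrow> 'a measure set" where
  "prob_on \<Omega> = {\<mu> \<in> prob_measures. emeasure \<mu> \<Omega> = 1}"

definition prob_1 :: "'a::euclidean_space measure set" where
  "prob_1 = {\<mu> \<in> prob_measures. integrable \<mu> norm}"

definition couplings :: "'a::euclidean_space measure \<Rightarrow> 'a measure \<Rightarrow> ('a \<times> 'a) measure set" where
  "couplings \<mu> \<nu> = {\<gamma>. sets \<gamma> = sets borel \<and> prob_space \<gamma> \<and>
      distr \<gamma> borel fst = \<mu> \<and> distr \<gamma> borel snd = \<nu>}"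

definition W2_sq :: "'a::euclidean_space measure \<Rightarrow> 'a measure \<Rightarrow> ennreal" where
  "W2_sq \<mu> \<nu> = (INF \<gamma>\<in>couplings \<mu> \<nu>. \<integral>\<^sup>+ z. ennreal ((norm (fst z - snd z))\<^sup>2) \<partial>\<gamma>)"

definition W2 :: "'a::euclidean_space measure \<Rightarrow> 'a measure \<Rightarrow> ennreal" where
  "W2 \<mu> \<nu> = (if W2_sq \<mu> \<nu> = \<infinity> then \<infinity> else ennreal (sqrt (enn2real (W2_sq \<mu> \<nu>))))"

definition dist_W2 :: "'a::euclidean_space measure set \<Rightarrow> 'a measure set \<Rightarrow> ennreal" where
  "dist_W2 A B = (INF a\<in>A. INF b\<in>B. W2 a b)"

definition Theta :: "'a::euclidean_space measure \<Rightarrow> real" where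
  "Theta \<mu> = Inf ((\<lambda>\<theta>. \<integral> y. \<bar>y \<bullet> \<theta>\<bar> \<partial>\<mu>) ` sphere 0 1)"

definition K_set :: "'a::euclidean_space set \<Rightarrow> real \<Rightarrow> 'a measure set" where
  "K_set \<Omega> th = {\<mu> \<in> prob_on \<Omega>. (\<integral> y. y \<partial>\<mu>) = 0 \<and> Theta \<mu> \<ge> th}"

text \<open>Entropy: integral of rho log rho for rho absolutely continuous (density w.r.t.
  Lebesgue measure), +infinity otherwise.  Written as positive part minus negative part.\<close>
definition entropy_H :: "'a::euclidean_space measure \<Rightarrow> ereal" where
  "entropy_H \<rho> = (if absolutely_continuous lborel \<rho> then
     (let f = (\<lambda>x. enn2real (RN_deriv lborel \<rho> x)) in
       enn2ereal (\<integral>\<^sup>+ x. ennreal (f x * ln (f x)) \<partial>lborel)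
       - enn2ereal (\<integral>\<^sup>+ x. ennreal (- (f x * ln (f x))) \<partial>lborel))
   else \<infinity>)"

definition transport_T :: "'a::euclidean_space measure \<Rightarrow> 'a measure \<Rightarrow> ereal" where
  "transport_T \<rho> \<mu> = (SUP \<gamma>\<in>couplings \<rho> \<mu>. ereal (\<integral> z. fst z \<bullet> snd z \<partial>\<gamma>))"

definition energy_E :: "'a::euclidean_space measure \<Rightarrow> 'a measure \<Rightarrow> ereal" where
  "energy_E \<mu> \<rho> = entropy_H \<rho> + transport_T \<rho> \<mu>"

definition M_set :: "'a::euclidean_space measure \<Rightarrow> 'a measure set" where
  "M_set \<mu> = {\<rho> \<in> prob_1. \<forall>\<sigma>\<in>prob_1. energy_E \<mu> \<rho> \<le> energy_E \<mu> \<sigma>}"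

end

theory Submission
  imports Defs "HOL-Complex_Analysis.Great_Picard"
begin

text \<open>
The measures in \<open>M_set \<mu>\<close> are found from the dual problem of minimising
\<open>J(\<psi>, f) = \<integral> f d\<mu> - ln \<integral> exp (-\<psi>)\<close> over pairs with \<open>x \<bullet> y \<le> \<psi> x + f y\<close>: a minimiser exists by
compactness of Lipschitz functions, and Kantorovich duality shows that its Gibbs measure
\<open>exp (-\<psi>) / Z\<close> minimises the energy.

For two such measures, the average of \<open>f\<close> for \<open>\<mu>\<close> and a Legendre transform truncated at radius \<open>R\<close> for
\<open>\<nu>\<close> is a competitor in the dual problem. Optimality then bounds the deficit in the
Prekopa-Leindler inequality for the two Gibbs densities, with an error of order \<open>R w + 1 / R^2\<close>, where
\<open>w = W2 \<mu> \<nu>\<close>. The deficit controls the distance: applying the inequality along Knothe maps to the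
densities multiplied by a Gaussian of variance \<open>s\<close> gives, for centered densities,
\<open>W2^2 \<le> C (s * deficit + 1 / s)\<close>. Taking \<open>R = s = w powr (-1/3)\<close> yields the exponent \<open>1/6\<close> for \<open>W2\<close>,
which is at least \<open>(p - 2) / (6 * p - 4)\<close> for every \<open>p > 2\<close>; as \<open>w\<close> is bounded, the smaller exponent follows.
\<close>

section \<open>One-dimensional transport and the Prekopa-Leindler inequality\<close>

text \<open>Minimisers of the energy come in whole translation classes, so two of them can be
  compared only after choosing representatives, and the centered choice is what makes the Gaussian
  localisation work. If the barycenters differed, the convolved densities would be at squared
  Hellinger distance of order \<open>1 / s\<close>, and this error, multiplied by \<open>s\<close>,
  would not tend to zero; with both barycenters at the origin the first order terms cancel and
  \<open>1 / s^2\<close> remains. The cubic power in the cutoff error matches the target: a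
  remainder \<open>norm y ^ k / R ^ (k - 1)\<close> leads to the exponent
  \<open>(k - 1) / (4 * k)\<close>, which is \<open>1/6\<close> for \<open>k = 3\<close>, the limit
  of the claimed exponents as \<open>p\<close> grows. The price is a bound on sixth moments, because
  a third power is paired with the geometric mean of two weights. These moments are bounded
  uniformly since \<open>th\<close> forces the potentials to grow linearly at rate
  \<open>th / 2\<close>.\<close>

lemma emeasure_le_lborel_if_intervals:
  fixes \<eta> :: "real measure"
  assumes sets[measurable_cong]: "sets \<eta> = sets borel"
    and le: "\<And>a b. a \<le> b \<Longrightarrow> emeasure \<eta> {a<..b} \<le> ennreal (b - a)"
    and A: "A \<in> sets borel"
  shows "emeasure \<eta> A \<le> emeasure lborel A"
proof -
  have op: "emeasure \<eta> U \<le> emeasure lborel U" if U: "open U" for U :: "real set"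
  proof -
    \<comment> \<open>Dyadic cells are half-open, so each generation \<open>n\<close> partitions the
      line and matches the intervals of the hypothesis \<open>le\<close>. The cells of generation
      \<open>n\<close> contained in \<open>U\<close> exhaust \<open>U\<close> as \<open>n\<close>
      grows.\<close>
    define c where "c n k = {real_of_int k / 2^n <.. (real_of_int k + 1) / 2^n}" for n k
    define K where "K n = {k. c n k \<subseteq> U}" for n
    define V where "V n = (\<Union>k\<in>K n. c n k)" for n
    have c_iff: "x \<in> c n k \<longleftrightarrow> \<lceil>x * 2^n\<rceil> = k + 1" for x n k
      by (auto simp: c_def ceiling_eq_iff field_simps)
    have cb[measurable]: "c n k \<in> sets borel" for n k
      by (simp add: c_def)
    have disj: "disjoint_family_on (c n) (K n)" for n
      unfolding disjoint_family_on_def by (auto simp: c_iff)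
    \<comment> \<open>A cell of the next generation lies in the cell of half its index, rounded
      down; this makes \<open>V\<close> increasing.\<close>
    have cc: "c (Suc n) k \<subseteq> c n (k div 2)" for n k
    proof
      fix x assume "x \<in> c (Suc n) k"
      then have x: "real_of_int k < x * 2^n * 2" "x * 2^n * 2 \<le> real_of_int k + 1"
        by (auto simp: c_def field_simps)
      have "real_of_int k = 2 * real_of_int (k div 2) + real_of_int (k mod 2)"
        using mult_div_mod_eq[of 2 k] by (metis of_int_add of_int_mult of_int_numeral)
      moreover have "0 \<le> real_of_int (k mod 2)" "real_of_int (k mod 2) \<le> 1"
        by auto
      ultimately show "x \<in> c n (k div 2)"
        using x by (auto simp: c_def field_simps)
    qed
    have leV: "emeasure \<eta> (V n) \<le> emeasure lborel (V n)" for n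
    proof -
      have "emeasure \<eta> (V n) = (\<integral>\<^sup>+k. emeasure \<eta> (c n k) \<partial>count_space (K n))"
        unfolding V_def by (rule emeasure_UN_countable) (use disj in \<open>auto simp: sets\<close>)
      also have "\<dots> \<le> (\<integral>\<^sup>+k. emeasure lborel (c n k) \<partial>count_space (K n))"
      proof (rule nn_integral_mono)
        fix k
        have "real_of_int k / 2 ^ n \<le> (real_of_int k + 1) / 2 ^ n"
          by (simp add: divide_right_mono)
        then show "emeasure \<eta> (c n k) \<le> emeasure lborel (c n k)"
          unfolding c_def using le by simp
      qed
      also have "\<dots> = emeasure lborel (V n)"
        unfolding V_def by (rule emeasure_UN_countable[symmetric]) (use disj in auto)
      finally show ?thesis .
    qed
    have inc: "incseq V"
    proof (rule incseq_SucI)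
      fix n show "V n \<subseteq> V (Suc n)"
      proof
        fix x assume "x \<in> V n"
        then obtain k where k: "c n k \<subseteq> U" "x \<in> c n k" by (auto simp: V_def K_def)
        define j where "j = \<lceil>x * 2^Suc n\<rceil> - 1"
        have xj: "x \<in> c (Suc n) j" by (simp add: c_iff j_def)
        then have "x \<in> c n (j div 2)" using cc by blast
        then have "j div 2 = k" using k by (simp add: c_iff)
        then have "c (Suc n) j \<subseteq> U" using cc[of n j] k by auto
        then show "x \<in> V (Suc n)" using xj by (auto simp: V_def K_def)
      qed
    qed
    have un: "(\<Union>n. V n) = U"
    proof
      show "(\<Union>n. V n) \<subseteq> U" by (auto simp: V_def K_def)
      show "U \<subseteq> (\<Union>n. V n)"
      proof
        fix x assume "x \<in> U"
        then obtain e where e: "e > 0" "ball x e \<subseteq> U"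
          using U by (auto simp: open_contains_ball)
        obtain n where n: "inverse (2::real)^n < e"
          using e real_arch_pow_inv[of e "inverse 2"] by auto
        define j where "j = \<lceil>x * 2^n\<rceil> - 1"
        have xj: "x \<in> c n j" by (simp add: c_iff j_def)
        have "c n j \<subseteq> ball x e"
        proof
          fix z assume z: "z \<in> c n j"
          have "\<bar>x - z\<bar> < inverse 2 ^ n + 0"
            using z xj unfolding c_def by (auto simp: field_simps abs_less_iff)
          then show "z \<in> ball x e" using n by (simp add: dist_real_def)
        qed
        then show "x \<in> (\<Union>n. V n)" using e xj by (auto simp: V_def K_def)
      qed
    qed
    have Vm: "V n \<in> sets borel" for n
      unfolding V_def by (intro sets.countable_UN') auto
    have "emeasure \<eta> U = (SUP n. emeasure \<eta> (V n))"
      using SUP_emeasure_incseq[of V \<eta>] inc Vm un by (simp add: sets image_subset_iff)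
    also have "\<dots> \<le> (SUP n. emeasure lborel (V n))"
      by (intro SUP_mono) (use leV in auto)
    also have "\<dots> = emeasure lborel U"
      using SUP_emeasure_incseq[of V lborel] inc Vm un by (simp add: image_subset_iff)
    finally show ?thesis .
  qed
  \<comment> \<open>Outer regularity of Lebesgue measure carries the bound from open sets to Borel
    sets.\<close>
  show ?thesis
  proof (rule ennreal_le_epsilon)
    fix e :: real assume "e > 0"
    then obtain U where U: "open U" "A \<subseteq> U" "emeasure lborel (U - A) < ennreal e"
      using outer_regular_lborel[OF A] by metis
    have "emeasure \<eta> A \<le> emeasure \<eta> U"
      using U sets by (intro emeasure_mono) auto
    also have "\<dots> \<le> emeasure lborel U" using op U by auto
    also have "\<dots> = emeasure lborel (A \<union> (U - A))"
      using U by (intro arg_cong[where f="emeasure lborel"]) auto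
    also have "\<dots> \<le> emeasure lborel A + emeasure lborel (U - A)"
      using U A by (intro emeasure_subadditive) auto
    also have "\<dots> \<le> emeasure lborel A + ennreal e"
      using U by (intro add_left_mono) auto
    finally show "emeasure \<eta> A \<le> emeasure lborel A + ennreal e" .
  qed
qed

text \<open>The integral is a supremum over simple functions, and for those the setwise domination
  of the measures is enough.\<close>

lemma nn_integral_mono_measure:
  assumes sets: "sets M = sets N"
    and le: "\<And>A. A \<in> sets N \<Longrightarrow> emeasure M A \<le> emeasure N A"
  shows "(\<integral>\<^sup>+x. f x \<partial>M) \<le> (\<integral>\<^sup>+x. f x \<partial>N)"
proof -
  have sp: "space M = space N" using sets by (rule sets_eq_imp_space_eq)
  have "simple_integral M g \<le> simple_integral N g" if "simple_function M g" for g :: "'a \<Rightarrow> ennreal"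
    unfolding simple_integral_def sp
  proof (intro sum_mono mult_left_mono le)
    fix x assume "x \<in> g ` space N"
    have "g -` {x} \<inter> space M \<in> sets M" using that \<open>x \<in> g ` space N\<close> by (auto simp: simple_function_def sp)
    then show "g -` {x} \<inter> space N \<in> sets N" by (simp add: sp sets)
  qed auto
  moreover have "simple_function M g = simple_function N g" for g :: "'a \<Rightarrow> ennreal"
    by (simp add: simple_function_def sets sp)
  ultimately show ?thesis
    unfolding nn_integral_def by (intro SUP_mono) auto
qed

section \<open>Uniform law on the unit interval and quantile functions\<close>

definition unif :: "real measure" where
  "unif = density lborel (indicator {0<..<1})"

lemma sets_unif[simp, measurable_cong]: "sets unif = sets borel"
  and space_unif[simp]: "space unif = UNIV"
  by (auto simp: unif_def)

lemma prob_space_unif: "prob_space unif"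
  by (rule prob_spaceI) (simp add: unif_def emeasure_density)

lemma nn_integral_unif:
  assumes [measurable]: "f \<in> borel_measurable borel"
  shows "(\<integral>\<^sup>+x. f x \<partial>unif) = (\<integral>\<^sup>+x. f x * indicator {0<..<1} x \<partial>lborel)"
  unfolding unif_def by (subst nn_integral_density) (auto simp: mult.commute)

text \<open>The left-continuous inverse of the distribution function. The value \<open>0\<close>
  outside the open unit interval keeps it real valued and measurable on the whole line, and
  \<open>unif\<close> gives no mass to that region.\<close>

definition quantile :: "real measure \<Rightarrow> real \<Rightarrow> real" where
  "quantile M v = (if 0 < v \<and> v < 1 then Inf {x. v \<le> cdf M x} else 0)"

text \<open>This Galois connection with \<open>cdf\<close> is the source of all later facts:
  measurability, inversion and monotonicity of quantiles are read off from it.\<close>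

lemma quantile_le_iff:
  assumes "real_distribution M" "0 < v" "v < 1"
  shows "quantile M v \<le> x \<longleftrightarrow> v \<le> cdf M x"
proof -
  interpret real_distribution M by fact
  interpret cdf_distribution M by standard
  show ?thesis using pseudoinverse[of v x] assms by (simp add: quantile_def)
qed

lemma borel_measurable_quantile [measurable]:
  assumes "real_distribution M" shows "quantile M \<in> borel_measurable borel"
proof (rule borel_measurableI_le)
  interpret real_distribution M by fact
  fix y
  have "{x \<in> space borel. quantile M x \<le> y} =
     {v. 0 < v \<and> v < 1 \<and> v \<le> cdf M y} \<union> {v. \<not> (0 < v \<and> v < 1) \<and> 0 \<le> y}"
    using quantile_le_iff[OF assms] by (auto simp: quantile_def)
  then show "{x \<in> space borel. quantile M x \<le> y} \<in> sets borel" by simp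
qed

text \<open>Inverse transform sampling: \<open>quantile M\<close> pushes the uniform law to
  \<open>M\<close>, by the representation \<open>distr_I_eq_M\<close>.\<close>

lemma nn_integral_quantile:
  assumes "real_distribution M" and [measurable]: "h \<in> borel_measurable borel"
  shows "(\<integral>\<^sup>+v. h (quantile M v) \<partial>unif) = (\<integral>\<^sup>+x. h x \<partial>M)"
proof -
  interpret real_distribution M by fact
  interpret cdf_distribution M by standard
  note borel_measurable_quantile[OF assms(1), measurable]
  have "(\<integral>\<^sup>+x. h x \<partial>M) = (\<integral>\<^sup>+x. h x \<partial>(distr (restrict_space lborel {0<..<1::real}) borel (\<lambda>\<omega>. Inf {x. \<omega> \<le> cdf M x})))"
    by (simp add: distr_I_eq_M)
  also have "\<dots> = (\<integral>\<^sup>+v. h (Inf {x. v \<le> cdf M x}) \<partial>(restrict_space lborel {0<..<1}))"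
    by (subst nn_integral_distr) (auto cong: measurable_cong_sets)
  also have "\<dots> = (\<integral>\<^sup>+v. h (Inf {x. v \<le> cdf M x}) * indicator {0<..<1} v \<partial>lborel)"
    by (subst nn_integral_restrict_space) auto
  also have "\<dots> = (\<integral>\<^sup>+v. h (quantile M v) * indicator {0<..<1} v \<partial>lborel)"
    by (intro nn_integral_cong) (auto simp: quantile_def indicator_def)
  also have "\<dots> = (\<integral>\<^sup>+v. h (quantile M v) \<partial>unif)"
    by (subst nn_integral_unif) auto
  finally show ?thesis by simp
qed

section \<open>Strictly positive densities on the line\<close>

context
  fixes p :: "real \<Rightarrow> real" and M
  assumes p[measurable]: "p \<in> borel_measurable borel" and pos: "\<And>x. 0 < p x"
    and one: "(\<integral>\<^sup>+x. p x \<partial>lborel) = 1"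
  defines "M \<equiv> density lborel (\<lambda>x. ennreal (p x))"
begin

lemma density_real_distribution: "real_distribution M"
proof -
  have "prob_space M"
    by (rule prob_spaceI) (simp add: M_def emeasure_density one)
  then show ?thesis by (simp add: real_distribution_def real_distribution_axioms_def M_def)
qed

interpretation D: real_distribution M by (rule density_real_distribution)

lemma density_cdf_strict_mono: assumes "x < y" shows "cdf M x < cdf M y"
proof -
  have "emeasure M {x<..y} \<noteq> 0"
  proof
    assume "emeasure M {x<..y} = 0"
    then have "{x<..y} \<in> null_sets M" by (auto simp: null_sets_def M_def)
    then have "AE z in lborel. z \<in> {x<..y} \<longrightarrow> ennreal (p z) = 0"
      unfolding M_def by (subst (asm) null_sets_density_iff) auto
    then have "AE z in lborel. z \<notin> {x<..y}"
      by eventually_elim (metis pos ennreal_eq_0_iff not_le)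
    then have "{x<..y} \<in> null_sets lborel" by (subst (asm) AE_iff_null_sets[symmetric]) auto
    then show False using assms by (auto simp: null_sets_def)
  qed
  then have "0 < measure M {x<..y}" by (simp add: D.emeasure_eq_measure measure_le_0_iff zero_less_measure_iff)
  then show ?thesis using D.cdf_diff_eq[OF assms] by simp
qed

lemma density_cdf_bounds: "0 < cdf M x" "cdf M x < 1"
  using density_cdf_strict_mono[of "x-1" x] density_cdf_strict_mono[of x "x+1"] D.cdf_nonneg[of "x-1"]
    D.cdf_bounded_prob[of "x+1"] by auto

lemma density_quantile_cdf: "quantile M (cdf M x) = x"
proof (rule antisym)
  note q = quantile_le_iff[OF density_real_distribution density_cdf_bounds]
  show "quantile M (cdf M x) \<le> x" by (simp add: q)
  show "x \<le> quantile M (cdf M x)"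
    using q[of x "quantile M (cdf M x)"] density_cdf_strict_mono[of "quantile M (cdf M x)" x] by force
qed

text \<open>If the distribution function exceeded \<open>v\<close> at the quantile, continuity (a
  density has no atoms) would keep it above \<open>v\<close> slightly to the left, against the
  minimality of the quantile.\<close>

lemma density_cdf_quantile: assumes v: "0 < v" "v < 1" shows "cdf M (quantile M v) = v"
proof (rule ccontr)
  note q = quantile_le_iff[OF density_real_distribution v]
  assume "cdf M (quantile M v) \<noteq> v"
  then have less: "v < cdf M (quantile M v)" using q[of "quantile M v"] by simp
  have "measure M {quantile M v} = 0"
  proof -
    have "absolutely_continuous lborel M"
      unfolding M_def by (rule absolutely_continuousI_density) simp
    moreover have "{quantile M v} \<in> null_sets lborel" by (auto simp: null_sets_def)
    ultimately have "{quantile M v} \<in> null_sets M" unfolding absolutely_continuous_def by blast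
    then show ?thesis by (simp add: measure_def null_setsD1)
  qed
  then have "isCont (cdf M) (quantile M v)" by (simp add: D.isCont_cdf)
  then have "(cdf M \<longlongrightarrow> cdf M (quantile M v)) (at_left (quantile M v))"
    using continuous_within tendsto_within_subset by (metis filterlim_at_split isCont_def)
  then have "eventually (\<lambda>y. v < cdf M y) (at_left (quantile M v))"
    using less by (rule order_tendstoD)
  moreover have "eventually (\<lambda>y. y < quantile M v) (at_left (quantile M v))"
    by (simp add: eventually_at_filter)
  ultimately have "eventually (\<lambda>y. False) (at_left (quantile M v))"
    by eventually_elim (metis q less_imp_le not_le)
  then show False by simp
qed

lemma density_quantile_mono: "0 < v \<Longrightarrow> v \<le> w \<Longrightarrow> w < 1 \<Longrightarrow> quantile M v \<le> quantile M w"
  using quantile_le_iff[OF density_real_distribution, of v] density_cdf_quantile[of w] by auto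

text \<open>Change of variables \<open>x = quantile M v\<close> without differentiation: formally
  the quantile function has derivative \<open>1 / p\<close>, so the left side is the length of the
  image of \<open>B\<close>. Transporting the integral to \<open>M\<close> cancels the density
  against \<open>1 / p\<close>.\<close>

lemma nn_integral_inverse_density_quantile:
  assumes [measurable]: "B \<in> sets borel" and B: "B \<subseteq> {0<..<1}"
  shows "(\<integral>\<^sup>+v. indicator B v * ennreal (1 / p (quantile M v)) \<partial>unif) = emeasure lborel {x. cdf M x \<in> B}"
proof -
  note borel_measurable_quantile[OF density_real_distribution, measurable]
  have [measurable]: "cdf M \<in> borel_measurable borel"
    by (intro borel_measurable_mono monoI D.cdf_nondecreasing)
  have "(\<integral>\<^sup>+v. indicator B v * ennreal (1 / p (quantile M v)) \<partial>unif)
      = (\<integral>\<^sup>+v. indicator B (cdf M (quantile M v)) * ennreal (1 / p (quantile M v)) \<partial>unif)"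
    unfolding unif_def
    by (intro nn_integral_cong_AE, subst AE_density) (auto simp: density_cdf_quantile indicator_def)
  also have "\<dots> = (\<integral>\<^sup>+x. indicator B (cdf M x) * ennreal (1 / p x) \<partial>M)"
    by (rule nn_integral_quantile[OF density_real_distribution]) measurable
  also have "\<dots> = (\<integral>\<^sup>+x. ennreal (p x) * (indicator B (cdf M x) * ennreal (1 / p x)) \<partial>lborel)"
  proof -
    have "(\<integral>\<^sup>+x. g x \<partial>M) = (\<integral>\<^sup>+x. ennreal (p x) * g x \<partial>lborel)" if "g \<in> borel_measurable borel" for g
      using that unfolding M_def by (subst nn_integral_density) auto
    then show ?thesis by simp
  qed
  also have "\<dots> = (\<integral>\<^sup>+x. indicator {x. cdf M x \<in> B} x \<partial>lborel)"
  proof (intro nn_integral_cong)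
    fix x
    have "ennreal (p x) * ennreal (1 / p x) = 1"
      using pos[of x] by (simp add: ennreal_mult[symmetric])
    then show "ennreal (p x) * (indicator B (cdf M x) * ennreal (1 / p x)) = indicator {x. cdf M x \<in> B} x"
      by (auto simp: indicator_def)
  qed
  also have "\<dots> = emeasure lborel {x. cdf M x \<in> B}"
    by (rule nn_integral_indicator) measurable
  finally show ?thesis .
qed

end

text \<open>The hypothesis bounds the diameters jointly, so the extrema of \<open>A\<close> and
  \<open>B\<close> are taken one at a time (facts 1 to 4) until the sets are enclosed in two
  intervals of total length at most \<open>c\<close>.\<close>

lemma emeasure_lborel_add_le:
  fixes A B :: "real set"
  assumes A: "A \<in> sets borel" "B \<in> sets borel" and c: "0 \<le> c"
    and ne: "A \<noteq> {}" "B \<noteq> {}"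
    and le: "\<And>x x' y y'. x \<in> A \<Longrightarrow> x' \<in> A \<Longrightarrow> y \<in> B \<Longrightarrow> y' \<in> B \<Longrightarrow> (x' - x) + (y' - y) \<le> c"
  shows "emeasure lborel A + emeasure lborel B \<le> ennreal c"
proof -
  obtain a b where ab: "a \<in> A" "b \<in> B" using ne by auto
  have bA: "bdd_above A" "bdd_below A"
    using le[OF ab(1) _ ab(2) ab(2)] le[OF _ ab(1) ab(2) ab(2)]
    by (auto intro!: bdd_aboveI[of _ "a + c"] bdd_belowI[of _ "a - c"] simp: algebra_simps)
  have bB: "bdd_above B" "bdd_below B"
    using le[OF ab(1) ab(1) ab(2)] le[OF ab(1) ab(1) _ ab(2)]
    by (auto intro!: bdd_aboveI[of _ "b + c"] bdd_belowI[of _ "b - c"] simp: algebra_simps)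
  have 1: "Sup A \<le> c + x - y' + y" if "x \<in> A" "y \<in> B" "y' \<in> B" for x y y'
    using ne le[OF that(1) _ that(2,3)] by (intro cSup_least) (auto simp: algebra_simps)
  have 2: "Sup A - c + y' - y \<le> Inf A" if "y \<in> B" "y' \<in> B" for y y'
    using ne 1[OF _ that] by (intro cInf_greatest) (auto simp: algebra_simps)
  have 3: "Sup B \<le> Inf A - Sup A + c + y" if "y \<in> B" for y
    using ne 2[OF that] by (intro cSup_least) (auto simp: algebra_simps)
  have 4: "Sup B - Inf A + Sup A - c \<le> Inf B"
    using ne 3 by (intro cInf_greatest) (auto simp: algebra_simps)
  have sub: "A \<subseteq> {Inf A..Sup A}" "B \<subseteq> {Inf B..Sup B}"
    using bA bB by (auto intro: cInf_lower cSup_upper)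
  have le': "Inf A \<le> Sup A" "Inf B \<le> Sup B" using sub ab by auto
  have "emeasure lborel A + emeasure lborel B \<le> emeasure lborel {Inf A..Sup A} + emeasure lborel {Inf B..Sup B}"
    using sub by (intro add_mono emeasure_mono) auto
  also have "\<dots> = ennreal ((Sup A - Inf A) + (Sup B - Inf B))"
    using le' by (simp add: ennreal_plus)
  also have "\<dots> \<le> ennreal c" using 4 by (intro ennreal_leI) auto
  finally show ?thesis .
qed

lemma inverse_sqrt_mult_le:
  fixes a b :: real assumes "0 < a" "0 < b"
  shows "1 / sqrt (a * b) \<le> (1/a + 1/b) / 2"
  using arith_geo_mean_sqrt[of "1/a" "1/b"] assms by (simp add: real_sqrt_divide)

text \<open>Formally, \<open>S = (P + Q) / 2\<close> has derivative
  \<open>(1 / p + 1 / q) / 2\<close>, which is at least \<open>1 / sqrt (p * q)\<close> by the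
  arithmetic-geometric mean, so the push-forward of the weighted uniform law by \<open>S\<close>
  stays below Lebesgue measure. The midpoint of the two quantiles is kept visible inside
  \<open>G\<close>, since the stability argument uses the coupling and not only the
  integrals.\<close>

lemma prekopa_leindler_quantile:
  fixes p q :: "real \<Rightarrow> real"
  assumes p[measurable]: "p \<in> borel_measurable borel" and p_pos: "\<And>x. 0 < p x"
    and p_one: "(\<integral>\<^sup>+x. p x \<partial>lborel) = 1"
  assumes q[measurable]: "q \<in> borel_measurable borel" and q_pos: "\<And>x. 0 < q x"
    and q_one: "(\<integral>\<^sup>+x. q x \<partial>lborel) = 1"
    and G[measurable]: "G \<in> borel_measurable borel"
  defines "P \<equiv> quantile (density lborel (\<lambda>x. ennreal (p x)))"
    and "Q \<equiv> quantile (density lborel (\<lambda>x. ennreal (q x)))"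
  shows "(\<integral>\<^sup>+v. G ((P v + Q v) / 2) * ennreal (1 / sqrt (p (P v) * q (Q v))) \<partial>unif) \<le> (\<integral>\<^sup>+x. G x \<partial>lborel)"
proof -
  note pa = p p_pos p_one and qa = q q_pos q_one
  have [measurable]: "P \<in> borel_measurable borel" "Q \<in> borel_measurable borel"
    unfolding P_def Q_def by (intro borel_measurable_quantile density_real_distribution pa qa)+
  define F where "F = cdf (density lborel (\<lambda>x. ennreal (p x)))"
  define H where "H = cdf (density lborel (\<lambda>x. ennreal (q x)))"
  define S where "S v = (P v + Q v) / 2" for v
  have [measurable]: "S \<in> borel_measurable borel" by (simp add: S_def[abs_def])
  define w where "w v = ennreal (1 / sqrt (p (P v) * q (Q v)))" for v
  have [measurable]: "w \<in> borel_measurable borel" by (simp add: w_def[abs_def])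
  have [measurable]: "F \<in> borel_measurable borel" "H \<in> borel_measurable borel"
    unfolding F_def H_def
    using density_real_distribution[OF pa] density_real_distribution[OF qa]
    by (auto intro!: borel_measurable_mono monoI finite_borel_measure.cdf_nondecreasing real_distribution.finite_borel_measure_M)
  define \<eta> where "\<eta> = distr (density unif w) borel S"
  \<comment> \<open>Domination by Lebesgue measure is checked on half-open intervals;
    \<open>B\<close> is the set of levels whose midpoint falls into the interval.\<close>
  have int: "emeasure \<eta> {a<..b} \<le> ennreal (b - a)" if "a \<le> b" for a b
  proof -
    define B where "B = {v. 0 < v \<and> v < 1 \<and> a < S v \<and> S v \<le> b}"
    have Bm[measurable]: "B \<in> sets borel" unfolding B_def by measurable
    have [measurable]: "S -` {a<..b} \<in> sets borel"
      by (rule measurable_sets_borel[of S borel]) auto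
    have B01: "B \<subseteq> {0<..<1}" by (auto simp: B_def)
    have "emeasure \<eta> {a<..b} = (\<integral>\<^sup>+v. w v * indicator (S -` {a<..b}) v \<partial>unif)"
      unfolding \<eta>_def by (subst emeasure_distr) (auto simp: emeasure_density)
    also have "\<dots> = (\<integral>\<^sup>+v. w v * indicator B v \<partial>unif)"
      unfolding unif_def by (intro nn_integral_cong_AE, subst AE_density) (auto simp: B_def indicator_def)
    also have "\<dots> \<le> (\<integral>\<^sup>+v. (indicator B v * ennreal (1 / p (P v)) + indicator B v * ennreal (1 / q (Q v))) / 2 \<partial>unif)"
    proof (intro nn_integral_mono)
      fix v
      have "w v \<le> ennreal ((1 / p (P v) + 1 / q (Q v)) / 2)"
        unfolding w_def by (intro ennreal_leI inverse_sqrt_mult_le p_pos q_pos)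
      also have "\<dots> = (ennreal (1 / p (P v)) + ennreal (1 / q (Q v))) / 2"
        using p_pos[of "P v"] q_pos[of "Q v"]
        by (simp add: divide_ennreal[symmetric] ennreal_plus)
      finally show "w v * indicator B v \<le> (indicator B v * ennreal (1 / p (P v)) + indicator B v * ennreal (1 / q (Q v))) / 2"
        by (auto simp: indicator_def)
    qed
    also have "\<dots> = ((\<integral>\<^sup>+v. indicator B v * ennreal (1 / p (P v)) \<partial>unif) + (\<integral>\<^sup>+v. indicator B v * ennreal (1 / q (Q v)) \<partial>unif)) / 2"
      by (subst nn_integral_divide) (auto simp: nn_integral_add)
    also have "\<dots> = (emeasure lborel {x. F x \<in> B} + emeasure lborel {x. H x \<in> B}) / 2"
      unfolding P_def Q_def F_def H_def
      by (simp add: nn_integral_inverse_density_quantile[OF pa Bm B01] nn_integral_inverse_density_quantile[OF qa Bm B01])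
    also have "\<dots> \<le> ennreal (2 * (b - a)) / 2"
    proof (intro divide_right_mono_ennreal)
      show "emeasure lborel {x. F x \<in> B} + emeasure lborel {x. H x \<in> B} \<le> ennreal (2 * (b - a))"
      proof (cases "B = {}")
        case False
        then obtain v where v: "v \<in> B" by auto
        have PF: "P (F x) = x" "Q (H x) = x" for x
          unfolding P_def F_def Q_def H_def by (rule density_quantile_cdf[OF pa] density_quantile_cdf[OF qa])+
        have FP: "F (P v) = v" "H (Q v) = v" if "v \<in> B" for v
          unfolding P_def F_def Q_def H_def
          using that B01 by (auto intro!: density_cdf_quantile[OF pa] density_cdf_quantile[OF qa])
        have mono: "P v \<le> P v'" "Q v \<le> Q v'" if "v \<in> B" "v' \<in> B" "v \<le> v'" for v v'
          unfolding P_def Q_def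
          using that B01 by (auto intro!: density_quantile_mono[OF pa] density_quantile_mono[OF qa])
        show ?thesis
        proof (rule emeasure_lborel_add_le)
          have "P v \<in> {x. F x \<in> B}" "Q v \<in> {x. H x \<in> B}" using FP[OF v] v by auto
          then show "{x. F x \<in> B} \<noteq> {}" "{x. H x \<in> B} \<noteq> {}" by blast+
          fix x x' y y' assume *: "x \<in> {x. F x \<in> B}" "x' \<in> {x. F x \<in> B}" "y \<in> {x. H x \<in> B}" "y' \<in> {x. H x \<in> B}"
          \<comment> \<open>The points \<open>x\<close> and \<open>y\<close> may come from different
            levels. Passing to the smaller of the lower levels and the larger of the upper ones lets
            both monotone quantiles be compared at common levels, which still belong to
            \<open>B\<close> because each is one of the original levels.\<close>
          define l where "l = min (F x) (H y)"
          define r where "r = max (F x') (H y')"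
          have lr: "l \<in> B" "r \<in> B" using * by (auto simp: l_def r_def min_def max_def)
          have "P l \<le> P (F x)" "Q l \<le> Q (H y)" "P (F x') \<le> P r" "Q (H y') \<le> Q r"
            using * lr by (auto intro!: mono simp: l_def r_def)
          then have "P l \<le> x" "Q l \<le> y" "x' \<le> P r" "y' \<le> Q r" by (auto simp: PF)
          moreover have "a < S l" "S r \<le> b" using lr by (auto simp: B_def)
          ultimately show "x' - x + (y' - y) \<le> 2 * (b - a)" by (simp add: S_def)
        qed (use that in auto)
      qed auto
    qed
    also have "\<dots> = ennreal (b - a)"
      using that divide_ennreal[of "2 * (b - a)" 2] by simp
    finally show ?thesis .
  qed
  have "(\<integral>\<^sup>+v. G (S v) * w v \<partial>unif) = (\<integral>\<^sup>+x. G x \<partial>\<eta>)"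
    unfolding \<eta>_def by (subst nn_integral_distr) (auto simp: nn_integral_density mult.commute)
  also have "\<dots> \<le> (\<integral>\<^sup>+x. G x \<partial>lborel)"
    by (rule nn_integral_mono_measure) (auto simp: \<eta>_def intro!: emeasure_le_lborel_if_intervals int[unfolded \<eta>_def])
  finally show ?thesis by (simp add: S_def w_def)
qed

section \<open>Unnormalised densities and measurable dependence on parameters\<close>

definition nquantile :: "(real \<Rightarrow> real) \<Rightarrow> real \<Rightarrow> real" where
  "nquantile f = quantile (density lborel (\<lambda>t. ennreal (f t / enn2real (\<integral>\<^sup>+t. f t \<partial>lborel))))"

lemma nn_integral_pos_real:
  assumes [measurable]: "f \<in> borel_measurable lborel" and pos: "\<And>t. 0 < f t"
  shows "0 < (\<integral>\<^sup>+t. ennreal (f t) \<partial>(lborel :: 'b::euclidean_space measure))"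
proof -
  have "(\<integral>\<^sup>+t. ennreal (f t) \<partial>(lborel::'b measure)) \<noteq> 0"
  proof
    assume "(\<integral>\<^sup>+t. ennreal (f t) \<partial>(lborel::'b measure)) = 0"
    then have "AE t in (lborel::'b measure). ennreal (f t) = 0" by (subst (asm) nn_integral_0_iff_AE) auto
    then have "AE t in (lborel::'b measure). False" by eventually_elim (metis pos ennreal_eq_0_iff not_le)
    then have "emeasure (lborel::'b measure) UNIV = 0" by (simp add: AE_iff_measurable[OF _ refl])
    then show False by simp
  qed
  then show ?thesis by (simp add: zero_less_iff_neq_zero)
qed

context
  fixes f :: "real \<Rightarrow> real"
  assumes f[measurable]: "f \<in> borel_measurable borel" and pos: "\<And>x. 0 < f x"
    and fin: "(\<integral>\<^sup>+x. f x \<partial>lborel) < \<infinity>"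
begin

lemma normalizer_pos: "0 < enn2real (\<integral>\<^sup>+x. f x \<partial>lborel)"
  using nn_integral_pos_real[of f] pos fin by (simp add: enn2real_positive_iff)

lemma normalized_density:
  "(\<lambda>t. f t / enn2real (\<integral>\<^sup>+x. f x \<partial>lborel)) \<in> borel_measurable borel"
  "\<And>x. 0 < f x / enn2real (\<integral>\<^sup>+x. f x \<partial>lborel)"
  "(\<integral>\<^sup>+x. ennreal (f x / enn2real (\<integral>\<^sup>+x. f x \<partial>lborel)) \<partial>lborel) = 1"
proof -
  define N where "N = enn2real (\<integral>\<^sup>+x. f x \<partial>lborel)"
  have N: "0 < N" "ennreal N = (\<integral>\<^sup>+x. f x \<partial>lborel)"
    using normalizer_pos fin by (auto simp: N_def)
  show "(\<lambda>t. f t / enn2real (\<integral>\<^sup>+x. f x \<partial>lborel)) \<in> borel_measurable borel"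
  "\<And>x. 0 < f x / enn2real (\<integral>\<^sup>+x. f x \<partial>lborel)"
    using pos normalizer_pos by auto
  have "(\<integral>\<^sup>+x. ennreal (f x / N) \<partial>lborel) = (\<integral>\<^sup>+x. ennreal (f x) / ennreal N \<partial>lborel)"
    using N(1) pos by (intro nn_integral_cong) (simp add: divide_ennreal less_imp_le)
  also have "\<dots> = 1"
    using N by (simp add: nn_integral_divide N(2)[symmetric] ennreal_divide_self)
  finally show "(\<integral>\<^sup>+x. ennreal (f x / enn2real (\<integral>\<^sup>+x. f x \<partial>lborel)) \<partial>lborel) = 1" by (simp add: N_def)
qed

lemma borel_measurable_nquantile: "nquantile f \<in> borel_measurable borel"
  unfolding nquantile_def by (intro borel_measurable_quantile density_real_distribution normalized_density)

lemma nn_integral_nquantile: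
  assumes [measurable]: "h \<in> borel_measurable borel"
  shows "(\<integral>\<^sup>+v. h (nquantile f v) \<partial>unif) * (\<integral>\<^sup>+x. f x \<partial>lborel) = (\<integral>\<^sup>+x. h x * ennreal (f x) \<partial>lborel)"
proof -
  define N where "N = enn2real (\<integral>\<^sup>+x. f x \<partial>lborel)"
  have N: "0 < N" "(\<integral>\<^sup>+x. f x \<partial>lborel) = ennreal N"
    using normalizer_pos fin by (auto simp: N_def)
  have "(\<integral>\<^sup>+v. h (nquantile f v) \<partial>unif) = (\<integral>\<^sup>+x. h x \<partial>(density lborel (\<lambda>x. ennreal (f x / N))))"
    unfolding nquantile_def N_def
    by (rule nn_integral_quantile) (auto intro!: density_real_distribution normalized_density)
  also have "\<dots> = (\<integral>\<^sup>+x. ennreal (f x / N) * h x \<partial>lborel)"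
    by (rule nn_integral_density) auto
  finally have "(\<integral>\<^sup>+v. h (nquantile f v) \<partial>unif) * ennreal N = (\<integral>\<^sup>+x. ennreal (f x / N) * h x * ennreal N \<partial>lborel)"
    by (simp add: nn_integral_multc)
  also have "\<dots> = (\<integral>\<^sup>+x. h x * ennreal (f x) \<partial>lborel)"
  proof (intro nn_integral_cong)
    fix x
    have "ennreal (f x / N) * ennreal N = ennreal (f x)"
      using N pos[of x] by (simp add: ennreal_mult[symmetric])
    then show "ennreal (f x / N) * h x * ennreal N = h x * ennreal (f x)"
      by (metis mult.assoc mult.commute)
  qed
  finally show ?thesis using N by simp
qed

end

text \<open>Dividing \<open>f\<close> and \<open>g\<close> by their masses multiplies the weight by
  the root of the product of the masses. In the induction over coordinates, the reciprocal of this
  factor becomes the weight attached to the marginals.\<close>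

lemma prekopa_leindler_nquantile:
  fixes f g :: "real \<Rightarrow> real"
  assumes f[measurable]: "f \<in> borel_measurable borel" and fpos: "\<And>x. 0 < f x"
    and ffin: "(\<integral>\<^sup>+x. f x \<partial>lborel) < \<infinity>"
  assumes g[measurable]: "g \<in> borel_measurable borel" and gpos: "\<And>x. 0 < g x"
    and gfin: "(\<integral>\<^sup>+x. g x \<partial>lborel) < \<infinity>"
    and G[measurable]: "G \<in> borel_measurable borel"
  shows "(\<integral>\<^sup>+v. G ((nquantile f v + nquantile g v) / 2) * ennreal (1 / sqrt (f (nquantile f v) * g (nquantile g v))) \<partial>unif)
     * ennreal (sqrt (enn2real (\<integral>\<^sup>+x. f x \<partial>lborel) * enn2real (\<integral>\<^sup>+x. g x \<partial>lborel))) \<le> (\<integral>\<^sup>+x. G x \<partial>lborel)"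
proof -
  note fa = f fpos ffin and ga = g gpos gfin
  note borel_measurable_nquantile[OF fa, measurable] borel_measurable_nquantile[OF ga, measurable]
  define N K where "N = enn2real (\<integral>\<^sup>+x. f x \<partial>lborel)" and "K = enn2real (\<integral>\<^sup>+x. g x \<partial>lborel)"
  have N: "0 < N" "0 < K" using normalizer_pos[OF fa] normalizer_pos[OF ga] by (auto simp: N_def K_def)
  have *: "1 / sqrt (a / N * (b / K)) = 1 / sqrt (a * b) * sqrt (N * K)" if "0 < a" "0 < b" for a b
    using N that by (simp add: real_sqrt_mult real_sqrt_divide)
  have "(\<integral>\<^sup>+v. G ((nquantile f v + nquantile g v) / 2) * ennreal (1 / sqrt (f (nquantile f v) * g (nquantile g v))) \<partial>unif)
     * ennreal (sqrt (N * K))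
    = (\<integral>\<^sup>+v. G ((nquantile f v + nquantile g v) / 2) * (ennreal (1 / sqrt (f (nquantile f v) * g (nquantile g v))) * ennreal (sqrt (N * K))) \<partial>unif)"
    by (subst nn_integral_multc[symmetric]) (auto simp: mult.assoc)
  also have "\<dots> = (\<integral>\<^sup>+v. G ((nquantile f v + nquantile g v) / 2) * ennreal (1 / sqrt ((f (nquantile f v) / N) * (g (nquantile g v) / K))) \<partial>unif)"
  proof (intro nn_integral_cong arg_cong2[where f="(*)"] refl)
    fix v
    show "ennreal (1 / sqrt (f (nquantile f v) * g (nquantile g v))) * ennreal (sqrt (N * K))
      = ennreal (1 / sqrt ((f (nquantile f v) / N) * (g (nquantile g v) / K)))"
      unfolding *[OF fpos gpos] using N fpos gpos
      by (intro ennreal_mult[symmetric]) (auto simp: less_imp_le)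
  qed
  also have "\<dots> \<le> (\<integral>\<^sup>+x. G x \<partial>lborel)"
    using prekopa_leindler_quantile[OF normalized_density[OF fa] normalized_density[OF ga] G]
    by (simp add: nquantile_def N_def K_def)
  finally show ?thesis by (simp add: N_def K_def)
qed

text \<open>Sublevel sets of the quantile compare the level with the distribution function at
  \<open>y\<close>, which depends measurably on the parameter as an integral over a slice. Joint
  measurability is what later permits integrating the transport maps over the centers of the
  Gaussians.\<close>

lemma measurable_nquantile_kernel:
  fixes f :: "'w \<Rightarrow> real \<Rightarrow> real"
  assumes f[measurable]: "(\<lambda>(w, t). f w t) \<in> borel_measurable (W \<Otimes>\<^sub>M borel)"
    and fpos: "\<And>w x. w \<in> space W \<Longrightarrow> 0 < f w x"
    and ffin: "\<And>w. w \<in> space W \<Longrightarrow> (\<integral>\<^sup>+x. f w x \<partial>lborel) < \<infinity>"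
  shows "(\<lambda>(w, v). nquantile (f w) v) \<in> borel_measurable (W \<Otimes>\<^sub>M borel)"
proof (rule borel_measurableI_le)
  fix y
  have fw[measurable]: "f w \<in> borel_measurable borel" if "w \<in> space W" for w
    using measurable_compose[OF measurable_Pair1'[OF that] f] by simp
  have [measurable]: "(\<lambda>(w,t). f w t) \<in> borel_measurable (W \<Otimes>\<^sub>M lborel)"
    using f by (simp cong: measurable_cong_sets sets_pair_measure_cong)
  define N where "N w = enn2real (\<integral>\<^sup>+x. f w x \<partial>lborel)" for w
  have [measurable]: "N \<in> borel_measurable W"
    unfolding N_def[abs_def] by measurable
  define F where "F w = enn2real (\<integral>\<^sup>+x. ennreal (f w x / N w) * indicator {..y} x \<partial>lborel)" for w
  have [measurable]: "F \<in> borel_measurable W"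
    unfolding F_def[abs_def] by measurable
  have le: "nquantile (f w) v \<le> y \<longleftrightarrow> (if 0 < v \<and> v < 1 then v \<le> F w else 0 \<le> y)" if w: "w \<in> space W" for w v
  proof -
    note a = fw[OF w] fpos[OF w] ffin[OF w]
    have "cdf (density lborel (\<lambda>t. ennreal (f w t / N w))) y = F w"
      unfolding cdf_def F_def measure_def using w by (subst emeasure_density) auto
    then show ?thesis
      using quantile_le_iff[OF density_real_distribution[OF normalized_density[OF a]], of v y]
      by (auto simp: nquantile_def N_def quantile_def)
  qed
  have "{x \<in> space (W \<Otimes>\<^sub>M borel). (case x of (w, v) \<Rightarrow> nquantile (f w) v) \<le> y}
    = {x \<in> space (W \<Otimes>\<^sub>M borel). (if 0 < snd x \<and> snd x < 1 then snd x \<le> F (fst x) else 0 \<le> y)}"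
    using le by (auto simp: space_pair_measure)
  also have "\<dots> \<in> sets (W \<Otimes>\<^sub>M borel)" by measurable
  finally show "{x \<in> space (W \<Otimes>\<^sub>M borel). (case x of (w, v) \<Rightarrow> nquantile (f w) v) \<le> y} \<in> sets (W \<Otimes>\<^sub>M borel)" .
qed

section \<open>Knothe maps\<close>

lemma nn_integral_exp_minus_abs: "(\<integral>\<^sup>+t. ennreal (exp (- \<bar>t\<bar>)) \<partial>(lborel::real measure)) < \<infinity>"
proof -
  have e: "(\<integral>\<^sup>+t. ennreal (exp (- t)) * indicator {0..} t \<partial>(lborel::real measure)) = 1"
  proof -
    have "(\<integral>\<^sup>+x. ennreal (exponential_density 1 x) \<partial>lborel) = 1"
      using nn_integral_erlang_ith_moment[of 1 0 0] by simp
    moreover have "exponential_density 1 x = exp (- x) * indicator {0..} x" for x :: real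
      by (auto simp: exponential_density_def indicator_def)
    ultimately show ?thesis by (simp add: ennreal_mult' ennreal_indicator)
  qed
  have "(\<integral>\<^sup>+t. ennreal (exp (- \<bar>t\<bar>)) \<partial>(lborel::real measure))
    \<le> (\<integral>\<^sup>+t. ennreal (exp (- t)) * indicator {0..} t + ennreal (exp (- (-t))) * indicator {0..} (-t) \<partial>lborel)"
    by (intro nn_integral_mono) (auto simp: indicator_def)
  also have "\<dots> = (\<integral>\<^sup>+t. ennreal (exp (- t)) * indicator {0..} t \<partial>lborel) + (\<integral>\<^sup>+t. ennreal (exp (- (-t))) * indicator {0..} (-t) \<partial>lborel)"
    by (rule nn_integral_add) auto
  also have "(\<integral>\<^sup>+t. ennreal (exp (- (-t))) * indicator {0..} (-t) \<partial>(lborel::real measure)) = (\<integral>\<^sup>+t. ennreal (exp (- t)) * indicator {0..} t \<partial>(distr lborel borel uminus))"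
    by (subst nn_integral_distr) auto
  finally have "(\<integral>\<^sup>+t. ennreal (exp (- \<bar>t\<bar>)) \<partial>(lborel::real measure)) \<le> 2"
    by (simp add: e lborel_distr_uminus)
  then show ?thesis by (rule le_less_trans) simp
qed

abbreviation "leb I \<equiv> PiM I (\<lambda>_. lborel :: real measure)"
abbreviation "cube I \<equiv> PiM I (\<lambda>_. unif)"
abbreviation "bor I \<equiv> PiM I (\<lambda>_. borel :: real measure)"

text \<open>All factors are measures on the whole real line, so \<open>leb\<close>,
  \<open>cube\<close> and \<open>bor\<close> share one sigma-algebra and measurability can always be
  stated with respect to \<open>bor\<close>.\<close>

lemma sets_leb: "sets (leb I) = sets (bor I)" and sets_cube: "sets (cube I) = sets (bor I)"
  by (auto intro!: sets_PiM_cong)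

text \<open>A class of densities stable under integrating out a coordinate: the product bound keeps
  every slice integrable, with a constant that may depend on the parameter \<open>p\<close>. The
  parameter will be the center of a Gaussian factor.\<close>

definition exp_dominated :: "'p measure \<Rightarrow> 'i set \<Rightarrow> ('p \<Rightarrow> ('i \<Rightarrow> real) \<Rightarrow> real) \<Rightarrow> bool" where
  "exp_dominated P I f \<longleftrightarrow> (\<lambda>(p, x). f p x) \<in> borel_measurable (P \<Otimes>\<^sub>M bor I) \<and>
     (\<forall>p\<in>space P. \<exists>C. \<forall>x\<in>space (bor I). 0 < f p x \<and> f p x \<le> C * (\<Prod>i\<in>I. exp (- \<bar>x i\<bar>)))"

definition marginal :: "'i \<Rightarrow> ('p \<Rightarrow> ('i \<Rightarrow> real) \<Rightarrow> real) \<Rightarrow> 'p \<Rightarrow> ('i \<Rightarrow> real) \<Rightarrow> real" where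
  "marginal i f p x = enn2real (\<integral>\<^sup>+t. ennreal (f p (x(i := t))) \<partial>lborel)"

context
  fixes P :: "'p measure" and I :: "'i set" and i :: 'i and f :: "'p \<Rightarrow> ('i \<Rightarrow> real) \<Rightarrow> real"
  assumes I: "finite I" "i \<notin> I" and dom: "exp_dominated P (insert i I) f"
begin

lemma slice_measurable: "(\<lambda>(w, t). f (fst w) ((snd w)(i := t))) \<in> borel_measurable ((P \<Otimes>\<^sub>M bor I) \<Otimes>\<^sub>M borel)"
proof -
  have f: "(\<lambda>(p, x). f p x) \<in> borel_measurable (P \<Otimes>\<^sub>M bor (insert i I))"
    using dom by (simp add: exp_dominated_def)
  have "(\<lambda>z. (fst (fst z), (snd (fst z))(i := snd z))) \<in> (P \<Otimes>\<^sub>M bor I) \<Otimes>\<^sub>M borel \<rightarrow>\<^sub>M P \<Otimes>\<^sub>M bor (insert i I)"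
    by (intro measurable_Pair measurable_fun_upd[where J=I]) auto
  from measurable_compose[OF this f] show ?thesis by (simp add: split_beta')
qed

lemma slice_pos: "p \<in> space P \<Longrightarrow> x \<in> space (bor I) \<Longrightarrow> 0 < f p (x(i := t))"
  using dom by (auto simp: exp_dominated_def space_PiM PiE_iff extensional_def)

lemma slice_bound:
  assumes p: "p \<in> space P"
  obtains C where "0 \<le> C" "\<And>x. x \<in> space (bor I) \<Longrightarrow> (\<integral>\<^sup>+t. ennreal (f p (x(i := t))) \<partial>lborel) \<le> ennreal (C * (\<Prod>i\<in>I. exp (- \<bar>x i\<bar>)))"
proof -
  obtain C where C: "\<And>x. x \<in> space (bor (insert i I)) \<Longrightarrow> 0 < f p x" "\<And>x. x \<in> space (bor (insert i I)) \<Longrightarrow> f p x \<le> C * (\<Prod>i\<in>insert i I. exp (- \<bar>x i\<bar>))"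
    using dom p unfolding exp_dominated_def by blast
  \<comment> \<open>Comparing the two bounds at a single point shows that \<open>C\<close> is
    positive, as is needed to split products in \<open>ennreal\<close>.\<close>
  have "0 < C * (\<Prod>j\<in>insert i I. exp (- \<bar>(\<lambda>j\<in>insert i I. 0) j\<bar>))"
    using C[of "\<lambda>j\<in>insert i I. 0"] by (auto simp: space_PiM)
  then have C0: "0 < C" by (subst (asm) zero_less_mult_iff) (auto simp: prod_pos not_less prod_nonneg)
  define E where "E = enn2real (\<integral>\<^sup>+t. ennreal (exp (- \<bar>t\<bar>)) \<partial>(lborel::real measure))"
  have E: "ennreal E = (\<integral>\<^sup>+t. ennreal (exp (- \<bar>t\<bar>)) \<partial>(lborel::real measure))" "0 \<le> E"
    using nn_integral_exp_minus_abs by (auto simp: E_def)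
  show ?thesis
  proof (rule that[of "C * E"])
    fix x :: "'i \<Rightarrow> real" assume x: "x \<in> space (bor I)"
    have "(\<integral>\<^sup>+t. ennreal (f p (x(i := t))) \<partial>lborel) \<le> (\<integral>\<^sup>+t. ennreal (C * (\<Prod>i\<in>I. exp (- \<bar>x i\<bar>))) * ennreal (exp (- \<bar>t\<bar>)) \<partial>lborel)"
    proof (intro nn_integral_mono)
      fix t
      have "x(i := t) \<in> space (bor (insert i I))" using x by (auto simp: space_PiM PiE_iff extensional_def)
      moreover have "(\<Prod>j\<in>insert i I. exp (- \<bar>(x(i := t)) j\<bar>)) = exp (- \<bar>t\<bar>) * (\<Prod>j\<in>I. exp (- \<bar>x j\<bar>))"
        using I by (subst prod.insert) (auto intro!: prod.cong)
      ultimately have "f p (x(i := t)) \<le> C * (\<Prod>j\<in>I. exp (- \<bar>x j\<bar>)) * exp (- \<bar>t\<bar>)"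
        using C(2)[of "x(i := t)"] by (simp add: mult_ac)
      then show "ennreal (f p (x(i := t))) \<le> ennreal (C * (\<Prod>i\<in>I. exp (- \<bar>x i\<bar>))) * ennreal (exp (- \<bar>t\<bar>))"
        using C0 by (subst ennreal_mult[symmetric]) (auto intro!: ennreal_leI mult_nonneg_nonneg prod_nonneg)
    qed
    also have "\<dots> = ennreal (C * (\<Prod>i\<in>I. exp (- \<bar>x i\<bar>))) * ennreal E"
      by (subst nn_integral_cmult) (auto simp: E)
    also have "\<dots> = ennreal (C * E * (\<Prod>i\<in>I. exp (- \<bar>x i\<bar>)))"
      using C0 E by (subst ennreal_mult[symmetric]) (auto intro!: mult_nonneg_nonneg prod_nonneg simp: mult_ac)
    finally show "(\<integral>\<^sup>+t. ennreal (f p (x(i := t))) \<partial>lborel) \<le> \<dots>" .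
  qed (use C0 E in auto)
qed

lemma slice_finite: "p \<in> space P \<Longrightarrow> x \<in> space (bor I) \<Longrightarrow> (\<integral>\<^sup>+t. ennreal (f p (x(i := t))) \<partial>lborel) < \<infinity>"
  by (rule slice_bound[of p]) (force intro: le_less_trans[where y="ennreal _"])+

lemma slice_measurable1: "p \<in> space P \<Longrightarrow> x \<in> space (bor I) \<Longrightarrow> (\<lambda>t. f p (x(i := t))) \<in> borel_measurable borel"
  using measurable_compose[OF measurable_Pair1' slice_measurable, of "(p, x)"] by (simp add: space_pair_measure)

lemma marginal_eq: "p \<in> space P \<Longrightarrow> x \<in> space (bor I) \<Longrightarrow> ennreal (marginal i f p x) = (\<integral>\<^sup>+t. ennreal (f p (x(i := t))) \<partial>lborel)"
  using slice_finite by (simp add: marginal_def)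

lemma marginal_pos: "p \<in> space P \<Longrightarrow> x \<in> space (bor I) \<Longrightarrow> 0 < marginal i f p x"
  unfolding marginal_def by (intro normalizer_pos slice_pos slice_finite slice_measurable1)

lemma exp_dominated_marginal: "exp_dominated P I (marginal i f)"
  unfolding exp_dominated_def
proof (intro conjI ballI)
  have [measurable]: "(\<lambda>(w, t). f (fst w) ((snd w)(i := t))) \<in> borel_measurable ((P \<Otimes>\<^sub>M bor I) \<Otimes>\<^sub>M lborel)"
    using slice_measurable by (simp cong: measurable_cong_sets sets_pair_measure_cong)
  have "(\<lambda>w. enn2real (\<integral>\<^sup>+t. ennreal (case (w, t) of (w, t) \<Rightarrow> f (fst w) ((snd w)(i := t))) \<partial>lborel)) \<in> borel_measurable (P \<Otimes>\<^sub>M bor I)"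
    by measurable
  then show "(\<lambda>(p, x). marginal i f p x) \<in> borel_measurable (P \<Otimes>\<^sub>M bor I)"
    by (simp add: marginal_def split_beta')
  fix p assume p: "p \<in> space P"
  from slice_bound[OF p] obtain C where C: "0 \<le> C" "\<And>x. x \<in> space (bor I) \<Longrightarrow> (\<integral>\<^sup>+t. ennreal (f p (x(i := t))) \<partial>lborel) \<le> ennreal (C * (\<Prod>i\<in>I. exp (- \<bar>x i\<bar>)))"
    by blast
  show "\<exists>C. \<forall>x\<in>space (bor I). 0 < marginal i f p x \<and> marginal i f p x \<le> C * (\<Prod>i\<in>I. exp (- \<bar>x i\<bar>))"
  proof (intro exI[of _ C] ballI conjI)
    fix x :: "'i \<Rightarrow> real" assume x: "x \<in> space (bor I)"
    show "0 < marginal i f p x" by (rule marginal_pos[OF p x])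
    show "marginal i f p x \<le> C * (\<Prod>i\<in>I. exp (- \<bar>x i\<bar>))"
      using C(2)[OF x] C(1) unfolding marginal_eq[OF p x, symmetric]
      by (subst (asm) ennreal_le_iff) (auto intro!: mult_nonneg_nonneg prod_nonneg)
  qed
qed

lemma nn_integral_insert_marginal:
  assumes h[measurable]: "h \<in> borel_measurable (bor (insert i I))" and p: "p \<in> space P"
  shows "(\<integral>\<^sup>+x. h x * ennreal (f p x) \<partial>leb (insert i I)) = (\<integral>\<^sup>+x. (\<integral>\<^sup>+t. h (x(i := t)) * ennreal (f p (x(i := t))) \<partial>lborel) \<partial>leb I)"
proof -
  interpret product_sigma_finite "\<lambda>_::'i. lborel :: real measure" by standard
  have f: "(\<lambda>(p, x). f p x) \<in> borel_measurable (P \<Otimes>\<^sub>M bor (insert i I))"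
    using dom by (simp add: exp_dominated_def)
  have [measurable]: "f p \<in> borel_measurable (bor (insert i I))"
    using measurable_compose[OF measurable_Pair1'[OF p] f] by simp
  show ?thesis
    by (subst product_nn_integral_insert[OF I]) (auto simp: measurable_cong_sets[OF sets_leb refl])
qed

end

text \<open>Up to normalisation, \<open>Q p\<close> pushes the uniform law of the cube to the
  density \<open>f p\<close>. The mass of \<open>f p\<close> multiplies the left side instead of
  dividing the right one, so unnormalised marginals fit directly.\<close>

definition transports :: "'p measure \<Rightarrow> 'i set \<Rightarrow> ('p \<Rightarrow> ('i \<Rightarrow> real) \<Rightarrow> real) \<Rightarrow> ('p \<Rightarrow> ('i \<Rightarrow> real) \<Rightarrow> 'i \<Rightarrow> real) \<Rightarrow> bool" where
  "transports P I f Q \<longleftrightarrow> (\<lambda>(p, u). Q p u) \<in> P \<Otimes>\<^sub>M bor I \<rightarrow>\<^sub>M bor I \<and>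
     (\<forall>p\<in>space P. \<forall>h\<in>borel_measurable (bor I).
        (\<integral>\<^sup>+u. h (Q p u) \<partial>cube I) * (\<integral>\<^sup>+x. ennreal (f p x) \<partial>leb I) = (\<integral>\<^sup>+x. h x * ennreal (f p x) \<partial>leb I))"

text \<open>Unlike the textbook Knothe map, the new coordinate is integrated out first: \<open>Q\<close> transports the cube to the marginal on \<open>I\<close>, and the conditional law of coordinate \<open>i\<close> is then reached by its quantile function.\<close>

definition knothe_step :: "'i set \<Rightarrow> 'i \<Rightarrow> ('p \<Rightarrow> ('i \<Rightarrow> real) \<Rightarrow> real) \<Rightarrow> ('p \<Rightarrow> ('i \<Rightarrow> real) \<Rightarrow> 'i \<Rightarrow> real) \<Rightarrow> 'p \<Rightarrow> ('i \<Rightarrow> real) \<Rightarrow> 'i \<Rightarrow> real" where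
  "knothe_step I i f Q p u = (let x = Q p (restrict u I) in x(i := nquantile (\<lambda>t. f p (x(i := t))) (u i)))"

lemma product_sigma_finite_unif: "product_sigma_finite (\<lambda>_. unif)"
  by (simp add: product_sigma_finite_def prob_space_unif prob_space_imp_sigma_finite)

lemma nn_integral_cube_insert:
  assumes "finite I" "i \<notin> I" "h \<in> borel_measurable (bor (insert i I))"
  shows "(\<integral>\<^sup>+u. h u \<partial>cube (insert i I)) = (\<integral>\<^sup>+u. (\<integral>\<^sup>+v. h (u(i := v)) \<partial>unif) \<partial>cube I)"
  using assms by (intro product_sigma_finite.product_nn_integral_insert[OF product_sigma_finite_unif])
    (auto simp: measurable_cong_sets[OF sets_cube refl])

lemma restrict_upd_cube:
  assumes "u \<in> space (cube I)" "i \<notin> I"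
  shows "restrict (u(i := v)) I = u"
  using assms by (auto simp: space_PiM PiE_iff extensional_def restrict_def fun_eq_iff)

lemma space_cube: "space (cube I) = space (bor I)" and space_leb: "space (leb I) = space (bor I)"
  by (auto simp: space_PiM)

lemma nn_integral_marginal:
  assumes I: "finite I" "i \<notin> I" and dom: "exp_dominated P (insert i I) f" and p: "p \<in> space P"
  shows "(\<integral>\<^sup>+x. ennreal (f p x) \<partial>leb (insert i I)) = (\<integral>\<^sup>+x. ennreal (marginal i f p x) \<partial>leb I)"
proof -
  have "(\<integral>\<^sup>+x. ennreal (f p x) \<partial>leb (insert i I)) = (\<integral>\<^sup>+x. (\<integral>\<^sup>+t. ennreal (f p (x(i := t))) \<partial>lborel) \<partial>leb I)"
    using nn_integral_insert_marginal[OF I dom _ p, of "\<lambda>_. 1"] by simp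
  also have "\<dots> = (\<integral>\<^sup>+x. ennreal (marginal i f p x) \<partial>leb I)"
    by (intro nn_integral_cong) (simp add: space_leb marginal_eq[OF I dom p])
  finally show ?thesis .
qed

text \<open>Disintegration: given the coordinates in \<open>I\<close>, the quantile of the slice
  samples the conditional law of coordinate \<open>i\<close>, under which \<open>h\<close> has mean
  \<open>g / marginal\<close>. Feeding this ratio to the hypothesis on \<open>Q\<close> cancels the
  marginal and leaves an iterated integral.\<close>

lemma transports_knothe_step:
  fixes P :: "'p measure" and I :: "'i set"
  assumes I: "finite I" "i \<notin> I" and dom: "exp_dominated P (insert i I) f"
    and Q: "transports P I (marginal i f) Q"
  shows "transports P (insert i I) f (knothe_step I i f Q)"
proof -
  have Qm[measurable]: "(\<lambda>(p, u). Q p u) \<in> P \<Otimes>\<^sub>M bor I \<rightarrow>\<^sub>M bor I"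
    using Q by (simp add: transports_def)
  have res: "(\<lambda>w. (fst w, restrict (snd w) I)) \<in> P \<Otimes>\<^sub>M bor (insert i I) \<rightarrow>\<^sub>M P \<Otimes>\<^sub>M bor I"
    by (intro measurable_Pair measurable_compose[OF measurable_snd] measurable_restrict_subset) auto
  have Q'[measurable]: "(\<lambda>w. Q (fst w) (restrict (snd w) I)) \<in> P \<Otimes>\<^sub>M bor (insert i I) \<rightarrow>\<^sub>M bor I"
    using measurable_compose[OF res Qm] by (simp add: split_beta')
  have q: "(\<lambda>(w, v). nquantile (\<lambda>t. f (fst w) ((snd w)(i := t))) v) \<in> borel_measurable ((P \<Otimes>\<^sub>M bor I) \<Otimes>\<^sub>M borel)"
    using slice_pos[OF I dom] slice_finite[OF I dom]
    by (intro measurable_nquantile_kernel slice_measurable[OF I dom]) (auto simp: space_pair_measure)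
  have "(\<lambda>w. ((fst w, Q (fst w) (restrict (snd w) I)), snd w i)) \<in> P \<Otimes>\<^sub>M bor (insert i I) \<rightarrow>\<^sub>M (P \<Otimes>\<^sub>M bor I) \<Otimes>\<^sub>M borel"
    by (intro measurable_Pair measurable_compose[OF measurable_snd] Q') auto
  from measurable_compose[OF this q]
  have q': "(\<lambda>w. nquantile (\<lambda>t. f (fst w) ((Q (fst w) (restrict (snd w) I))(i := t))) (snd w i)) \<in> borel_measurable (P \<Otimes>\<^sub>M bor (insert i I))"
    by (simp add: split_beta')
  have m: "(\<lambda>(p, u). knothe_step I i f Q p u) \<in> P \<Otimes>\<^sub>M bor (insert i I) \<rightarrow>\<^sub>M bor (insert i I)"
    unfolding knothe_step_def Let_def split_beta'
    by (intro measurable_fun_upd[where J=I] Q' q') auto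
  show ?thesis
    unfolding transports_def
  proof (intro conjI ballI m)
    fix p and h :: "('i \<Rightarrow> real) \<Rightarrow> ennreal" assume p: "p \<in> space P" and h[measurable]: "h \<in> borel_measurable (bor (insert i I))"
    have mp[measurable]: "knothe_step I i f Q p \<in> bor (insert i I) \<rightarrow>\<^sub>M bor (insert i I)"
      using measurable_compose[OF measurable_Pair1'[OF p] m] by simp
    have Qp[measurable]: "Q p \<in> bor I \<rightarrow>\<^sub>M bor I"
      using measurable_compose[OF measurable_Pair1'[OF p] Qm] by simp
    define g where "g x = (\<integral>\<^sup>+t. h (x(i := t)) * ennreal (f p (x(i := t))) \<partial>lborel)" for x
    have fm: "(\<lambda>(p, x). f p x) \<in> borel_measurable (P \<Otimes>\<^sub>M bor (insert i I))"
      using dom by (simp add: exp_dominated_def)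
    have fp[measurable]: "f p \<in> borel_measurable (bor (insert i I))"
      using measurable_compose[OF measurable_Pair1'[OF p] fm] by simp
    have gm[measurable]: "g \<in> borel_measurable (bor I)"
    proof -
      have "(\<lambda>(x, t). x(i := t)) \<in> bor I \<Otimes>\<^sub>M lborel \<rightarrow>\<^sub>M bor (insert i I)"
        unfolding split_beta' by (intro measurable_fun_upd[where J=I]) auto
      note [measurable] = measurable_compose[OF this h] measurable_compose[OF this fp]
      have "(\<lambda>(x, t). h (x(i := t)) * ennreal (f p (x(i := t)))) \<in> borel_measurable (bor I \<Otimes>\<^sub>M lborel)"
        using measurable_compose[OF \<open>(\<lambda>(x, t). x(i := t)) \<in> bor I \<Otimes>\<^sub>M lborel \<rightarrow>\<^sub>M bor (insert i I)\<close>, of "\<lambda>x. h x * ennreal (f p x)" borel]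
        by (simp add: split_beta')
      then show ?thesis unfolding g_def[abs_def] by measurable
    qed
    have mm[measurable]: "marginal i f p \<in> borel_measurable (bor I)"
    proof -
      have "(\<lambda>(p, x). marginal i f p x) \<in> borel_measurable (P \<Otimes>\<^sub>M bor I)"
        using exp_dominated_marginal[OF I dom] by (simp add: exp_dominated_def)
      from measurable_compose[OF measurable_Pair1'[OF p] this] show ?thesis by simp
    qed
    have "(\<integral>\<^sup>+u. h (knothe_step I i f Q p u) \<partial>cube (insert i I)) = (\<integral>\<^sup>+u. (\<integral>\<^sup>+v. h (knothe_step I i f Q p (u(i := v))) \<partial>unif) \<partial>cube I)"
      by (rule nn_integral_cube_insert[OF I]) measurable
    also have "\<dots> = (\<integral>\<^sup>+u. g (Q p u) / ennreal (marginal i f p (Q p u)) \<partial>cube I)"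
    proof (rule nn_integral_cong)
      fix u assume u: "u \<in> space (cube I)"
      define x where "x = Q p u"
      have x: "x \<in> space (bor I)" using u measurable_space[OF Qp] by (simp add: space_cube x_def)
      define N where "N = marginal i f p x"
      have N: "0 < N" "(\<integral>\<^sup>+t. ennreal (f p (x(i := t))) \<partial>lborel) = ennreal N"
        using marginal_pos[OF I dom p x] marginal_eq[OF I dom p x] by (auto simp: N_def)
      have hm: "(\<lambda>t. h (x(i := t))) \<in> borel_measurable borel"
        using x by (intro measurable_compose[OF _ h] measurable_fun_upd[where J=I]) auto
      have *: "(\<integral>\<^sup>+v. h (x(i := nquantile (\<lambda>t. f p (x(i := t))) v)) \<partial>unif) * ennreal N = g x"
        using nn_integral_nquantile[OF slice_measurable1[OF I dom p x] slice_pos[OF I dom p x] slice_finite[OF I dom p x] hm] N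
        by (simp add: g_def)
      have "(\<integral>\<^sup>+v. h (knothe_step I i f Q p (u(i := v))) \<partial>unif) = (\<integral>\<^sup>+v. h (x(i := nquantile (\<lambda>t. f p (x(i := t))) v)) \<partial>unif)"
        by (simp add: knothe_step_def restrict_upd_cube[OF u I(2)] x_def Let_def)
      also have "\<dots> = g x / ennreal N"
        unfolding *[symmetric] using N by (simp add: ennreal_mult_divide_eq)
      finally show "(\<integral>\<^sup>+v. h (knothe_step I i f Q p (u(i := v))) \<partial>unif) = g (Q p u) / ennreal (marginal i f p (Q p u))"
        by (simp add: x_def N_def)
    qed
    finally have 1: "(\<integral>\<^sup>+u. h (knothe_step I i f Q p u) \<partial>cube (insert i I)) = (\<integral>\<^sup>+u. g (Q p u) / ennreal (marginal i f p (Q p u)) \<partial>cube I)" .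
    have 2: "(\<integral>\<^sup>+x. ennreal (f p x) \<partial>leb (insert i I)) = (\<integral>\<^sup>+x. ennreal (marginal i f p x) \<partial>leb I)"
      by (rule nn_integral_marginal[OF I dom p])
    have "(\<integral>\<^sup>+u. h (knothe_step I i f Q p u) \<partial>cube (insert i I)) * (\<integral>\<^sup>+x. ennreal (f p x) \<partial>leb (insert i I))
       = (\<integral>\<^sup>+x. (g x / ennreal (marginal i f p x)) * ennreal (marginal i f p x) \<partial>leb I)"
    proof -
      have "(\<lambda>x. g x / ennreal (marginal i f p x)) \<in> borel_measurable (bor I)" by measurable
      from bspec[OF bspec[OF conjunct2[OF Q[unfolded transports_def]] p] this]
      show ?thesis unfolding 1 2 .
    qed
    also have "\<dots> = (\<integral>\<^sup>+x. g x \<partial>leb I)"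
    proof (intro nn_integral_cong)
      fix x assume "x \<in> space (leb I)"
      then have "0 < marginal i f p x" using marginal_pos[OF I dom p] by (simp add: space_leb)
      then show "(g x / ennreal (marginal i f p x)) * ennreal (marginal i f p x) = g x"
        by (simp add: ennreal_divide_times mult_divide_eq_ennreal)
    qed
    also have "\<dots> = (\<integral>\<^sup>+x. h x * ennreal (f p x) \<partial>leb (insert i I))"
      by (simp add: nn_integral_insert_marginal[OF I dom h p] g_def)
    finally show "(\<integral>\<^sup>+u. h (knothe_step I i f Q p u) \<partial>cube (insert i I)) * (\<integral>\<^sup>+x. ennreal (f p x) \<partial>leb (insert i I))
       = (\<integral>\<^sup>+x. h x * ennreal (f p x) \<partial>leb (insert i I))" .
  qed
qed

text \<open>Induction over the coordinates. For fixed old coordinates, the one-dimensional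
  inequality along the slices through \<open>x\<close> and \<open>y\<close> bounds the inner
  integral by \<open>H\<close> at the midpoint, divided by the root of the two slice masses. This is
  the integrand of the inequality for the marginals with \<open>H\<close> in place of
  \<open>G\<close>, so the induction has to run over all \<open>f\<close> and
  \<open>g\<close>.\<close>

lemma prekopa_leindler_knothe:
  fixes P :: "'p measure" and I :: "'i set"
  assumes I: "finite I" and domf: "exp_dominated P I f" and domg: "exp_dominated P I g"
  shows "\<exists>Q R. transports P I f Q \<and> transports P I g R \<and>
    (\<forall>p\<in>space P. \<forall>G\<in>borel_measurable (bor I).
       (\<integral>\<^sup>+u. G (\<lambda>i\<in>I. (Q p u i + R p u i) / 2) * ennreal (1 / sqrt (f p (Q p u) * g p (R p u))) \<partial>cube I)
        * ennreal (sqrt (enn2real (\<integral>\<^sup>+x. ennreal (f p x) \<partial>leb I) * enn2real (\<integral>\<^sup>+x. ennreal (g p x) \<partial>leb I)))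
        \<le> (\<integral>\<^sup>+x. G x \<partial>leb I))"
  using I domf domg
proof (induction I arbitrary: f g rule: finite_induct)
  case empty
  have pos: "0 < f p (\<lambda>_. undefined)" "0 < g p (\<lambda>_. undefined)" if "p \<in> space P" for p
    using empty that by (auto simp: exp_dominated_def space_PiM)
  \<comment> \<open>Over the empty index set there is exactly one point, so both sides reduce to one
    evaluation and the weights cancel.\<close>
  define T where "T = (\<lambda>(p::'p) (u::'i \<Rightarrow> real) (i::'i). undefined :: real)"
  have T: "transports P {} h T" for h
    unfolding transports_def T_def by (auto simp: PiM_empty nn_integral_count_space_finite space_PiM)
  have "(\<integral>\<^sup>+u. G (\<lambda>i\<in>{}. (T p u i + T p u i) / 2) * ennreal (1 / sqrt (f p (T p u) * g p (T p u))) \<partial>cube {})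
        * ennreal (sqrt (enn2real (\<integral>\<^sup>+x. ennreal (f p x) \<partial>leb {}) * enn2real (\<integral>\<^sup>+x. ennreal (g p x) \<partial>leb {})))
        \<le> (\<integral>\<^sup>+x. G x \<partial>leb {})" if p: "p \<in> space P" for p and G :: "('i \<Rightarrow> real) \<Rightarrow> ennreal"
  proof -
    have "ennreal (1 / sqrt (f p (\<lambda>_. undefined) * g p (\<lambda>_. undefined))) * ennreal (sqrt (f p (\<lambda>_. undefined) * g p (\<lambda>_. undefined))) = 1"
      using pos[OF p] by (subst ennreal_mult[symmetric]) auto
    then show ?thesis
      using pos[OF p] by (simp add: T_def PiM_empty nn_integral_count_space_finite restrict_def mult.assoc less_imp_le)
  qed
  with T show ?case by blast
next
  case (insert i I)
  note I = insert.hyps and df = insert.prems(1) and dg = insert.prems(2)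
  obtain Q R where Q: "transports P I (marginal i f) Q" and R: "transports P I (marginal i g) R" and
    PL: "\<And>p G. p \<in> space P \<Longrightarrow> G \<in> borel_measurable (bor I) \<Longrightarrow>
       (\<integral>\<^sup>+u. G (\<lambda>i\<in>I. (Q p u i + R p u i) / 2) * ennreal (1 / sqrt (marginal i f p (Q p u) * marginal i g p (R p u))) \<partial>cube I)
        * ennreal (sqrt (enn2real (\<integral>\<^sup>+x. ennreal (marginal i f p x) \<partial>leb I) * enn2real (\<integral>\<^sup>+x. ennreal (marginal i g p x) \<partial>leb I)))
        \<le> (\<integral>\<^sup>+x. G x \<partial>leb I)"
    using insert.IH[OF exp_dominated_marginal[OF I df] exp_dominated_marginal[OF I dg]] by blast
  define Q' R' where "Q' = knothe_step I i f Q" and "R' = knothe_step I i g R"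
  have Q': "transports P (insert i I) f Q'" and R': "transports P (insert i I) g R'"
    unfolding Q'_def R'_def by (intro transports_knothe_step I df dg Q R)+
  show ?case
  proof (rule exI[of _ Q'], rule exI[of _ R'], intro conjI ballI Q' R')
    fix p and G :: "('i \<Rightarrow> real) \<Rightarrow> ennreal"
    assume p: "p \<in> space P" and G[measurable]: "G \<in> borel_measurable (bor (insert i I))"
    have m1: "h p \<in> borel_measurable (bor J)" if "exp_dominated P J h" for h and J :: "'i set"
      using measurable_compose[OF measurable_Pair1'[OF p], of "\<lambda>(p, x). h p x"] that by (simp add: exp_dominated_def)
    have m2: "T p \<in> bor J \<rightarrow>\<^sub>M bor J" if "transports P J h T" for h T and J :: "'i set"
      using measurable_compose[OF measurable_Pair1'[OF p], of "\<lambda>(p, x). T p x"] that by (simp add: transports_def)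
    note [measurable] = m1[OF df] m1[OF dg] m1[OF exp_dominated_marginal[OF I df]] m1[OF exp_dominated_marginal[OF I dg]]
      m2[OF Q] m2[OF R] m2[OF Q'] m2[OF R']
    define H where "H x = (\<integral>\<^sup>+t. G (x(i := t)) \<partial>lborel)" for x
    have Gm: "(\<lambda>(x, t). G (x(i := t))) \<in> borel_measurable (bor I \<Otimes>\<^sub>M lborel)"
    proof -
      have "(\<lambda>w. (fst w)(i := snd w)) \<in> bor I \<Otimes>\<^sub>M lborel \<rightarrow>\<^sub>M bor (insert i I)"
        by (intro measurable_fun_upd[where J=I]) auto
      from measurable_compose[OF this G] show ?thesis by (simp add: split_beta')
    qed
    then have H[measurable]: "H \<in> borel_measurable (bor I)" unfolding H_def[abs_def] by measurable
    define mid where "mid J x y = (\<lambda>j\<in>J. (x j + y j) / 2 :: real)" for J :: "'i set" and x y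
    have mid[measurable]: "(\<lambda>u. mid J (S u) (T u)) \<in> bor J \<rightarrow>\<^sub>M bor J"
      if [measurable]: "S \<in> bor J \<rightarrow>\<^sub>M bor J" "T \<in> bor J \<rightarrow>\<^sub>M bor J" for S T and J :: "'i set"
      unfolding mid_def by (intro measurable_restrict) measurable
    have N: "(\<integral>\<^sup>+x. ennreal (h p x) \<partial>leb (insert i I)) = (\<integral>\<^sup>+x. ennreal (marginal i h p x) \<partial>leb I)"
      if "exp_dominated P (insert i I) h" for h
      by (rule nn_integral_marginal[OF I that p])
    have "(\<integral>\<^sup>+u. G (mid (insert i I) (Q' p u) (R' p u)) * ennreal (1 / sqrt (f p (Q' p u) * g p (R' p u))) \<partial>cube (insert i I))
      = (\<integral>\<^sup>+u. (\<integral>\<^sup>+v. G (mid (insert i I) (Q' p (u(i := v))) (R' p (u(i := v)))) * ennreal (1 / sqrt (f p (Q' p (u(i := v))) * g p (R' p (u(i := v))))) \<partial>unif) \<partial>cube I)"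
      by (rule nn_integral_cube_insert[OF I]) measurable
    also have "\<dots> \<le> (\<integral>\<^sup>+u. H (mid I (Q p u) (R p u)) * ennreal (1 / sqrt (marginal i f p (Q p u) * marginal i g p (R p u))) \<partial>cube I)"
    proof (rule nn_integral_mono)
      fix u assume u: "u \<in> space (cube I)"
      define x y where "x = Q p u" and "y = R p u"
      have xy: "x \<in> space (bor I)" "y \<in> space (bor I)"
        using u measurable_space[OF m2[OF Q]] measurable_space[OF m2[OF R]] by (auto simp: space_cube x_def y_def)
      define qf qg where "qf = nquantile (\<lambda>t. f p (x(i := t)))" and "qg = nquantile (\<lambda>t. g p (y(i := t)))"
      define nf ng where "nf = marginal i f p x" and "ng = marginal i g p y"
      have n: "0 < nf" "0 < ng" using marginal_pos[OF I df p] marginal_pos[OF I dg p] xy by (auto simp: nf_def ng_def)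
      have mm: "mid (insert i I) (x(i := s)) (y(i := t)) = (mid I x y)(i := (s + t) / 2)" for s t
        using I by (auto simp: mid_def restrict_def)
      have z: "mid I x y \<in> space (bor I)" by (auto simp: mid_def space_PiM)
      have Gz: "(\<lambda>t. G ((mid I x y)(i := t))) \<in> borel_measurable borel"
        using measurable_compose[OF measurable_Pair1' Gm, of "mid I x y"] z by simp
      have "(\<integral>\<^sup>+v. G (mid (insert i I) (Q' p (u(i := v))) (R' p (u(i := v)))) * ennreal (1 / sqrt (f p (Q' p (u(i := v))) * g p (R' p (u(i := v))))) \<partial>unif)
        = (\<integral>\<^sup>+v. G ((mid I x y)(i := (qf v + qg v) / 2)) * ennreal (1 / sqrt (f p (x(i := qf v)) * g p (y(i := qg v)))) \<partial>unif)" (is "?L = ?A")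
        by (simp add: Q'_def R'_def knothe_step_def restrict_upd_cube[OF u I(2)] x_def[symmetric] y_def[symmetric] Let_def mm qf_def[symmetric] qg_def[symmetric])
      moreover have "?A * ennreal (sqrt (nf * ng)) \<le> H (mid I x y)"
        unfolding qf_def qg_def nf_def ng_def marginal_def H_def
        by (rule prekopa_leindler_nquantile[OF slice_measurable1[OF I df p xy(1)] slice_pos[OF I df p xy(1)] slice_finite[OF I df p xy(1)]
            slice_measurable1[OF I dg p xy(2)] slice_pos[OF I dg p xy(2)] slice_finite[OF I dg p xy(2)] Gz])
      then have "?A * ennreal (sqrt (nf * ng)) * ennreal (1 / sqrt (nf * ng)) \<le> H (mid I x y) * ennreal (1 / sqrt (nf * ng))"
        by (rule mult_right_mono) simp
      moreover have "ennreal (sqrt (nf * ng)) * ennreal (1 / sqrt (nf * ng)) = 1"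
        using n by (subst ennreal_mult[symmetric]) auto
      ultimately have "?L \<le> H (mid I x y) * ennreal (1 / sqrt (nf * ng))"
        by (simp add: mult.assoc)
      then show "?L \<le> H (mid I (Q p u) (R p u)) * ennreal (1 / sqrt (marginal i f p (Q p u) * marginal i g p (R p u)))"
        by (simp add: x_def y_def nf_def ng_def)
    qed
    finally have "(\<integral>\<^sup>+u. G (mid (insert i I) (Q' p u) (R' p u)) * ennreal (1 / sqrt (f p (Q' p u) * g p (R' p u))) \<partial>cube (insert i I))
        * ennreal (sqrt (enn2real (\<integral>\<^sup>+x. ennreal (f p x) \<partial>leb (insert i I)) * enn2real (\<integral>\<^sup>+x. ennreal (g p x) \<partial>leb (insert i I))))
      \<le> (\<integral>\<^sup>+u. H (mid I (Q p u) (R p u)) * ennreal (1 / sqrt (marginal i f p (Q p u) * marginal i g p (R p u))) \<partial>cube I)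
        * ennreal (sqrt (enn2real (\<integral>\<^sup>+x. ennreal (marginal i f p x) \<partial>leb I) * enn2real (\<integral>\<^sup>+x. ennreal (marginal i g p x) \<partial>leb I)))"
      unfolding N[OF df] N[OF dg] by (rule mult_right_mono) simp
    also have "\<dots> \<le> (\<integral>\<^sup>+x. H x \<partial>leb I)"
      unfolding mid_def by (rule PL[OF p H])
    also have "\<dots> = (\<integral>\<^sup>+x. G x \<partial>leb (insert i I))"
    proof -
      interpret product_sigma_finite "\<lambda>_::'i. lborel :: real measure" by standard
      show ?thesis unfolding H_def
        by (subst product_nn_integral_insert[OF I]) (auto simp: measurable_cong_sets[OF sets_leb refl])
    qed
    finally show "(\<integral>\<^sup>+u. G (\<lambda>j\<in>insert i I. (Q' p u j + R' p u j) / 2) * ennreal (1 / sqrt (f p (Q' p u) * g p (R' p u))) \<partial>cube (insert i I))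
        * ennreal (sqrt (enn2real (\<integral>\<^sup>+x. ennreal (f p x) \<partial>leb (insert i I)) * enn2real (\<integral>\<^sup>+x. ennreal (g p x) \<partial>leb (insert i I))))
      \<le> (\<integral>\<^sup>+x. G x \<partial>leb (insert i I))"
      by (simp add: mid_def)
  qed
qed

section \<open>From coordinate functions to Euclidean space\<close>

definition of_coords :: "('a::euclidean_space \<Rightarrow> real) \<Rightarrow> 'a" where
  "of_coords x = (\<Sum>b\<in>Basis. x b *\<^sub>R b)"

lemma measurable_of_coords [measurable]: "of_coords \<in> borel_measurable (bor Basis)"
  unfolding of_coords_def[abs_def] by measurable

lemma of_coords_inner: "b \<in> Basis \<Longrightarrow> of_coords x \<bullet> b = x b"
  by (simp add: of_coords_def inner_sum_left inner_Basis if_distrib comm_monoid_add_class.sum.delta cong: if_cong)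

lemma nn_integral_lborel_coords:
  assumes [measurable]: "h \<in> borel_measurable (borel :: 'a::euclidean_space measure)"
  shows "(\<integral>\<^sup>+x. h x \<partial>lborel) = (\<integral>\<^sup>+x. h (of_coords x) \<partial>leb (Basis :: 'a set))"
proof -
  have [measurable]: "of_coords \<in> borel_measurable (leb (Basis :: 'a set))"
    using measurable_of_coords by (simp add: measurable_cong_sets[OF sets_leb refl])
  show ?thesis
    by (subst lborel_eq) (simp add: nn_integral_distr of_coords_def[symmetric])
qed

lemma of_coords_midpoint:
  "of_coords (\<lambda>i\<in>Basis. (x i + y i) / 2) = (1/2) *\<^sub>R (of_coords x + of_coords y)"
  by (rule euclidean_eqI) (simp add: of_coords_inner inner_add_left)

text \<open>The common source \<open>U\<close> is the point: for each parameter the pair of maps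
  couples the two normalised densities, and the inequality holds along this coupling with the
  midpoint visible. The \<open>l1\<close> norm appears because its exponential factorises over
  coordinates, as \<open>exp_dominated\<close> asks.\<close>

theorem prekopa_leindler_coupling:
  fixes f g :: "'p \<Rightarrow> 'a::euclidean_space \<Rightarrow> real" and P :: "'p measure"
  assumes f[measurable]: "(\<lambda>(p, x). f p x) \<in> borel_measurable (P \<Otimes>\<^sub>M borel)"
    and fb: "\<And>p. p \<in> space P \<Longrightarrow> \<exists>C. \<forall>x. 0 < f p x \<and> f p x \<le> C * exp (- (\<Sum>b\<in>Basis. \<bar>x \<bullet> b\<bar>))"
    and g[measurable]: "(\<lambda>(p, x). g p x) \<in> borel_measurable (P \<Otimes>\<^sub>M borel)"
    and gb: "\<And>p. p \<in> space P \<Longrightarrow> \<exists>C. \<forall>x. 0 < g p x \<and> g p x \<le> C * exp (- (\<Sum>b\<in>Basis. \<bar>x \<bullet> b\<bar>))"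
  obtains U :: "('a \<Rightarrow> real) measure" and Q R where "prob_space U"
    "(\<lambda>(p, u). Q p u) \<in> borel_measurable (P \<Otimes>\<^sub>M U)" "(\<lambda>(p, u). R p u) \<in> borel_measurable (P \<Otimes>\<^sub>M U)"
    "\<And>p h. p \<in> space P \<Longrightarrow> h \<in> borel_measurable borel \<Longrightarrow>
       (\<integral>\<^sup>+u. h (Q p u) \<partial>U) * (\<integral>\<^sup>+x. ennreal (f p x) \<partial>lborel) = (\<integral>\<^sup>+x. h x * ennreal (f p x) \<partial>lborel)"
    "\<And>p h. p \<in> space P \<Longrightarrow> h \<in> borel_measurable borel \<Longrightarrow>
       (\<integral>\<^sup>+u. h (R p u) \<partial>U) * (\<integral>\<^sup>+x. ennreal (g p x) \<partial>lborel) = (\<integral>\<^sup>+x. h x * ennreal (g p x) \<partial>lborel)"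
    "\<And>p G. p \<in> space P \<Longrightarrow> G \<in> borel_measurable borel \<Longrightarrow>
       (\<integral>\<^sup>+u. G ((1/2) *\<^sub>R (Q p u + R p u)) * ennreal (1 / sqrt (f p (Q p u) * g p (R p u))) \<partial>U)
        * ennreal (sqrt (enn2real (\<integral>\<^sup>+x. ennreal (f p x) \<partial>lborel) * enn2real (\<integral>\<^sup>+x. ennreal (g p x) \<partial>lborel)))
       \<le> (\<integral>\<^sup>+x. G x \<partial>lborel)"
proof -
  let ?B = "Basis :: 'a set"
  have dom: "exp_dominated P ?B (\<lambda>p x. h p (of_coords x))"
    if h[measurable]: "(\<lambda>(p, x). h p x) \<in> borel_measurable (P \<Otimes>\<^sub>M borel)"
    and hb: "\<And>p. p \<in> space P \<Longrightarrow> \<exists>C. \<forall>x. 0 < h p x \<and> h p x \<le> C * exp (- (\<Sum>b\<in>Basis. \<bar>x \<bullet> b\<bar>))" for h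
    unfolding exp_dominated_def
  proof (intro conjI ballI)
    show "(\<lambda>(p, x). h p (of_coords x)) \<in> borel_measurable (P \<Otimes>\<^sub>M bor ?B)" by measurable
    fix p assume "p \<in> space P"
    from hb[OF this] obtain C where C: "\<And>x. 0 < h p x" "\<And>x. h p x \<le> C * exp (- (\<Sum>b\<in>Basis. \<bar>x \<bullet> b\<bar>))" by auto
    have "exp (- (\<Sum>b\<in>Basis. \<bar>of_coords x \<bullet> b\<bar>)) = (\<Prod>b\<in>?B. exp (- \<bar>x b\<bar>))" for x
      by (simp add: of_coords_inner exp_sum[symmetric] sum_negf)
    then have "h p (of_coords x) \<le> C * (\<Prod>b\<in>?B. exp (- \<bar>x b\<bar>))" for x
      using C(2)[of "of_coords x"] by simp
    then show "\<exists>C. \<forall>x\<in>space (bor ?B). 0 < h p (of_coords x) \<and> h p (of_coords x) \<le> C * (\<Prod>b\<in>?B. exp (- \<bar>x b\<bar>))"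
      using C(1) by blast
  qed
  from prekopa_leindler_knothe[OF finite_Basis dom[OF f fb] dom[OF g gb]]
  obtain Q R where Q: "transports P ?B (\<lambda>p x. f p (of_coords x)) Q" and R: "transports P ?B (\<lambda>p x. g p (of_coords x)) R"
    and PL: "\<And>p G. p \<in> space P \<Longrightarrow> G \<in> borel_measurable (bor ?B) \<Longrightarrow>
       (\<integral>\<^sup>+u. G (\<lambda>i\<in>?B. (Q p u i + R p u i) / 2) * ennreal (1 / sqrt (f p (of_coords (Q p u)) * g p (of_coords (R p u)))) \<partial>cube ?B)
        * ennreal (sqrt (enn2real (\<integral>\<^sup>+x. ennreal (f p (of_coords x)) \<partial>leb ?B) * enn2real (\<integral>\<^sup>+x. ennreal (g p (of_coords x)) \<partial>leb ?B)))
        \<le> (\<integral>\<^sup>+x. G x \<partial>leb ?B)" by blast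
  have p1: "(\<lambda>x. h p x) \<in> borel_measurable borel" if "(\<lambda>(p, x). h p x) \<in> borel_measurable (P \<Otimes>\<^sub>M borel)" "p \<in> space P"
    for h :: "'p \<Rightarrow> 'a \<Rightarrow> real" and p
    using measurable_compose[OF measurable_Pair1'[OF that(2)] that(1)] by simp
  have meas: "(\<lambda>(p, u). of_coords (S p u)) \<in> borel_measurable (P \<Otimes>\<^sub>M cube ?B)" if "transports P ?B h S" for S h
  proof -
    have "(\<lambda>(p, u). S p u) \<in> P \<Otimes>\<^sub>M bor ?B \<rightarrow>\<^sub>M bor ?B" using that by (simp add: transports_def)
    from measurable_compose[OF this measurable_of_coords]
    show ?thesis by (simp add: split_beta' measurable_cong_sets[OF sets_pair_measure_cong[OF refl sets_cube] refl])
  qed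
  have law: "(\<integral>\<^sup>+u. h (of_coords (S p u)) \<partial>cube ?B) * (\<integral>\<^sup>+x. ennreal (k p x) \<partial>lborel) = (\<integral>\<^sup>+x. h x * ennreal (k p x) \<partial>lborel)"
    if S: "transports P ?B (\<lambda>p x. k p (of_coords x)) S" and k: "(\<lambda>(p, x). k p x) \<in> borel_measurable (P \<Otimes>\<^sub>M borel)"
      and p: "p \<in> space P" and [measurable]: "h \<in> borel_measurable borel" for S k p h
  proof -
    note p1[OF k p, measurable]
    have "(\<lambda>x. h (of_coords x)) \<in> borel_measurable (bor ?B)" by measurable
    from bspec[OF bspec[OF conjunct2[OF S[unfolded transports_def]] p] this]
    show ?thesis by (simp add: nn_integral_lborel_coords)
  qed
  show ?thesis
  proof (rule that[of "cube ?B" "\<lambda>p u. of_coords (Q p u)" "\<lambda>p u. of_coords (R p u)"])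
    show "prob_space (cube ?B)" by (intro prob_space_PiM prob_space_unif)
    fix p and G :: "'a \<Rightarrow> ennreal" assume p: "p \<in> space P" and [measurable]: "G \<in> borel_measurable borel"
    note p1[OF f p, measurable] p1[OF g p, measurable]
    have "(\<lambda>x. G (of_coords x)) \<in> borel_measurable (bor ?B)" by measurable
    from PL[OF p this]
    show "(\<integral>\<^sup>+u. G ((1/2) *\<^sub>R (of_coords (Q p u) + of_coords (R p u))) * ennreal (1 / sqrt (f p (of_coords (Q p u)) * g p (of_coords (R p u)))) \<partial>cube ?B)
        * ennreal (sqrt (enn2real (\<integral>\<^sup>+x. ennreal (f p x) \<partial>lborel) * enn2real (\<integral>\<^sup>+x. ennreal (g p x) \<partial>lborel)))
       \<le> (\<integral>\<^sup>+x. G x \<partial>lborel)"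
      by (simp add: nn_integral_lborel_coords of_coords_midpoint)
  qed (use meas[OF Q] meas[OF R] law[OF Q f] law[OF R g] in auto)
qed

section \<open>Gaussian marginals\<close>

lemma nn_integral_exp_minus_l1:
  "(\<integral>\<^sup>+(x::'a::euclidean_space). ennreal (exp (- (\<Sum>b\<in>Basis. \<bar>x \<bullet> b\<bar>))) \<partial>lborel) < \<infinity>"
proof -
  have "(\<integral>\<^sup>+(x::'a). ennreal (exp (- (\<Sum>b\<in>Basis. \<bar>x \<bullet> b\<bar>))) \<partial>lborel) = (\<integral>\<^sup>+(x::'a). (\<Prod>b\<in>Basis. ennreal (exp (- \<bar>x \<bullet> b\<bar>))) \<partial>lborel)"
    by (simp add: exp_sum[symmetric] sum_negf prod_ennreal)
  also have "\<dots> = (\<Prod>b\<in>(Basis::'a set). (\<integral>\<^sup>+t. ennreal (exp (- \<bar>t\<bar>)) \<partial>lborel))"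
    by (rule nn_integral_lborel_prod) auto
  also have "\<dots> < \<infinity>" using nn_integral_exp_minus_abs by (simp add: power_less_top_ennreal)
  finally show ?thesis .
qed

lemma l1_le_DIM_norm: "(\<Sum>b\<in>Basis. \<bar>x \<bullet> b\<bar>) \<le> DIM('a) * norm (x::'a::euclidean_space)"
  using sum_bounded_above[of Basis "\<lambda>b. \<bar>x \<bullet> b\<bar>" "norm x"] by (simp add: Basis_le_norm)

text \<open>The nonnegative square \<open>(r - s * d)^2 / (2 * s)\<close> trades the Gaussian for an
  exponential of slope \<open>d\<close>, the slope that dominates the \<open>l1\<close> norm. This
  puts every bounded density times a Gaussian within reach of the coupling theorem.\<close>

lemma gaussian_le_exp_l1:
  fixes x y :: "'a::euclidean_space" and s :: real
  assumes s: "s > 0"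
  shows "exp (- (norm (x - y))\<^sup>2 / (2 * s)) \<le> exp (s * DIM('a)^2 / 2 + DIM('a) * norm y) * exp (- (\<Sum>b\<in>Basis. \<bar>x \<bullet> b\<bar>))"
proof -
  define d where "d = real DIM('a)"
  define r where "r = norm (x - y)"
  have "0 \<le> (r - s * d)\<^sup>2 / (2 * s)" using s by simp
  then have "d * r - s * d^2 / 2 \<le> r\<^sup>2 / (2 * s)"
    using s by (simp add: field_simps power2_eq_square)
  moreover have "(\<Sum>b\<in>Basis. \<bar>x \<bullet> b\<bar>) \<le> d * norm x" unfolding d_def by (rule l1_le_DIM_norm)
  moreover have "d * norm x \<le> d * (r + norm y)"
    unfolding d_def r_def by (intro mult_left_mono) (auto intro: norm_triangle_sub[THEN order_trans] simp: norm_minus_commute add.commute)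
  ultimately show ?thesis
    unfolding exp_add[symmetric] r_def[symmetric] of_nat_power by (simp add: d_def algebra_simps)
qed

text \<open>The value is \<open>(2 * pi * s) powr (d / 2)\<close>, but the arguments use only that
  it is finite and positive, hence the definition by the integral itself. The type argument fixes
  the dimension.\<close>

definition gauss_const :: "'a::euclidean_space itself \<Rightarrow> real \<Rightarrow> real" where
  "gauss_const _ s = enn2real (\<integral>\<^sup>+(z::'a). ennreal (exp (- (norm z)\<^sup>2 / (2 * s))) \<partial>lborel)"

definition gauss :: "real \<Rightarrow> 'a::euclidean_space \<Rightarrow> 'a \<Rightarrow> real" where
  "gauss s x y = exp (- (norm (x - y))\<^sup>2 / (2 * s)) / gauss_const TYPE('a) s"

lemma measurable_gauss [measurable]:
  "(\<lambda>(x, y). gauss s x y) \<in> borel_measurable (borel \<Otimes>\<^sub>M borel)"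
  unfolding gauss_def by measurable

lemma nn_integral_lborel_translate:
  fixes f :: "'a::euclidean_space \<Rightarrow> ennreal"
  assumes [measurable]: "f \<in> borel_measurable borel"
  shows "(\<integral>\<^sup>+x. f (c + x) \<partial>lborel) = (\<integral>\<^sup>+x. f x \<partial>lborel)"
proof -
  have "(\<integral>\<^sup>+x. f x \<partial>lborel) = (\<integral>\<^sup>+x. f x \<partial>(distr lborel borel ((+) c)))" by (simp add: lborel_distr_plus)
  also have "\<dots> = (\<integral>\<^sup>+x. f (c + x) \<partial>lborel)" by (subst nn_integral_distr) auto
  finally show ?thesis by simp
qed

section \<open>Identities for Gaussian kernels\<close>

context
  fixes s :: real
  assumes s: "s > 0"
begin

lemma gauss_normalizer:
  shows "(\<integral>\<^sup>+(z::'a::euclidean_space). ennreal (exp (- (norm z)\<^sup>2 / (2 * s))) \<partial>lborel) < \<infinity>" (is "?I < _")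
    and "0 < gauss_const TYPE('a) s"
proof -
  have "?I \<le> (\<integral>\<^sup>+(x::'a). ennreal (exp (s * DIM('a)^2 / 2)) * ennreal (exp (- (\<Sum>b\<in>Basis. \<bar>x \<bullet> b\<bar>))) \<partial>lborel)"
    using gaussian_le_exp_l1[OF s, where y="0::'a"]
    by (intro nn_integral_mono) (auto simp: ennreal_mult[symmetric] intro!: ennreal_leI)
  also have "\<dots> = ennreal (exp (s * DIM('a)^2 / 2)) * (\<integral>\<^sup>+(x::'a). ennreal (exp (- (\<Sum>b\<in>Basis. \<bar>x \<bullet> b\<bar>))) \<partial>lborel)"
    by (rule nn_integral_cmult) auto
  also have "\<dots> < \<infinity>" using nn_integral_exp_minus_l1[where 'a='a] by (simp add: ennreal_mult_less_top)
  finally show fin: "?I < \<infinity>" .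
  have "0 < ?I" by (rule nn_integral_pos_real) auto
  with fin have "0 < enn2real ?I" by (simp add: enn2real_positive_iff)
  then show "0 < gauss_const TYPE('a) s" unfolding gauss_const_def .
qed

lemma gauss_pos: "0 < gauss s (x::'a::euclidean_space) y"
  unfolding gauss_def using gauss_normalizer(2)[where 'a='a] by simp

lemma nn_integral_gauss: "(\<integral>\<^sup>+(y::'a::euclidean_space). ennreal (gauss s x y) \<partial>lborel) = 1"
proof -
  define c where "c = gauss_const TYPE('a) s"
  have c: "0 < c" "(\<integral>\<^sup>+(z::'a). ennreal (exp (- (norm z)\<^sup>2 / (2 * s))) \<partial>lborel) = ennreal c"
    using gauss_normalizer[where 'a='a] unfolding c_def gauss_const_def by (simp_all add: less_top)
  have "(\<integral>\<^sup>+y. ennreal (gauss s x y) \<partial>lborel) = (\<integral>\<^sup>+y. ennreal (gauss s x (x + y)) \<partial>lborel)"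
    by (rule nn_integral_lborel_translate[symmetric]) measurable
  also have "\<dots> = (\<integral>\<^sup>+(y::'a). ennreal (exp (- (norm y)\<^sup>2 / (2 * s))) / ennreal c \<partial>lborel)"
    using c(1) by (intro nn_integral_cong) (simp add: gauss_def c_def[symmetric] divide_ennreal)
  also have "\<dots> = 1" using c by (simp add: nn_integral_divide ennreal_divide_self)
  finally show ?thesis .
qed

text \<open>The parallelogram identity for \<open>x - y\<close> and \<open>x' - y\<close> leaves the
  term \<open>(norm (x - x'))^2 / 4\<close>; divided by \<open>2 * s\<close> it produces the gain
  with constant \<open>8\<close>.\<close>

lemma gauss_midpoint:
  fixes x x' y :: "'a::euclidean_space"
  shows "gauss s ((1/2) *\<^sub>R (x + x')) y = sqrt (gauss s x y * gauss s x' y) * exp ((norm (x - x'))\<^sup>2 / (8 * s))"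
proof -
  define c where "c = gauss_const TYPE('a) s"
  have c: "0 < c" using gauss_normalizer(2)[where 'a='a] by (auto simp: c_def)
  have id: "(norm ((1/2) *\<^sub>R (x + x') - y))\<^sup>2 = (norm (x - y))\<^sup>2 / 2 + (norm (x' - y))\<^sup>2 / 2 - (norm (x - x'))\<^sup>2 / 4"
    by (simp add: power2_norm_eq_inner inner_diff_left inner_diff_right inner_add_left inner_add_right inner_commute field_simps)
  define E where "E z = exp (- (norm (z - y))\<^sup>2 / (4 * s))" for z
  have E2: "exp (- (norm (z - y))\<^sup>2 / (2 * s)) = (E z)\<^sup>2" for z
    using s by (simp add: E_def exp_double[symmetric] field_simps)
  have "sqrt (gauss s x y * gauss s x' y) = sqrt ((E x * E x' / c)\<^sup>2)"
    unfolding gauss_def c_def[symmetric] E2 by (simp add: power2_eq_square)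
  also have "\<dots> = E x * E x' / c" using c by (intro real_sqrt_abs[THEN trans] abs_of_nonneg) (auto simp: E_def)
  finally have "sqrt (gauss s x y * gauss s x' y) * exp ((norm (x - x'))\<^sup>2 / (8 * s)) = E x * E x' * exp ((norm (x - x'))\<^sup>2 / (8 * s)) / c"
    by simp
  also have "\<dots> = gauss s ((1/2) *\<^sub>R (x + x')) y"
    using s unfolding gauss_def id c_def[symmetric] E_def exp_add[symmetric] by (simp add: field_simps)
  finally show ?thesis by simp
qed

text \<open>Completing the square: the quotient is again a Gaussian kernel, centered at
  \<open>x + x'\<close>, times a factor free of \<open>y\<close>. Integration over \<open>y\<close>
  therefore turns the chi-square distance of a Gaussian mixture into a double integral of
  \<open>exp (x \<bullet> x' / s)\<close>.\<close>

lemma gauss_mult: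
  fixes x x' y :: "'a::euclidean_space"
  shows "gauss s x y * gauss s x' y / gauss s 0 y = gauss s (x + x') y * exp (x \<bullet> x' / s)"
proof -
  define c where "c = gauss_const TYPE('a) s"
  have c: "0 < c" using gauss_normalizer(2)[where 'a='a] by (auto simp: c_def)
  have id: "- (norm (x - y))\<^sup>2 / (2 * s) + - (norm (x' - y))\<^sup>2 / (2 * s) = (- (norm (x + x' - y))\<^sup>2 / (2 * s) + x \<bullet> x' / s) + - (norm (0 - y))\<^sup>2 / (2 * s)"
    using s by (simp add: power2_norm_eq_inner inner_diff_left inner_diff_right inner_add_left inner_add_right inner_commute field_simps)
  have "gauss s x y * gauss s x' y * c = gauss s (x + x') y * exp (x \<bullet> x' / s) * gauss s 0 y * c"
    using c arg_cong[OF id, of exp] unfolding gauss_def c_def[symmetric] exp_add by (simp add: field_simps)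
  then show ?thesis using c gauss_pos[of 0 y] by (simp add: field_simps)
qed

lemma gauss_le_exp_l1: "\<exists>C\<ge>0. \<forall>x::'a::euclidean_space. gauss s x y \<le> C * exp (- (\<Sum>b\<in>Basis. \<bar>x \<bullet> b\<bar>))"
proof -
  define c where "c = gauss_const TYPE('a) s"
  have c: "0 < c" using gauss_normalizer(2)[where 'a='a] by (auto simp: c_def)
  have "gauss s x y \<le> exp (s * DIM('a)^2 / 2 + DIM('a) * norm y) * exp (- (\<Sum>b\<in>Basis. \<bar>x \<bullet> b\<bar>)) / c" for x
    unfolding gauss_def c_def[symmetric] using gaussian_le_exp_l1[OF s, of x y] c by (intro divide_right_mono) auto
  then show ?thesis using c by (intro exI[of _ "exp (s * DIM('a)^2 / 2 + DIM('a) * norm y) / c"]) auto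
qed

end

lemma exp_le_quadratic:
  fixes t :: real assumes "\<bar>t\<bar> \<le> 1" shows "exp t \<le> 1 + t + t\<^sup>2"
proof (cases "0 \<le> t")
  case True then show ?thesis using exp_bound[of t] assms by auto
next
  case False
  define r where "r = - t"
  have r: "0 < r" using False by (simp add: r_def)
  have "exp t = 1 / exp r" by (simp add: r_def exp_minus field_simps)
  also have "\<dots> \<le> 1 / (1 + r)" using r exp_ge_add_one_self[of r] by (intro divide_left_mono) auto
  also have "\<dots> \<le> 1 - r + r\<^sup>2"
  proof -
    have "(1 - r + r\<^sup>2) * (1 + r) = 1 + r^3" by (simp add: algebra_simps power2_eq_square power3_eq_cube)
    then have "1 \<le> (1 - r + r\<^sup>2) * (1 + r)" using r by simp
    then show ?thesis using r by (simp add: divide_le_eq)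
  qed
  finally show ?thesis by (simp add: r_def)
qed

text \<open>Multiplying by \<open>(sqrt a + sqrt c)^2\<close>, which is at least \<open>c\<close>,
  bounds the integrand of the squared Hellinger distance by that of the chi-square distance.\<close>

lemma sqrt_diff_power2_le:
  fixes a c :: real assumes "0 \<le> a" "0 < c"
  shows "(sqrt a - sqrt c)\<^sup>2 \<le> (a - c)\<^sup>2 / c"
proof -
  have "(a - c)\<^sup>2 = (sqrt a - sqrt c)\<^sup>2 * (sqrt a + sqrt c)\<^sup>2"
    using assms by (simp add: power_mult_distrib[symmetric] square_diff_square_factored[symmetric] mult.commute flip: power2_eq_square)
      (simp add: algebra_simps power2_eq_square)
  moreover have "c \<le> (sqrt a + sqrt c)\<^sup>2" using assms by (simp add: power2_sum)
  ultimately have "(sqrt a - sqrt c)\<^sup>2 * c \<le> (a - c)\<^sup>2" by (simp add: mult_left_mono)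
  then show ?thesis using assms by (simp add: le_divide_eq)
qed

text \<open>The weights consist of main parts \<open>a\<close>, \<open>a'\<close> near a common
  reference \<open>c\<close> and of remainders \<open>b\<close>, \<open>b'\<close>. Cauchy-Schwarz
  for the vectors of square roots separates the two kinds; the main parts are compared through
  \<open>c\<close>, while the remainders enter linearly.\<close>

lemma sqrt_diff_power2_split:
  fixes a a' b b' c :: real assumes "0 \<le> a" "0 \<le> a'" "0 \<le> b" "0 \<le> b'" "0 < c"
  shows "(sqrt (a + b) - sqrt (a' + b'))\<^sup>2 \<le> 2 * ((a - c)\<^sup>2 / c) + 2 * ((a' - c)\<^sup>2 / c) + b + b'"
proof -
  have cs: "sqrt (a * a') + sqrt (b * b') \<le> sqrt ((a + b) * (a' + b'))"
  proof (rule real_le_rsqrt)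
    have "2 * (sqrt (a * a') * sqrt (b * b')) \<le> a * b' + a' * b"
      using sum_squares_bound[of "sqrt (a * b')" "sqrt (a' * b)"] assms by (simp add: real_sqrt_mult[symmetric] mult_ac)
    then show "(sqrt (a * a') + sqrt (b * b'))\<^sup>2 \<le> (a + b) * (a' + b')"
      using assms by (simp add: power2_sum algebra_simps)
  qed
  have e: "(sqrt x - sqrt y)\<^sup>2 = x + y - 2 * sqrt (x * y)" if "0 \<le> x" "0 \<le> y" for x y :: real
    using that by (simp add: power2_diff real_sqrt_mult)
  have q: "(u - v)\<^sup>2 \<le> 2 * (u - w)\<^sup>2 + 2 * (v - w)\<^sup>2" for u v w :: real
    using zero_le_power2[of "u + v - 2 * w"] by (simp add: power2_eq_square algebra_simps)
  have "(sqrt (a + b) - sqrt (a' + b'))\<^sup>2 \<le> (sqrt a - sqrt a')\<^sup>2 + (sqrt b - sqrt b')\<^sup>2"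
    using assms cs by (simp add: e)
  also have "(sqrt b - sqrt b')\<^sup>2 \<le> b + b'" using assms by (simp add: e)
  also have "(sqrt a - sqrt a')\<^sup>2 \<le> 2 * (sqrt a - sqrt c)\<^sup>2 + 2 * (sqrt a' - sqrt c)\<^sup>2"
    by (rule q)
  also have "\<dots> \<le> 2 * ((a - c)\<^sup>2 / c) + 2 * ((a' - c)\<^sup>2 / c)"
    using assms by (intro add_mono mult_left_mono sqrt_diff_power2_le) auto
  finally show ?thesis by simp
qed

lemma power_le_one_plus_power6:
  fixes r :: real assumes "0 \<le> r" "k \<le> 6" shows "r ^ k \<le> 1 + r ^ 6"
proof (cases "r \<le> 1")
  case True
  then have "r ^ k \<le> 1" using assms by (simp add: power_le_one)
  then show ?thesis using assms by (simp add: add_increasing2)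
next
  case False
  then have "r ^ k \<le> r ^ 6" using assms by (intro power_increasing) auto
  then show ?thesis by simp
qed

section \<open>Gaussian convolution of a centered density and its chi-square distance to the
  Gaussian\<close>

context
  fixes p :: "'a::euclidean_space \<Rightarrow> real" and s M :: real
  assumes p[measurable]: "p \<in> borel_measurable borel" and p0: "\<And>x. 0 \<le> p x" and p1: "(\<integral>\<^sup>+x. p x \<partial>lborel) = 1"
    and mom: "(\<integral>\<^sup>+x. ennreal ((1 + norm x ^ 6) * p x) \<partial>lborel) \<le> ennreal M"
    and mean: "(\<integral>x. p x *\<^sub>R x \<partial>lborel) = 0" and s: "s > 0"
begin

text \<open>The constant term in the sixth moment makes \<open>M\<close> at least the mass of
  \<open>p\<close>, which is \<open>1\<close>; this later allows \<open>M\<close> to be absorbed in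
  \<open>M^2\<close>.\<close>

lemma moment_bound:
  assumes "k \<le> 6"
  shows "integrable lborel (\<lambda>x. norm x ^ k * p x)" "(\<integral>x. norm x ^ k * p x \<partial>lborel) \<le> M" "1 \<le> M"
proof -
  have "(\<integral>\<^sup>+x. ennreal (p x) \<partial>lborel) \<le> (\<integral>\<^sup>+x. ennreal ((1 + norm x ^ 6) * p x) \<partial>lborel)"
    using p0 by (intro nn_integral_mono ennreal_leI) (simp add: distrib_right)
  then have "ennreal 1 \<le> ennreal M" by (metis ennreal_1 p1 mom order_trans)
  then show M1: "1 \<le> M" unfolding ennreal_le_iff2 by auto
  have *: "(\<integral>\<^sup>+x. ennreal (norm x ^ k * p x) \<partial>lborel) \<le> ennreal M"
    by (rule order_trans[OF nn_integral_mono mom], intro ennreal_leI mult_right_mono power_le_one_plus_power6)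
       (use p0 assms in auto)
  show i: "integrable lborel (\<lambda>x. norm x ^ k * p x)"
    using * p0 by (intro integrableI_bounded) (auto simp: abs_mult intro: le_less_trans)
  show "(\<integral>x. norm x ^ k * p x \<partial>lborel) \<le> M"
    using * nn_integral_eq_integral[OF i] p0 M1 by (simp add: mult_nonneg_nonneg)
qed

lemma integrable_density_real: "integrable lborel p" "(\<integral>x. p x \<partial>lborel) = 1"
  using moment_bound(1)[of 0] p1 p0 by (auto simp: integral_eq_nn_integral)

text \<open>The radius \<open>sqrt s\<close> is the largest one for which
  \<open>x \<bullet> x' / s\<close> stays between \<open>-1\<close> and \<open>1\<close>, where the
  exponential has a quadratic upper bound. The measure is not renormalised; its missing mass is
  tracked separately.\<close>

definition "trunc = density lborel (\<lambda>x. ennreal (p x * indicator {x. (norm x)\<^sup>2 \<le> s} x))"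

lemma sets_trunc [simp, measurable_cong]: "sets trunc = sets borel" and space_trunc [simp]: "space trunc = UNIV"
  by (auto simp: trunc_def)

lemma nn_integral_trunc:
  assumes [measurable]: "h \<in> borel_measurable borel"
  shows "(\<integral>\<^sup>+x. h x \<partial>trunc) = (\<integral>\<^sup>+x. ennreal (p x * indicator {x. (norm x)\<^sup>2 \<le> s} x) * h x \<partial>lborel)"
  unfolding trunc_def by (subst nn_integral_density) auto

lemma integral_trunc:
  fixes h :: "'a \<Rightarrow> 'b::{banach, second_countable_topology}"
  assumes [measurable]: "h \<in> borel_measurable borel"
  shows "(\<integral>x. h x \<partial>trunc) = (\<integral>x. (p x * indicator {x. (norm x)\<^sup>2 \<le> s} x) *\<^sub>R h x \<partial>lborel)"
  unfolding trunc_def using p0 by (subst integral_density) auto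

lemma AE_trunc: "AE x in trunc. norm x \<le> sqrt s"
  unfolding trunc_def by (subst AE_density) (auto simp: indicator_def real_le_rsqrt)

lemma finite_measure_trunc: "finite_measure trunc"
proof
  have "emeasure trunc (space trunc) \<le> (\<integral>\<^sup>+x. p x \<partial>lborel)"
    unfolding trunc_def using p0 by (simp add: emeasure_density) (intro nn_integral_mono ennreal_leI, auto simp: indicator_def)
  then show "emeasure trunc (space trunc) \<noteq> \<infinity>" using p1 by (auto simp: top_unique)
qed

interpretation T: finite_measure trunc by (rule finite_measure_trunc)

lemma integrable_trunc_bounded:
  fixes h :: "'a \<Rightarrow> 'b::{banach, second_countable_topology}"
  assumes [measurable]: "h \<in> borel_measurable borel" and "\<And>x. norm x \<le> sqrt s \<Longrightarrow> norm (h x) \<le> C"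
  shows "integrable trunc h"
  by (rule T.integrable_const_bound[where B=C]) (use AE_trunc assms(2) in \<open>auto elim: eventually_mono\<close>)

text \<open>Outside the ball, \<open>1 \<le> norm x ^ 4 / s^2\<close> and
  \<open>norm x \<le> norm x ^ 2 / sqrt s\<close>. So the fourth moment controls the lost mass and
  the second moment controls the barycenter, which was zero before the cutoff.\<close>

lemma trunc_mass:
  "measure trunc UNIV \<le> 1" "1 - measure trunc UNIV \<le> M / s\<^sup>2"
  "(\<integral>x. (norm x)\<^sup>2 \<partial>trunc) \<le> M" "norm (\<integral>x. x \<partial>trunc) \<le> M / sqrt s"
proof -
  let ?A = "{x::'a. (norm x)\<^sup>2 \<le> s}"
  have meas: "measure trunc UNIV = (\<integral>x. p x * indicator ?A x \<partial>lborel)"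
    using integral_trunc[of "\<lambda>_. 1::real"] by simp
  have i1: "integrable lborel (\<lambda>x. p x * indicator ?A x)"
    by (rule Bochner_Integration.integrable_bound[OF integrable_density_real(1)]) (auto simp: indicator_def p0)
  show "measure trunc UNIV \<le> 1"
    unfolding meas integrable_density_real(2)[symmetric]
    by (intro integral_mono i1 integrable_density_real) (auto simp: indicator_def p0)
  have "1 - measure trunc UNIV = (\<integral>x. p x - p x * indicator ?A x \<partial>lborel)"
    unfolding meas using i1 integrable_density_real by simp
  also have "\<dots> \<le> (\<integral>x. norm x ^ 4 * p x / s\<^sup>2 \<partial>lborel)"
  proof (intro integral_mono)
    fix x
    show "p x - p x * indicator ?A x \<le> norm x ^ 4 * p x / s\<^sup>2"
    proof (cases "(norm x)\<^sup>2 \<le> s")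
      case False
      then have "s\<^sup>2 \<le> ((norm x)\<^sup>2)\<^sup>2" using s by (intro power_mono) auto
      then have "s\<^sup>2 * p x \<le> norm x ^ 4 * p x" using p0 by (intro mult_right_mono) auto
      then show ?thesis using False s by (simp add: field_simps)
    qed (use p0 in auto)
  qed (use i1 integrable_density_real moment_bound(1)[of 4] in auto)
  also have "\<dots> \<le> M / s\<^sup>2" using moment_bound(2)[of 4] s by (simp add: divide_right_mono)
  finally show "1 - measure trunc UNIV \<le> M / s\<^sup>2" .
  have "(\<integral>x. (norm x)\<^sup>2 \<partial>trunc) = (\<integral>x. p x * indicator ?A x * (norm x)\<^sup>2 \<partial>lborel)"
    by (subst integral_trunc) auto
  also have "\<dots> \<le> (\<integral>x. norm x ^ 2 * p x \<partial>lborel)"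
    by (rule integral_mono_AE[OF Bochner_Integration.integrable_bound[OF moment_bound(1)[of 2]] moment_bound(1)[of 2]])
       (auto simp: indicator_def p0)
  also have "\<dots> \<le> M" using moment_bound(2)[of 2] by simp
  finally show "(\<integral>x. (norm x)\<^sup>2 \<partial>trunc) \<le> M" .
  have i2: "integrable lborel (\<lambda>x. p x *\<^sub>R x)"
    by (rule Bochner_Integration.integrable_bound[OF moment_bound(1)[of 1]]) (auto simp: p0)
  have i3: "integrable lborel (\<lambda>x. (p x * indicator ?A x) *\<^sub>R x)"
    by (rule Bochner_Integration.integrable_bound[OF moment_bound(1)[of 1]]) (auto simp: p0 indicator_def)
  have "norm (\<integral>x. x \<partial>trunc) = norm (\<integral>x. (p x * indicator ?A x) *\<^sub>R x - p x *\<^sub>R x \<partial>lborel)"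
    using i2 i3 mean by (simp add: integral_trunc)
  also have "\<dots> \<le> (\<integral>x. norm x ^ 2 * p x / sqrt s \<partial>lborel)"
  proof (rule Bochner_Integration.integral_norm_bound_integral)
    fix x
    show "norm ((p x * indicator ?A x) *\<^sub>R x - p x *\<^sub>R x) \<le> norm x ^ 2 * p x / sqrt s"
    proof (cases "(norm x)\<^sup>2 \<le> s")
      case False
      then have "sqrt s \<le> norm x" using s by (simp add: real_le_lsqrt)
      then have "sqrt s * (norm x * p x) \<le> norm x * (norm x * p x)" using p0 by (intro mult_right_mono) auto
      then show ?thesis using False s p0[of x] by (simp add: field_simps power2_eq_square)
    qed (use p0 s in auto)
  qed (use i2 i3 moment_bound(1)[of 2] in auto)
  also have "\<dots> \<le> M / sqrt s" using moment_bound(2)[of 2] s by (simp add: divide_right_mono)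
  finally show "norm (\<integral>x. x \<partial>trunc) \<le> M / sqrt s" .
qed

text \<open>The constant term of the expansion gives the squared mass, the linear term the squared
  barycenter over \<open>s\<close>, and the quadratic term the squared second moment over
  \<open>s^2\<close>. The smallness of the barycenter brings the linear term down to order
  \<open>1 / s^2\<close> as well.\<close>

lemma nn_integral_trunc_exp:
  "(\<integral>\<^sup>+x. (\<integral>\<^sup>+x'. ennreal (exp (x \<bullet> x' / s)) \<partial>trunc) \<partial>trunc) \<le> ennreal ((measure trunc UNIV)\<^sup>2 + 2 * M\<^sup>2 / s\<^sup>2)"
proof -
  define \<alpha> where "\<alpha> = measure trunc UNIV"
  define \<xi> where "\<xi> = (\<integral>x. x \<partial>trunc)"
  define \<beta> where "\<beta> = (\<integral>x. (norm x)\<^sup>2 \<partial>trunc)"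
  have ix: "integrable trunc (\<lambda>x. x)" by (rule integrable_trunc_bounded[where C="sqrt s"]) auto
  have ix2: "integrable trunc (\<lambda>x. (norm x)\<^sup>2)"
    by (rule integrable_trunc_bounded[where C="(sqrt s)\<^sup>2"]) (auto intro: power_mono)
  have \<beta>0: "0 \<le> \<beta>" unfolding \<beta>_def by simp
  have inner: "(\<integral>\<^sup>+x'. ennreal (exp (x \<bullet> x' / s)) \<partial>trunc) \<le> ennreal (\<alpha> + x \<bullet> \<xi> / s + (norm x)\<^sup>2 * \<beta> / s\<^sup>2)"
    and nn: "0 \<le> \<alpha> + x \<bullet> \<xi> / s + (norm x)\<^sup>2 * \<beta> / s\<^sup>2"
    if x: "norm x \<le> sqrt s" for x :: 'a
  proof -
    have i: "integrable trunc (\<lambda>x'. 1 + x \<bullet> x' / s + (norm x)\<^sup>2 * (norm x')\<^sup>2 / s\<^sup>2)"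
      using ix ix2 by auto
    have b: "exp (x \<bullet> x' / s) \<le> 1 + x \<bullet> x' / s + (norm x)\<^sup>2 * (norm x')\<^sup>2 / s\<^sup>2" if x': "norm x' \<le> sqrt s" for x'
    proof -
      have cs: "\<bar>x \<bullet> x'\<bar> \<le> norm x * norm x'" by (rule Cauchy_Schwarz_ineq2)
      also have "\<dots> \<le> sqrt s * sqrt s" using x x' s by (intro mult_mono) auto
      finally have "\<bar>x \<bullet> x' / s\<bar> \<le> 1" using s by (simp add: abs_divide)
      then have "exp (x \<bullet> x' / s) \<le> 1 + x \<bullet> x' / s + (x \<bullet> x' / s)\<^sup>2" by (rule exp_le_quadratic)
      moreover have "(x \<bullet> x' / s)\<^sup>2 \<le> (norm x)\<^sup>2 * (norm x')\<^sup>2 / s\<^sup>2"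
        using power_mono[OF cs, of 2] by (simp add: power_divide power_mult_distrib divide_right_mono)
      ultimately show ?thesis by simp
    qed
    have b': "AE x' in trunc. exp (x \<bullet> x' / s) \<le> 1 + x \<bullet> x' / s + (norm x)\<^sup>2 * (norm x')\<^sup>2 / s\<^sup>2"
      using AE_trunc by eventually_elim (rule b)
    have "(\<integral>\<^sup>+x'. ennreal (exp (x \<bullet> x' / s)) \<partial>trunc) \<le> (\<integral>\<^sup>+x'. ennreal (1 + x \<bullet> x' / s + (norm x)\<^sup>2 * (norm x')\<^sup>2 / s\<^sup>2) \<partial>trunc)"
      using b' by (intro nn_integral_mono_AE) (auto elim!: eventually_mono intro: ennreal_leI)
    also have "\<dots> = ennreal (\<integral>x'. 1 + x \<bullet> x' / s + (norm x)\<^sup>2 * (norm x')\<^sup>2 / s\<^sup>2 \<partial>trunc)"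
      by (rule nn_integral_eq_integral[OF i]) (use b' in \<open>auto elim!: eventually_mono intro: order_trans[OF exp_ge_zero]\<close>)
    also have eq: "(\<integral>x'. 1 + x \<bullet> x' / s + (norm x)\<^sup>2 * (norm x')\<^sup>2 / s\<^sup>2 \<partial>trunc) = \<alpha> + x \<bullet> \<xi> / s + (norm x)\<^sup>2 * \<beta> / s\<^sup>2"
      using ix ix2 by (simp add: \<alpha>_def \<xi>_def \<beta>_def)
    finally show "(\<integral>\<^sup>+x'. ennreal (exp (x \<bullet> x' / s)) \<partial>trunc) \<le> ennreal (\<alpha> + x \<bullet> \<xi> / s + (norm x)\<^sup>2 * \<beta> / s\<^sup>2)" .
    show "0 \<le> \<alpha> + x \<bullet> \<xi> / s + (norm x)\<^sup>2 * \<beta> / s\<^sup>2"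
      unfolding eq[symmetric] by (rule integral_nonneg_AE) (use b' in \<open>auto elim!: eventually_mono intro: order_trans[OF exp_ge_zero]\<close>)
  qed
  have "(\<integral>\<^sup>+x. (\<integral>\<^sup>+x'. ennreal (exp (x \<bullet> x' / s)) \<partial>trunc) \<partial>trunc) \<le> (\<integral>\<^sup>+x. ennreal (\<alpha> + x \<bullet> \<xi> / s + (norm x)\<^sup>2 * \<beta> / s\<^sup>2) \<partial>trunc)"
    using AE_trunc by (intro nn_integral_mono_AE) (auto elim!: eventually_mono intro: inner)
  also have "\<dots> = ennreal (\<integral>x. \<alpha> + x \<bullet> \<xi> / s + (norm x)\<^sup>2 * \<beta> / s\<^sup>2 \<partial>trunc)"
    by (rule nn_integral_eq_integral) (use AE_trunc ix ix2 in \<open>auto elim!: eventually_mono intro: nn\<close>)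
  also have "(\<integral>x. \<alpha> + x \<bullet> \<xi> / s + (norm x)\<^sup>2 * \<beta> / s\<^sup>2 \<partial>trunc) = \<alpha> * \<alpha> + \<xi> \<bullet> \<xi> / s + \<beta> * \<beta> / s\<^sup>2"
    using ix ix2 by (simp add: \<alpha>_def[symmetric] \<xi>_def[symmetric] \<beta>_def[symmetric])
  also have "\<dots> = \<alpha>\<^sup>2 + \<xi> \<bullet> \<xi> / s + \<beta>\<^sup>2 / s\<^sup>2" by (simp add: power2_eq_square)
  also have "\<dots> \<le> \<alpha>\<^sup>2 + 2 * M\<^sup>2 / s\<^sup>2"
  proof -
    have "\<xi> \<bullet> \<xi> \<le> (M / sqrt s)\<^sup>2" unfolding power2_norm_eq_inner[symmetric]
      using trunc_mass(4) by (intro power_mono) (auto simp: \<xi>_def)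
    then have "\<xi> \<bullet> \<xi> / s \<le> M\<^sup>2 / s\<^sup>2" using s by (simp add: power_divide field_simps power2_eq_square)
    moreover have "\<beta>\<^sup>2 / s\<^sup>2 \<le> M\<^sup>2 / s\<^sup>2"
      using trunc_mass(3) \<beta>0 by (intro divide_right_mono power_mono) (auto simp: \<beta>_def)
    ultimately show ?thesis by simp
  qed
  finally show ?thesis by (simp add: \<alpha>_def ennreal_leI)
qed

definition "trunc_marginal y = enn2real (\<integral>\<^sup>+x. ennreal (gauss s x y) \<partial>trunc)"

lemma gauss_bound: "\<exists>C. \<forall>x. gauss s x (y::'a) \<le> C"
  unfolding gauss_def using s gauss_normalizer(2)[OF s, where 'a='a]
  by (intro exI[of _ "1 / gauss_const TYPE('a) s"] allI divide_right_mono) auto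

lemma trunc_marginal_eq: "ennreal (trunc_marginal y) = (\<integral>\<^sup>+x. ennreal (gauss s x y) \<partial>trunc)"
proof -
  obtain C where C: "\<And>x. gauss s x y \<le> C" using gauss_bound by auto
  have "(\<integral>\<^sup>+x. ennreal (gauss s x y) \<partial>trunc) \<le> (\<integral>\<^sup>+x. ennreal C \<partial>trunc)"
    by (intro nn_integral_mono ennreal_leI C)
  also have "\<dots> < \<infinity>" by (simp add: ennreal_mult_less_top T.emeasure_eq_measure)
  finally show ?thesis by (simp add: trunc_marginal_def)
qed

lemma sigma_finite_trunc: "sigma_finite_measure trunc" by (rule T.sigma_finite_measure)

lemma measurable_trunc_marginal [measurable]: "trunc_marginal \<in> borel_measurable borel"
proof -
  interpret sigma_finite_measure trunc by (rule sigma_finite_trunc)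
  have "(\<lambda>(y, x). ennreal (gauss s x y)) \<in> borel_measurable (borel \<Otimes>\<^sub>M trunc)"
    by measurable
  then show ?thesis unfolding trunc_marginal_def[abs_def] by measurable
qed

lemma nn_integral_trunc_marginal: "(\<integral>\<^sup>+y. ennreal (trunc_marginal y) \<partial>lborel) = ennreal (measure trunc UNIV)"
proof -
  interpret sigma_finite_measure trunc by (rule sigma_finite_trunc)
  interpret pair_sigma_finite lborel trunc ..
  have "(\<integral>\<^sup>+y. ennreal (trunc_marginal y) \<partial>lborel) = (\<integral>\<^sup>+x. (\<integral>\<^sup>+y. ennreal (gauss s x y) \<partial>lborel) \<partial>trunc)"
    unfolding trunc_marginal_eq by (rule Fubini'[symmetric]) measurable
  also have "\<dots> = ennreal (measure trunc UNIV)" by (simp add: nn_integral_gauss[OF s] T.emeasure_eq_measure)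
  finally show ?thesis .
qed

text \<open>In the expanded square, the mixed term is a multiple of the mass \<open>\<alpha>\<close>
  and the square term is the double exponential integral; what remains is
  \<open>(1 - \<alpha>)^2 + 2 * M^2 / s^2\<close>. The third multiple of \<open>M^2 / s^2\<close>
  pays for the lost mass.\<close>

lemma nn_integral_chi2_trunc_marginal: "(\<integral>\<^sup>+y. ennreal ((trunc_marginal y - gauss s 0 y)\<^sup>2 / gauss s 0 y) \<partial>lborel) \<le> ennreal (3 * M\<^sup>2 / s\<^sup>2)"
proof -
  interpret sigma_finite_measure trunc by (rule sigma_finite_trunc)
  interpret pair_sigma_finite lborel trunc ..
  define \<alpha> where "\<alpha> = measure trunc UNIV"
  have \<alpha>: "0 \<le> \<alpha>" "\<alpha> \<le> 1" "1 - \<alpha> \<le> M / s\<^sup>2" using trunc_mass by (auto simp: \<alpha>_def)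
  have g0: "0 < gauss s 0 y" for y :: 'a using gauss_pos[OF s] .
  have gn: "0 \<le> gauss s x y" for x y :: 'a using gauss_pos[OF s] by (rule less_imp_le)
  have sq: "ennreal ((trunc_marginal y)\<^sup>2 / gauss s 0 y) = (\<integral>\<^sup>+x. (\<integral>\<^sup>+x'. ennreal (gauss s (x + x') y * exp (x \<bullet> x' / s)) \<partial>trunc) \<partial>trunc)" for y
  proof -
    have "(\<integral>\<^sup>+x. (\<integral>\<^sup>+x'. ennreal (gauss s (x + x') y * exp (x \<bullet> x' / s)) \<partial>trunc) \<partial>trunc)
      = (\<integral>\<^sup>+x. (\<integral>\<^sup>+x'. ennreal (1 / gauss s 0 y) * ennreal (gauss s x y) * ennreal (gauss s x' y) \<partial>trunc) \<partial>trunc)"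
      unfolding gauss_mult[OF s, symmetric] using g0[of y] gauss_pos[OF s, of _ y]
      by (intro nn_integral_cong) (simp add: ennreal_mult[symmetric] less_imp_le)
    also have "\<dots> = ennreal (1 / gauss s 0 y) * ennreal (trunc_marginal y) * ennreal (trunc_marginal y)"
      by (simp add: nn_integral_cmult nn_integral_multc trunc_marginal_eq)
    also have "\<dots> = ennreal ((trunc_marginal y)\<^sup>2 / gauss s 0 y)"
      using g0[of y] by (simp add: ennreal_mult[symmetric] trunc_marginal_def power2_eq_square)
    finally show ?thesis by simp
  qed
  have "(\<integral>\<^sup>+y. ennreal ((trunc_marginal y)\<^sup>2 / gauss s 0 y) \<partial>lborel) = (\<integral>\<^sup>+x. (\<integral>\<^sup>+y. (\<integral>\<^sup>+x'. ennreal (gauss s (x + x') y * exp (x \<bullet> x' / s)) \<partial>trunc) \<partial>lborel) \<partial>trunc)"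
    unfolding sq by (rule Fubini'[symmetric]) measurable
  also have "\<dots> = (\<integral>\<^sup>+x. (\<integral>\<^sup>+x'. (\<integral>\<^sup>+y. ennreal (gauss s (x + x') y * exp (x \<bullet> x' / s)) \<partial>lborel) \<partial>trunc) \<partial>trunc)"
    by (intro nn_integral_cong Fubini'[symmetric]) measurable
  also have "\<dots> = (\<integral>\<^sup>+x. (\<integral>\<^sup>+x'. ennreal (exp (x \<bullet> x' / s)) \<partial>trunc) \<partial>trunc)"
    by (simp add: ennreal_mult gn nn_integral_multc nn_integral_gauss[OF s])
  also have "\<dots> \<le> ennreal (\<alpha>\<^sup>2 + 2 * M\<^sup>2 / s\<^sup>2)" unfolding \<alpha>_def by (rule nn_integral_trunc_exp)
  finally have X: "(\<integral>\<^sup>+y. ennreal ((trunc_marginal y)\<^sup>2 / gauss s 0 y) \<partial>lborel) \<le> ennreal (\<alpha>\<^sup>2 + 2 * M\<^sup>2 / s\<^sup>2)" .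
  define I where "I = (\<integral>\<^sup>+y. ennreal ((trunc_marginal y - gauss s 0 y)\<^sup>2 / gauss s 0 y) \<partial>lborel)"
  \<comment> \<open>The negative mixed term is moved to the other side, since subtraction in
    \<open>ennreal\<close> is truncated.\<close>
  have "I + ennreal (2 * \<alpha>) = (\<integral>\<^sup>+y. ennreal ((trunc_marginal y - gauss s 0 y)\<^sup>2 / gauss s 0 y) + 2 * ennreal (trunc_marginal y) \<partial>lborel)"
    using \<alpha> by (simp add: I_def nn_integral_add nn_integral_cmult nn_integral_trunc_marginal \<alpha>_def ennreal_mult)
  also have "\<dots> = (\<integral>\<^sup>+y. ennreal ((trunc_marginal y)\<^sup>2 / gauss s 0 y) + ennreal (gauss s 0 y) \<partial>lborel)"
  proof (intro nn_integral_cong)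
    fix y :: 'a
    have m: "0 \<le> trunc_marginal y" by (simp add: trunc_marginal_def)
    have "ennreal ((trunc_marginal y - gauss s 0 y)\<^sup>2 / gauss s 0 y) + 2 * ennreal (trunc_marginal y) = ennreal ((trunc_marginal y - gauss s 0 y)\<^sup>2 / gauss s 0 y + 2 * trunc_marginal y)"
      using m g0[of y] by (simp add: ennreal_plus ennreal_mult)
    also have "(trunc_marginal y - gauss s 0 y)\<^sup>2 / gauss s 0 y + 2 * trunc_marginal y = (trunc_marginal y)\<^sup>2 / gauss s 0 y + gauss s 0 y"
      using g0[of y] by (simp add: field_simps power2_eq_square)
    finally show "ennreal ((trunc_marginal y - gauss s 0 y)\<^sup>2 / gauss s 0 y) + 2 * ennreal (trunc_marginal y) = ennreal ((trunc_marginal y)\<^sup>2 / gauss s 0 y) + ennreal (gauss s 0 y)"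
      using m g0[of y] by (simp add: ennreal_plus)
  qed
  also have "\<dots> = (\<integral>\<^sup>+y. ennreal ((trunc_marginal y)\<^sup>2 / gauss s 0 y) \<partial>lborel) + 1"
    by (simp add: nn_integral_add nn_integral_gauss[OF s])
  also have "\<dots> \<le> ennreal (\<alpha>\<^sup>2 + 2 * M\<^sup>2 / s\<^sup>2 + 1)"
    using add_right_mono[OF X, of 1] \<alpha> by (simp add: ennreal_plus)
  finally have J: "I + ennreal (2 * \<alpha>) \<le> ennreal (\<alpha>\<^sup>2 + 2 * M\<^sup>2 / s\<^sup>2 + 1)" .
  have "I < \<infinity>"
  proof -
    have "I \<le> ennreal (\<alpha>\<^sup>2 + 2 * M\<^sup>2 / s\<^sup>2 + 1)" using J by (rule order_trans[rotated]) simp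
    then show ?thesis by (rule le_less_trans) simp
  qed
  then obtain r where r: "0 \<le> r" "I = ennreal r" by (metis ennreal_cases infinity_ennreal_def less_irrefl)
  have "r + 2 * \<alpha> \<le> \<alpha>\<^sup>2 + 2 * M\<^sup>2 / s\<^sup>2 + 1"
    using J r \<alpha> by (simp add: ennreal_plus[symmetric] del: ennreal_plus)
  moreover have "1 - \<alpha> \<le> M\<^sup>2 / s\<^sup>2"
  proof -
    have "M \<le> M\<^sup>2" using moment_bound(3)[of 0] by (simp add: power2_eq_square mult_le_cancel_left1)
    then have "M / s\<^sup>2 \<le> M\<^sup>2 / s\<^sup>2" by (simp add: divide_right_mono)
    then show ?thesis using \<alpha> by simp
  qed
  moreover have "\<alpha>\<^sup>2 + 1 - 2 * \<alpha> \<le> 1 - \<alpha>"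
    using \<alpha> by (simp add: power2_eq_square mult_left_le)
  ultimately have "r \<le> 3 * M\<^sup>2 / s\<^sup>2" by simp
  then show ?thesis using r by (simp add: I_def ennreal_leI)
qed

definition "gauss_marginal y = enn2real (\<integral>\<^sup>+x. ennreal (p x * gauss s x y) \<partial>lborel)"

lemma gauss_marginal_eq: "ennreal (gauss_marginal y) = (\<integral>\<^sup>+x. ennreal (p x * gauss s x y) \<partial>lborel)"
proof -
  obtain C where C: "\<And>x. gauss s x y \<le> C" using gauss_bound by auto
  have "(\<integral>\<^sup>+x. ennreal (p x * gauss s x y) \<partial>lborel) \<le> (\<integral>\<^sup>+x. ennreal C * ennreal (p x) \<partial>lborel)"
  proof (intro nn_integral_mono)
    fix x
    have "0 \<le> C" using order_trans[OF less_imp_le[OF gauss_pos[OF s]] C] .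
    moreover have "p x * gauss s x y \<le> C * p x" by (subst mult.commute) (intro mult_right_mono C p0)
    ultimately show "ennreal (p x * gauss s x y) \<le> ennreal C * ennreal (p x)"
      using p0 by (simp add: ennreal_mult[symmetric] ennreal_leI)
  qed
  also have "\<dots> < \<infinity>" using p1 by (simp add: nn_integral_cmult)
  finally show ?thesis by (simp add: gauss_marginal_def)
qed

lemma measurable_gauss_marginal [measurable]: "gauss_marginal \<in> borel_measurable borel"
proof -
  have "(\<lambda>(y, x). ennreal (p x * gauss s x y)) \<in> borel_measurable (borel \<Otimes>\<^sub>M lborel)"
    by measurable
  then show ?thesis unfolding gauss_marginal_def[abs_def] by measurable
qed

text \<open>For fixed \<open>x\<close> the kernel has mass one in \<open>y\<close>, so averaging the
  localised densities over all centers gives back \<open>p\<close>. In this way couplings of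
  localised densities can be glued to a coupling of the original ones.\<close>

lemma nn_integral_gauss_marginal:
  assumes [measurable]: "h \<in> borel_measurable borel"
  shows "(\<integral>\<^sup>+y. (\<integral>\<^sup>+x. h x * ennreal (p x * gauss s x y) \<partial>lborel) \<partial>lborel) = (\<integral>\<^sup>+x. h x * ennreal (p x) \<partial>lborel)"
proof -
  have "(\<integral>\<^sup>+y. (\<integral>\<^sup>+x. h x * ennreal (p x * gauss s x y) \<partial>lborel) \<partial>lborel)
     = (\<integral>\<^sup>+x. (\<integral>\<^sup>+y. h x * ennreal (p x * gauss s x y) \<partial>lborel) \<partial>lborel)"
    by (rule lborel_pair.Fubini') measurable
  also have "\<dots> = (\<integral>\<^sup>+x. (\<integral>\<^sup>+y. (h x * ennreal (p x)) * ennreal (gauss s x y) \<partial>lborel) \<partial>lborel)"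
    using p0 gauss_pos[OF s, where 'a='a] by (simp add: ennreal_mult' less_imp_le mult.assoc)
  also have "\<dots> = (\<integral>\<^sup>+x. h x * ennreal (p x) \<partial>lborel)"
    by (simp add: nn_integral_cmult nn_integral_gauss[OF s])
  finally show ?thesis .
qed

lemma nn_integral_gauss_marginal_1: "(\<integral>\<^sup>+y. ennreal (gauss_marginal y) \<partial>lborel) = 1"
  using nn_integral_gauss_marginal[of "\<lambda>_. 1"] p1 by (simp add: gauss_marginal_eq)

lemma gauss_marginal_nonneg: "0 \<le> gauss_marginal y" "0 \<le> trunc_marginal y"
  by (auto simp: gauss_marginal_def trunc_marginal_def)

lemma trunc_marginal_le: "trunc_marginal y \<le> gauss_marginal y"
proof -
  have "ennreal (trunc_marginal y) \<le> ennreal (gauss_marginal y)"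
    unfolding trunc_marginal_eq gauss_marginal_eq using p0 gauss_pos[OF s, where 'a='a]
    by (subst nn_integral_trunc) (auto intro!: nn_integral_mono ennreal_leI simp: ennreal_mult'[symmetric] indicator_def less_imp_le)
  then show ?thesis by (simp add: gauss_marginal_nonneg)
qed

lemma nn_integral_marginal_diff: "(\<integral>\<^sup>+y. ennreal (gauss_marginal y - trunc_marginal y) \<partial>lborel) \<le> ennreal (M / s\<^sup>2)"
proof -
  define I where "I = (\<integral>\<^sup>+y. ennreal (gauss_marginal y - trunc_marginal y) \<partial>lborel)"
  have "I + ennreal (measure trunc UNIV) = (\<integral>\<^sup>+y. ennreal (gauss_marginal y - trunc_marginal y) + ennreal (trunc_marginal y) \<partial>lborel)"
    unfolding I_def nn_integral_trunc_marginal[symmetric] by (rule nn_integral_add[symmetric]) measurable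
  also have "\<dots> = (\<integral>\<^sup>+y. ennreal (gauss_marginal y) \<partial>lborel)"
    using trunc_marginal_le gauss_marginal_nonneg by (intro nn_integral_cong) (simp add: ennreal_plus[symmetric] del: ennreal_plus)
  also have "\<dots> = 1" by (rule nn_integral_gauss_marginal_1)
  finally have J: "I + ennreal (measure trunc UNIV) = 1" .
  then have "I \<le> 1" by (metis le_iff_add)
  then obtain r where r: "0 \<le> r" "I = ennreal r" by (metis ennreal_cases ennreal_one_neq_top top_unique)
  have "r + measure trunc UNIV = 1" using J r by (simp add: ennreal_plus[symmetric] del: ennreal_plus)
  then have "r \<le> M / s\<^sup>2" using trunc_mass(2) by simp
  then show ?thesis using r by (simp add: I_def ennreal_leI)
qed

end

section \<open>Stability in the Prekopa-Leindler inequality\<close>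

text \<open>Serves to add the matched and the unmatched part of a coupling. Additivity of the
  integral goes from sets to functions through sums and monotone limits.\<close>

lemma exists_sum_measure:
  assumes sets: "sets M = sets N"
  obtains L where "sets L = sets N"
    "\<And>h. h \<in> borel_measurable N \<Longrightarrow> (\<integral>\<^sup>+x. h x \<partial>L) = (\<integral>\<^sup>+x. h x \<partial>M) + (\<integral>\<^sup>+x. h x \<partial>N)"
proof -
  have sp: "space M = space N" using sets by (rule sets_eq_imp_space_eq)
  define L where "L = measure_of (space N) (sets N) (\<lambda>A. emeasure M A + emeasure N A)"
  have sL: "sets L = sets N" "space L = space N"
    by (auto simp: L_def sets.sets_measure_of_eq)
  have eL: "emeasure L A = emeasure M A + emeasure N A" if "A \<in> sets N" for A
    unfolding L_def
  proof (rule emeasure_measure_of_sigma)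
    show "sigma_algebra (space N) (sets N)" by (rule sets.sigma_algebra_axioms)
    show "positive (sets N) (\<lambda>A. emeasure M A + emeasure N A)" by (simp add: positive_def)
    show "countably_additive (sets N) (\<lambda>A. emeasure M A + emeasure N A)"
    proof (rule countably_additiveI)
      fix A :: "nat \<Rightarrow> _" assume A: "range A \<subseteq> sets N" "disjoint_family A"
      have "(\<Sum>i. emeasure M (A i) + emeasure N (A i)) = (\<Sum>i. emeasure M (A i)) + (\<Sum>i. emeasure N (A i))"
        by (rule suminf_add[symmetric]) auto
      also have "\<dots> = emeasure M (\<Union>i. A i) + emeasure N (\<Union>i. A i)"
        using A sets by (simp add: suminf_emeasure)
      finally show "(\<Sum>i. emeasure M (A i) + emeasure N (A i)) = emeasure M (\<Union>i. A i) + emeasure N (\<Union>i. A i)" .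
    qed
  qed fact
  have "(\<integral>\<^sup>+x. h x \<partial>L) = (\<integral>\<^sup>+x. h x \<partial>M) + (\<integral>\<^sup>+x. h x \<partial>N)" if "h \<in> borel_measurable N" for h
    using that
  proof (induction rule: borel_measurable_induct)
    case (cong f g)
    then show ?case by (metis nn_integral_cong sp sL(2))
  next
    case (set A)
    then show ?case using eL sets sL by simp
  next
    case (mult u c)
    then show ?case by (simp add: nn_integral_cmult measurable_cong_sets[OF sL(1) refl] measurable_cong_sets[OF sets refl] distrib_left)
  next
    case (add u v)
    then show ?case by (simp add: nn_integral_add measurable_cong_sets[OF sL(1) refl] measurable_cong_sets[OF sets refl] ac_simps)
  next
    case (seq U)
    note [simp] = measurable_cong_sets[OF sL(1) refl] measurable_cong_sets[OF sets refl]
    have "(\<integral>\<^sup>+x. (SUP i. U i) x \<partial>L) = (SUP i. \<integral>\<^sup>+x. U i x \<partial>L)"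
      using seq by (simp add: nn_integral_monotone_convergence_SUP image_comp)
    also have "\<dots> = (SUP i. (\<integral>\<^sup>+x. U i x \<partial>M) + (\<integral>\<^sup>+x. U i x \<partial>N))"
      using seq by simp
    also have "\<dots> = (SUP i. (\<integral>\<^sup>+x. U i x \<partial>M)) + (SUP i. (\<integral>\<^sup>+x. U i x \<partial>N))"
      using seq(3) by (intro ennreal_SUP_add) (auto intro!: nn_integral_mono simp: incseq_def le_fun_def)
    also have "\<dots> = (\<integral>\<^sup>+x. (SUP i. U i) x \<partial>M) + (\<integral>\<^sup>+x. (SUP i. U i) x \<partial>N)"
      using seq by (simp add: nn_integral_monotone_convergence_SUP image_comp)
    finally show ?case .
  qed
  with sL that show ?thesis by blast
qed

lemma norm_diff_power2_le: "(norm (x - y))\<^sup>2 \<le> 2 * (norm x)\<^sup>2 + 2 * (norm (y::'a::real_normed_vector))\<^sup>2"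
proof -
  have "(norm (x - y))\<^sup>2 \<le> (norm x + norm y)\<^sup>2" by (intro power_mono norm_triangle_ineq4) auto
  also have "\<dots> \<le> 2 * (norm x)\<^sup>2 + 2 * (norm y)\<^sup>2"
    using sum_squares_bound[of "norm x" "norm y"] by (simp add: power2_sum)
  finally show ?thesis .
qed

text \<open>Both laws are mixtures over centers, with weights \<open>m\<close> and \<open>n\<close>.
  On the common weight \<open>min (m y) (n y)\<close> the maps use the same center and the same
  \<open>u\<close>. The excess weights have equal mass \<open>\<tau>\<close> and are joined with
  independent centers \<open>y\<close> and \<open>z\<close>, normalised by \<open>\<tau>\<close>;
  there the cost is bounded crudely by second moments.\<close>

lemma W2_sq_le_mixture:
  fixes Q R :: "'a::euclidean_space \<Rightarrow> 'u \<Rightarrow> 'a" and \<rho> \<sigma> :: "'a measure" and m n :: "'a \<Rightarrow> real"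
  assumes U: "prob_space U"
    and Q[measurable]: "(\<lambda>(y, u). Q y u) \<in> borel_measurable (borel \<Otimes>\<^sub>M U)"
    and R[measurable]: "(\<lambda>(y, u). R y u) \<in> borel_measurable (borel \<Otimes>\<^sub>M U)"
    and m[measurable]: "m \<in> borel_measurable borel" and m0: "\<And>y. 0 \<le> m y" and m1: "(\<integral>\<^sup>+y. m y \<partial>lborel) = 1"
    and n[measurable]: "n \<in> borel_measurable borel" and n0: "\<And>y. 0 \<le> n y" and n1: "(\<integral>\<^sup>+y. n y \<partial>lborel) = 1"
    and s: "sets \<rho> = sets borel" "sets \<sigma> = sets borel"
    and lQ: "\<And>h. h \<in> borel_measurable borel \<Longrightarrow> (\<integral>\<^sup>+y. ennreal (m y) * (\<integral>\<^sup>+u. h (Q y u) \<partial>U) \<partial>lborel) = (\<integral>\<^sup>+x. h x \<partial>\<rho>)"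
    and lR: "\<And>h. h \<in> borel_measurable borel \<Longrightarrow> (\<integral>\<^sup>+y. ennreal (n y) * (\<integral>\<^sup>+u. h (R y u) \<partial>U) \<partial>lborel) = (\<integral>\<^sup>+x. h x \<partial>\<sigma>)"
  shows "W2_sq \<rho> \<sigma> \<le> (\<integral>\<^sup>+y. ennreal (min (m y) (n y)) * (\<integral>\<^sup>+u. ennreal ((norm (Q y u - R y u))\<^sup>2) \<partial>U) \<partial>lborel)
     + 2 * (\<integral>\<^sup>+y. ennreal (max 0 (m y - n y)) * (\<integral>\<^sup>+u. ennreal ((norm (Q y u))\<^sup>2) \<partial>U) \<partial>lborel)
     + 2 * (\<integral>\<^sup>+y. ennreal (max 0 (n y - m y)) * (\<integral>\<^sup>+u. ennreal ((norm (R y u))\<^sup>2) \<partial>U) \<partial>lborel)"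
proof -
  interpret U: prob_space U by fact
  have [measurable]: "fst \<in> borel_measurable (borel :: ('a \<times> 'a) measure)" "snd \<in> borel_measurable (borel :: ('a \<times> 'a) measure)"
    by (auto intro!: borel_measurable_continuous_onI continuous_intros)
  have [measurable]: "(\<lambda>(y, u). Q y u) \<in> borel_measurable (lborel \<Otimes>\<^sub>M U)" "(\<lambda>(y, u). R y u) \<in> borel_measurable (lborel \<Otimes>\<^sub>M U)"
    using Q R by (simp_all cong: measurable_cong_sets sets_pair_measure_cong)
  have [measurable]: "Q y \<in> borel_measurable U" "R y \<in> borel_measurable U" for y
    using measurable_compose[OF measurable_Pair1' Q, of y] measurable_compose[OF measurable_Pair1' R, of y] by auto
  define a b c where "a y = ennreal (min (m y) (n y))" and "b y = ennreal (max 0 (m y - n y))" and "c y = ennreal (max 0 (n y - m y))" for y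
  have [measurable]: "a \<in> borel_measurable borel" "b \<in> borel_measurable borel" "c \<in> borel_measurable borel"
    unfolding a_def[abs_def] b_def[abs_def] c_def[abs_def] by measurable
  have ab: "ennreal (m y) = a y + b y" "ennreal (n y) = a y + c y" for y
    using m0[of y] n0[of y] ennreal_plus[of "m y" "n y - m y"] ennreal_plus[of "n y" "m y - n y"]
    unfolding a_def b_def c_def by (cases "m y \<le> n y"; simp add: max_def min_def)+
  have "(\<integral>\<^sup>+y. a y \<partial>lborel) + (\<integral>\<^sup>+y. b y \<partial>lborel) = 1" "(\<integral>\<^sup>+y. a y \<partial>lborel) + (\<integral>\<^sup>+y. c y \<partial>lborel) = 1"
    using m1 n1 unfolding ab by (simp_all add: nn_integral_add)
  moreover define \<tau> where "\<tau> = (\<integral>\<^sup>+y. b y \<partial>lborel)"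
  ultimately have \<tau>c: "(\<integral>\<^sup>+y. c y \<partial>lborel) = \<tau>" and \<tau>: "\<tau> \<noteq> \<infinity>"
    by (metis ennreal_add_left_cancel ennreal_one_neq_top ennreal_add_eq_top infinity_ennreal_def)+
  define L1 where "L1 = distr (density (lborel \<Otimes>\<^sub>M U) (\<lambda>(y, u). a y)) borel (\<lambda>(y, u). (Q y u, R y u))"
  \<comment> \<open>Dividing by \<open>\<tau>\<close> is harmless when \<open>\<tau>\<close> is
    zero: both excess weights then vanish almost everywhere, and \<open>0 / 0 = 0\<close> in
    \<open>ennreal\<close>.\<close>
  define L2 where "L2 = distr (density (lborel \<Otimes>\<^sub>M (lborel \<Otimes>\<^sub>M U)) (\<lambda>(y, z, u). b y * c z / \<tau>)) borel (\<lambda>(y, z, u). (Q y u, R z u))"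
  have sf: "sigma_finite_measure (lborel \<Otimes>\<^sub>M U :: ('a \<times> 'u) measure)"
    by (intro sigma_finite_pair_measure lborel.sigma_finite_measure_axioms U.sigma_finite_measure_axioms)
  interpret LU: sigma_finite_measure "lborel \<Otimes>\<^sub>M U :: ('a \<times> 'u) measure" by (rule sf)
  have [measurable]: "(\<lambda>(y, z, u). Q y u) \<in> borel_measurable (lborel \<Otimes>\<^sub>M (lborel \<Otimes>\<^sub>M U))"
    "(\<lambda>(y, z, u). R z u) \<in> borel_measurable (lborel \<Otimes>\<^sub>M (lborel \<Otimes>\<^sub>M U))"
    by measurable
  have i1: "(\<integral>\<^sup>+z. h z \<partial>L1) = (\<integral>\<^sup>+y. a y * (\<integral>\<^sup>+u. h (Q y u, R y u) \<partial>U) \<partial>lborel)"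
    if [measurable]: "h \<in> borel_measurable borel" for h :: "'a \<times> 'a \<Rightarrow> ennreal"
  proof -
    have "(\<integral>\<^sup>+z. h z \<partial>L1) = (\<integral>\<^sup>+w. (case w of (y, u) \<Rightarrow> a y * h (Q y u, R y u)) \<partial>(lborel \<Otimes>\<^sub>M U))"
      unfolding L1_def by (subst nn_integral_distr, (measurable; fail), (measurable; fail), subst nn_integral_density) (auto simp: split_beta')
    also have "\<dots> = (\<integral>\<^sup>+y. (\<integral>\<^sup>+u. a y * h (Q y u, R y u) \<partial>U) \<partial>lborel)"
      by (subst U.nn_integral_fst[symmetric]) auto
    also have "\<dots> = (\<integral>\<^sup>+y. a y * (\<integral>\<^sup>+u. h (Q y u, R y u) \<partial>U) \<partial>lborel)"
      by (intro nn_integral_cong nn_integral_cmult) measurable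
    finally show ?thesis .
  qed
  have i2: "(\<integral>\<^sup>+z. h z \<partial>L2) = (\<integral>\<^sup>+y. (\<integral>\<^sup>+z. b y * c z / \<tau> * (\<integral>\<^sup>+u. h (Q y u, R z u) \<partial>U) \<partial>lborel) \<partial>lborel)"
    if [measurable]: "h \<in> borel_measurable borel" for h :: "'a \<times> 'a \<Rightarrow> ennreal"
  proof -
    have "(\<integral>\<^sup>+z. h z \<partial>L2) = (\<integral>\<^sup>+w. (case w of (y, z, u) \<Rightarrow> b y * c z / \<tau> * h (Q y u, R z u)) \<partial>(lborel \<Otimes>\<^sub>M (lborel \<Otimes>\<^sub>M U)))"
      unfolding L2_def by (subst nn_integral_distr, (measurable; fail), (measurable; fail), subst nn_integral_density) (auto simp: split_beta')
    also have "\<dots> = (\<integral>\<^sup>+y. (\<integral>\<^sup>+w. (case w of (z, u) \<Rightarrow> b y * c z / \<tau> * h (Q y u, R z u)) \<partial>(lborel \<Otimes>\<^sub>M U)) \<partial>lborel)"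
      by (subst LU.nn_integral_fst[symmetric]) (auto simp: split_beta')
    also have "\<dots> = (\<integral>\<^sup>+y. (\<integral>\<^sup>+z. (\<integral>\<^sup>+u. b y * c z / \<tau> * h (Q y u, R z u) \<partial>U) \<partial>lborel) \<partial>lborel)"
      by (intro nn_integral_cong, subst U.nn_integral_fst[symmetric]) auto
    also have "\<dots> = (\<integral>\<^sup>+y. (\<integral>\<^sup>+z. b y * c z / \<tau> * (\<integral>\<^sup>+u. h (Q y u, R z u) \<partial>U) \<partial>lborel) \<partial>lborel)"
      by (intro nn_integral_cong nn_integral_cmult) measurable
    finally show ?thesis .
  qed
  have null: "(\<integral>\<^sup>+y. w y * H y \<partial>lborel) = 0" if "(\<integral>\<^sup>+y. w y \<partial>lborel) = 0"
    "w \<in> borel_measurable borel" for w H :: "'a \<Rightarrow> ennreal"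
  proof -
    have "AE y in lborel. w y = 0" using that by (subst (asm) nn_integral_0_iff_AE) auto
    then have "(\<integral>\<^sup>+y. w y * H y \<partial>lborel) = (\<integral>\<^sup>+y. 0 \<partial>(lborel::'a measure))" by (intro nn_integral_cong_AE) auto
    then show ?thesis by simp
  qed
  have fstQ: "(\<integral>\<^sup>+y. (\<integral>\<^sup>+z. b y * c z / \<tau> * H y \<partial>lborel) \<partial>lborel) = (\<integral>\<^sup>+y. b y * H y \<partial>lborel)"
    if [measurable]: "H \<in> borel_measurable borel" for H :: "'a \<Rightarrow> ennreal"
  proof (cases "\<tau> = 0")
    case True
    have "AE z in lborel. c z = 0" using nn_integral_0_iff_AE[of c lborel] True \<tau>c by simp
    then have "(\<integral>\<^sup>+z. b y * c z / \<tau> * H y \<partial>lborel) = (\<integral>\<^sup>+z. 0 \<partial>(lborel::'a measure))" for y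
      by (intro nn_integral_cong_AE) auto
    then have "(\<integral>\<^sup>+z. b y * c z / \<tau> * H y \<partial>lborel) = 0" for y by simp
    then show ?thesis using null[of b H] True by (simp add: \<tau>_def)
  next
    case False
    have "(\<integral>\<^sup>+z. b y * c z / \<tau> * H y \<partial>lborel) = b y * H y" for y
    proof -
      have "(\<integral>\<^sup>+z. b y * c z / \<tau> * H y \<partial>lborel) = (\<integral>\<^sup>+z. (b y * H y / \<tau>) * c z \<partial>lborel)"
        by (simp add: ennreal_times_divide divide_ennreal_def ac_simps)
      also have "\<dots> = b y * H y" using False \<tau> \<tau>c ennreal_divide_self[of \<tau>]
        by (simp add: nn_integral_cmult nn_integral_divide less_top ennreal_divide_times mult_divide_eq_ennreal)
      finally show ?thesis .
    qed
    then show ?thesis by simp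
  qed
  have sndR: "(\<integral>\<^sup>+y. (\<integral>\<^sup>+z. b y * c z / \<tau> * H z \<partial>lborel) \<partial>lborel) = (\<integral>\<^sup>+y. c y * H y \<partial>lborel)"
    if [measurable]: "H \<in> borel_measurable borel" for H :: "'a \<Rightarrow> ennreal"
  proof -
    have "(\<integral>\<^sup>+y. (\<integral>\<^sup>+z. b y * c z / \<tau> * H z \<partial>lborel) \<partial>lborel) = (\<integral>\<^sup>+y. b y / \<tau> * (\<integral>\<^sup>+z. c z * H z \<partial>lborel) \<partial>lborel)"
      by (subst nn_integral_cmult[symmetric]) (auto simp: divide_ennreal_def ac_simps)
    also have "\<dots> = \<tau> / \<tau> * (\<integral>\<^sup>+z. c z * H z \<partial>lborel)"
      by (simp add: nn_integral_multc nn_integral_divide \<tau>_def)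
    also have "\<dots> = (\<integral>\<^sup>+z. c z * H z \<partial>lborel)"
      using null[of c H] \<tau>c \<tau> ennreal_divide_self[of \<tau>] by (cases "\<tau> = 0") (auto simp: less_top)
    finally show ?thesis .
  qed
  have sL: "sets L1 = sets L2" "sets L2 = sets borel" by (auto simp: L1_def L2_def)
  obtain \<gamma> where sg: "sets \<gamma> = sets L2" and ig: "\<And>h. h \<in> borel_measurable L2 \<Longrightarrow> (\<integral>\<^sup>+x. h x \<partial>\<gamma>) = (\<integral>\<^sup>+x. h x \<partial>L1) + (\<integral>\<^sup>+x. h x \<partial>L2)"
    using exists_sum_measure[OF sL(1)] by blast
  have sg'[measurable_cong]: "sets \<gamma> = sets borel" using sg sL by simp
  have i\<gamma>: "(\<integral>\<^sup>+z. h z \<partial>\<gamma>) = (\<integral>\<^sup>+y. a y * (\<integral>\<^sup>+u. h (Q y u, R y u) \<partial>U) \<partial>lborel)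
     + (\<integral>\<^sup>+y. (\<integral>\<^sup>+z. b y * c z / \<tau> * (\<integral>\<^sup>+u. h (Q y u, R z u) \<partial>U) \<partial>lborel) \<partial>lborel)"
    if "h \<in> borel_measurable borel" for h
    using ig[of h] i1[OF that] i2[OF that] that by (simp add: measurable_cong_sets[OF sL(2) refl])
  have f\<gamma>: "(\<integral>\<^sup>+z. h (fst z) \<partial>\<gamma>) = (\<integral>\<^sup>+x. h x \<partial>\<rho>)" if [measurable]: "h \<in> borel_measurable borel" for h :: "'a \<Rightarrow> ennreal"
  proof -
    have "(\<integral>\<^sup>+z. h (fst z) \<partial>\<gamma>) = (\<integral>\<^sup>+y. a y * (\<integral>\<^sup>+u. h (Q y u) \<partial>U) \<partial>lborel) + (\<integral>\<^sup>+y. b y * (\<integral>\<^sup>+u. h (Q y u) \<partial>U) \<partial>lborel)"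
      by (subst i\<gamma>) (auto simp: fstQ)
    also have "\<dots> = (\<integral>\<^sup>+y. ennreal (m y) * (\<integral>\<^sup>+u. h (Q y u) \<partial>U) \<partial>lborel)"
      unfolding ab by (subst nn_integral_add[symmetric]) (auto simp: distrib_right)
    finally show ?thesis using lQ by simp
  qed
  have s\<gamma>: "(\<integral>\<^sup>+z. h (snd z) \<partial>\<gamma>) = (\<integral>\<^sup>+x. h x \<partial>\<sigma>)" if [measurable]: "h \<in> borel_measurable borel" for h :: "'a \<Rightarrow> ennreal"
  proof -
    have "(\<integral>\<^sup>+z. h (snd z) \<partial>\<gamma>) = (\<integral>\<^sup>+y. a y * (\<integral>\<^sup>+u. h (R y u) \<partial>U) \<partial>lborel) + (\<integral>\<^sup>+y. c y * (\<integral>\<^sup>+u. h (R y u) \<partial>U) \<partial>lborel)"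
      by (subst i\<gamma>) (auto simp: sndR)
    also have "\<dots> = (\<integral>\<^sup>+y. ennreal (n y) * (\<integral>\<^sup>+u. h (R y u) \<partial>U) \<partial>lborel)"
      unfolding ab by (subst nn_integral_add[symmetric]) (auto simp: distrib_right)
    finally show ?thesis using lR by simp
  qed
  have "\<gamma> \<in> couplings \<rho> \<sigma>"
    unfolding couplings_def mem_Collect_eq
  proof (intro conjI)
    show "sets \<gamma> = sets borel" by fact
    have "emeasure \<gamma> (space \<gamma>) = (\<integral>\<^sup>+z. (\<lambda>_. 1) (fst z) \<partial>\<gamma>)" by simp
    also have "\<dots> = (\<integral>\<^sup>+x. 1 \<partial>\<rho>)" by (rule f\<gamma>) auto
    also have "\<dots> = 1" using lQ[of "\<lambda>_. 1"] m1 by (simp add: U.emeasure_space_1)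
    finally show "prob_space \<gamma>" by (rule prob_spaceI)
    show "distr \<gamma> borel fst = \<rho>"
    proof (rule measure_eqI)
      fix A assume "A \<in> sets (distr \<gamma> borel fst)"
      then have [measurable]: "A \<in> sets borel" by simp
      show "emeasure (distr \<gamma> borel fst) A = emeasure \<rho> A"
      proof -
        have "emeasure (distr \<gamma> borel fst) A = (\<integral>\<^sup>+z. indicator A z \<partial>distr \<gamma> borel fst)" by simp
        also have "\<dots> = (\<integral>\<^sup>+z. indicator A (fst z) \<partial>\<gamma>)" by (subst nn_integral_distr) auto
        also have "\<dots> = emeasure \<rho> A" by (subst f\<gamma>) (auto simp: s)
        finally show ?thesis .
      qed
    qed (simp add: s)
    show "distr \<gamma> borel snd = \<sigma>"
    proof (rule measure_eqI)
      fix A assume "A \<in> sets (distr \<gamma> borel snd)"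
      then have [measurable]: "A \<in> sets borel" by simp
      show "emeasure (distr \<gamma> borel snd) A = emeasure \<sigma> A"
      proof -
        have "emeasure (distr \<gamma> borel snd) A = (\<integral>\<^sup>+z. indicator A z \<partial>distr \<gamma> borel snd)" by simp
        also have "\<dots> = (\<integral>\<^sup>+z. indicator A (snd z) \<partial>\<gamma>)" by (subst nn_integral_distr) auto
        also have "\<dots> = emeasure \<sigma> A" by (subst s\<gamma>) (auto simp: s)
        finally show ?thesis .
      qed
    qed (simp add: s)
  qed
  then have "W2_sq \<rho> \<sigma> \<le> (\<integral>\<^sup>+z. ennreal ((norm (fst z - snd z))\<^sup>2) \<partial>\<gamma>)"
    unfolding W2_sq_def by (rule INF_lower)
  also have "\<dots> = (\<integral>\<^sup>+y. a y * (\<integral>\<^sup>+u. ennreal ((norm (Q y u - R y u))\<^sup>2) \<partial>U) \<partial>lborel)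
     + (\<integral>\<^sup>+y. (\<integral>\<^sup>+z. b y * c z / \<tau> * (\<integral>\<^sup>+u. ennreal ((norm (Q y u - R z u))\<^sup>2) \<partial>U) \<partial>lborel) \<partial>lborel)"
    by (subst i\<gamma>) auto
  also have "(\<integral>\<^sup>+y. (\<integral>\<^sup>+z. b y * c z / \<tau> * (\<integral>\<^sup>+u. ennreal ((norm (Q y u - R z u))\<^sup>2) \<partial>U) \<partial>lborel) \<partial>lborel)
     \<le> (\<integral>\<^sup>+y. (\<integral>\<^sup>+z. b y * c z / \<tau> * (2 * (\<integral>\<^sup>+u. ennreal ((norm (Q y u))\<^sup>2) \<partial>U)) + b y * c z / \<tau> * (2 * (\<integral>\<^sup>+u. ennreal ((norm (R z u))\<^sup>2) \<partial>U)) \<partial>lborel) \<partial>lborel)"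
  proof (intro nn_integral_mono)
    fix y z
    have "(\<integral>\<^sup>+u. ennreal ((norm (Q y u - R z u))\<^sup>2) \<partial>U) \<le> (\<integral>\<^sup>+u. 2 * ennreal ((norm (Q y u))\<^sup>2) + 2 * ennreal ((norm (R z u))\<^sup>2) \<partial>U)"
    proof (intro nn_integral_mono)
      fix u
      have "ennreal ((norm (Q y u - R z u))\<^sup>2) \<le> ennreal (2 * (norm (Q y u))\<^sup>2 + 2 * (norm (R z u))\<^sup>2)"
        by (intro ennreal_leI norm_diff_power2_le)
      then show "ennreal ((norm (Q y u - R z u))\<^sup>2) \<le> 2 * ennreal ((norm (Q y u))\<^sup>2) + 2 * ennreal ((norm (R z u))\<^sup>2)"
        by (simp add: ennreal_plus ennreal_mult)
    qed
    also have "\<dots> = 2 * (\<integral>\<^sup>+u. ennreal ((norm (Q y u))\<^sup>2) \<partial>U) + 2 * (\<integral>\<^sup>+u. ennreal ((norm (R z u))\<^sup>2) \<partial>U)"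
      by (simp add: nn_integral_add nn_integral_cmult)
    finally show "b y * c z / \<tau> * (\<integral>\<^sup>+u. ennreal ((norm (Q y u - R z u))\<^sup>2) \<partial>U) \<le> b y * c z / \<tau> * (2 * (\<integral>\<^sup>+u. ennreal ((norm (Q y u))\<^sup>2) \<partial>U)) + b y * c z / \<tau> * (2 * (\<integral>\<^sup>+u. ennreal ((norm (R z u))\<^sup>2) \<partial>U))"
      unfolding distrib_left[symmetric] by (intro mult_left_mono) auto
  qed
  also have "\<dots> = (\<integral>\<^sup>+y. (\<integral>\<^sup>+z. b y * c z / \<tau> * (2 * (\<integral>\<^sup>+u. ennreal ((norm (Q y u))\<^sup>2) \<partial>U)) \<partial>lborel) \<partial>lborel)
     + (\<integral>\<^sup>+y. (\<integral>\<^sup>+z. b y * c z / \<tau> * (2 * (\<integral>\<^sup>+u. ennreal ((norm (R z u))\<^sup>2) \<partial>U)) \<partial>lborel) \<partial>lborel)"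
    by (subst nn_integral_add[symmetric]) (auto intro!: nn_integral_cong nn_integral_add)
  also have "\<dots> = 2 * (\<integral>\<^sup>+y. b y * (\<integral>\<^sup>+u. ennreal ((norm (Q y u))\<^sup>2) \<partial>U) \<partial>lborel) + 2 * (\<integral>\<^sup>+y. c y * (\<integral>\<^sup>+u. ennreal ((norm (R y u))\<^sup>2) \<partial>U) \<partial>lborel)"
    by (subst fstQ, measurable, subst sndR, measurable) (simp add: mult.left_commute[of _ "2::ennreal"] nn_integral_cmult)
  finally show ?thesis
    by (simp add: a_def b_def c_def add.assoc add_left_mono)
qed

text \<open>Applied with a third power as \<open>g\<close>: the weight \<open>a\<close> receives the
  sixth power and \<open>b\<close> is integrated alone.\<close>

lemma real_sqrt_mult_le_weighted:
  fixes a b g :: real assumes "0 \<le> a" "0 \<le> b"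
  shows "sqrt (a * b) * g \<le> (a * g\<^sup>2 + b) / 2"
  using sum_squares_bound[of "sqrt a * g" "sqrt b"] assms
  by (simp add: real_sqrt_mult power_mult_distrib field_simps)

lemma ennreal_2_mult: "2 * ennreal x = ennreal (2 * x)"
  by (simp add: ennreal_mult')

text \<open>Factoring \<open>a - b\<close> through square roots, Young's inequality with parameter
  \<open>t\<close> splits the excess weight into a moment over \<open>t\<close> and \<open>t\<close>
  times the Hellinger integrand.\<close>

lemma positive_part_diff_le:
  fixes a b g t :: real assumes "0 \<le> a" "0 \<le> b" "0 < t" "0 \<le> g"
  shows "max 0 (a - b) * g \<le> a * g\<^sup>2 / t + t * (sqrt a - sqrt b)\<^sup>2"
proof (cases "b \<le> a")
  case True
  then have "sqrt b \<le> sqrt a" by simp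
  have "a - b = (sqrt a - sqrt b) * (sqrt a + sqrt b)" using assms by (simp add: algebra_simps)
  also have "\<dots> \<le> (sqrt a - sqrt b) * (2 * sqrt a)" using \<open>sqrt b \<le> sqrt a\<close> by (intro mult_left_mono) auto
  finally have "(a - b) * g \<le> (sqrt a - sqrt b) * (2 * sqrt a) * g" using assms by (intro mult_right_mono)
  also have "\<dots> = 2 * (sqrt a * g) * (sqrt a - sqrt b)" by simp
  also have "\<dots> \<le> (sqrt a * g)\<^sup>2 / t + t * (sqrt a - sqrt b)\<^sup>2"
  proof -
    have "0 \<le> (sqrt a * g - t * (sqrt a - sqrt b))\<^sup>2 / t" using assms by simp
    also have "\<dots> = (sqrt a * g)\<^sup>2 / t + t * (sqrt a - sqrt b)\<^sup>2 - 2 * (sqrt a * g) * (sqrt a - sqrt b)"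
      using assms by (simp add: power2_eq_square field_simps)
    finally show ?thesis by simp
  qed
  finally show ?thesis using True assms by (simp add: power_mult_distrib)
qed (use assms in auto)

text \<open>Both convolutions are compared with the same centered Gaussian. The constant counts two
  chi-square terms with factor \<open>2 * 3\<close> and two lost masses, with
  \<open>M \<le> M^2\<close>.\<close>

lemma hellinger_marginals_le:
  fixes p q :: "'a::euclidean_space \<Rightarrow> real"
  assumes p: "p \<in> borel_measurable borel" "\<And>x. 0 \<le> p x" "(\<integral>\<^sup>+x. p x \<partial>lborel) = 1"
    "(\<integral>\<^sup>+x. ennreal ((1 + norm x ^ 6) * p x) \<partial>lborel) \<le> ennreal M" "(\<integral>x. p x *\<^sub>R x \<partial>lborel) = 0"
  assumes q: "q \<in> borel_measurable borel" "\<And>x. 0 \<le> q x" "(\<integral>\<^sup>+x. q x \<partial>lborel) = 1"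
    "(\<integral>\<^sup>+x. ennreal ((1 + norm x ^ 6) * q x) \<partial>lborel) \<le> ennreal M" "(\<integral>x. q x *\<^sub>R x \<partial>lborel) = 0"
  assumes s: "s > 0"
  shows "(\<integral>\<^sup>+y. ennreal ((sqrt (gauss_marginal p s y) - sqrt (gauss_marginal q s y))\<^sup>2) \<partial>lborel) \<le> ennreal (14 * M\<^sup>2 / s\<^sup>2)"
proof -
  define a a' m m' where "a = trunc_marginal p s" and "a' = trunc_marginal q s" and "m = gauss_marginal p s" and "m' = gauss_marginal q s"
  note pa = p s and qa = q s
  have [measurable]: "a \<in> borel_measurable borel" "a' \<in> borel_measurable borel" "m \<in> borel_measurable borel" "m' \<in> borel_measurable borel"
    unfolding a_def a'_def m_def m'_def
    by (intro measurable_trunc_marginal[OF pa] measurable_trunc_marginal[OF qa] measurable_gauss_marginal[OF pa] measurable_gauss_marginal[OF qa])+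
  have am: "0 \<le> a y" "a y \<le> m y" "0 \<le> a' y" "a' y \<le> m' y" for y
    unfolding a_def a'_def m_def m'_def
    using gauss_marginal_nonneg[OF pa] gauss_marginal_nonneg[OF qa] trunc_marginal_le[OF pa] trunc_marginal_le[OF qa] by auto
  have M: "1 \<le> M" using moment_bound(3)[OF pa, of 0] by simp
  have "(\<integral>\<^sup>+y. ennreal ((sqrt (m y) - sqrt (m' y))\<^sup>2) \<partial>lborel) \<le>
     (\<integral>\<^sup>+y. 2 * ennreal ((a y - gauss s 0 y)\<^sup>2 / gauss s 0 y) + 2 * ennreal ((a' y - gauss s 0 y)\<^sup>2 / gauss s 0 y) + ennreal (m y - a y) + ennreal (m' y - a' y) \<partial>lborel)"
  proof (intro nn_integral_mono)
    fix y :: 'a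
    have g: "0 < gauss s 0 y" by (rule gauss_pos[OF s])
    define X X' where "X = (a y - gauss s 0 y)\<^sup>2 / gauss s 0 y" and "X' = (a' y - gauss s 0 y)\<^sup>2 / gauss s 0 y"
    have X: "0 \<le> X" "0 \<le> X'" using g by (auto simp: X_def X'_def)
    have "(sqrt (m y) - sqrt (m' y))\<^sup>2 \<le> 2 * X + 2 * X' + (m y - a y) + (m' y - a' y)"
      using sqrt_diff_power2_split[of "a y" "a' y" "m y - a y" "m' y - a' y" "gauss s 0 y"] am[of y] g by (simp add: X_def X'_def)
    then have "ennreal ((sqrt (m y) - sqrt (m' y))\<^sup>2) \<le> ennreal (2 * X + 2 * X' + (m y - a y) + (m' y - a' y))"
      by (rule ennreal_leI)
    also have "\<dots> = 2 * ennreal X + 2 * ennreal X' + ennreal (m y - a y) + ennreal (m' y - a' y)"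
      using am[of y] X by (simp add: ennreal_plus ennreal_mult)
    finally show "ennreal ((sqrt (m y) - sqrt (m' y))\<^sup>2) \<le> 2 * ennreal ((a y - gauss s 0 y)\<^sup>2 / gauss s 0 y) + 2 * ennreal ((a' y - gauss s 0 y)\<^sup>2 / gauss s 0 y) + ennreal (m y - a y) + ennreal (m' y - a' y)"
      unfolding X_def X'_def .
  qed
  also have "\<dots> = 2 * (\<integral>\<^sup>+y. ennreal ((a y - gauss s 0 y)\<^sup>2 / gauss s 0 y) \<partial>lborel) + 2 * (\<integral>\<^sup>+y. ennreal ((a' y - gauss s 0 y)\<^sup>2 / gauss s 0 y) \<partial>lborel)
     + (\<integral>\<^sup>+y. ennreal (m y - a y) \<partial>lborel) + (\<integral>\<^sup>+y. ennreal (m' y - a' y) \<partial>lborel)"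
    by (simp add: nn_integral_add nn_integral_cmult)
  also have "\<dots> \<le> 2 * ennreal (3 * M\<^sup>2 / s\<^sup>2) + 2 * ennreal (3 * M\<^sup>2 / s\<^sup>2) + ennreal (M / s\<^sup>2) + ennreal (M / s\<^sup>2)"
    unfolding a_def a'_def m_def m'_def
    by (intro add_mono mult_left_mono nn_integral_chi2_trunc_marginal[OF pa] nn_integral_chi2_trunc_marginal[OF qa]
        nn_integral_marginal_diff[OF pa] nn_integral_marginal_diff[OF qa]) auto
  also have "\<dots> = ennreal (2 * (3 * M\<^sup>2 / s\<^sup>2) + 2 * (3 * M\<^sup>2 / s\<^sup>2) + M / s\<^sup>2 + M / s\<^sup>2)"
  proof -
    have X: "0 \<le> 3 * M\<^sup>2 / s\<^sup>2" "0 \<le> M / s\<^sup>2" using M by auto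
    show ?thesis unfolding ennreal_2_mult
      by (simp only: ennreal_plus[symmetric] X add_nonneg_nonneg mult_nonneg_nonneg zero_le_numeral)
  qed
  also have "\<dots> \<le> ennreal (14 * M\<^sup>2 / s\<^sup>2)"
  proof (rule ennreal_leI)
    have "M \<le> M\<^sup>2" using M by (simp add: power2_eq_square mult_le_cancel_left1)
    then have "M / s\<^sup>2 \<le> M\<^sup>2 / s\<^sup>2" by (simp add: divide_right_mono)
    then show "2 * (3 * M\<^sup>2 / s\<^sup>2) + 2 * (3 * M\<^sup>2 / s\<^sup>2) + M / s\<^sup>2 + M / s\<^sup>2 \<le> 14 * M\<^sup>2 / s\<^sup>2" by simp
  qed
  finally show ?thesis unfolding m_def m'_def .
qed

text \<open>For fixed \<open>y\<close>, multiplying both densities by a Gaussian of variance \<open>s\<close> around \<open>y\<close> gains the factor \<open>exp (|x0 - x1|^2 / (8 s))\<close> at midpoints. The loss is the squared Hellinger distance of the two convolved densities, which is of order \<open>1 / s^2\<close> because both barycenters vanish.\<close>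

theorem prekopa_leindler_stability:
  fixes p q v :: "'a::euclidean_space \<Rightarrow> real"
  assumes p[measurable]: "p \<in> borel_measurable borel" and p0: "\<And>x. 0 < p x" and pB: "\<And>x. p x \<le> B" and p1: "(\<integral>\<^sup>+x. p x \<partial>lborel) = 1"
    and pM: "(\<integral>\<^sup>+x. ennreal ((1 + norm x ^ 6) * p x) \<partial>lborel) \<le> ennreal M" and pm: "(\<integral>x. p x *\<^sub>R x \<partial>lborel) = 0"
  assumes q[measurable]: "q \<in> borel_measurable borel" and q0: "\<And>x. 0 < q x" and qB: "\<And>x. q x \<le> B" and q1: "(\<integral>\<^sup>+x. q x \<partial>lborel) = 1"
    and qM: "(\<integral>\<^sup>+x. ennreal ((1 + norm x ^ 6) * q x) \<partial>lborel) \<le> ennreal M" and qm: "(\<integral>x. q x *\<^sub>R x \<partial>lborel) = 0"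
  assumes v[measurable]: "v \<in> borel_measurable borel" and s: "s > 0" and \<kappa>: "\<kappa> \<ge> 0" and \<epsilon>: "\<epsilon> \<ge> 0"
    and vle: "\<And>x y. sqrt (p x * q y) * exp (- \<kappa> * (norm x ^ 3 + norm y ^ 3)) \<le> v ((1/2) *\<^sub>R (x + y))"
    and vI: "(\<integral>\<^sup>+x. v x \<partial>lborel) \<le> ennreal (1 + \<epsilon>)"
  shows "W2_sq (density lborel p) (density lborel q) \<le> ennreal (8 * s * (\<epsilon> + \<kappa> * M) + 116 * M\<^sup>2 / s)"
proof -
  note pa = p less_imp_le[OF p0] p1 pM pm s and qa = q less_imp_le[OF q0] q1 qM qm s
  have M: "1 \<le> M" using moment_bound(3)[OF pa, of 0] by simp
  define m n where "m = gauss_marginal p s" and "n = gauss_marginal q s"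
  define f g where "f y x = p x * gauss s x y" and "g y x = q x * gauss s x y" for x y
  have gp: "0 < gauss s x y" for x y :: 'a by (rule gauss_pos[OF s])
  have [measurable]: "m \<in> borel_measurable borel" "n \<in> borel_measurable borel"
    unfolding m_def n_def by (intro measurable_gauss_marginal[OF pa] measurable_gauss_marginal[OF qa])+
  have mn0: "0 \<le> m y" "0 \<le> n y" for y
    unfolding m_def n_def using gauss_marginal_nonneg(1)[OF pa] gauss_marginal_nonneg(1)[OF qa] by auto
  have mn1: "(\<integral>\<^sup>+y. m y \<partial>lborel) = 1" "(\<integral>\<^sup>+y. n y \<partial>lborel) = 1"
    unfolding m_def n_def using nn_integral_gauss_marginal_1[OF pa] nn_integral_gauss_marginal_1[OF qa] by auto
  have mf: "(\<integral>\<^sup>+x. ennreal (f y x) \<partial>lborel) = ennreal (m y)" "(\<integral>\<^sup>+x. ennreal (g y x) \<partial>lborel) = ennreal (n y)" for y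
    unfolding m_def n_def f_def g_def using gauss_marginal_eq[OF pa] gauss_marginal_eq[OF qa] by auto
  \<comment> \<open>A bounded density times a Gaussian has the exponential bound for every center,
    so the coupling theorem applies with the center \<open>y\<close> as parameter.\<close>
  have dom: "\<exists>C. \<forall>x. 0 < r x * gauss s x y \<and> r x * gauss s x y \<le> C * exp (- (\<Sum>b\<in>Basis. \<bar>x \<bullet> b\<bar>))"
    if r: "\<And>x. 0 < r x" "\<And>x. r x \<le> B" for r and y :: 'a
  proof -
    obtain C where C: "C \<ge> 0" "\<And>x::'a. gauss s x y \<le> C * exp (- (\<Sum>b\<in>Basis. \<bar>x \<bullet> b\<bar>))"
      using gauss_le_exp_l1[OF s, of y] by auto
    have "r x * gauss s x y \<le> B * (C * exp (- (\<Sum>b\<in>Basis. \<bar>x \<bullet> b\<bar>)))" for x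
      using r[of x] C gp[of x y] by (intro mult_mono) auto
    then show ?thesis using r gp by (intro exI[of _ "B * C"]) (auto simp: mult.assoc)
  qed
  have fg: "(\<lambda>(y, x). f y x) \<in> borel_measurable (borel \<Otimes>\<^sub>M borel)" "(\<lambda>(y, x). g y x) \<in> borel_measurable (borel \<Otimes>\<^sub>M borel)"
    unfolding f_def g_def by measurable
  obtain U :: "('a \<Rightarrow> real) measure" and Q R where U: "prob_space U"
    and Q: "(\<lambda>(p, u). Q p u) \<in> borel_measurable (borel \<Otimes>\<^sub>M U)" and R: "(\<lambda>(p, u). R p u) \<in> borel_measurable (borel \<Otimes>\<^sub>M U)"
    and lQ: "\<And>y h. y \<in> space borel \<Longrightarrow> h \<in> borel_measurable borel \<Longrightarrow>
       (\<integral>\<^sup>+u. h (Q y u) \<partial>U) * (\<integral>\<^sup>+x. ennreal (f y x) \<partial>lborel) = (\<integral>\<^sup>+x. h x * ennreal (f y x) \<partial>lborel)"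
    and lR: "\<And>y h. y \<in> space borel \<Longrightarrow> h \<in> borel_measurable borel \<Longrightarrow>
       (\<integral>\<^sup>+u. h (R y u) \<partial>U) * (\<integral>\<^sup>+x. ennreal (g y x) \<partial>lborel) = (\<integral>\<^sup>+x. h x * ennreal (g y x) \<partial>lborel)"
    and PL: "\<And>y G. y \<in> space borel \<Longrightarrow> G \<in> borel_measurable borel \<Longrightarrow>
       (\<integral>\<^sup>+u. G ((1/2) *\<^sub>R (Q y u + R y u)) * ennreal (1 / sqrt (f y (Q y u) * g y (R y u))) \<partial>U)
        * ennreal (sqrt (enn2real (\<integral>\<^sup>+x. ennreal (f y x) \<partial>lborel) * enn2real (\<integral>\<^sup>+x. ennreal (g y x) \<partial>lborel)))
       \<le> (\<integral>\<^sup>+x. G x \<partial>lborel)"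
    by (rule prekopa_leindler_coupling[OF fg(1) _ fg(2), of thesis])
       (use dom[OF p0 pB] dom[OF q0 qB] in \<open>auto simp: f_def g_def\<close>)
  interpret U: prob_space U by fact
  note [measurable] = Q R
  have [measurable]: "(\<lambda>(y, u). Q y u) \<in> borel_measurable (lborel \<Otimes>\<^sub>M U)" "(\<lambda>(y, u). R y u) \<in> borel_measurable (lborel \<Otimes>\<^sub>M U)"
    using Q R by (simp_all cong: measurable_cong_sets sets_pair_measure_cong)
  have [measurable]: "Q y \<in> borel_measurable U" "R y \<in> borel_measurable U" for y
    using measurable_compose[OF measurable_Pair1' Q, of y] measurable_compose[OF measurable_Pair1' R, of y] by auto
  have LQ: "(\<integral>\<^sup>+y. ennreal (m y) * (\<integral>\<^sup>+u. h (Q y u) \<partial>U) \<partial>lborel) = (\<integral>\<^sup>+x. h x * ennreal (p x) \<partial>lborel)"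
    if "h \<in> borel_measurable borel" for h
  proof -
    have "ennreal (m y) * (\<integral>\<^sup>+u. h (Q y u) \<partial>U) = (\<integral>\<^sup>+x. h x * ennreal (f y x) \<partial>lborel)" for y
      using lQ[of y h] that unfolding mf by (simp add: mult.commute)
    then show ?thesis using nn_integral_gauss_marginal[OF pa that] by (simp add: f_def)
  qed
  have LR: "(\<integral>\<^sup>+y. ennreal (n y) * (\<integral>\<^sup>+u. h (R y u) \<partial>U) \<partial>lborel) = (\<integral>\<^sup>+x. h x * ennreal (q x) \<partial>lborel)"
    if "h \<in> borel_measurable borel" for h
  proof -
    have "ennreal (n y) * (\<integral>\<^sup>+u. h (R y u) \<partial>U) = (\<integral>\<^sup>+x. h x * ennreal (g y x) \<partial>lborel)" for y
      using lR[of y h] that unfolding mf by (simp add: mult.commute)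
    then show ?thesis using nn_integral_gauss_marginal[OF qa that] by (simp add: g_def)
  qed
  define H where "H = (\<integral>\<^sup>+y. ennreal ((sqrt (m y) - sqrt (n y))\<^sup>2) \<partial>lborel)"
  have H: "H \<le> ennreal (14 * M\<^sup>2 / s\<^sup>2)"
    unfolding H_def m_def n_def by (rule hellinger_marginals_le[OF pa(1-5) qa])
  \<comment> \<open>The transport cost weighted by the geometric mean of the marginals; it dominates
    the cost on the common weight \<open>min (m y) (n y)\<close>.\<close>
  define T where "T = (\<integral>\<^sup>+y. ennreal (sqrt (m y * n y)) * (\<integral>\<^sup>+u. ennreal ((norm (Q y u - R y u))\<^sup>2) \<partial>U) \<partial>lborel)"
  \<comment> \<open>The coupling inequality is applied to \<open>v\<close> times the Gaussian.
    Pointwise it contains \<open>exp (e - k)\<close>, with the Gaussian gain \<open>e\<close> and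
    the cubic loss \<open>k\<close>, and \<open>1 + (e - k) \<le> exp (e - k)\<close> makes both
    linear.\<close>
  have key: "ennreal (sqrt (m y * n y)) + ennreal (1 / (8 * s)) * (ennreal (sqrt (m y * n y)) * (\<integral>\<^sup>+u. ennreal ((norm (Q y u - R y u))\<^sup>2) \<partial>U))
      \<le> (\<integral>\<^sup>+x. ennreal (v x * gauss s x y) \<partial>lborel) + ennreal (\<kappa> / 2) * ((ennreal (m y) * (\<integral>\<^sup>+u. ennreal (norm (Q y u) ^ 6) \<partial>U) + ennreal (n y)) + (ennreal (n y) * (\<integral>\<^sup>+u. ennreal (norm (R y u) ^ 6) \<partial>U) + ennreal (m y)))" for y
  proof -
    define w where "w = sqrt (m y * n y)"
    have w0: "0 \<le> w" using mn0 by (simp add: w_def)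
    have "ennreal w + ennreal (1 / (8 * s)) * (ennreal w * (\<integral>\<^sup>+u. ennreal ((norm (Q y u - R y u))\<^sup>2) \<partial>U))
      = (\<integral>\<^sup>+u. ennreal w + ennreal (1 / (8 * s)) * (ennreal w * ennreal ((norm (Q y u - R y u))\<^sup>2)) \<partial>U)"
      by (subst nn_integral_add) (auto simp: nn_integral_cmult U.emeasure_space_1)
    also have "\<dots> \<le> (\<integral>\<^sup>+u. ennreal (v ((1/2) *\<^sub>R (Q y u + R y u)) * gauss s ((1/2) *\<^sub>R (Q y u + R y u)) y) * ennreal (1 / sqrt (f y (Q y u) * g y (R y u))) * ennreal w
        + ennreal (\<kappa> / 2) * ((ennreal (m y) * ennreal (norm (Q y u) ^ 6) + ennreal (n y)) + (ennreal (n y) * ennreal (norm (R y u) ^ 6) + ennreal (m y))) \<partial>U)"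
    proof (intro nn_integral_mono)
      fix u
      define a b where "a = Q y u" and "b = R y u"
      define e where "e = (norm (a - b))\<^sup>2 / (8 * s)"
      define k where "k = \<kappa> * (norm a ^ 3 + norm b ^ 3)"
      define V where "V = v ((1/2) *\<^sub>R (a + b)) * gauss s ((1/2) *\<^sub>R (a + b)) y"
      have fgpos: "0 < f y a" "0 < g y b" using p0 q0 gp by (auto simp: f_def g_def)
      have "sqrt (f y a * g y b) * exp (e - k) = (sqrt (p a * q b) * exp (- k)) * (sqrt (gauss s a y * gauss s b y) * exp e)"
        by (simp add: f_def g_def real_sqrt_mult exp_diff exp_minus field_simps)
      also have "\<dots> \<le> v ((1/2) *\<^sub>R (a + b)) * (sqrt (gauss s a y * gauss s b y) * exp e)"
        using vle[of a b] gp by (intro mult_right_mono mult_nonneg_nonneg) (auto simp: k_def less_imp_le)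
      also have "\<dots> = V" unfolding V_def e_def gauss_midpoint[OF s] by simp
      finally have V: "sqrt (f y a * g y b) * exp (e - k) \<le> V" .
      then have "exp (e - k) \<le> V * (1 / sqrt (f y a * g y b))"
        using fgpos by (simp add: le_divide_eq mult.commute)
      moreover have "1 + (e - k) \<le> exp (e - k)" by (rule exp_ge_add_one_self)
      ultimately have "1 + e - k \<le> V * (1 / sqrt (f y a * g y b))" by linarith
      then have "w * (1 + e) \<le> w * (V * (1 / sqrt (f y a * g y b)) + k)"
        using w0 by (intro mult_left_mono) auto
      also have "w * (V * (1 / sqrt (f y a * g y b)) + k) = V * (1 / sqrt (f y a * g y b)) * w + \<kappa> * (w * norm a ^ 3 + w * norm b ^ 3)"
        by (simp add: k_def algebra_simps)
      \<comment> \<open>Each power is paired with the marginal of its own map, \<open>m\<close> for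
        \<open>a\<close> and \<open>n\<close> for \<open>b\<close>, so that integration over
        \<open>y\<close> reproduces the sixth moments of \<open>p\<close> and
        \<open>q\<close>.\<close>
      also have "\<kappa> * (w * norm a ^ 3 + w * norm b ^ 3) \<le> \<kappa> * ((m y * norm a ^ 6 + n y) / 2 + (n y * norm b ^ 6 + m y) / 2)"
      proof -
        have "w * norm a ^ 3 \<le> (m y * (norm a ^ 3)\<^sup>2 + n y) / 2"
          unfolding w_def by (rule real_sqrt_mult_le_weighted) (auto simp: mn0)
        moreover have "w * norm b ^ 3 \<le> (n y * (norm b ^ 3)\<^sup>2 + m y) / 2"
          unfolding w_def mult.commute[of "m y" "n y"] by (rule real_sqrt_mult_le_weighted) (auto simp: mn0)
        ultimately show ?thesis using \<kappa> unfolding power_mult[symmetric] by (intro mult_left_mono add_mono) auto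
      qed
      also have "\<kappa> * ((m y * norm a ^ 6 + n y) / 2 + (n y * norm b ^ 6 + m y) / 2) = \<kappa> / 2 * ((m y * norm a ^ 6 + n y) + (n y * norm b ^ 6 + m y))"
        by (simp add: field_simps)
      finally have "w + 1 / (8 * s) * (w * (norm (a - b))\<^sup>2) \<le> V * (1 / sqrt (f y a * g y b)) * w + \<kappa> / 2 * ((m y * norm a ^ 6 + n y) + (n y * norm b ^ 6 + m y))"
        by (simp add: e_def algebra_simps)
      moreover have "0 \<le> V" using order_trans[OF _ V, of 0] fgpos by simp
      ultimately have "ennreal (w + 1 / (8 * s) * (w * (norm (a - b))\<^sup>2)) \<le> ennreal (V * (1 / sqrt (f y a * g y b)) * w + \<kappa> / 2 * ((m y * norm a ^ 6 + n y) + (n y * norm b ^ 6 + m y)))"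
        by (intro ennreal_leI)
      show "ennreal w + ennreal (1 / (8 * s)) * (ennreal w * ennreal ((norm (Q y u - R y u))\<^sup>2))
        \<le> ennreal (v ((1/2) *\<^sub>R (Q y u + R y u)) * gauss s ((1/2) *\<^sub>R (Q y u + R y u)) y) * ennreal (1 / sqrt (f y (Q y u) * g y (R y u))) * ennreal w
        + ennreal (\<kappa> / 2) * ((ennreal (m y) * ennreal (norm (Q y u) ^ 6) + ennreal (n y)) + (ennreal (n y) * ennreal (norm (R y u) ^ 6) + ennreal (m y)))"
      proof -
        have nn: "0 \<le> 1 / (8 * s)" "0 \<le> (norm (a - b))\<^sup>2" "0 \<le> 1 / sqrt (f y a * g y b)" "0 \<le> \<kappa> / 2" "0 \<le> norm a ^ 6" "0 \<le> norm b ^ 6"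
          using s \<kappa> fgpos by auto
        show ?thesis
          using \<open>ennreal (w + _) \<le> _\<close> unfolding a_def[symmetric] b_def[symmetric] V_def[symmetric]
          by (simp only: ennreal_plus ennreal_mult nn w0 \<open>0 \<le> V\<close> mn0 add_nonneg_nonneg mult_nonneg_nonneg)
      qed
    qed
    also have "\<dots> = (\<integral>\<^sup>+u. ennreal (v ((1/2) *\<^sub>R (Q y u + R y u)) * gauss s ((1/2) *\<^sub>R (Q y u + R y u)) y) * ennreal (1 / sqrt (f y (Q y u) * g y (R y u))) \<partial>U) * ennreal w
        + ennreal (\<kappa> / 2) * ((ennreal (m y) * (\<integral>\<^sup>+u. ennreal (norm (Q y u) ^ 6) \<partial>U) + ennreal (n y)) + (ennreal (n y) * (\<integral>\<^sup>+u. ennreal (norm (R y u) ^ 6) \<partial>U) + ennreal (m y)))"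
      unfolding f_def g_def
      by (subst nn_integral_add) (auto simp: nn_integral_multc nn_integral_cmult nn_integral_add U.emeasure_space_1)
    also have "(\<integral>\<^sup>+u. ennreal (v ((1/2) *\<^sub>R (Q y u + R y u)) * gauss s ((1/2) *\<^sub>R (Q y u + R y u)) y) * ennreal (1 / sqrt (f y (Q y u) * g y (R y u))) \<partial>U) * ennreal w
      \<le> (\<integral>\<^sup>+x. ennreal (v x * gauss s x y) \<partial>lborel)"
      using PL[of y "\<lambda>x. ennreal (v x * gauss s x y)"] mn0 by (simp add: mf w_def)
    finally show ?thesis by (simp add: w_def)
  qed
  \<comment> \<open>With both points equal to \<open>x\<close> the midpoint is \<open>x\<close>, so
    the lower bound itself makes \<open>v\<close> nonnegative.\<close>
  have v0: "0 \<le> v x" for x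
    using vle[of x x] p0[of x] q0[of x] by (intro order_trans[OF _ vle[of x x, simplified]]) (auto simp: less_imp_le scaleR_2[symmetric])
  have "(\<integral>\<^sup>+y. ennreal (sqrt (m y * n y)) \<partial>lborel) + ennreal (1 / (8 * s)) * T = (\<integral>\<^sup>+y. ennreal (sqrt (m y * n y)) + ennreal (1 / (8 * s)) * (ennreal (sqrt (m y * n y)) * (\<integral>\<^sup>+u. ennreal ((norm (Q y u - R y u))\<^sup>2) \<partial>U)) \<partial>lborel)"
    unfolding T_def by (subst nn_integral_add) (auto simp: nn_integral_cmult)
  also have "\<dots> \<le> (\<integral>\<^sup>+y. (\<integral>\<^sup>+x. ennreal (v x * gauss s x y) \<partial>lborel) + ennreal (\<kappa> / 2) * ((ennreal (m y) * (\<integral>\<^sup>+u. ennreal (norm (Q y u) ^ 6) \<partial>U) + ennreal (n y)) + (ennreal (n y) * (\<integral>\<^sup>+u. ennreal (norm (R y u) ^ 6) \<partial>U) + ennreal (m y))) \<partial>lborel)"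
    by (intro nn_integral_mono key)
  also have "\<dots> = (\<integral>\<^sup>+y. (\<integral>\<^sup>+x. ennreal (v x * gauss s x y) \<partial>lborel) \<partial>lborel) + ennreal (\<kappa> / 2) * (((\<integral>\<^sup>+x. ennreal (norm x ^ 6) * ennreal (p x) \<partial>lborel) + 1) + ((\<integral>\<^sup>+x. ennreal (norm x ^ 6) * ennreal (q x) \<partial>lborel) + 1))"
    using LQ[of "\<lambda>x. ennreal (norm x ^ 6)"] LR[of "\<lambda>x. ennreal (norm x ^ 6)"]
    by (simp add: nn_integral_add nn_integral_cmult mn1)
  also have "(\<integral>\<^sup>+y. (\<integral>\<^sup>+x. ennreal (v x * gauss s x y) \<partial>lborel) \<partial>lborel) = (\<integral>\<^sup>+x. (\<integral>\<^sup>+y. ennreal (v x * gauss s x y) \<partial>lborel) \<partial>lborel)"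
    by (rule lborel_pair.Fubini') measurable
  also have "\<dots> = (\<integral>\<^sup>+x. v x \<partial>lborel)"
    using v0 gp by (simp add: ennreal_mult less_imp_le nn_integral_cmult nn_integral_gauss[OF s])
  also have "(\<integral>\<^sup>+x. ennreal (norm x ^ 6) * ennreal (p x) \<partial>lborel) + 1 = (\<integral>\<^sup>+x. ennreal ((1 + norm x ^ 6) * p x) \<partial>lborel)"
    unfolding p1[symmetric] using p0 by (subst nn_integral_add[symmetric]) (auto simp: distrib_right ennreal_plus ennreal_mult less_imp_le add.commute)
  also have "(\<integral>\<^sup>+x. ennreal (norm x ^ 6) * ennreal (q x) \<partial>lborel) + 1 = (\<integral>\<^sup>+x. ennreal ((1 + norm x ^ 6) * q x) \<partial>lborel)"
    unfolding q1[symmetric] using q0 by (subst nn_integral_add[symmetric]) (auto simp: distrib_right ennreal_plus ennreal_mult less_imp_le add.commute)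
  also have "(\<integral>\<^sup>+x. v x \<partial>lborel) + ennreal (\<kappa> / 2) * ((\<integral>\<^sup>+x. ennreal ((1 + norm x ^ 6) * p x) \<partial>lborel) + (\<integral>\<^sup>+x. ennreal ((1 + norm x ^ 6) * q x) \<partial>lborel))
     \<le> ennreal (1 + \<epsilon>) + ennreal (\<kappa> / 2) * (ennreal M + ennreal M)"
    by (intro add_mono mult_left_mono vI pM qM) auto
  also have "\<dots> = ennreal (1 + \<epsilon> + \<kappa> * M)"
    using \<kappa> \<epsilon> M by (simp add: ennreal_plus[symmetric] ennreal_mult[symmetric] del: ennreal_plus)
  finally have TI: "(\<integral>\<^sup>+y. ennreal (sqrt (m y * n y)) \<partial>lborel) + ennreal (1 / (8 * s)) * T \<le> ennreal (1 + \<epsilon> + \<kappa> * M)" .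
  \<comment> \<open>The mass of the geometric mean falls short of one by half the squared Hellinger
    distance; this deficit reappears as \<open>h / 2\<close> in the bound for
    \<open>T\<close>.\<close>
  have HI: "2 * (\<integral>\<^sup>+y. ennreal (sqrt (m y * n y)) \<partial>lborel) + H = 2"
  proof -
    have "2 * (\<integral>\<^sup>+y. ennreal (sqrt (m y * n y)) \<partial>lborel) + H = (\<integral>\<^sup>+y. 2 * ennreal (sqrt (m y * n y)) + ennreal ((sqrt (m y) - sqrt (n y))\<^sup>2) \<partial>lborel)"
      unfolding H_def by (subst nn_integral_add) (auto simp: nn_integral_cmult)
    also have "\<dots> = (\<integral>\<^sup>+y. ennreal (m y) + ennreal (n y) \<partial>lborel)"
    proof (intro nn_integral_cong)
      fix y
      have "2 * sqrt (m y * n y) + (sqrt (m y) - sqrt (n y))\<^sup>2 = m y + n y"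
        using mn0[of y] by (simp add: power2_diff real_sqrt_mult)
      then have "ennreal (2 * sqrt (m y * n y) + (sqrt (m y) - sqrt (n y))\<^sup>2) = ennreal (m y + n y)" by simp
      then show "2 * ennreal (sqrt (m y * n y)) + ennreal ((sqrt (m y) - sqrt (n y))\<^sup>2) = ennreal (m y) + ennreal (n y)"
        using mn0[of y] by (simp add: ennreal_plus ennreal_mult)
    qed
    also have "\<dots> = 2" by (simp add: nn_integral_add mn1)
    finally show ?thesis .
  qed
  obtain h where h: "0 \<le> h" "H = ennreal h" "h \<le> 14 * M\<^sup>2 / s\<^sup>2"
  proof -
    have "H < \<infinity>" using H by (rule le_less_trans) simp
    then obtain h where "0 \<le> h" "H = ennreal h" by (metis ennreal_cases infinity_ennreal_def less_irrefl)
    with H that show ?thesis by simp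
  qed
  obtain c where c: "0 \<le> c" "(\<integral>\<^sup>+y. ennreal (sqrt (m y * n y)) \<partial>lborel) = ennreal c"
  proof -
    have "(\<integral>\<^sup>+y. ennreal (sqrt (m y * n y)) \<partial>lborel) \<le> ennreal (1 + \<epsilon> + \<kappa> * M)"
      by (rule order_trans[OF _ TI]) simp
    then show ?thesis using that by (metis ennreal_cases ennreal_neq_top top_unique)
  qed
  obtain t where t: "0 \<le> t" "T = ennreal t"
  proof (cases T rule: ennreal_cases)
    case top
    then have "ennreal (1 / (8 * s)) * T = \<top>" using s by (simp add: ennreal_mult_eq_top_iff)
    then show ?thesis using TI by (simp add: top_unique)
  qed (use that in auto)
  have ch: "2 * c + h = 2"
  proof -
    have "ennreal (2 * c + h) = ennreal 2" using HI c h by (simp add: ennreal_plus ennreal_mult)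
    then show ?thesis using c h by (subst (asm) ennreal_inj) auto
  qed
  have "ennreal (c + 1 / (8 * s) * t) \<le> ennreal (1 + \<epsilon> + \<kappa> * M)"
  proof -
    have "0 \<le> 1 / (8 * s)" using s by simp
    then show ?thesis
      using TI unfolding c(2) t(2) by (simp only: ennreal_plus ennreal_mult c(1) t(1) mult_nonneg_nonneg)
  qed
  then have "c + 1 / (8 * s) * t \<le> 1 + \<epsilon> + \<kappa> * M" using \<epsilon> \<kappa> M by (subst (asm) ennreal_le_iff) auto
  then have "1 / (8 * s) * t \<le> \<epsilon> + \<kappa> * M + h / 2" using ch by simp
  then have tle: "t \<le> 8 * s * (\<epsilon> + \<kappa> * M + h / 2)" using s by (simp add: field_simps)
  \<comment> \<open>Young's inequality is used with parameter \<open>s\<close>: the fourth moment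
    contributes \<open>M / s\<close> and the Hellinger term \<open>s * h\<close>, both of order
    \<open>1 / s\<close> by the bound on \<open>h\<close>.\<close>
  have rem: "(\<integral>\<^sup>+y. ennreal (max 0 (a y - b y)) * (\<integral>\<^sup>+u. ennreal ((norm (S y u))\<^sup>2) \<partial>U) \<partial>lborel) \<le> ennreal (M / s + s * h)"
    if [measurable]: "a \<in> borel_measurable borel" "b \<in> borel_measurable borel" "(\<lambda>(y, u). S y u) \<in> borel_measurable (lborel \<Otimes>\<^sub>M U)"
      "\<And>y. S y \<in> borel_measurable U"
    and ab0: "\<And>y. 0 \<le> a y" "\<And>y. 0 \<le> b y"
    and ab: "(\<integral>\<^sup>+y. ennreal ((sqrt (a y) - sqrt (b y))\<^sup>2) \<partial>lborel) = ennreal h"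
    and LS: "(\<integral>\<^sup>+y. ennreal (a y) * (\<integral>\<^sup>+u. ennreal (norm (S y u) ^ 4) \<partial>U) \<partial>lborel) \<le> ennreal M"
    for a b :: "'a \<Rightarrow> real" and S :: "'a \<Rightarrow> ('a \<Rightarrow> real) \<Rightarrow> 'a"
  proof -
    have "(\<integral>\<^sup>+y. ennreal (max 0 (a y - b y)) * (\<integral>\<^sup>+u. ennreal ((norm (S y u))\<^sup>2) \<partial>U) \<partial>lborel)
      \<le> (\<integral>\<^sup>+y. ennreal (1 / s) * (ennreal (a y) * (\<integral>\<^sup>+u. ennreal (norm (S y u) ^ 4) \<partial>U)) + ennreal s * ennreal ((sqrt (a y) - sqrt (b y))\<^sup>2) \<partial>lborel)"
    proof (intro nn_integral_mono)
      fix y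
      have "ennreal (max 0 (a y - b y)) * (\<integral>\<^sup>+u. ennreal ((norm (S y u))\<^sup>2) \<partial>U) = (\<integral>\<^sup>+u. ennreal (max 0 (a y - b y)) * ennreal ((norm (S y u))\<^sup>2) \<partial>U)"
        by (rule nn_integral_cmult[symmetric]) measurable
      also have "\<dots> \<le> (\<integral>\<^sup>+u. ennreal (1 / s) * (ennreal (a y) * ennreal (norm (S y u) ^ 4)) + ennreal s * ennreal ((sqrt (a y) - sqrt (b y))\<^sup>2) \<partial>U)"
      proof (intro nn_integral_mono)
        fix u
        have "max 0 (a y - b y) * (norm (S y u))\<^sup>2 \<le> a y * ((norm (S y u))\<^sup>2)\<^sup>2 / s + s * (sqrt (a y) - sqrt (b y))\<^sup>2"
          using ab0 s by (intro positive_part_diff_le) auto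
        then have "ennreal (max 0 (a y - b y) * (norm (S y u))\<^sup>2) \<le> ennreal (1 / s * (a y * norm (S y u) ^ 4) + s * (sqrt (a y) - sqrt (b y))\<^sup>2)"
          by (intro ennreal_leI) (simp add: power_mult[symmetric])
        also have "\<dots> = ennreal (1 / s) * (ennreal (a y) * ennreal (norm (S y u) ^ 4)) + ennreal s * ennreal ((sqrt (a y) - sqrt (b y))\<^sup>2)"
        proof -
          have "ennreal (1 / s * (a y * norm (S y u) ^ 4)) = ennreal (1 / s) * (ennreal (a y) * ennreal (norm (S y u) ^ 4))"
            using ab0[of y] s by (simp only: ennreal_mult mult_nonneg_nonneg zero_le_power norm_ge_zero divide_nonneg_pos zero_le_one)
          moreover have "ennreal (s * (sqrt (a y) - sqrt (b y))\<^sup>2) = ennreal s * ennreal ((sqrt (a y) - sqrt (b y))\<^sup>2)"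
            using s by (intro ennreal_mult) auto
          moreover have "0 \<le> 1 / s * (a y * norm (S y u) ^ 4)" "0 \<le> s * (sqrt (a y) - sqrt (b y))\<^sup>2" using ab0[of y] s by auto
          ultimately show ?thesis by (simp only: ennreal_plus)
        qed
        finally show "ennreal (max 0 (a y - b y)) * ennreal ((norm (S y u))\<^sup>2) \<le> \<dots>"
          by (simp add: ennreal_mult)
      qed
      also have "\<dots> = ennreal (1 / s) * (ennreal (a y) * (\<integral>\<^sup>+u. ennreal (norm (S y u) ^ 4) \<partial>U)) + ennreal s * ennreal ((sqrt (a y) - sqrt (b y))\<^sup>2)"
        by (simp add: nn_integral_add nn_integral_cmult U.emeasure_space_1)
      finally show "ennreal (max 0 (a y - b y)) * (\<integral>\<^sup>+u. ennreal ((norm (S y u))\<^sup>2) \<partial>U) \<le> \<dots>" .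
    qed
    also have "\<dots> = ennreal (1 / s) * (\<integral>\<^sup>+y. ennreal (a y) * (\<integral>\<^sup>+u. ennreal (norm (S y u) ^ 4) \<partial>U) \<partial>lborel) + ennreal s * ennreal h"
      unfolding ab[symmetric] by (subst nn_integral_add) (auto simp: nn_integral_cmult)
    also have "\<dots> \<le> ennreal (1 / s) * ennreal M + ennreal s * ennreal h"
      by (intro add_mono mult_left_mono LS) auto
    also have "\<dots> = ennreal (M / s + s * h)"
      using s M h(1) by (simp add: ennreal_plus[symmetric] ennreal_mult[symmetric] del: ennreal_plus)
    finally show ?thesis .
  qed
  have m4: "(\<integral>\<^sup>+x. ennreal (norm x ^ 4) * ennreal (r x) \<partial>lborel) \<le> ennreal M"
    if "(\<integral>\<^sup>+x. ennreal ((1 + norm x ^ 6) * r x) \<partial>lborel) \<le> ennreal M" "\<And>x. 0 < r x" for r :: "'a \<Rightarrow> real"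
    by (rule order_trans[OF nn_integral_mono that(1)])
       (use that(2) in \<open>auto simp: ennreal_mult[symmetric] less_imp_le intro!: ennreal_leI mult_right_mono power_le_one_plus_power6\<close>)
  have "W2_sq (density lborel p) (density lborel q) \<le> (\<integral>\<^sup>+y. ennreal (min (m y) (n y)) * (\<integral>\<^sup>+u. ennreal ((norm (Q y u - R y u))\<^sup>2) \<partial>U) \<partial>lborel)
     + 2 * (\<integral>\<^sup>+y. ennreal (max 0 (m y - n y)) * (\<integral>\<^sup>+u. ennreal ((norm (Q y u))\<^sup>2) \<partial>U) \<partial>lborel)
     + 2 * (\<integral>\<^sup>+y. ennreal (max 0 (n y - m y)) * (\<integral>\<^sup>+u. ennreal ((norm (R y u))\<^sup>2) \<partial>U) \<partial>lborel)"
    by (rule W2_sq_le_mixture[OF U Q R]) (auto simp: mn0 mn1 LQ LR nn_integral_density mult.commute)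
  also have "\<dots> \<le> T + 2 * ennreal (M / s + s * h) + 2 * ennreal (M / s + s * h)"
  proof (intro add_mono mult_left_mono)
    show "(\<integral>\<^sup>+y. ennreal (min (m y) (n y)) * (\<integral>\<^sup>+u. ennreal ((norm (Q y u - R y u))\<^sup>2) \<partial>U) \<partial>lborel) \<le> T"
      unfolding T_def
    proof (intro nn_integral_mono mult_right_mono ennreal_leI real_le_rsqrt)
      fix y
      show "(min (m y) (n y))\<^sup>2 \<le> m y * n y" using mn0[of y] by (simp add: power2_eq_square mult_mono)
    qed auto
    show "(\<integral>\<^sup>+y. ennreal (max 0 (m y - n y)) * (\<integral>\<^sup>+u. ennreal ((norm (Q y u))\<^sup>2) \<partial>U) \<partial>lborel) \<le> ennreal (M / s + s * h)"
      using h(2) LQ[of "\<lambda>x. ennreal (norm x ^ 4)"] m4[OF pM p0] by (intro rem) (auto simp: mn0 H_def)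
    have "(\<integral>\<^sup>+y. ennreal ((sqrt (n y) - sqrt (m y))\<^sup>2) \<partial>lborel) = ennreal h"
      unfolding h(2)[symmetric] H_def by (simp add: power2_commute)
    then show "(\<integral>\<^sup>+y. ennreal (max 0 (n y - m y)) * (\<integral>\<^sup>+u. ennreal ((norm (R y u))\<^sup>2) \<partial>U) \<partial>lborel) \<le> ennreal (M / s + s * h)"
      using LR[of "\<lambda>x. ennreal (norm x ^ 4)"] m4[OF qM q0] by (intro rem) (auto simp: mn0)
  qed auto
  also have "\<dots> = ennreal (t + 2 * (M / s + s * h) + 2 * (M / s + s * h))"
  proof -
    have "0 \<le> M / s + s * h" using s M h by auto
    then show ?thesis unfolding t(2) ennreal_2_mult
      by (simp only: ennreal_plus[symmetric] t(1) add_nonneg_nonneg mult_nonneg_nonneg zero_le_numeral)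
  qed
  \<comment> \<open>The bound on \<open>t\<close> contributes \<open>4 * (s * h)\<close> and the two
    remainders \<open>4 * (M / s) + 4 * (s * h)\<close>; since
    \<open>s * h \<le> 14 * M^2 / s\<close>, the constant is
    \<open>4 + 8 * 14 = 116\<close>.\<close>
  also have "\<dots> \<le> ennreal (8 * s * (\<epsilon> + \<kappa> * M) + 116 * M\<^sup>2 / s)"
  proof (rule ennreal_leI)
    have "s * h \<le> s * (14 * M\<^sup>2 / s\<^sup>2)" using s h by (intro mult_left_mono) auto
    also have "\<dots> = 14 * M\<^sup>2 / s" using s by (simp add: power2_eq_square)
    finally have sh: "s * h \<le> 14 * M\<^sup>2 / s" .
    have "M \<le> M\<^sup>2" using M by (simp add: power2_eq_square mult_le_cancel_left1)
    then have Ms: "M / s \<le> M\<^sup>2 / s" using s by (simp add: divide_right_mono)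
    have "t + 2 * (M / s + s * h) + 2 * (M / s + s * h) \<le> 8 * s * (\<epsilon> + \<kappa> * M) + 4 * (M / s) + 8 * (s * h)"
      using tle by (simp add: algebra_simps)
    also have "\<dots> \<le> 8 * s * (\<epsilon> + \<kappa> * M) + 4 * (M\<^sup>2 / s) + 8 * (14 * M\<^sup>2 / s)" using sh Ms by linarith
    also have "\<dots> = 8 * s * (\<epsilon> + \<kappa> * M) + 116 * M\<^sup>2 / s" by simp
    finally show "t + 2 * (M / s + s * h) + 2 * (M / s + s * h) \<le> 8 * s * (\<epsilon> + \<kappa> * M) + 116 * M\<^sup>2 / s" .
  qed
  finally show ?thesis .
qed

section \<open>The dual problem\<close>

text \<open>Diagonal extraction on a countable dense set; the common Lipschitz bound then carries
  the Cauchy property to every point by a three-term estimate.\<close>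

lemma lipschitz_pointwise_subseq:
  fixes \<psi> :: "nat \<Rightarrow> 'a::euclidean_space \<Rightarrow> real"
  assumes lip: "\<And>n x y. \<bar>\<psi> n x - \<psi> n y\<bar> \<le> D * norm (x - y)" and zero: "\<And>n. \<psi> n 0 = 0"
  obtains r \<phi> where "strict_mono (r :: nat \<Rightarrow> nat)" "\<And>x. (\<lambda>n. \<psi> (r n) x) \<longlonglongrightarrow> \<phi> x"
proof -
  obtain S :: "'a set" where S: "countable S" "\<And>X. open X \<Longrightarrow> X \<noteq> {} \<Longrightarrow> \<exists>d\<in>S. d \<in> X"
    using countable_dense_setE by blast
  obtain b :: 'a where b: "b \<in> Basis" using nonempty_Basis by blast
  have D0: "0 \<le> D" using lip[of 0 b 0] b by (simp add: order_trans[OF abs_ge_zero])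
  \<comment> \<open>Division by \<open>1 + norm x\<close> makes the family uniformly bounded, the
    form expected by \<open>function_convergent_subsequence\<close>; it is undone pointwise
    afterwards.\<close>
  define g where "g n x = \<psi> n x / (1 + norm x)" for n x
  have gb: "norm (g n x) \<le> D" for n x
  proof -
    have "\<bar>\<psi> n x\<bar> \<le> D * (1 + norm x)"
      using lip[of n x 0] zero D0 by (simp add: algebra_simps)
    then show ?thesis by (simp add: g_def abs_divide divide_le_eq add_pos_nonneg)
  qed
  obtain r where r: "strict_mono (r::nat\<Rightarrow>nat)" "\<And>x. x \<in> S \<Longrightarrow> \<exists>l. (\<lambda>n. g (r n) x) \<longlonglongrightarrow> l"
    using function_convergent_subsequence[of S g D] S(1) gb by blast
  have convS: "Cauchy (\<lambda>n. \<psi> (r n) x)" if "x \<in> S" for x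
  proof -
    obtain l where "(\<lambda>n. g (r n) x) \<longlonglongrightarrow> l" using r(2)[OF \<open>x \<in> S\<close>] by auto
    then have "(\<lambda>n. g (r n) x * (1 + norm x)) \<longlonglongrightarrow> l * (1 + norm x)" by (intro tendsto_intros)
    moreover have "g (r n) x * (1 + norm x) = \<psi> (r n) x" for n
    proof -
      have "1 + norm x \<noteq> 0" using norm_ge_zero[of x] by linarith
      then show ?thesis by (simp add: g_def)
    qed
    ultimately show ?thesis by (auto simp: LIMSEQ_imp_Cauchy)
  qed
  have "Cauchy (\<lambda>n. \<psi> (r n) x)" for x
  proof (rule metric_CauchyI)
    fix e :: real assume e: "0 < e"
    have "0 < e / (3 * (D + 1))" using e D0 by simp
    then obtain d where d: "d \<in> S" "d \<in> ball x (e / (3 * (D + 1)))"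
      using S(2)[of "ball x (e / (3 * (D + 1)))"] by fastforce
    have "norm (x - d) < e / (3 * (D + 1))" using d by (simp add: dist_norm)
    then have "D * norm (x - d) \<le> D * (e / (3 * (D + 1)))" using D0 by (intro mult_left_mono) auto
    also have "\<dots> \<le> e / 3" using D0 e by (simp add: field_simps)
    finally have dd: "D * norm (x - d) \<le> e / 3" .
    obtain N where N: "\<And>m n. m \<ge> N \<Longrightarrow> n \<ge> N \<Longrightarrow> dist (\<psi> (r m) d) (\<psi> (r n) d) < e / 3"
      using metric_CauchyD[OF convS[OF d(1)], of "e / 3"] e by auto
    show "\<exists>M. \<forall>m\<ge>M. \<forall>n\<ge>M. dist (\<psi> (r m) x) (\<psi> (r n) x) < e"
    proof (intro exI[of _ N] allI impI)
      fix m n assume "N \<le> m" "N \<le> n"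
      then show "dist (\<psi> (r m) x) (\<psi> (r n) x) < e"
        using N[of m n] lip[of "r m" x d] lip[of "r n" x d] dd unfolding dist_real_def by linarith
    qed
  qed
  then have "\<exists>l. (\<lambda>n. \<psi> (r n) x) \<longlonglongrightarrow> l" for x
    using Cauchy_convergent convergent_def by blast
  then obtain \<phi> where "\<And>x. (\<lambda>n. \<psi> (r n) x) \<longlonglongrightarrow> \<phi> x" by metis
  with r that show ?thesis by blast
qed

text \<open>What is kept of membership in \<open>K_set\<close>: the set enters only through the
  radius \<open>D\<close>, so constants derived from this predicate depend on the space,
  \<open>D\<close> and \<open>th\<close> alone. The lower bound holds for all \<open>x\<close> by
  homogeneity.\<close>

definition centered :: "real \<Rightarrow> real \<Rightarrow> 'a::euclidean_space measure \<Rightarrow> bool" where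
  "centered D th \<mu> \<longleftrightarrow> sets \<mu> = sets borel \<and> prob_space \<mu> \<and> (AE y in \<mu>. norm y \<le> D) \<and>
     (\<integral>y. y \<partial>\<mu>) = 0 \<and> (\<forall>x. th * norm x \<le> (\<integral>y. \<bar>y \<bullet> x\<bar> \<partial>\<mu>))"

text \<open>The second component may exceed the conjugate of \<open>\<psi>\<close> and is
  constrained only for almost every \<open>y\<close>, which makes the class stable under lower
  limits. Slopes are bounded by \<open>D\<close> because the measure lives in the ball of radius
  \<open>D\<close>.\<close>

definition dual_pair :: "real \<Rightarrow> 'a::euclidean_space measure \<Rightarrow> ('a \<Rightarrow> real) \<Rightarrow> ('a \<Rightarrow> real) \<Rightarrow> bool" where
  "dual_pair D \<mu> \<psi> f \<longleftrightarrow> convex_on UNIV \<psi> \<and> (\<forall>x y. \<bar>\<psi> x - \<psi> y\<bar> \<le> D * norm (x - y)) \<and>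
     integrable \<mu> f \<and> (AE y in \<mu>. \<forall>x. x \<bullet> y \<le> \<psi> x + f y)"

definition partition_fun :: "('a::euclidean_space \<Rightarrow> real) \<Rightarrow> real" where
  "partition_fun \<psi> = (\<integral>x. exp (- \<psi> x) \<partial>lborel)"

definition dual_J :: "'a::euclidean_space measure \<Rightarrow> ('a \<Rightarrow> real) \<Rightarrow> ('a \<Rightarrow> real) \<Rightarrow> real" where
  "dual_J \<mu> \<psi> f = (\<integral>y. f y \<partial>\<mu>) - ln (partition_fun \<psi>)"

lemma lipschitz_continuous:
  fixes \<psi> :: "'a::real_normed_vector \<Rightarrow> real"
  assumes "\<And>x y. \<bar>\<psi> x - \<psi> y\<bar> \<le> D * norm (x - y)"
  shows "continuous_on UNIV \<psi>"
proof -
  have "\<bar>\<psi> x - \<psi> y\<bar> \<le> (\<bar>D\<bar> + 1) * norm (x - y)" for x y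
    using assms[of x y] by (rule order_trans) (simp add: mult_right_mono)
  then have "(\<bar>D\<bar> + 1)-lipschitz_on UNIV \<psi>" by (intro lipschitz_onI) (auto simp: dist_norm)
  then show ?thesis by (rule lipschitz_on_continuous_on)
qed

lemma dual_pairD:
  assumes "dual_pair D \<mu> \<psi> f"
  shows "convex_on UNIV \<psi>" "\<And>x y. \<bar>\<psi> x - \<psi> y\<bar> \<le> D * norm (x - y)" "integrable \<mu> f"
    "AE y in \<mu>. \<forall>x. x \<bullet> y \<le> \<psi> x + f y" "continuous_on UNIV \<psi>" "\<psi> \<in> borel_measurable borel"
proof -
  show *: "convex_on UNIV \<psi>" "\<And>x y. \<bar>\<psi> x - \<psi> y\<bar> \<le> D * norm (x - y)" "integrable \<mu> f"
    "AE y in \<mu>. \<forall>x. x \<bullet> y \<le> \<psi> x + f y" using assms by (auto simp: dual_pair_def)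
  show "continuous_on UNIV \<psi>" by (rule lipschitz_continuous[OF *(2)])
  then show "\<psi> \<in> borel_measurable borel" by (rule borel_measurable_continuous_onI)
qed

text \<open>Fatou's lemma for the second components: the normalisation at the origin makes them
  nonnegative, their lower limit keeps the constraint, and in the limit the integral can only
  drop.\<close>

lemma dual_pair_limit:
  assumes s[measurable_cong]: "sets \<mu> = sets borel" and dp: "\<And>n. dual_pair D \<mu> (\<psi> n) (f n)" and zero: "\<And>n. \<psi> n 0 = 0"
    and lim: "\<And>x. (\<lambda>n. \<psi> n x) \<longlonglongrightarrow> \<phi> x" and L: "(\<lambda>n. \<integral>y. f n y \<partial>\<mu>) \<longlonglongrightarrow> L"
  obtains g where "dual_pair D \<mu> \<phi> g" "(\<integral>y. g y \<partial>\<mu>) \<le> L"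
proof -
  have fm[measurable]: "f n \<in> borel_measurable \<mu>" for n using dual_pairD(3)[OF dp[of n]] by auto
  have con: "AE y in \<mu>. \<forall>n x. x \<bullet> y \<le> \<psi> n x + f n y"
    using dual_pairD(4)[OF dp] by (simp add: AE_all_countable)
  have nn: "AE y in \<mu>. \<forall>n. 0 \<le> f n y"
    using con by eventually_elim (metis add_0 inner_zero_left zero)
  define F where "F y = liminf (\<lambda>n. ennreal (f n y))" for y
  have [measurable]: "F \<in> borel_measurable \<mu>" unfolding F_def by measurable
  have "(\<integral>\<^sup>+y. F y \<partial>\<mu>) \<le> liminf (\<lambda>n. \<integral>\<^sup>+y. ennreal (f n y) \<partial>\<mu>)"
    unfolding F_def by (rule nn_integral_liminf) simp
  also have "(\<lambda>n. \<integral>\<^sup>+y. ennreal (f n y) \<partial>\<mu>) = (\<lambda>n. ennreal (\<integral>y. f n y \<partial>\<mu>))"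
    using nn by (intro ext nn_integral_eq_integral dual_pairD(3)[OF dp]) (auto elim: eventually_mono)
  also have "liminf (\<lambda>n. ennreal (\<integral>y. f n y \<partial>\<mu>)) = ennreal L"
    using L by (intro lim_imp_Liminf tendsto_ennrealI) auto
  finally have FL: "(\<integral>\<^sup>+y. F y \<partial>\<mu>) \<le> ennreal L" .
  have L0: "0 \<le> L"
    using nn by (intro LIMSEQ_le_const[OF L]) (auto intro!: integral_nonneg_AE elim: eventually_mono)
  have fin: "AE y in \<mu>. F y \<noteq> \<infinity>"
    by (rule nn_integral_noteq_infinite) (use FL in \<open>auto simp: top_unique\<close>)
  define g where "g y = enn2real (F y)" for y
  have gF: "AE y in \<mu>. ennreal (g y) = F y" using fin by eventually_elim (simp add: g_def less_top)
  have [measurable]: "g \<in> borel_measurable \<mu>" unfolding g_def by measurable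
  have gint: "(\<integral>\<^sup>+y. ennreal (g y) \<partial>\<mu>) \<le> ennreal L" using FL nn_integral_cong_AE[OF gF] by simp
  have ig: "integrable \<mu> g"
    by (rule integrableI_bounded) (use gint in \<open>auto simp: g_def intro: le_less_trans\<close>)
  have "(\<integral>y. g y \<partial>\<mu>) \<le> L"
  proof -
    have "\<And>y. 0 \<le> g y" by (simp add: g_def)
    then show ?thesis using gint nn_integral_eq_integral[OF ig] L0 by simp
  qed
  moreover have "dual_pair D \<mu> \<phi> g"
    unfolding dual_pair_def
  proof (intro conjI allI ig)
    show "convex_on UNIV \<phi>"
      unfolding convex_on_def
    proof (intro conjI ballI allI impI)
      fix x y :: 'a and u v :: real assume uv: "0 \<le> u" "0 \<le> v" "u + v = 1"
      show "\<phi> (u *\<^sub>R x + v *\<^sub>R y) \<le> u * \<phi> x + v * \<phi> y"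
        using dual_pairD(1)[OF dp] uv
        by (intro LIMSEQ_le[OF lim tendsto_add[OF tendsto_mult_left[OF lim] tendsto_mult_left[OF lim]]])
           (auto simp: convex_on_def)
    qed auto
    fix x y
    show "\<bar>\<phi> x - \<phi> y\<bar> \<le> D * norm (x - y)"
      by (rule LIMSEQ_le_const2[OF tendsto_rabs[OF tendsto_diff[OF lim lim]]]) (use dual_pairD(2)[OF dp] in auto)
  next
    show "AE y in \<mu>. \<forall>x. x \<bullet> y \<le> \<phi> x + g y"
      using con gF
    proof eventually_elim
      fix y assume c: "\<forall>n x. x \<bullet> y \<le> \<psi> n x + f n y" and g: "ennreal (g y) = F y"
      show "\<forall>x. x \<bullet> y \<le> \<phi> x + g y"
      proof
        fix x
        have "ennreal (x \<bullet> y - \<phi> x) = liminf (\<lambda>n. ennreal (x \<bullet> y - \<psi> n x))"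
          by (intro lim_imp_Liminf[symmetric] tendsto_ennrealI tendsto_intros lim) auto
        also have "\<dots> \<le> F y" unfolding F_def
          by (intro Liminf_mono always_eventually allI ennreal_leI) (use c in \<open>auto simp: algebra_simps\<close>)
        finally have "ennreal (x \<bullet> y - \<phi> x) \<le> ennreal (g y)" using g by simp
        moreover have "0 \<le> g y" by (simp add: g_def)
        ultimately have "x \<bullet> y - \<phi> x \<le> g y" by (auto simp: ennreal_le_iff2)
        then show "x \<bullet> y \<le> \<phi> x + g y" by simp
      qed
    qed
  qed
  ultimately show ?thesis using that by blast
qed

lemma integrable_exp_norm:
  assumes c: "c > 0"
  shows "integrable lborel (\<lambda>x::'a::euclidean_space. exp (- c * norm x))"
proof -
  define k where "k = c / DIM('a)"
  have k: "k > 0" using c by (simp add: k_def)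
  have "(\<integral>\<^sup>+t. ennreal (exp (- \<bar>t\<bar>)) \<partial>(lborel::real measure)) = ennreal k * (\<integral>\<^sup>+t. ennreal (exp (- \<bar>0 + k * t\<bar>)) \<partial>(lborel::real measure))"
    using k nn_integral_real_affine[of "\<lambda>t. ennreal (exp (- \<bar>t\<bar>))" k 0] by simp
  then have fin: "(\<integral>\<^sup>+t. ennreal (exp (- (k * \<bar>t\<bar>))) \<partial>(lborel::real measure)) < \<infinity>"
    using nn_integral_exp_minus_abs k by (auto simp: abs_mult ennreal_mult_less_top)
  have "(\<integral>\<^sup>+x. ennreal (norm (exp (- c * norm x))) \<partial>(lborel::'a measure)) \<le> (\<integral>\<^sup>+(x::'a). (\<Prod>b\<in>Basis. ennreal (exp (- (k * \<bar>x \<bullet> b\<bar>)))) \<partial>lborel)"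
  proof (intro nn_integral_mono)
    fix x :: 'a
    have "k * (\<Sum>b\<in>Basis. \<bar>x \<bullet> b\<bar>) \<le> k * (DIM('a) * norm x)" using k by (intro mult_left_mono l1_le_DIM_norm) auto
    then have "exp (- c * norm x) \<le> exp (- (\<Sum>b\<in>Basis. k * \<bar>x \<bullet> b\<bar>))"
      by (simp add: k_def sum_distrib_left sum_divide_distrib)
    then show "ennreal (norm (exp (- c * norm x))) \<le> (\<Prod>b\<in>Basis. ennreal (exp (- (k * \<bar>x \<bullet> b\<bar>))))"
      by (simp add: prod_ennreal exp_sum[symmetric] sum_negf ennreal_leI)
  qed
  also have "\<dots> = (\<Prod>b\<in>(Basis::'a set). (\<integral>\<^sup>+t. ennreal (exp (- (k * \<bar>t\<bar>))) \<partial>lborel))"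
    by (rule nn_integral_lborel_prod) auto
  also have "\<dots> < \<infinity>" using fin by (simp add: power_less_top_ennreal)
  finally show ?thesis by (intro integrableI_bounded) auto
qed

lemma integral_exp_pos:
  fixes \<psi> :: "'a::euclidean_space \<Rightarrow> real"
  assumes "integrable lborel (\<lambda>x. exp (- \<psi> x))"
  shows "0 < partition_fun \<psi>"
proof -
  have [measurable]: "(\<lambda>x. exp (- \<psi> x)) \<in> borel_measurable lborel" using assms by auto
  have "0 < (\<integral>\<^sup>+x. ennreal (exp (- \<psi> x)) \<partial>lborel)" by (rule nn_integral_pos_real) auto
  also have "\<dots> = ennreal (partition_fun \<psi>)" unfolding partition_fun_def by (rule nn_integral_eq_integral[OF assms]) auto
  finally show ?thesis by (simp add: ennreal_less_zero_iff)
qed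

lemma integrable_exp_minus:
  fixes \<psi> :: "'a::euclidean_space \<Rightarrow> real"
  assumes [measurable]: "\<psi> \<in> borel_measurable borel" and c: "c > 0" and le: "\<And>x. c * norm x - K \<le> \<psi> x"
  shows "integrable lborel (\<lambda>x. exp (- \<psi> x))" "partition_fun \<psi> \<le> exp K * partition_fun (\<lambda>x::'a. c * norm x)"
proof -
  have i: "integrable lborel (\<lambda>x::'a. exp K * exp (- c * norm x))" using integrable_exp_norm[OF c] by auto
  have b: "exp (- \<psi> x) \<le> exp K * exp (- c * norm x)" for x
    unfolding exp_add[symmetric] using le[of x] by simp
  show i': "integrable lborel (\<lambda>x. exp (- \<psi> x))"
    by (rule Bochner_Integration.integrable_bound[OF i]) (use b in auto)
  have "partition_fun \<psi> \<le> (\<integral>(x::'a). exp K * exp (- c * norm x) \<partial>lborel)"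
    unfolding partition_fun_def by (rule integral_mono[OF i' i b])
  then show "partition_fun \<psi> \<le> exp K * partition_fun (\<lambda>x::'a. c * norm x)"
    by (simp add: partition_fun_def)
qed

lemma integral_lborel_translate:
  fixes h :: "'b::euclidean_space \<Rightarrow> 'c::{banach, second_countable_topology}"
  assumes [measurable]: "h \<in> borel_measurable borel"
  shows "(\<integral>x. h (x + a) \<partial>lborel) = (\<integral>x. h x \<partial>lborel)"
proof -
  have "(\<integral>x. h x \<partial>lborel) = (\<integral>x. h x \<partial>(distr lborel borel ((+) a)))" by (simp add: lborel_distr_plus)
  also have "\<dots> = (\<integral>x. h (a + x) \<partial>lborel)" by (subst integral_distr) auto
  finally show ?thesis by (simp add: add.commute)
qed

lemma partition_fun_translate:
  fixes \<psi> :: "'a::euclidean_space \<Rightarrow> real"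
  assumes [measurable]: "\<psi> \<in> borel_measurable borel"
  shows "partition_fun (\<lambda>x. \<psi> (x + a) + c) = exp (- c) * partition_fun \<psi>"
proof -
  have "partition_fun (\<lambda>x. \<psi> (x + a) + c) = (\<integral>x. exp (- c) * exp (- \<psi> (x + a)) \<partial>lborel)"
    unfolding partition_fun_def exp_add[symmetric] by (simp add: algebra_simps)
  then show ?thesis using integral_lborel_translate[of "\<lambda>x. exp (- \<psi> x)" a] by (simp add: partition_fun_def)
qed

section \<open>Coercivity and normalisation of dual pairs for a centered measure\<close>

context
  fixes D th :: real and \<mu> :: "'a::euclidean_space measure"
  assumes cen: "centered D th \<mu>"
begin

lemma centeredD:
  "sets \<mu> = sets borel" "prob_space \<mu>" "AE y in \<mu>. norm y \<le> D" "(\<integral>y. y \<partial>\<mu>) = 0" "th * norm x \<le> (\<integral>y. \<bar>y \<bullet> x\<bar> \<partial>\<mu>)"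
  "integrable \<mu> (\<lambda>y. y)"
proof -
  show *: "sets \<mu> = sets borel" "prob_space \<mu>" "AE y in \<mu>. norm y \<le> D" "(\<integral>y. y \<partial>\<mu>) = 0" "th * norm x \<le> (\<integral>y. \<bar>y \<bullet> x\<bar> \<partial>\<mu>)"
    using cen by (auto simp: centered_def)
  interpret prob_space \<mu> by fact
  have "(\<lambda>y. y) \<in> borel_measurable \<mu>" by (rule measurable_ident_sets[OF *(1)])
  then show "integrable \<mu> (\<lambda>y. y)" by (intro integrable_const_bound[OF *(3)])
qed

lemma centered_D_pos: assumes "th > 0" shows "0 < D"
proof -
  interpret prob_space \<mu> by (rule centeredD)
  obtain b :: 'a where b: "b \<in> Basis" using nonempty_Basis by blast
  have "th * norm b \<le> (\<integral>y. \<bar>y \<bullet> b\<bar> \<partial>\<mu>)" by (rule centeredD)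
  also have "\<dots> \<le> (\<integral>y. D \<partial>\<mu>)"
  proof (rule integral_mono_AE)
    show "integrable \<mu> (\<lambda>y. \<bar>y \<bullet> b\<bar>)" using centeredD(6) by auto
    show "AE y in \<mu>. \<bar>y \<bullet> b\<bar> \<le> D"
      using centeredD(3) by eventually_elim (metis Basis_le_norm b order_trans)
  qed auto
  finally show ?thesis using b assms by (simp add: prob_space)
qed

text \<open>Since \<open>max 0 t = (t + \<bar>t\<bar>) / 2\<close> and the barycenter vanishes,
  positive parts carry half of the absolute moment.\<close>

lemma centered_positive_part: "th / 2 * norm x \<le> (\<integral>y. max 0 (x \<bullet> y) \<partial>\<mu>)"
proof -
  have "(\<integral>y. max 0 (x \<bullet> y) \<partial>\<mu>) = (\<integral>y. (y \<bullet> x + \<bar>y \<bullet> x\<bar>) / 2 \<partial>\<mu>)"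
    by (intro Bochner_Integration.integral_cong) (auto simp: max_def inner_commute)
  also have "\<dots> = ((\<integral>y. y \<partial>\<mu>) \<bullet> x + (\<integral>y. \<bar>y \<bullet> x\<bar> \<partial>\<mu>)) / 2"
    using centeredD(6) by simp
  finally show ?thesis using centeredD(4,5) by simp
qed

text \<open>Using the constraint at both \<open>x\<close> and \<open>0\<close> gives
  \<open>f y \<ge> max 0 (x \<bullet> y) - \<psi> x\<close> once
  \<open>\<psi> 0 \<le> \<psi> x\<close>. Integration turns the spread of the measure in every
  direction into linear growth of the potential.\<close>

lemma dual_pair_lower:
  assumes dp: "dual_pair D \<mu> \<psi> f" and z: "\<psi> 0 \<le> \<psi> x"
  shows "th / 2 * norm x - (\<integral>y. f y \<partial>\<mu>) \<le> \<psi> x"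
proof -
  interpret prob_space \<mu> by (rule centeredD)
  have "(\<integral>y. max 0 (x \<bullet> y) - \<psi> x \<partial>\<mu>) \<le> (\<integral>y. f y \<partial>\<mu>)"
  proof (rule integral_mono_AE)
    show "integrable \<mu> (\<lambda>y. max 0 (x \<bullet> y) - \<psi> x)" using centeredD(6) by auto
    show "integrable \<mu> f" by (rule dual_pairD[OF dp])
    show "AE y in \<mu>. max 0 (x \<bullet> y) - \<psi> x \<le> f y"
      using dual_pairD(4)[OF dp]
    proof eventually_elim
      case (elim y)
      then have "x \<bullet> y \<le> \<psi> x + f y" "0 \<bullet> y \<le> \<psi> 0 + f y" by blast+
      then show ?case using z by (auto simp: max_def)
    qed
  qed
  then show ?thesis using centered_positive_part[of x] centeredD(6) by (simp add: prob_space)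
qed

text \<open>A point with \<open>\<psi> x < \<psi> 0\<close> satisfies the same estimate with
  \<open>\<psi> 0\<close> in place of \<open>\<psi> x\<close>, so it lies in a ball of explicit
  radius, on which continuity yields a minimum.\<close>

lemma dual_pair_minimum:
  assumes th: "th > 0" and dp: "dual_pair D \<mu> \<psi> f"
  obtains a where "\<And>x. \<psi> a \<le> \<psi> x"
proof -
  interpret prob_space \<mu> by (rule centeredD)
  define r where "r = max 0 (2 * ((\<integral>y. f y \<partial>\<mu>) + \<psi> 0) / th)"
  have out: "\<psi> 0 \<le> \<psi> x" if x: "norm x > r" for x
  proof (rule ccontr)
    assume n: "\<not> \<psi> 0 \<le> \<psi> x"
    have "(\<integral>y. max 0 (x \<bullet> y) - \<psi> 0 \<partial>\<mu>) \<le> (\<integral>y. f y \<partial>\<mu>)"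
    proof (rule integral_mono_AE)
      show "integrable \<mu> (\<lambda>y. max 0 (x \<bullet> y) - \<psi> 0)" using centeredD(6) by auto
      show "integrable \<mu> f" by (rule dual_pairD[OF dp])
      show "AE y in \<mu>. max 0 (x \<bullet> y) - \<psi> 0 \<le> f y"
        using dual_pairD(4)[OF dp]
      proof eventually_elim
        case (elim y)
        then have "x \<bullet> y \<le> \<psi> x + f y" "0 \<bullet> y \<le> \<psi> 0 + f y" by blast+
        then show ?case using n by (auto simp: max_def)
      qed
    qed
    then have "th / 2 * norm x \<le> (\<integral>y. f y \<partial>\<mu>) + \<psi> 0" using centered_positive_part[of x] centeredD(6) by (simp add: prob_space)
    then have "norm x \<le> 2 * ((\<integral>y. f y \<partial>\<mu>) + \<psi> 0) / th" using th by (simp add: field_simps)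
    then show False using x by (simp add: r_def)
  qed
  obtain a where a: "a \<in> cball 0 r" "\<And>x. x \<in> cball 0 r \<Longrightarrow> \<psi> a \<le> \<psi> x"
    using continuous_attains_inf[of "cball (0::'a) r" \<psi>] continuous_on_subset[OF dual_pairD(5)[OF dp]]
    by (auto simp: r_def)
  have "\<psi> a \<le> \<psi> 0" by (rule a(2)) (simp add: r_def)
  then have "\<psi> a \<le> \<psi> x" for x using a(2)[of x] out[of x] by (cases "norm x \<le> r") auto
  then show ?thesis using that by blast
qed

text \<open>A shift of \<open>\<psi>\<close> is matched by subtracting a linear function from
  \<open>f\<close>, whose integral vanishes together with the barycenter. This is the translation
  freedom of the moment measure problem.\<close>

lemma dual_pair_translate:
  assumes dp: "dual_pair D \<mu> \<psi> f"
  shows "dual_pair D \<mu> (\<lambda>x. \<psi> (x + a) + c) (\<lambda>y. f y - y \<bullet> a - c)"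
    "(\<integral>y. f y - y \<bullet> a - c \<partial>\<mu>) = (\<integral>y. f y \<partial>\<mu>) - c"
proof -
  interpret prob_space \<mu> by (rule centeredD)
  note d = dual_pairD[OF dp]
  show "(\<integral>y. f y - y \<bullet> a - c \<partial>\<mu>) = (\<integral>y. f y \<partial>\<mu>) - c"
    using d(3) centeredD(4,6) by (simp add: prob_space)
  show "dual_pair D \<mu> (\<lambda>x. \<psi> (x + a) + c) (\<lambda>y. f y - y \<bullet> a - c)"
    unfolding dual_pair_def
  proof (intro conjI allI)
    show "convex_on UNIV (\<lambda>x. \<psi> (x + a) + c)"
      unfolding convex_on_def
    proof (intro conjI ballI allI impI)
      fix x y :: 'a and u v :: real assume uv: "0 \<le> u" "0 \<le> v" "u + v = 1"
      have "(u + v) *\<^sub>R a = a" using uv by simp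
      then have eq: "u *\<^sub>R x + v *\<^sub>R y + a = u *\<^sub>R (x + a) + v *\<^sub>R (y + a)"
        by (simp add: scaleR_right_distrib scaleR_add_left add_ac)
      have "\<psi> (u *\<^sub>R (x + a) + v *\<^sub>R (y + a)) \<le> u * \<psi> (x + a) + v * \<psi> (y + a)"
        using d(1) uv by (auto simp: convex_on_def)
      moreover have "u * c + v * c = c" using uv by (simp add: distrib_right[symmetric])
      ultimately show "\<psi> (u *\<^sub>R x + v *\<^sub>R y + a) + c \<le> u * (\<psi> (x + a) + c) + v * (\<psi> (y + a) + c)"
        unfolding eq distrib_left by linarith
    qed auto
    show "\<bar>\<psi> (x + a) + c - (\<psi> (y + a) + c)\<bar> \<le> D * norm (x - y)" for x y
      using d(2)[of "x + a" "y + a"] by simp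
    show "integrable \<mu> (\<lambda>y. f y - y \<bullet> a - c)" using d(3) centeredD(6) by auto
    show "AE y in \<mu>. \<forall>x. x \<bullet> y \<le> \<psi> (x + a) + c + (f y - y \<bullet> a - c)"
      using d(4)
    proof eventually_elim
      case (elim y)
      show ?case
      proof
        fix x
        have "(x + a) \<bullet> y \<le> \<psi> (x + a) + f y" using elim by blast
        then show "x \<bullet> y \<le> \<psi> (x + a) + c + (f y - y \<bullet> a - c)" by (simp add: inner_add_left inner_commute[of y a])
      qed
    qed
  qed
qed

lemma dual_pair_integrable:
  assumes th: "th > 0" and dp: "dual_pair D \<mu> \<psi> f"
  shows "integrable lborel (\<lambda>x. exp (- \<psi> x))" "0 < partition_fun \<psi>" "\<exists>K. \<forall>x. th / 2 * norm x - K \<le> \<psi> x"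
proof -
  obtain a where a: "\<And>x. \<psi> a \<le> \<psi> x" using dual_pair_minimum[OF th dp] by blast
  have dp': "dual_pair D \<mu> (\<lambda>x. \<psi> (x + a) + 0) (\<lambda>y. f y - y \<bullet> a - 0)" by (rule dual_pair_translate[OF dp])
  have "th / 2 * norm x - ((\<integral>y. f y \<partial>\<mu>) + th / 2 * norm a) \<le> \<psi> x" for x
  proof -
    have "th / 2 * norm (x - a) - (\<integral>y. f y \<partial>\<mu>) \<le> \<psi> x"
      using dual_pair_lower[OF dp', of "x - a"] a dual_pair_translate(2)[OF dp, of a 0] by simp
    moreover have "th / 2 * norm x \<le> th / 2 * (norm (x - a) + norm a)"
      using th norm_triangle_sub[of x a] by (intro mult_left_mono) (auto simp: add.commute)
    ultimately show ?thesis by (simp add: algebra_simps)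
  qed
  then show K: "\<exists>K. \<forall>x. th / 2 * norm x - K \<le> \<psi> x" by blast
  then obtain K where K: "\<And>x. th / 2 * norm x - K \<le> \<psi> x" by blast
  show i: "integrable lborel (\<lambda>x. exp (- \<psi> x))"
    by (rule integrable_exp_minus(1)[OF dual_pairD(6)[OF dp] _ K]) (use th in simp)
  then show "0 < partition_fun \<psi>" by (rule integral_exp_pos)
qed

lemma dual_J_translate:
  assumes th: "th > 0" and dp: "dual_pair D \<mu> \<psi> f"
  shows "dual_J \<mu> (\<lambda>x. \<psi> (x + a) + c) (\<lambda>y. f y - y \<bullet> a - c) = dual_J \<mu> \<psi> f"
  unfolding dual_J_def dual_pair_translate(2)[OF dp] partition_fun_translate[OF dual_pairD(6)[OF dp]]
  using ln_mult_pos[OF exp_gt_zero dual_pair_integrable(2)[OF th dp], of "- c"] by simp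

lemma dual_pair_normalize:
  assumes th: "th > 0" and dp: "dual_pair D \<mu> \<psi> f"
  obtains \<phi> g where "dual_pair D \<mu> \<phi> g" "\<phi> 0 = 0" "\<And>x. 0 \<le> \<phi> x" "dual_J \<mu> \<phi> g = dual_J \<mu> \<psi> f"
proof -
  obtain a where a: "\<And>x. \<psi> a \<le> \<psi> x" using dual_pair_minimum[OF th dp] by blast
  show ?thesis
  proof (rule that[OF dual_pair_translate(1)[OF dp, of a "- \<psi> a"]])
    show "dual_J \<mu> (\<lambda>x. \<psi> (x + a) + - \<psi> a) (\<lambda>y. f y - y \<bullet> a - - \<psi> a) = dual_J \<mu> \<psi> f"
      by (rule dual_J_translate[OF th dp])
    show "\<psi> (0 + a) + - \<psi> a = 0" by simp
    show "0 \<le> \<psi> (x + a) + - \<psi> a" for x using a[of "x + a"] by linarith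
  qed
qed

lemma dual_pair_coercive:
  assumes th: "th > 0" and dp: "dual_pair D \<mu> \<psi> f" and z: "\<psi> 0 = 0" "\<And>x. 0 \<le> \<psi> x"
  shows "(\<integral>y. f y \<partial>\<mu>) \<le> 2 * (dual_J \<mu> \<psi> f + ln (partition_fun (\<lambda>x::'a. th / 4 * norm x)))" "0 \<le> (\<integral>y. f y \<partial>\<mu>)"
proof -
  define A where "A = (\<integral>y. f y \<partial>\<mu>)"
  \<comment> \<open>Averaging the two lower bounds \<open>th / 2 * norm x - A\<close> and
    \<open>0\<close> halves the loss. The logarithm of the partition function then grows at most
    like \<open>A / 2\<close>, so \<open>dual_J\<close> still controls the other half of
    \<open>A\<close>; the first bound alone would leave nothing.\<close>
  have "th / 4 * norm x - A / 2 \<le> \<psi> x" for x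
  proof -
    have 0: "\<psi> 0 \<le> \<psi> x" using z by simp
    show ?thesis using dual_pair_lower[OF dp 0] z(2)[of x] by (simp add: A_def)
  qed
  then have le: "partition_fun \<psi> \<le> exp (A / 2) * partition_fun (\<lambda>x::'a. th / 4 * norm x)"
    using integrable_exp_minus(2)[OF dual_pairD(6)[OF dp], of "th / 4" "A / 2"] th by simp
  have p: "0 < partition_fun \<psi>" by (rule dual_pair_integrable[OF th dp])
  have p': "0 < partition_fun (\<lambda>x::'a. th / 4 * norm x)"
    using integral_exp_pos[of "\<lambda>x::'a. th / 4 * norm x"] integrable_exp_norm[of "th / 4", where 'a='a] th by simp
  have "ln (partition_fun \<psi>) \<le> ln (exp (A / 2) * partition_fun (\<lambda>x::'a. th / 4 * norm x))"
    using le p by simp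
  also have "\<dots> = A / 2 + ln (partition_fun (\<lambda>x::'a. th / 4 * norm x))"
    using ln_mult_pos[OF exp_gt_zero p', of "A / 2"] by simp
  finally show "(\<integral>y. f y \<partial>\<mu>) \<le> 2 * (dual_J \<mu> \<psi> f + ln (partition_fun (\<lambda>x::'a. th / 4 * norm x)))"
    by (simp add: dual_J_def A_def)
  show "0 \<le> (\<integral>y. f y \<partial>\<mu>)"
    using dual_pair_lower[OF dp order_refl] z by simp
qed

text \<open>An explicit competitor: it shows that dual values exist, and later bounds the minimal
  value by a constant that is the same for all centered measures.\<close>

lemma dual_pair_cone:
  assumes "0 \<le> D" shows "dual_pair D \<mu> (\<lambda>x. D * norm x) (\<lambda>_. 0)"
  unfolding dual_pair_def
proof (intro conjI allI)
  show "convex_on UNIV (\<lambda>x::'a. D * norm x)"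
    using convex_on_cmul[OF assms convex_on_dist[OF convex_UNIV, of 0]] by simp
  show "\<bar>D * norm x - D * norm y\<bar> \<le> D * norm (x - y)" for x y :: 'a
    using assms mult_left_mono[OF norm_triangle_ineq3[of x y] assms] by (simp add: right_diff_distrib[symmetric] abs_mult)
  show "AE y in \<mu>. \<forall>x. x \<bullet> y \<le> D * norm x + 0"
    using centeredD(3)
  proof eventually_elim
    case (elim y)
    show ?case
    proof
      fix x :: 'a
      have "x \<bullet> y \<le> norm x * norm y" by (rule norm_cauchy_schwarz)
      also have "\<dots> \<le> norm x * D" using elim by (intro mult_left_mono) auto
      finally show "x \<bullet> y \<le> D * norm x + 0" by (simp add: mult.commute)
    qed
  qed
qed auto

end

theorem dual_minimizer_exists:
  fixes \<mu> :: "'a::euclidean_space measure"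
  assumes th: "th > 0" and cen: "centered D th \<mu>"
  obtains \<psi> f where "dual_pair D \<mu> \<psi> f" "\<psi> 0 = 0" "\<And>x. 0 \<le> \<psi> x"
    "\<And>\<psi>' f'. dual_pair D \<mu> \<psi>' f' \<Longrightarrow> dual_J \<mu> \<psi> f \<le> dual_J \<mu> \<psi>' f'"
proof -
  note c = centeredD[OF cen]
  interpret prob_space \<mu> by (rule c)
  define C where "C = ln (partition_fun (\<lambda>x::'a. th / 4 * norm x))"
  define V where "V = {dual_J \<mu> \<psi> f |\<psi> f. dual_pair D \<mu> \<psi> f}"
  have ne: "V \<noteq> {}" using dual_pair_cone[OF cen] centered_D_pos[OF cen th] by (auto simp: V_def)
  have lb: "- C \<le> v" if "v \<in> V" for v
  proof -
    obtain \<psi> f where dp: "dual_pair D \<mu> \<psi> f" and v: "v = dual_J \<mu> \<psi> f" using \<open>v \<in> V\<close> by (auto simp: V_def)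
    obtain \<phi> g where n: "dual_pair D \<mu> \<phi> g" "\<phi> 0 = 0" "\<And>x. 0 \<le> \<phi> x" "dual_J \<mu> \<phi> g = dual_J \<mu> \<psi> f"
      using dual_pair_normalize[OF cen th dp] by blast
    show ?thesis using dual_pair_coercive[OF cen th n(1-3)] n(4) v by (simp add: C_def)
  qed
  define m where "m = Inf V"
  have bdd: "bdd_below V" by (rule bdd_belowI[OF lb])
  have "\<exists>\<psi> f. dual_pair D \<mu> \<psi> f \<and> \<psi> 0 = 0 \<and> (\<forall>x. 0 \<le> \<psi> x) \<and> dual_J \<mu> \<psi> f < m + 1 / real (Suc n)" for n
  proof -
    have "\<exists>v\<in>V. v < m + 1 / real (Suc n)" unfolding m_def by (subst cInf_less_iff[OF ne bdd, symmetric]) auto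
    then obtain \<psi> f where dp: "dual_pair D \<mu> \<psi> f" and v: "dual_J \<mu> \<psi> f < m + 1 / real (Suc n)" by (auto simp: V_def)
    obtain \<phi> g where "dual_pair D \<mu> \<phi> g" "\<phi> 0 = 0" "\<And>x. 0 \<le> \<phi> x" "dual_J \<mu> \<phi> g = dual_J \<mu> \<psi> f"
      using dual_pair_normalize[OF cen th dp] by blast
    then have "dual_pair D \<mu> \<phi> g \<and> \<phi> 0 = 0 \<and> (\<forall>x. 0 \<le> \<phi> x) \<and> dual_J \<mu> \<phi> g < m + 1 / real (Suc n)" using v by simp
    then show ?thesis by blast
  qed
  then obtain \<psi> f where dp: "\<And>n. dual_pair D \<mu> (\<psi> n) (f n)" and z: "\<And>n. \<psi> n 0 = 0" and nn: "\<And>n x. 0 \<le> \<psi> n x"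
    and J: "\<And>n. dual_J \<mu> (\<psi> n) (f n) < m + 1 / real (Suc n)" by metis
  define K where "K = 2 * (m + 1 + C)"
  have fK: "0 \<le> (\<integral>y. f n y \<partial>\<mu>)" "(\<integral>y. f n y \<partial>\<mu>) \<le> K" for n
  proof -
    have "dual_J \<mu> (\<psi> n) (f n) < m + 1" by (rule less_le_trans[OF J]) simp
    then show "0 \<le> (\<integral>y. f n y \<partial>\<mu>)" "(\<integral>y. f n y \<partial>\<mu>) \<le> K"
      using dual_pair_coercive[OF cen th dp z nn, of n] by (auto simp: K_def C_def)
  qed
  have "bounded (range (\<lambda>n. \<integral>y. f n y \<partial>\<mu>))" using fK by (auto intro!: boundedI[of _ K])
  then obtain L r where r: "strict_mono r" "((\<lambda>n. \<integral>y. f n y \<partial>\<mu>) \<circ> r) \<longlonglongrightarrow> L"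
    using bounded_imp_convergent_subsequence by blast
  obtain r' \<phi> where r': "strict_mono (r' :: nat \<Rightarrow> nat)" "\<And>x. (\<lambda>n. \<psi> (r (r' n)) x) \<longlonglongrightarrow> \<phi> x"
    using lipschitz_pointwise_subseq[of "\<lambda>n. \<psi> (r n)" D] dual_pairD(2)[OF dp] z by blast
  define q where "q n = r (r' n)" for n
  have q: "strict_mono q" using strict_mono_o[OF r(1) r'(1)] unfolding q_def[abs_def] o_def .
  have limL: "(\<lambda>n. \<integral>y. f (q n) y \<partial>\<mu>) \<longlonglongrightarrow> L"
    using LIMSEQ_subseq_LIMSEQ[OF r(2) r'(1)] by (simp add: o_def q_def)
  have lim: "\<And>x. (\<lambda>n. \<psi> (q n) x) \<longlonglongrightarrow> \<phi> x" using r'(2) by (simp add: q_def)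
  obtain g where g: "dual_pair D \<mu> \<phi> g" "(\<integral>y. g y \<partial>\<mu>) \<le> L"
    using dual_pair_limit[OF c(1) dp z lim limL] by blast
  \<comment> \<open>A lower bound common to the whole sequence supplies the dominating function for
    the partition functions. Hence the logarithmic term converges, and only the integral of
    \<open>f\<close> has to be treated by lower semicontinuity.\<close>
  have low: "th / 2 * norm x - K \<le> \<psi> n x" for n x
    using dual_pair_lower[OF cen dp, of n x] z nn fK[of n] by (smt (verit))
  have Zlim: "(\<lambda>n. partition_fun (\<psi> (q n))) \<longlonglongrightarrow> partition_fun \<phi>"
    unfolding partition_fun_def
  proof (rule integral_dominated_convergence)
    show "(\<lambda>x. exp (- \<phi> x)) \<in> borel_measurable lborel" using dual_pairD(6)[OF g(1)] by simp
    show "(\<lambda>x. exp (- \<psi> (q n) x)) \<in> borel_measurable lborel" for n using dual_pairD(6)[OF dp] by simp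
    show "integrable lborel (\<lambda>x::'a. exp K * exp (- (th / 2) * norm x))" using integrable_exp_norm[of "th / 2"] th by auto
    show "AE x in lborel. (\<lambda>n. exp (- \<psi> (q n) x)) \<longlonglongrightarrow> exp (- \<phi> x)"
      by (intro AE_I2 tendsto_intros lim)
    show "AE x in lborel. norm (exp (- \<psi> (q n) x)) \<le> exp K * exp (- (th / 2) * norm x)" for n
      unfolding exp_add[symmetric] using low[of _ "q n"] by (intro AE_I2) (simp add: algebra_simps)
  qed
  have Z: "0 < partition_fun \<phi>" by (rule dual_pair_integrable[OF cen th g(1)])
  have "(\<lambda>n. dual_J \<mu> (\<psi> (q n)) (f (q n))) \<longlonglongrightarrow> L - ln (partition_fun \<phi>)"
    unfolding dual_J_def using Z by (intro tendsto_intros limL Zlim) auto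
  moreover have "(\<lambda>n. m + 1 / real (Suc (q n))) \<longlonglongrightarrow> m + 0"
    using LIMSEQ_subseq_LIMSEQ[OF LIMSEQ_Suc[OF lim_1_over_n] q] by (intro tendsto_intros) (simp add: o_def)
  ultimately have "L - ln (partition_fun \<phi>) \<le> m + 0"
    by (rule LIMSEQ_le) (use J in \<open>auto intro: less_imp_le\<close>)
  then have Jm: "dual_J \<mu> \<phi> g \<le> m" using g(2) by (simp add: dual_J_def)
  show ?thesis
  proof (rule that[OF g(1)])
    show "\<phi> 0 = 0" using LIMSEQ_unique[OF lim[of 0]] z by simp
    show "0 \<le> \<phi> x" for x by (rule LIMSEQ_le_const[OF lim]) (use nn in auto)
    fix \<psi>' f' assume "dual_pair D \<mu> \<psi>' f'"
    then have "m \<le> dual_J \<mu> \<psi>' f'" unfolding m_def by (intro cInf_lower bdd) (auto simp: V_def)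
    then show "dual_J \<mu> \<phi> g \<le> dual_J \<mu> \<psi>' f'" using Jm by simp
  qed
qed

text \<open>Legendre transforms over a set \<open>S\<close> of slopes, in a form that serves for
  potentials and, with the variables exchanged, for the truncated transform on a ball. The last
  property replaces maximisers by almost maximising slopes, as the supremum need not be
  attained.\<close>

lemma sup_affine:
  fixes g :: "'a::euclidean_space \<Rightarrow> real"
  assumes S: "S \<noteq> {}" "S \<subseteq> cball 0 D" and bd: "\<forall>x. \<forall>y\<in>S. x \<bullet> y - g y \<le> B x"
  defines "h \<equiv> \<lambda>x. SUP y\<in>S. x \<bullet> y - g y"
  shows "\<And>x y. y \<in> S \<Longrightarrow> x \<bullet> y \<le> h x + g y" "\<And>x b. (\<And>y. y \<in> S \<Longrightarrow> x \<bullet> y - g y \<le> b) \<Longrightarrow> h x \<le> b"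
    "convex_on UNIV h" "\<And>x y. \<bar>h x - h y\<bar> \<le> D * norm (x - y)"
    "\<And>x e. 0 < e \<Longrightarrow> \<exists>y\<in>S. h x < x \<bullet> y - g y + e"
proof -
  have bdd: "bdd_above ((\<lambda>y. x \<bullet> y - g y) ` S)" for x by (rule bdd_aboveI2[of _ _ "B x"]) (use bd in blast)
  have up': "x \<bullet> y - g y \<le> h x" if "y \<in> S" for x y
    unfolding h_def by (rule cSUP_upper[OF that bdd])
  show up: "x \<bullet> y \<le> h x + g y" if "y \<in> S" for x y using up'[OF that, of x] by simp
  show least: "h x \<le> b" if "\<And>y. y \<in> S \<Longrightarrow> x \<bullet> y - g y \<le> b" for x b
    unfolding h_def by (rule cSUP_least[OF S(1) that])
  show "convex_on UNIV h"
    unfolding convex_on_def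
  proof (intro conjI ballI allI impI)
    fix x y :: 'a and u v :: real assume uv: "0 \<le> u" "0 \<le> v" "u + v = 1"
    show "h (u *\<^sub>R x + v *\<^sub>R y) \<le> u * h x + v * h y"
    proof (rule least)
      fix z assume z: "z \<in> S"
      have "(u *\<^sub>R x + v *\<^sub>R y) \<bullet> z - g z = u * (x \<bullet> z - g z) + v * (y \<bullet> z - g z)"
      proof -
        have "g z = u * g z + v * g z" using uv by (simp add: distrib_right[symmetric])
        then show ?thesis by (simp only: inner_add_left inner_scaleR_left right_diff_distrib)
      qed
      also have "\<dots> \<le> u * h x + v * h y" using uv up'[OF z] by (intro add_mono mult_left_mono) auto
      finally show "(u *\<^sub>R x + v *\<^sub>R y) \<bullet> z - g z \<le> u * h x + v * h y" .
    qed
  qed auto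
  have half: "h x \<le> h y + D * norm (x - y)" for x y
  proof (rule least)
    fix z assume z: "z \<in> S"
    have "x \<bullet> z - g z = (y \<bullet> z - g z) + (x - y) \<bullet> z" by (simp add: inner_diff_left)
    moreover have "(x - y) \<bullet> z \<le> norm (x - y) * norm z" by (rule norm_cauchy_schwarz)
    moreover have "norm (x - y) * norm z \<le> norm (x - y) * D" using S(2) z by (intro mult_left_mono) auto
    ultimately show "x \<bullet> z - g z \<le> h y + D * norm (x - y)" using up'[OF z, of y] by (simp add: mult.commute)
  qed
  show "\<bar>h x - h y\<bar> \<le> D * norm (x - y)" for x y
    using half[of x y] half[of y x] by (simp add: norm_minus_commute abs_le_iff)
  fix x and e :: real assume e: "0 < e"
  show "\<exists>y\<in>S. h x < x \<bullet> y - g y + e"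
  proof (rule ccontr)
    assume "\<not> ?thesis"
    then have "h x \<le> h x - e" by (intro least) (force simp: not_less)
    then show False using e by simp
  qed
qed

section \<open>Subgradients of convex Lipschitz functions\<close>

definition subgradient :: "('a::euclidean_space \<Rightarrow> real) \<Rightarrow> 'a \<Rightarrow> 'a \<Rightarrow> bool" where
  "subgradient \<phi> x y \<longleftrightarrow> (\<forall>z. \<phi> x + (z - x) \<bullet> y \<le> \<phi> z)"

lemma integrable_exp_norm1: "integrable lborel (\<lambda>x::'a::euclidean_space. exp (- norm x))"
  using integrable_exp_norm[of 1, where 'a='a] by simp

text \<open>Integrated against \<open>exp (- |x|)\<close>, the second difference quotient tends to zero because the difference can be moved onto the weight by translation.\<close>

lemma AE_liminf_second_difference:
  fixes \<phi> :: "'a::euclidean_space \<Rightarrow> real"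
  assumes lip: "\<And>x y. \<bar>\<phi> x - \<phi> y\<bar> \<le> D * norm (x - y)" and e: "norm e = 1"
    and sg: "\<And>x h. 0 < h \<Longrightarrow> \<phi> x - \<phi> (x - h *\<^sub>R e) \<le> \<phi> (x + h *\<^sub>R e) - \<phi> x"
  defines "t \<equiv> \<lambda>n. 1 / real (Suc n)"
  shows "AE x in lborel. liminf (\<lambda>n. ennreal ((\<phi> (x + t n *\<^sub>R e) - \<phi> x) / t n - (\<phi> x - \<phi> (x - t n *\<^sub>R e)) / t n)) = 0"
proof -
  have [measurable]: "\<phi> \<in> borel_measurable borel" by (intro borel_measurable_continuous_onI lipschitz_continuous[OF lip])
  have t: "0 < t n" for n by (simp add: t_def)
  define u where "u n x = (\<phi> (x + t n *\<^sub>R e) - \<phi> x) / t n" for n x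
  define w where "w n x = (\<phi> x - \<phi> (x - t n *\<^sub>R e)) / t n" for n x
  have [measurable]: "u n \<in> borel_measurable borel" "w n \<in> borel_measurable borel" for n
    unfolding u_def w_def by measurable
  have ub: "\<bar>u n x\<bar> \<le> D" for n x
    using lip[of "x + t n *\<^sub>R e" x] t[of n] e by (simp add: u_def abs_divide divide_le_eq)
  have wu: "w n x = u n (x + (- (t n *\<^sub>R e)))" for n x by (simp add: u_def w_def)
  have wle: "w n x \<le> u n x" for n x using sg[OF t[of n], of x] t[of n] by (simp add: u_def w_def divide_right_mono)
  define k where "k x = exp (- norm x)" for x :: 'a
  have [measurable]: "k \<in> borel_measurable borel" by (simp add: k_def[abs_def])
  have ik: "integrable lborel k" using integrable_exp_norm1 by (simp add: k_def[abs_def])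
  have D0: "0 \<le> D" using ub[of 0 0] by linarith
  have iu: "integrable lborel (\<lambda>x. u n x * k x)" for n
    by (rule Bochner_Integration.integrable_bound[OF integrable_mult_right[OF ik, of D]])
       (use ub D0 in \<open>auto simp: abs_mult k_def intro!: mult_right_mono\<close>)
  have iw: "integrable lborel (\<lambda>x. w n x * k x)" for n
    by (rule Bochner_Integration.integrable_bound[OF integrable_mult_right[OF ik, of D]])
       (use ub D0 wu in \<open>auto simp: abs_mult k_def intro!: mult_right_mono\<close>)
  have k0: "0 \<le> k x" for x by (simp add: k_def)
  \<comment> \<open>Moving by distance \<open>t n\<close> changes the weight
    \<open>exp (- norm x)\<close> by a factor between \<open>exp (- t n)\<close> and
    \<open>exp (t n)\<close>.\<close>
  have kt: "\<bar>k x - k (x + t n *\<^sub>R e)\<bar> \<le> (exp (t n) - 1) * k x" for x n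
  proof -
    define y where "y = x + t n *\<^sub>R e"
    have n: "\<bar>norm x - norm y\<bar> \<le> t n" using norm_triangle_ineq3[of x y] t[of n] e by (simp add: y_def)
    have "k y \<le> exp (t n) * k x" unfolding k_def exp_add[symmetric] using n by simp
    moreover have "exp (- t n) * k x \<le> k y" unfolding k_def exp_add[symmetric] using n by simp
    moreover have "1 - exp (- t n) \<le> exp (t n) - 1"
    proof -
      have "2 \<le> exp (t n) + exp (- t n)"
        using exp_ge_add_one_self[of "t n"] exp_ge_add_one_self[of "- t n"] by linarith
      then show ?thesis by simp
    qed
    moreover from this have "(1 - exp (- t n)) * k x \<le> (exp (t n) - 1) * k x" by (intro mult_right_mono) (auto simp: k_def)
    ultimately show ?thesis by (simp add: y_def[symmetric] abs_le_iff left_diff_distrib)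
  qed
  define \<nu> where "\<nu> = density lborel (\<lambda>x. ennreal (k x))"
  have [measurable_cong]: "sets \<nu> = sets borel" by (simp add: \<nu>_def)
  define \<delta> where "\<delta> n x = ennreal (u n x - w n x)" for n x
  have [measurable]: "\<delta> n \<in> borel_measurable borel" for n by (simp add: \<delta>_def[abs_def])
  have bound: "(\<integral>\<^sup>+x. \<delta> n x \<partial>\<nu>) \<le> ennreal (D * (exp (t n) - 1) * (\<integral>x. k x \<partial>lborel))" for n
  proof -
    have "(\<integral>\<^sup>+x. \<delta> n x \<partial>\<nu>) = (\<integral>\<^sup>+x. ennreal (u n x * k x - w n x * k x) \<partial>lborel)"
    proof -
      have "(\<integral>\<^sup>+x. \<delta> n x \<partial>\<nu>) = (\<integral>\<^sup>+x. ennreal (k x) * \<delta> n x \<partial>lborel)"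
        unfolding \<nu>_def by (rule nn_integral_density) auto
      also have "\<dots> = (\<integral>\<^sup>+x. ennreal (u n x * k x - w n x * k x) \<partial>lborel)"
        using wle[of n] by (intro nn_integral_cong) (simp add: \<delta>_def ennreal_mult[symmetric] k_def algebra_simps)
      finally show ?thesis .
    qed
    also have "\<dots> = ennreal (\<integral>x. u n x * k x - w n x * k x \<partial>lborel)"
      using iu iw wle[of n] by (intro nn_integral_eq_integral) (auto simp: k_def)
    also have "(\<integral>x. u n x * k x - w n x * k x \<partial>lborel) = (\<integral>x. u n x * k x \<partial>lborel) - (\<integral>x. w n x * k x \<partial>lborel)"
      using iu iw by simp
    also have "(\<integral>x. w n x * k x \<partial>lborel) = (\<integral>x. u n x * k (x + t n *\<^sub>R e) \<partial>lborel)"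
      unfolding wu using integral_lborel_translate[of "\<lambda>x. u n x * k (x + t n *\<^sub>R e)" "- (t n *\<^sub>R e)"] by simp
    also have "(\<integral>x. u n x * k x \<partial>lborel) - (\<integral>x. u n x * k (x + t n *\<^sub>R e) \<partial>lborel) = (\<integral>x. u n x * (k x - k (x + t n *\<^sub>R e)) \<partial>lborel)"
    proof -
      have "integrable lborel (\<lambda>x. u n x * k (x + t n *\<^sub>R e))"
      proof (rule Bochner_Integration.integrable_bound[OF integrable_mult_right[OF ik, of "D * exp (t n)"]])
        show "AE x in lborel. norm (u n x * k (x + t n *\<^sub>R e)) \<le> norm (D * exp (t n) * k x)"
        proof (intro AE_I2)
          fix x
          have "\<bar>k (x + t n *\<^sub>R e)\<bar> \<le> exp (t n) * k x"
            using kt[of x n] k0[of "x + t n *\<^sub>R e"] unfolding left_diff_distrib by linarith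
          then have "\<bar>u n x\<bar> * \<bar>k (x + t n *\<^sub>R e)\<bar> \<le> D * (exp (t n) * k x)" using ub[of n x] D0 by (intro mult_mono) auto
          then show "norm (u n x * k (x + t n *\<^sub>R e)) \<le> norm (D * exp (t n) * k x)"
            using D0 by (simp add: abs_mult mult.assoc) (simp add: k_def)
        qed
      qed measurable
      then show ?thesis using iu[of n] by (simp add: right_diff_distrib)
    qed
    also have "\<dots> \<le> (\<integral>x. D * (exp (t n) - 1) * k x \<partial>lborel)"
    proof (rule integral_mono_AE')
      show "integrable lborel (\<lambda>x. D * (exp (t n) - 1) * k x)" using ik by simp
      show "AE x in lborel. u n x * (k x - k (x + t n *\<^sub>R e)) \<le> D * (exp (t n) - 1) * k x"
      proof (intro AE_I2)
        fix x
        have "u n x * (k x - k (x + t n *\<^sub>R e)) \<le> \<bar>u n x\<bar> * \<bar>k x - k (x + t n *\<^sub>R e)\<bar>" by (metis abs_ge_self abs_mult)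
        also have "\<dots> \<le> D * ((exp (t n) - 1) * k x)" using ub kt D0 by (intro mult_mono) auto
        finally show "u n x * (k x - k (x + t n *\<^sub>R e)) \<le> D * (exp (t n) - 1) * k x" by (simp add: mult.assoc)
      qed
      show "AE x in lborel. 0 \<le> D * (exp (t n) - 1) * k x" using D0 t[of n] by (auto simp: k_def)
    qed
    finally show ?thesis using ik by (simp add: ennreal_leI)
  qed
  have "(\<integral>\<^sup>+x. liminf (\<lambda>n. \<delta> n x) \<partial>\<nu>) \<le> liminf (\<lambda>n. \<integral>\<^sup>+x. \<delta> n x \<partial>\<nu>)"
    by (rule nn_integral_liminf) simp
  also have "\<dots> \<le> liminf (\<lambda>n. ennreal (D * (exp (t n) - 1) * (\<integral>x. k x \<partial>lborel)))"
    by (intro Liminf_mono always_eventually allI bound)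
  also have "\<dots> = ennreal (D * (exp 0 - 1) * (\<integral>x. k x \<partial>lborel))"
    unfolding t_def by (intro lim_imp_Liminf tendsto_ennrealI tendsto_intros LIMSEQ_Suc[OF lim_1_over_n]) auto
  finally have "(\<integral>\<^sup>+x. liminf (\<lambda>n. \<delta> n x) \<partial>\<nu>) = 0" by simp
  then have "AE x in \<nu>. liminf (\<lambda>n. \<delta> n x) = 0"
    using nn_integral_0_iff_AE[of "\<lambda>x. liminf (\<lambda>n. \<delta> n x)" \<nu>] by simp
  then show ?thesis
    unfolding \<nu>_def by (subst (asm) AE_density) (auto simp: k_def \<delta>_def u_def w_def)
qed

text \<open>The coordinates of any subgradient lie between backward and forward difference
  quotients. Where the second differences have lower limit zero, each coordinate must be the infimum
  of the forward quotients along the steps \<open>t n\<close>; this countable infimum is also a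
  measurable choice.\<close>

lemma AE_unique_subgradient:
  fixes \<phi> :: "'a::euclidean_space \<Rightarrow> real"
  assumes conv: "convex_on UNIV \<phi>" and lip: "\<And>x y. \<bar>\<phi> x - \<phi> y\<bar> \<le> D * norm (x - y)"
  obtains G where "G \<in> borel_measurable borel" "AE x in lborel. \<forall>y. subgradient \<phi> x y \<longrightarrow> y = G x"
proof -
  have [measurable]: "\<phi> \<in> borel_measurable borel" by (intro borel_measurable_continuous_onI lipschitz_continuous[OF lip])
  define t where "t n = 1 / real (Suc n)" for n
  have t: "0 < t n" for n by (simp add: t_def)
  define u where "u n x e = (\<phi> (x + t n *\<^sub>R e) - \<phi> x) / t n" for n x e
  define w where "w n x e = (\<phi> x - \<phi> (x - t n *\<^sub>R e)) / t n" for n x e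
  have mid: "\<phi> x - \<phi> (x - h *\<^sub>R e) \<le> \<phi> (x + h *\<^sub>R e) - \<phi> x" for x e h
  proof -
    have "\<phi> ((1/2) *\<^sub>R (x - h *\<^sub>R e) + (1/2) *\<^sub>R (x + h *\<^sub>R e)) \<le> 1/2 * \<phi> (x - h *\<^sub>R e) + 1/2 * \<phi> (x + h *\<^sub>R e)"
      using convex_onD[OF conv, of "1/2" "x - h *\<^sub>R e" "x + h *\<^sub>R e"] by simp
    moreover have "(1/2) *\<^sub>R (x - h *\<^sub>R e) + (1/2) *\<^sub>R (x + h *\<^sub>R e) = x"
      by (simp add: scaleR_right_distrib[symmetric])
    ultimately show ?thesis by simp
  qed
  have ae: "AE x in lborel. \<forall>e\<in>Basis. liminf (\<lambda>n. ennreal (u n x e - w n x e)) = 0"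
    unfolding u_def w_def t_def
    by (subst AE_ball_countable[OF countable_finite[OF finite_Basis]], rule ballI, rule AE_liminf_second_difference[OF lip _ mid]) simp
  define G where "G x = (\<Sum>e\<in>Basis. (INF n. u n x e) *\<^sub>R e)" for x
  have lower: "- (\<bar>D\<bar> * norm e) \<le> u n x e" for n x e
  proof -
    have "\<bar>\<phi> (x + t n *\<^sub>R e) - \<phi> x\<bar> \<le> D * norm (t n *\<^sub>R e)" using lip[of "x + t n *\<^sub>R e" x] by simp
    also have "\<dots> \<le> \<bar>D\<bar> * norm (t n *\<^sub>R e)" by (intro mult_right_mono) auto
    finally have "- (\<bar>D\<bar> * norm e * t n) \<le> \<phi> (x + t n *\<^sub>R e) - \<phi> x" using t[of n] by (simp add: abs_le_iff algebra_simps)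
    then show ?thesis using t[of n] by (simp add: u_def le_divide_eq)
  qed
  have bdd: "bdd_below (range (\<lambda>n. u n x e))" for x e using lower by (intro bdd_belowI2)
  have "G \<in> borel_measurable borel"
    unfolding G_def[abs_def] u_def
    by (intro borel_measurable_sum borel_measurable_scaleR borel_measurable_cINF) (use bdd in \<open>auto simp: u_def\<close>)
  moreover have "AE x in lborel. \<forall>y. subgradient \<phi> x y \<longrightarrow> y = G x"
    using ae
  proof eventually_elim
    case (elim x)
    show ?case
    proof (intro allI impI)
      fix y assume y: "subgradient \<phi> x y"
      have "y \<bullet> e = (INF n. u n x e)" if e: "e \<in> Basis" for e
      proof (rule antisym)
        have yu: "y \<bullet> e \<le> u n x e" for n
        proof -
          have "\<phi> x + (x + t n *\<^sub>R e - x) \<bullet> y \<le> \<phi> (x + t n *\<^sub>R e)" using y unfolding subgradient_def by blast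
          then show ?thesis using t[of n] by (simp add: u_def le_divide_eq inner_commute algebra_simps)
        qed
        have wy: "w n x e \<le> y \<bullet> e" for n
        proof -
          have "\<phi> x + (x - t n *\<^sub>R e - x) \<bullet> y \<le> \<phi> (x - t n *\<^sub>R e)" using y unfolding subgradient_def by blast
          then show ?thesis using t[of n] by (simp add: w_def divide_le_eq inner_commute algebra_simps)
        qed
        show "y \<bullet> e \<le> (INF n. u n x e)" by (rule cINF_greatest) (use yu in auto)
        have "ennreal ((INF n. u n x e) - y \<bullet> e) \<le> liminf (\<lambda>n. ennreal (u n x e - w n x e))"
        proof (intro Liminf_bounded always_eventually allI ennreal_leI)
          fix n
          have "(INF n. u n x e) \<le> u n x e" by (rule cINF_lower[OF bdd]) simp
          then show "(INF n. u n x e) - y \<bullet> e \<le> u n x e - w n x e" using wy[of n] by simp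
        qed
        then show "(INF n. u n x e) \<le> y \<bullet> e" using elim e by (simp add: ennreal_eq_0_iff)
      qed
      then show "y = G x"
        unfolding G_def by (subst euclidean_representation[symmetric]) (auto intro: sum.cong)
    qed
  qed
  ultimately show ?thesis using that by blast
qed

text \<open>Limits of approximate subgradients with vanishing error are subgradients. Bounded slopes
  have convergent subsequences, so uniqueness forces the whole sequence to the only candidate, which
  is thereby shown to be a subgradient.\<close>

lemma approx_subgradient_tendsto:
  fixes \<phi> :: "'a::euclidean_space \<Rightarrow> real"
  assumes uniq: "\<And>y. subgradient \<phi> x y \<Longrightarrow> y = g" and bd: "\<And>n. norm (y n) \<le> D"
    and ap: "\<And>n z. \<phi> x + (z - x) \<bullet> y n - \<epsilon> n \<le> \<phi> z" and \<epsilon>: "\<epsilon> \<longlonglongrightarrow> 0"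
  shows "y \<longlonglongrightarrow> g" "subgradient \<phi> x g"
proof -
  have sub: "\<exists>s. strict_mono s \<and> (\<lambda>n. y (r (s n))) \<longlonglongrightarrow> g \<and> subgradient \<phi> x g" if r: "strict_mono r" for r :: "nat \<Rightarrow> nat"
  proof -
    have "bounded (range (\<lambda>n. y (r n)))" using bd by (auto intro!: boundedI[of _ D])
    then obtain l s where s: "strict_mono s" "((\<lambda>n. y (r n)) \<circ> s) \<longlonglongrightarrow> l"
      using bounded_imp_convergent_subsequence by blast
    have \<epsilon>': "(\<lambda>n. \<epsilon> (r (s n))) \<longlonglongrightarrow> 0"
      using LIMSEQ_subseq_LIMSEQ[OF \<epsilon> strict_mono_o[OF r s(1)]] by (simp add: o_def)
    have "subgradient \<phi> x l"
      unfolding subgradient_def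
    proof
      fix z
      have "(\<lambda>n. \<phi> x + (z - x) \<bullet> y (r (s n)) - \<epsilon> (r (s n))) \<longlonglongrightarrow> \<phi> x + (z - x) \<bullet> l - 0"
        using s(2) by (intro tendsto_intros \<epsilon>') (simp add: o_def)
      from LIMSEQ_le_const2[OF this, of "\<phi> z"] show "\<phi> x + (z - x) \<bullet> l \<le> \<phi> z" using ap by simp
    qed
    then show ?thesis using uniq s by (auto simp: o_def)
  qed
  show "subgradient \<phi> x g" using sub[OF strict_mono_id] by blast
  show "y \<longlonglongrightarrow> g"
  proof (rule ccontr)
    assume "\<not> y \<longlonglongrightarrow> g"
    then obtain e where e: "e > 0" "\<forall>N. \<exists>n\<ge>N. e \<le> dist (y n) g" by (auto simp: lim_sequentially not_less)
    have inf: "infinite {n. e \<le> dist (y n) g}" using e(2) by (simp add: infinite_nat_iff_unbounded_le)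
    obtain r :: "nat \<Rightarrow> nat" where r: "strict_mono r" "\<forall>n. r n \<in> {n. e \<le> dist (y n) g}"
      using infinite_enumerate[OF inf] by blast
    obtain s where s: "(\<lambda>n. y (r (s n))) \<longlonglongrightarrow> g" using sub[OF r(1)] by blast
    then have "\<forall>\<^sub>F n in sequentially. dist (y (r (s n))) g < e" using e(1) by (rule tendstoD)
    then obtain n where "dist (y (r (s n))) g < e" by (auto simp: eventually_sequentially)
    then show False using spec[OF r(2), of "s n"] by simp
  qed
qed

section \<open>Kantorovich duality for absolutely continuous measures\<close>

text \<open>Closed sets form an intersection-stable generator, and the continuous tents
  \<open>max 0 (1 - n * infdist x C)\<close>, with values between zero and one, converge to the
  indicator of a closed set \<open>C\<close>.\<close>

lemma measure_eqI_bounded_continuous: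
  fixes M N :: "'a::euclidean_space measure"
  assumes s: "sets M = sets borel" "sets N = sets borel" and p: "prob_space M" "prob_space N"
    and eq: "\<And>k :: 'a \<Rightarrow> real. continuous_on UNIV k \<Longrightarrow> (\<And>x. \<bar>k x\<bar> \<le> 1) \<Longrightarrow> (\<integral>x. k x \<partial>M) = (\<integral>x. k x \<partial>N)"
  shows "M = N"
proof -
  interpret M: prob_space M by fact
  interpret N: prob_space N by fact
  have cl: "emeasure M C = emeasure N C" if C: "closed C" "C \<noteq> {}" for C :: "'a set"
  proof -
    define k where "k n x = max 0 (1 - real n * infdist x C)" for n x
    have kc: "continuous_on UNIV (k n)" for n unfolding k_def by (intro continuous_intros)
    have kb: "\<bar>k n x\<bar> \<le> 1" for n x using infdist_nonneg[of x C] by (auto simp: k_def)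
    have [measurable]: "k n \<in> borel_measurable borel" for n by (rule borel_measurable_continuous_onI[OF kc])
    have lim: "(\<lambda>n. k n x) \<longlonglongrightarrow> indicator C x" for x
    proof (cases "x \<in> C")
      case True then show ?thesis by (simp add: k_def)
    next
      case False
      then have pos: "0 < infdist x C" using C by (metis in_closed_iff_infdist_zero infdist_nonneg less_le)
      obtain N where N: "1 / infdist x C < real N" using reals_Archimedean2 by blast
      have "k n x = 0" if "n \<ge> N" for n
      proof -
        have "1 / infdist x C < real n" using N that by linarith
        then show ?thesis using pos by (simp add: k_def field_simps)
      qed
      then have "eventually (\<lambda>n. k n x = indicator C x) sequentially" using False by (auto simp: eventually_sequentially)
      then show ?thesis by (rule tendsto_eventually)
    qed
    have conv: "(\<lambda>n. \<integral>x. k n x \<partial>L) \<longlonglongrightarrow> measure L C" if "prob_space L" "sets L = sets borel" for L :: "'a measure"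
    proof -
      interpret L: prob_space L by fact
      note [measurable_cong] = that(2)
      have [measurable]: "C \<in> sets borel" using C(1) by simp
      have "(\<lambda>n. \<integral>x. k n x \<partial>L) \<longlonglongrightarrow> (\<integral>x. indicator C x \<partial>L)"
      proof (rule integral_dominated_convergence[where w="\<lambda>_. 1"])
        show "(indicator C :: 'a \<Rightarrow> real) \<in> borel_measurable L" by measurable
        show "k n \<in> borel_measurable L" for n by measurable
        show "AE x in L. (\<lambda>n. k n x) \<longlonglongrightarrow> indicator C x" using lim by simp
        show "AE x in L. norm (k n x) \<le> 1" for n using kb by simp
      qed auto
      then show ?thesis using C(1) that(2) by simp
    qed
    have "measure M C = measure N C"
      using LIMSEQ_unique[OF conv[OF p(1) s(1)]] conv[OF p(2) s(2)] eq[OF kc kb] by simp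
    then show ?thesis by (simp add: M.emeasure_eq_measure N.emeasure_eq_measure)
  qed
  show ?thesis
  proof (rule measure_eqI_generator_eq[where E="Collect closed" and \<Omega>=UNIV and A="\<lambda>_. UNIV"])
    show "Int_stable (Collect (closed :: 'a set \<Rightarrow> bool))" by (auto simp: Int_stable_def)
    show "emeasure M X = emeasure N X" if "X \<in> Collect closed" for X
      using cl[of X] that by (cases "X = {}") auto
    show "sets M = sigma_sets UNIV (Collect closed)" "sets N = sigma_sets UNIV (Collect closed)"
      using s by (simp_all add: borel_eq_closed)
    show "emeasure M UNIV \<noteq> \<infinity>" using M.emeasure_finite by simp
  qed auto
qed

text \<open>A minimiser \<open>\<phi>\<close> of the dual functional is perturbed along bounded continuous functions of \<open>y\<close>; the first order condition says that the subgradient map of \<open>\<phi>\<close> pushes \<open>\<sigma>\<close> to \<open>\<mu>\<close>.\<close>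

theorem kantorovich_duality:
  fixes \<mu> \<sigma> :: "'a::euclidean_space measure"
  assumes th: "th > 0" and cen: "centered D th \<mu>" and \<sigma>: "\<sigma> \<in> prob_1" and ac: "absolutely_continuous lborel \<sigma>"
  obtains \<phi> g where "dual_pair D \<mu> \<phi> g" "integrable \<sigma> \<phi>" "ereal ((\<integral>x. \<phi> x \<partial>\<sigma>) + (\<integral>y. g y \<partial>\<mu>)) \<le> transport_T \<sigma> \<mu>"
proof -
  note c = centeredD[OF cen]
  note [measurable_cong] = c(1)
  interpret \<mu>: prob_space \<mu> by (rule c)
  have s\<sigma>[measurable_cong]: "sets \<sigma> = sets borel" and p\<sigma>: "prob_space \<sigma>" and n\<sigma>: "integrable \<sigma> norm"
    using \<sigma> by (auto simp: prob_1_def prob_measures_def)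
  interpret \<sigma>: prob_space \<sigma> by fact
  have D: "0 < D" by (rule centered_D_pos[OF cen th])
  have i\<sigma>: "integrable \<sigma> \<phi>" if "\<And>x y. \<bar>\<phi> x - \<phi> y\<bar> \<le> D * norm (x - y)" for \<phi> :: "'a \<Rightarrow> real"
  proof (rule Bochner_Integration.integrable_bound[of _ "\<lambda>x. \<bar>\<phi> 0\<bar> + D * norm x"])
    show "integrable \<sigma> (\<lambda>x. \<bar>\<phi> 0\<bar> + D * norm x)" using n\<sigma> by auto
    have [measurable]: "\<phi> \<in> borel_measurable borel" by (intro borel_measurable_continuous_onI lipschitz_continuous[OF that])
    show "\<phi> \<in> borel_measurable \<sigma>" by measurable
    have "\<bar>\<phi> x\<bar> \<le> \<bar>\<phi> 0\<bar> + D * norm x" for x using that[of x 0] by simp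
    then show "AE x in \<sigma>. norm (\<phi> x) \<le> norm (\<bar>\<phi> 0\<bar> + D * norm x)" using D by (intro AE_I2) (auto intro: order_trans[OF _ abs_ge_self])
  qed
  \<comment> \<open>The dual functional of optimal transport between the two fixed measures. The
    normalisation in \<open>V\<close> fixes only the additive constant: \<open>mle\<close> extends
    the bound to all dual pairs.\<close>
  define K where "K \<phi> f = (\<integral>x. \<phi> x \<partial>\<sigma>) + (\<integral>y. f y \<partial>\<mu>)" for \<phi> f :: "'a \<Rightarrow> real"
  define V where "V = {K \<phi> f |\<phi> f. dual_pair D \<mu> \<phi> f \<and> \<phi> 0 = 0}"
  define B where "B = D * (\<integral>x. norm x \<partial>\<sigma>)"
  have ne: "V \<noteq> {}" using dual_pair_cone[OF cen] D by (auto simp: V_def)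
  have phiB: "\<bar>\<integral>x. \<phi> x \<partial>\<sigma>\<bar> \<le> B" if dp: "dual_pair D \<mu> \<phi> f" "\<phi> 0 = 0" for \<phi> f
  proof -
    have "\<bar>\<integral>x. \<phi> x \<partial>\<sigma>\<bar> \<le> (\<integral>x. D * norm x \<partial>\<sigma>)"
      using dual_pairD(2)[OF dp(1), of _ 0] dp(2) n\<sigma> i\<sigma>[OF dual_pairD(2)[OF dp(1)]]
      by (intro order_trans[OF integral_abs_bound] integral_mono) auto
    then show ?thesis by (simp add: B_def)
  qed
  have fnn: "0 \<le> (\<integral>y. f y \<partial>\<mu>)" if dp: "dual_pair D \<mu> \<phi> f" "\<phi> 0 = 0" for \<phi> f
    using dual_pair_lower[OF cen dp(1) order_refl] dp(2) by simp
  have lb: "- B \<le> v" if "v \<in> V" for v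
    using that phiB fnn unfolding V_def K_def by (force simp: abs_le_iff)
  have bdd: "bdd_below V" by (rule bdd_belowI[OF lb])
  define m where "m = Inf V"
  have mle: "m \<le> K \<phi> f" if dp: "dual_pair D \<mu> \<phi> f" for \<phi> f
  proof -
    have "dual_pair D \<mu> (\<lambda>x. \<phi> (x + 0) + (- \<phi> 0)) (\<lambda>y. f y - y \<bullet> 0 - (- \<phi> 0))" by (rule dual_pair_translate[OF cen dp])
    then have dp': "dual_pair D \<mu> (\<lambda>x. \<phi> x - \<phi> 0) (\<lambda>y. f y + \<phi> 0)" by simp
    have "m \<le> K (\<lambda>x. \<phi> x - \<phi> 0) (\<lambda>y. f y + \<phi> 0)"
      unfolding m_def by (rule cInf_lower[OF _ bdd], unfold V_def mem_Collect_eq, rule exI, rule exI, rule conjI[OF refl]) (use dp' in simp)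
    also have "\<dots> = K \<phi> f"
      using i\<sigma>[OF dual_pairD(2)[OF dp]] dual_pairD(3)[OF dp] by (simp add: K_def \<sigma>.prob_space \<mu>.prob_space)
    finally show ?thesis .
  qed
  have "\<exists>\<phi> f. dual_pair D \<mu> \<phi> f \<and> \<phi> 0 = 0 \<and> K \<phi> f < m + 1 / real (Suc n)" for n
  proof -
    have "\<exists>v\<in>V. v < m + 1 / real (Suc n)" unfolding m_def by (subst cInf_less_iff[OF ne bdd, symmetric]) auto
    then show ?thesis unfolding V_def by blast
  qed
  then obtain \<psi> f where dp: "\<And>n. dual_pair D \<mu> (\<psi> n) (f n)" and z: "\<And>n. \<psi> n 0 = 0"
    and Kn: "\<And>n. K (\<psi> n) (f n) < m + 1 / real (Suc n)" by metis
  have Klim: "(\<lambda>n. K (\<psi> n) (f n)) \<longlonglongrightarrow> m"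
  proof (rule tendsto_sandwich[of "\<lambda>_. m" _ _ "\<lambda>n. m + 1 / real (Suc n)"])
    show "(\<lambda>n. m + 1 / real (Suc n)) \<longlonglongrightarrow> m" using tendsto_add[OF tendsto_const[of m] LIMSEQ_Suc[OF lim_1_over_n]] by simp
  qed (use Kn mle[OF dp] in \<open>auto intro!: always_eventually less_imp_le\<close>)
  obtain r \<phi> where r: "strict_mono (r :: nat \<Rightarrow> nat)" and lim: "\<And>x. (\<lambda>n. \<psi> (r n) x) \<longlonglongrightarrow> \<phi> x"
    using lipschitz_pointwise_subseq[of \<psi> D] dual_pairD(2)[OF dp] z by blast
  have \<phi>lip: "\<bar>\<phi> x - \<phi> y\<bar> \<le> D * norm (x - y)" for x y
    by (rule LIMSEQ_le_const2[OF tendsto_rabs[OF tendsto_diff[OF lim lim]]]) (use dual_pairD(2)[OF dp] in auto)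
  have [measurable]: "\<phi> \<in> borel_measurable borel" by (intro borel_measurable_continuous_onI lipschitz_continuous[OF \<phi>lip])
  have \<psi>lim: "(\<lambda>n. \<integral>x. \<psi> (r n) x \<partial>\<sigma>) \<longlonglongrightarrow> (\<integral>x. \<phi> x \<partial>\<sigma>)"
  proof (rule integral_dominated_convergence[where w="\<lambda>x. D * norm x"])
    show "\<phi> \<in> borel_measurable \<sigma>" by measurable
    show "\<psi> (r n) \<in> borel_measurable \<sigma>" for n using i\<sigma>[OF dual_pairD(2)[OF dp]] by auto
    show "integrable \<sigma> (\<lambda>x. D * norm x)" using n\<sigma> by auto
    show "AE x in \<sigma>. (\<lambda>n. \<psi> (r n) x) \<longlonglongrightarrow> \<phi> x" using lim by simp
    show "AE x in \<sigma>. norm (\<psi> (r n) x) \<le> D * norm x" for n using dual_pairD(2)[OF dp, of "r n" _ 0] z by simp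
  qed
  have flim: "(\<lambda>n. \<integral>y. f (r n) y \<partial>\<mu>) \<longlonglongrightarrow> m - (\<integral>x. \<phi> x \<partial>\<sigma>)"
    using tendsto_diff[OF LIMSEQ_subseq_LIMSEQ[OF Klim r] \<psi>lim] by (simp add: o_def K_def)
  obtain F where F: "dual_pair D \<mu> \<phi> F" "(\<integral>y. F y \<partial>\<mu>) \<le> m - (\<integral>x. \<phi> x \<partial>\<sigma>)"
    using dual_pair_limit[OF c(1) dp z lim flim] by blast
  \<comment> \<open>A set of full measure on which the almost sure constraints hold for every point;
    from here on it is the set of admissible slopes.\<close>
  define S where "S = {y. norm y \<le> D \<and> (\<forall>x. x \<bullet> y \<le> \<phi> x + F y)}"
  have AES: "AE y in \<mu>. y \<in> S" using c(3) dual_pairD(4)[OF F(1)] by eventually_elim (simp add: S_def)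
  have "S \<noteq> {}"
  proof
    assume "S = {}"
    then have "AE y in \<mu>. False" using AES by simp
    then show False using \<mu>.AE_False by blast
  qed
  moreover have "S \<subseteq> cball 0 D" by (auto simp: S_def)
  ultimately have S: "S \<noteq> {}" "S \<subseteq> cball 0 D" by blast+
  \<comment> \<open>Replacing \<open>\<phi>\<close> by the transform of \<open>F\<close> over
    \<open>S\<close> can only lower the first integral and keeps the constraint, so the pair stays
    optimal. In return, each value of \<open>\<phi>0\<close> is nearly attained by a slope in
    \<open>S\<close>.\<close>
  define \<phi>0 where "\<phi>0 x = (SUP y\<in>S. x \<bullet> y - F y)" for x
  have bd0: "x \<bullet> y - F y \<le> \<phi> x" if "y \<in> S" for x y
  proof -
    have "x \<bullet> y \<le> \<phi> x + F y" using that by (auto simp: S_def)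
    then show ?thesis by simp
  qed
  have bd0': "\<forall>x. \<forall>y\<in>S. x \<bullet> y - F y \<le> \<phi> x" using bd0 by blast
  note sup0 = sup_affine[OF S bd0', folded \<phi>0_def]
  have dp0: "dual_pair D \<mu> \<phi>0 F"
    unfolding dual_pair_def using sup0(3,4) dual_pairD(3)[OF F(1)] AES by (auto elim!: eventually_mono intro: sup0(1))
  have [measurable]: "\<phi>0 \<in> borel_measurable borel" by (rule dual_pairD(6)[OF dp0])
  have K0: "K \<phi>0 F \<le> m"
  proof -
    have "\<phi>0 x \<le> \<phi> x" for x by (rule sup0(2)) (rule bd0)
    then have "(\<integral>x. \<phi>0 x \<partial>\<sigma>) \<le> (\<integral>x. \<phi> x \<partial>\<sigma>)"
      by (intro integral_mono i\<sigma> sup0(4) \<phi>lip)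
    then show ?thesis using F(2) by (simp add: K_def)
  qed
  obtain G where G[measurable]: "G \<in> borel_measurable borel" and Gae: "AE x in lborel. \<forall>y. subgradient \<phi>0 x y \<longrightarrow> y = G x"
    using AE_unique_subgradient[OF sup0(3,4)] by blast
  have G\<sigma>: "AE x in \<sigma>. \<forall>y. subgradient \<phi>0 x y \<longrightarrow> y = G x"
    using absolutely_continuous_AE[OF _ ac Gae] s\<sigma> by simp
  have Gsub: "AE x in \<sigma>. subgradient \<phi>0 x (G x)"
    using G\<sigma>
  proof eventually_elim
    case (elim x)
    have "\<exists>y\<in>S. \<phi>0 x < x \<bullet> y - F y + 1 / real (Suc n)" for n by (rule sup0(5)) simp
    then obtain y where y: "\<And>n. y n \<in> S" "\<And>n. \<phi>0 x < x \<bullet> y n - F (y n) + 1 / real (Suc n)" by metis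
    show ?case
    proof (rule approx_subgradient_tendsto(2)[of \<phi>0 x "G x" y D "\<lambda>n. 1 / real (Suc n)"])
      show "norm (y n) \<le> D" for n using y(1)[of n] by (simp add: S_def)
      show "\<phi>0 x + (z - x) \<bullet> y n - 1 / real (Suc n) \<le> \<phi>0 z" for n z
        using y(2)[of n] sup0(1)[OF y(1)[of n], of z] by (simp add: inner_diff_left)
    qed (use elim LIMSEQ_Suc[OF lim_1_over_n] in auto)
  qed
  \<comment> \<open>One inequality per test function suffices, since it can be applied to
    \<open>- k\<close> too. Optimality bounds the integral of the quotient \<open>d n\<close> by
    that of \<open>k\<close>, and the lower limit of \<open>d n\<close> is at least
    \<open>k (G x)\<close>.\<close>
  have le: "(\<integral>x. k (G x) \<partial>\<sigma>) \<le> (\<integral>y. k y \<partial>\<mu>)" if kc: "continuous_on UNIV k" and kb: "\<And>y. \<bar>k y\<bar> \<le> 1" for k :: "'a \<Rightarrow> real"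
  proof -
    have [measurable]: "k \<in> borel_measurable borel" by (rule borel_measurable_continuous_onI[OF kc])
    define t where "t n = 1 / real (Suc n)" for n
    have t: "0 < t n" for n by (simp add: t_def)
    have tlim: "t \<longlonglongrightarrow> 0" using LIMSEQ_Suc[OF lim_1_over_n] by (simp add: t_def[abs_def])
    define p where "p n x = (SUP y\<in>S. x \<bullet> y - (F y + t n * k y))" for n x
    have tk: "\<bar>t n * k y\<bar> \<le> t n" for n y using kb[of y] t[of n] by (simp add: abs_mult mult_left_le)
    have bdp: "x \<bullet> y - (F y + t n * k y) \<le> \<phi> x + t n" if "y \<in> S" for x y n
      using bd0[OF that, of x] tk[of n y] by (simp add: abs_le_iff)
    have bdp': "\<forall>x. \<forall>y\<in>S. x \<bullet> y - (F y + t n * k y) \<le> \<phi> x + t n" for n using bdp by blast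
    note supp = sup_affine[OF S bdp', folded p_def]
    have ik: "integrable \<mu> k" by (rule \<mu>.integrable_const_bound[of _ 1]) (use kb in auto)
    have dpp: "dual_pair D \<mu> (p n) (\<lambda>y. F y + t n * k y)" for n
      unfolding dual_pair_def using supp(3,4)[of n] dual_pairD(3)[OF F(1)] ik AES by (auto elim!: eventually_mono intro: supp(1))
    have [measurable]: "p n \<in> borel_measurable borel" for n by (rule dual_pairD(6)[OF dpp])
    define d where "d n x = (\<phi>0 x - p n x) / t n" for n x
    have [measurable]: "d n \<in> borel_measurable borel" for n unfolding d_def by measurable
    have pge: "\<phi>0 x - t n \<le> p n x" for n x
    proof -
      have "\<phi>0 x \<le> p n x + t n"
      proof (rule sup0(2))
        fix y assume y: "y \<in> S"
        have "x \<bullet> y \<le> p n x + (F y + t n * k y)" by (rule supp(1)[OF y])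
        then show "x \<bullet> y - F y \<le> p n x + t n" using tk[of n y] by linarith
      qed
      then show ?thesis by simp
    qed
    have ple: "p n x \<le> \<phi>0 x + t n" for n x
    proof (rule supp(2))
      fix y assume y: "y \<in> S"
      show "x \<bullet> y - (F y + t n * k y) \<le> \<phi>0 x + t n" using sup0(1)[OF y, of x] tk[of n y] by linarith
    qed
    have db: "\<bar>d n x\<bar> \<le> 1" for n x
      using pge[of x n] ple[of n x] t[of n] by (simp add: d_def abs_divide divide_le_eq abs_le_iff)
    have id: "integrable \<sigma> (d n)" for n by (rule \<sigma>.integrable_const_bound[of _ 1]) (use db in auto)
    have dint: "(\<integral>x. d n x \<partial>\<sigma>) \<le> (\<integral>y. k y \<partial>\<mu>)" for n
    proof -
      have "K \<phi>0 F \<le> K (p n) (\<lambda>y. F y + t n * k y)" by (rule order_trans[OF K0 mle[OF dpp]])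
      then have "(\<integral>x. \<phi>0 x \<partial>\<sigma>) - (\<integral>x. p n x \<partial>\<sigma>) \<le> t n * (\<integral>y. k y \<partial>\<mu>)"
        using dual_pairD(3)[OF F(1)] ik by (simp add: K_def)
      moreover have "(\<integral>x. d n x \<partial>\<sigma>) = ((\<integral>x. \<phi>0 x \<partial>\<sigma>) - (\<integral>x. p n x \<partial>\<sigma>)) / t n"
        using i\<sigma>[OF sup0(4)] i\<sigma>[OF supp(4)] by (simp add: d_def)
      ultimately show ?thesis using t[of n] by (simp add: divide_le_eq mult.commute)
    qed
    \<comment> \<open>Adding one makes the functions nonnegative, as Fatou's lemma in
      \<open>ennreal\<close> requires.\<close>
    have lower: "AE x in \<sigma>. ennreal (k (G x) + 1) \<le> liminf (\<lambda>n. ennreal (d n x + 1))"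
      using G\<sigma>
    proof eventually_elim
      case (elim x)
      \<comment> \<open>The tolerance \<open>(t n)^2\<close> is of smaller order than
        \<open>t n\<close>, so it disappears after the division in \<open>d n\<close>.\<close>
      have "\<exists>y\<in>S. p n x < x \<bullet> y - (F y + t n * k y) + (t n)\<^sup>2" for n by (rule supp(5)) (use t[of n] in simp)
      then obtain y where y: "\<And>n. y n \<in> S" "\<And>n. p n x < x \<bullet> y n - (F (y n) + t n * k (y n)) + (t n)\<^sup>2" by metis
      \<comment> \<open>The perturbation changes values by at most \<open>t n\<close>, which enters
        twice. Near-maximisers of the perturbed transform are therefore subgradients of
        \<open>\<phi>0\<close> up to \<open>2 * t n + (t n)^2\<close> and must approach
        \<open>G x\<close>.\<close>
      have ylim: "y \<longlonglongrightarrow> G x"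
      proof (rule approx_subgradient_tendsto(1)[of \<phi>0 x "G x" y D "\<lambda>n. 2 * t n + (t n)\<^sup>2"])
        show "norm (y n) \<le> D" for n using y(1)[of n] by (simp add: S_def)
        show "\<phi>0 x + (z - x) \<bullet> y n - (2 * t n + (t n)\<^sup>2) \<le> \<phi>0 z" for n z
          using y(2)[of n] sup0(1)[OF y(1)[of n], of z] pge[of x n] tk[of n "y n"] by (simp add: inner_diff_left abs_le_iff)
        have "(\<lambda>n. 2 * t n + (t n)\<^sup>2) \<longlonglongrightarrow> 2 * 0 + 0\<^sup>2" by (intro tendsto_intros tlim)
        then show "(\<lambda>n. 2 * t n + (t n)\<^sup>2) \<longlonglongrightarrow> 0" by simp
      qed (use elim in auto)
      have "isCont k (G x)" using kc by (simp add: continuous_on_eq_continuous_at)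
      from isCont_tendsto_compose[OF this ylim] have "(\<lambda>n. k (y n)) \<longlonglongrightarrow> k (G x)" .
      then have "(\<lambda>n. k (y n) - t n + 1) \<longlonglongrightarrow> k (G x) - 0 + 1" by (intro tendsto_intros tlim)
      then have "ennreal (k (G x) - 0 + 1) = liminf (\<lambda>n. ennreal (k (y n) - t n + 1))"
        by (intro lim_imp_Liminf[symmetric] tendsto_ennrealI) auto
      also have "\<dots> \<le> liminf (\<lambda>n. ennreal (d n x + 1))"
      proof (intro Liminf_mono always_eventually allI ennreal_leI)
        fix n
        have "p n x + t n * k (y n) - (t n)\<^sup>2 \<le> \<phi>0 x" using y(2)[of n] sup0(1)[OF y(1)[of n], of x] by simp
        then have "t n * (k (y n) - t n) \<le> \<phi>0 x - p n x" by (simp add: power2_eq_square right_diff_distrib)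
        then have "k (y n) - t n \<le> d n x" using t[of n] by (simp add: d_def le_divide_eq mult.commute)
        then show "k (y n) - t n + 1 \<le> d n x + 1" by simp
      qed
      finally show ?case by simp
    qed
    have "(\<integral>\<^sup>+x. ennreal (k (G x) + 1) \<partial>\<sigma>) \<le> (\<integral>\<^sup>+x. liminf (\<lambda>n. ennreal (d n x + 1)) \<partial>\<sigma>)"
      by (rule nn_integral_mono_AE[OF lower])
    also have "\<dots> \<le> liminf (\<lambda>n. \<integral>\<^sup>+x. ennreal (d n x + 1) \<partial>\<sigma>)" by (rule nn_integral_liminf) simp
    also have "\<dots> \<le> liminf (\<lambda>n. ennreal ((\<integral>y. k y \<partial>\<mu>) + 1))"
    proof (intro Liminf_mono always_eventually allI)
      fix n
      have "(\<integral>\<^sup>+x. ennreal (d n x + 1) \<partial>\<sigma>) = ennreal (\<integral>x. d n x + 1 \<partial>\<sigma>)"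
      proof (rule nn_integral_eq_integral)
        show "integrable \<sigma> (\<lambda>x. d n x + 1)" using id[of n] by simp
        show "AE x in \<sigma>. 0 \<le> d n x + 1"
        proof (intro AE_I2)
          show "0 \<le> d n x + 1" for x using db[of n x] by linarith
        qed
      qed
      also have "(\<integral>x. d n x + 1 \<partial>\<sigma>) = (\<integral>x. d n x \<partial>\<sigma>) + 1" using id[of n] by (simp add: \<sigma>.prob_space)
      finally show "(\<integral>\<^sup>+x. ennreal (d n x + 1) \<partial>\<sigma>) \<le> ennreal ((\<integral>y. k y \<partial>\<mu>) + 1)" using dint[of n] by (simp add: ennreal_leI)
    qed
    also have "\<dots> = ennreal ((\<integral>y. k y \<partial>\<mu>) + 1)" by (simp add: Liminf_const)
    finally have fin: "(\<integral>\<^sup>+x. ennreal (k (G x) + 1) \<partial>\<sigma>) \<le> ennreal ((\<integral>y. k y \<partial>\<mu>) + 1)" .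
    have ikG: "integrable \<sigma> (\<lambda>x. k (G x))" by (rule \<sigma>.integrable_const_bound[of _ 1]) (use kb in auto)
    have k1: "0 \<le> k y + 1" for y using kb[of y] by (simp add: abs_le_iff)
    have "(\<integral>\<^sup>+x. ennreal (k (G x) + 1) \<partial>\<sigma>) = ennreal (\<integral>x. k (G x) + 1 \<partial>\<sigma>)"
      using ikG k1 by (intro nn_integral_eq_integral) auto
    also have "(\<integral>x. k (G x) + 1 \<partial>\<sigma>) = (\<integral>x. k (G x) \<partial>\<sigma>) + 1" using ikG by (simp add: \<sigma>.prob_space)
    finally have "ennreal ((\<integral>x. k (G x) \<partial>\<sigma>) + 1) \<le> ennreal ((\<integral>y. k y \<partial>\<mu>) + 1)" using fin by simp
    moreover have "0 \<le> (\<integral>y. k y \<partial>\<mu>) + 1"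
    proof -
      have "0 \<le> (\<integral>y. k y + 1 \<partial>\<mu>)" using k1 by (intro integral_nonneg_AE) auto
      then show ?thesis using ik by (simp add: \<mu>.prob_space)
    qed
    ultimately show ?thesis by (simp add: ennreal_le_iff)
  qed
  have push: "distr \<sigma> borel G = \<mu>"
  proof (rule measure_eqI_bounded_continuous)
    show "prob_space (distr \<sigma> borel G)" by (rule \<sigma>.prob_space_distr) measurable
    fix k :: "'a \<Rightarrow> real" assume k: "continuous_on UNIV k" "\<And>x. \<bar>k x\<bar> \<le> 1"
    have [measurable]: "k \<in> borel_measurable borel" by (rule borel_measurable_continuous_onI[OF k(1)])
    have "(\<integral>x. k x \<partial>distr \<sigma> borel G) = (\<integral>x. k (G x) \<partial>\<sigma>)" by (subst integral_distr) auto
    also have "\<dots> = (\<integral>y. k y \<partial>\<mu>)"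
    proof (rule antisym)
      show "(\<integral>x. k (G x) \<partial>\<sigma>) \<le> (\<integral>y. k y \<partial>\<mu>)" by (rule le[OF k])
      show "(\<integral>y. k y \<partial>\<mu>) \<le> (\<integral>x. k (G x) \<partial>\<sigma>)"
        using le[of "\<lambda>x. - k x"] k by (simp add: continuous_on_minus)
    qed
    finally show "(\<integral>x. k x \<partial>distr \<sigma> borel G) = (\<integral>y. k y \<partial>\<mu>)" .
  qed (use c in auto)
  obtain Dn :: "'a set" where Dn: "countable Dn" "\<And>X. open X \<Longrightarrow> X \<noteq> {} \<Longrightarrow> \<exists>d\<in>Dn. d \<in> X"
    using countable_dense_setE by blast
  \<comment> \<open>The conjugate of \<open>\<phi>0\<close>, written as a supremum over a countable
    dense set to be measurable. Adding \<open>\<phi>0 0\<close> makes the full supremum nonnegative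
    (take \<open>z = 0\<close>), so the truncation at zero by \<open>ennreal\<close> loses
    nothing.\<close>
  define Fc where "Fc y = (SUP z\<in>Dn. ennreal (z \<bullet> y - \<phi>0 z + \<phi>0 0))" for y
  have Fc_all: "ennreal (z \<bullet> y - \<phi>0 z + \<phi>0 0) \<le> Fc y" for y z
  proof -
    let ?A = "{z. ennreal (z \<bullet> y - \<phi>0 z + \<phi>0 0) \<le> Fc y}"
    have "closed ?A"
      using dual_pairD(5)[OF dp0] by (intro closed_Collect_le continuous_on_ennreal continuous_intros)
    moreover have "Dn \<subseteq> ?A" unfolding Fc_def by (auto intro: SUP_upper)
    ultimately have "closure Dn \<subseteq> ?A" by (rule closure_minimal[rotated])
    moreover have "closure Dn = UNIV"
    proof -
      have "- closure Dn = {}"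
        using Dn(2)[of "- closure Dn"] closure_subset[of Dn] by blast
      then show ?thesis by auto
    qed
    ultimately show ?thesis by blast
  qed
  define g where "g y = enn2real (Fc y) - \<phi>0 0" for y
  have [measurable]: "Fc \<in> borel_measurable borel" unfolding Fc_def[abs_def] by (rule borel_measurable_SUP[OF Dn(1)]) measurable
  have [measurable]: "g \<in> borel_measurable borel" unfolding g_def[abs_def] by measurable
  have gS: "(\<forall>x. x \<bullet> y \<le> \<phi>0 x + g y) \<and> - \<phi>0 0 \<le> g y \<and> g y \<le> F y" if y: "y \<in> S" for y
  proof -
    have F0: "0 \<le> F y + \<phi>0 0" using sup0(1)[OF y, of 0] by simp
    have "Fc y \<le> ennreal (F y + \<phi>0 0)"
      unfolding Fc_def by (intro SUP_least ennreal_leI) (use sup0(1)[OF y] in \<open>auto simp: algebra_simps\<close>)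
    then obtain q where q: "0 \<le> q" "Fc y = ennreal q" "q \<le> F y + \<phi>0 0"
      using F0 by (metis ennreal_cases ennreal_le_iff ennreal_neq_top top_unique)
    have "x \<bullet> y \<le> \<phi>0 x + g y" for x
      using Fc_all[of x y] q by (auto simp: g_def ennreal_le_iff2)
    then show ?thesis using q by (simp add: g_def)
  qed
  have dpg: "dual_pair D \<mu> \<phi>0 g"
    unfolding dual_pair_def
  proof (intro conjI allI sup0(3,4))
    show "integrable \<mu> g"
    proof (rule Bochner_Integration.integrable_bound[of _ "\<lambda>y. \<bar>\<phi>0 0\<bar> + \<bar>F y\<bar>"])
      show "integrable \<mu> (\<lambda>y. \<bar>\<phi>0 0\<bar> + \<bar>F y\<bar>)" using dual_pairD(3)[OF F(1)] by auto
      show "g \<in> borel_measurable \<mu>" by measurable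
      show "AE y in \<mu>. norm (g y) \<le> norm (\<bar>\<phi>0 0\<bar> + \<bar>F y\<bar>)" using AES
      proof eventually_elim
        case (elim y)
        then show ?case using gS[OF elim] by auto
      qed
    qed
    show "AE y in \<mu>. \<forall>x. x \<bullet> y \<le> \<phi>0 x + g y" using AES by eventually_elim (use gS in blast)
  qed
  \<comment> \<open>Young's inequality is an equality at a subgradient. With the push-forward
    identity, the dual value becomes the cost of the coupling carried by the graph of
    \<open>G\<close>.\<close>
  have gG: "AE x in \<sigma>. g (G x) = x \<bullet> G x - \<phi>0 x"
    using Gsub
  proof eventually_elim
    case (elim x)
    have sub: "z \<bullet> G x - \<phi>0 z \<le> x \<bullet> G x - \<phi>0 x" for z
    proof -
      have "\<phi>0 x + (z - x) \<bullet> G x \<le> \<phi>0 z" using elim by (simp add: subgradient_def)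
      then show ?thesis by (simp add: inner_diff_left)
    qed
    have "Fc (G x) \<le> ennreal (x \<bullet> G x - \<phi>0 x + \<phi>0 0)"
      unfolding Fc_def by (intro SUP_least ennreal_leI) (use sub in simp)
    then have "Fc (G x) = ennreal (x \<bullet> G x - \<phi>0 x + \<phi>0 0)" using Fc_all[of x "G x"] by simp
    moreover have "0 \<le> x \<bullet> G x - \<phi>0 x + \<phi>0 0" using sub[of 0] by simp
    ultimately show ?case by (simp add: g_def)
  qed
  have inner: "integrable \<sigma> (\<lambda>x. x \<bullet> G x)"
  proof (rule Bochner_Integration.integrable_bound[of _ "\<lambda>x. D * norm x"])
    show "integrable \<sigma> (\<lambda>x. D * norm x)" using n\<sigma> by auto
    have "AE y in distr \<sigma> borel G. norm y \<le> D" unfolding push by (rule c(3))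
    then have "AE x in \<sigma>. norm (G x) \<le> D" by (subst (asm) AE_distr_iff) auto
    then show "AE x in \<sigma>. norm (x \<bullet> G x) \<le> norm (D * norm x)"
    proof eventually_elim
      case (elim x)
      have "\<bar>x \<bullet> G x\<bar> \<le> norm x * norm (G x)" by (rule Cauchy_Schwarz_ineq2)
      also have "\<dots> \<le> norm x * D" using elim by (intro mult_left_mono) auto
      finally show ?case using D by (simp add: mult.commute)
    qed
  qed measurable
  have "(\<integral>y. g y \<partial>\<mu>) = (\<integral>x. g (G x) \<partial>\<sigma>)" unfolding push[symmetric] by (subst integral_distr) auto
  also have "\<dots> = (\<integral>x. x \<bullet> G x - \<phi>0 x \<partial>\<sigma>)" by (rule integral_cong_AE) (use gG in auto)
  also have "\<dots> = (\<integral>x. x \<bullet> G x \<partial>\<sigma>) - (\<integral>x. \<phi>0 x \<partial>\<sigma>)" using inner i\<sigma>[OF sup0(4)] by simp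
  finally have val: "(\<integral>x. \<phi>0 x \<partial>\<sigma>) + (\<integral>y. g y \<partial>\<mu>) = (\<integral>x. x \<bullet> G x \<partial>\<sigma>)" by simp
  define \<gamma> where "\<gamma> = distr \<sigma> borel (\<lambda>x. (x, G x))"
  have pm[measurable]: "(\<lambda>x. (x, G x)) \<in> borel_measurable \<sigma>"
    unfolding borel_prod[symmetric] by measurable
  have fs[measurable]: "fst \<in> borel_measurable (borel :: ('a \<times> 'a) measure)" "snd \<in> borel_measurable (borel :: ('a \<times> 'a) measure)"
    by (auto intro!: borel_measurable_continuous_onI continuous_intros)
  have "\<gamma> \<in> couplings \<sigma> \<mu>"
    unfolding couplings_def mem_Collect_eq
  proof (intro conjI)
    show "prob_space \<gamma>" unfolding \<gamma>_def by (rule \<sigma>.prob_space_distr) measurable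
    show "distr \<gamma> borel fst = \<sigma>" unfolding \<gamma>_def by (subst distr_distr) (auto simp: comp_def distr_id2 s\<sigma>)
    show "distr \<gamma> borel snd = \<mu>" unfolding \<gamma>_def using push by (subst distr_distr) (auto simp: comp_def)
  qed (simp add: \<gamma>_def)
  moreover have "(\<integral>z. fst z \<bullet> snd z \<partial>\<gamma>) = (\<integral>x. x \<bullet> G x \<partial>\<sigma>)"
    unfolding \<gamma>_def by (subst integral_distr) auto
  ultimately have "ereal (\<integral>x. x \<bullet> G x \<partial>\<sigma>) \<le> transport_T \<sigma> \<mu>"
    unfolding transport_T_def by (intro SUP_upper2[of \<gamma>]) auto
  with that[OF dpg i\<sigma>[OF sup0(4)]] val show ?thesis by simp
qed

section \<open>Gibbs measures as minimisers\<close>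

lemma power_le_fact_exp:
  fixes x :: real assumes "0 \<le> x" shows "x ^ k \<le> fact k * exp x"
proof -
  have "(\<Sum>n\<in>{k}. x ^ n /\<^sub>R fact n) \<le> (\<Sum>n. x ^ n /\<^sub>R fact n)"
    using assms by (intro sum_le_suminf summable_exp_generic) auto
  then show ?thesis by (simp add: exp_def divide_simps mult.commute)
qed

text \<open>Half of the exponential decay absorbs the power, the other half stays
  integrable.\<close>

lemma integrable_power_exp_minus:
  fixes \<psi> :: "'a::euclidean_space \<Rightarrow> real"
  assumes [measurable]: "\<psi> \<in> borel_measurable borel" and c: "c > 0" and le: "\<And>x. c * norm x - K \<le> \<psi> x"
  shows "integrable lborel (\<lambda>x. norm x ^ k * exp (- \<psi> x))"
proof (rule Bochner_Integration.integrable_bound)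
  show "integrable lborel (\<lambda>x::'a. (fact k * (2 / c) ^ k * exp K) * exp (- (c / 2) * norm x))"
    using integrable_exp_norm[of "c / 2"] c by (intro integrable_mult_right) auto
  show "AE x in lborel. norm (norm x ^ k * exp (- \<psi> x)) \<le> norm ((fact k * (2 / c) ^ k * exp K) * exp (- (c / 2) * norm x))"
  proof (intro AE_I2)
    fix x :: 'a
    have "(c / 2 * norm x) ^ k \<le> fact k * exp (c / 2 * norm x)" using c by (intro power_le_fact_exp) auto
    then have "(2 / c) ^ k * (c / 2 * norm x) ^ k \<le> (2 / c) ^ k * (fact k * exp (c / 2 * norm x))" using c by (intro mult_left_mono) auto
    also have "(2 / c) ^ k * (c / 2 * norm x) ^ k = norm x ^ k" using c by (simp add: power_mult_distrib[symmetric])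
    finally have "norm x ^ k * exp (- \<psi> x) \<le> (2 / c) ^ k * (fact k * exp (c / 2 * norm x)) * exp (K - c * norm x)"
      using le[of x] c by (intro mult_mono) auto
    also have "\<dots> = (fact k * (2 / c) ^ k * exp K) * exp (- (c / 2) * norm x)"
    proof -
      have "exp (c / 2 * norm x) * exp (K - c * norm x) = exp K * exp (- (c / 2) * norm x)"
        unfolding exp_add[symmetric] by (simp add: field_simps)
      then show ?thesis by (simp add: mult_ac)
    qed
    finally show "norm (norm x ^ k * exp (- \<psi> x)) \<le> norm ((fact k * (2 / c) ^ k * exp K) * exp (- (c / 2) * norm x))"
      using c by (simp add: abs_mult)
  qed
qed measurable

definition gibbs :: "('a::euclidean_space \<Rightarrow> real) \<Rightarrow> 'a measure" where
  "gibbs \<psi> = density lborel (\<lambda>x. ennreal (exp (- \<psi> x) / partition_fun \<psi>))"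

text \<open>Nonnegativity of the entropy of \<open>\<sigma>\<close> relative to the Gibbs density
  \<open>q\<close>. The minorant \<open>l\<close> contains \<open>r - q\<close>, of integral zero,
  so that \<open>ln t \<le> t - 1\<close> yields it pointwise. Being integrable, \<open>l\<close>
  also makes the negative part of the entropy finite, which gives sense to the difference of
  extended integrals.\<close>

lemma gibbs_inequality:
  fixes \<sigma> :: "'a::euclidean_space measure"
  assumes \<sigma>: "\<sigma> \<in> prob_1" and ac: "absolutely_continuous lborel \<sigma>" and [measurable]: "\<phi> \<in> borel_measurable borel"
    and i\<phi>: "integrable \<sigma> \<phi>" and Zi: "integrable lborel (\<lambda>x. exp (- \<phi> x))"
  shows "ereal (- (\<integral>x. \<phi> x \<partial>\<sigma>) - ln (partition_fun \<phi>)) \<le> entropy_H \<sigma>"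
proof -
  have s\<sigma>: "sets \<sigma> = sets lborel" and p\<sigma>: "prob_space \<sigma>" using \<sigma> by (auto simp: prob_1_def prob_measures_def)
  interpret \<sigma>: prob_space \<sigma> by fact
  define r where "r x = enn2real (RN_deriv lborel \<sigma> x)" for x
  have [measurable]: "r \<in> borel_measurable borel"
  proof -
    have "r \<in> borel_measurable lborel" unfolding r_def by measurable
    then show ?thesis by simp
  qed
  have r0: "0 \<le> r x" for x by (simp add: r_def)
  have \<sigma>r: "\<sigma> = density lborel (\<lambda>x. ennreal (r x))"
  proof -
    have "\<sigma> = density lborel (RN_deriv lborel \<sigma>)" using sigma_finite_measure.density_RN_deriv[OF lborel.sigma_finite_measure_axioms ac s\<sigma>] by simp
    also have "\<dots> = density lborel (\<lambda>x. ennreal (r x))"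
    proof (rule density_cong)
      show "AE x in lborel. RN_deriv lborel \<sigma> x = ennreal (r x)"
        using sigma_finite_measure.RN_deriv_finite[OF lborel.sigma_finite_measure_axioms \<sigma>.sigma_finite_measure_axioms ac s\<sigma>] by eventually_elim (simp add: r_def less_top)
    qed auto
    finally show ?thesis .
  qed
  have r1: "integrable lborel r" "(\<integral>x. r x \<partial>lborel) = 1"
  proof -
    have "(\<integral>\<^sup>+x. ennreal (r x) \<partial>lborel) = 1"
      using \<sigma>.emeasure_space_1 by (subst (asm) (1) \<sigma>r, subst (asm) emeasure_density) (auto simp: \<sigma>r)
    then show "integrable lborel r" "(\<integral>x. r x \<partial>lborel) = 1"
      using r0 by (auto intro!: integrableI_bounded simp: integral_eq_nn_integral)
  qed
  have ir\<phi>: "integrable lborel (\<lambda>x. r x * \<phi> x)"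
  proof -
    have "integrable (density lborel (\<lambda>x. ennreal (r x))) \<phi>" using i\<phi> by (simp only: \<sigma>r[symmetric])
    then show ?thesis using r0 by (subst (asm) integrable_density) auto
  qed
  have er\<phi>: "(\<integral>x. \<phi> x \<partial>\<sigma>) = (\<integral>x. r x * \<phi> x \<partial>lborel)"
  proof -
    have "(\<integral>x. \<phi> x \<partial>\<sigma>) = (\<integral>x. \<phi> x \<partial>density lborel (\<lambda>x. ennreal (r x)))" by (simp only: \<sigma>r[symmetric])
    also have "\<dots> = (\<integral>x. r x * \<phi> x \<partial>lborel)" using r0 by (subst integral_density) auto
    finally show ?thesis .
  qed
  define Z where "Z = partition_fun \<phi>"
  have Z: "0 < Z" using integral_exp_pos[OF Zi] by (simp add: Z_def)
  define q where "q x = exp (- \<phi> x) / Z" for x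
  have iq: "integrable lborel q" "(\<integral>x. q x \<partial>lborel) = 1"
    using Zi Z by (auto simp: q_def[abs_def] Z_def partition_fun_def)
  define l where "l x = - (r x * \<phi> x) - r x * ln Z + r x - q x" for x
  have il: "integrable lborel l" unfolding l_def[abs_def] using ir\<phi> r1 iq by auto
  have ell: "(\<integral>x. l x \<partial>lborel) = - (\<integral>x. \<phi> x \<partial>\<sigma>) - ln Z"
    unfolding l_def[abs_def] er\<phi> using ir\<phi> r1 iq by simp
  have pt: "l x \<le> r x * ln (r x)" for x
  proof (cases "r x = 0")
    case True then show ?thesis using Z by (simp add: l_def q_def)
  next
    case False
    then have rp: "0 < r x" using r0[of x] by simp
    have qp: "0 < q x" using Z by (simp add: q_def)
    have "ln (q x / r x) \<le> q x / r x - 1" using qp rp by (intro ln_le_minus_one) auto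
    then have "r x * (ln (q x) - ln (r x)) \<le> r x * (q x / r x - 1)"
      using rp qp by (intro mult_left_mono) (auto simp: ln_div)
    moreover have "ln (q x) = - \<phi> x - ln Z" using Z by (simp add: q_def ln_div)
    ultimately show ?thesis using rp by (simp add: l_def algebra_simps)
  qed
  define P where "P = (\<integral>\<^sup>+x. ennreal (r x * ln (r x)) \<partial>lborel)"
  define N where "N = (\<integral>\<^sup>+x. ennreal (- (r x * ln (r x))) \<partial>lborel)"
  have H: "entropy_H \<sigma> = enn2ereal P - enn2ereal N"
    using ac by (simp add: entropy_H_def P_def N_def Let_def r_def)
  have Nf: "N < \<infinity>"
  proof -
    have "N \<le> (\<integral>\<^sup>+x. ennreal (norm (l x)) \<partial>lborel)"
      unfolding N_def using pt by (intro nn_integral_mono ennreal_leI) (smt (verit) real_norm_def)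
    also have "\<dots> < \<infinity>" using il by (simp add: integrable_iff_bounded)
    finally show ?thesis .
  qed
  show ?thesis
  proof (cases "P = \<infinity>")
    case True
    then have "entropy_H \<sigma> = \<infinity>" using H Nf by (cases N rule: ennreal_cases) auto
    then show ?thesis by simp
  next
    case False
    have i: "integrable lborel (\<lambda>x. r x * ln (r x))"
      using False Nf by (auto simp: real_integrable_def P_def N_def less_top)
    have "(\<integral>x. r x * ln (r x) \<partial>lborel) = enn2real P - enn2real N"
      by (simp add: real_lebesgue_integral_def[OF i] P_def N_def)
    moreover have "enn2ereal P = ereal (enn2real P)" "enn2ereal N = ereal (enn2real N)"
      using False Nf by (cases P rule: ennreal_cases, auto) (cases N rule: ennreal_cases, auto)
    ultimately have "entropy_H \<sigma> = ereal (\<integral>x. r x * ln (r x) \<partial>lborel)" using H by simp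
    moreover have "(\<integral>x. l x \<partial>lborel) \<le> (\<integral>x. r x * ln (r x) \<partial>lborel)" by (rule integral_mono[OF il i pt])
    ultimately show ?thesis using ell by (simp add: Z_def)
  qed
qed

section \<open>Moments and entropy of Gibbs measures\<close>

context
  fixes \<psi> :: "'a::euclidean_space \<Rightarrow> real" and c K D :: real
  assumes c: "c > 0" and low: "\<And>x. c * norm x - K \<le> \<psi> x" and lip: "\<And>x y. \<bar>\<psi> x - \<psi> y\<bar> \<le> D * norm (x - y)"
begin

lemma gibbs_measurable [measurable]: "\<psi> \<in> borel_measurable borel"
  by (intro borel_measurable_continuous_onI lipschitz_continuous[OF lip])

lemma gibbs_partition: "integrable lborel (\<lambda>x. exp (- \<psi> x))" "0 < partition_fun \<psi>"
  using integrable_exp_minus(1)[OF gibbs_measurable c low] integral_exp_pos by auto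

lemma nn_integral_gibbs_density: "(\<integral>\<^sup>+x. ennreal (exp (- \<psi> x) / partition_fun \<psi>) \<partial>lborel) = 1"
proof -
  have "(\<integral>\<^sup>+x. ennreal (exp (- \<psi> x) / partition_fun \<psi>) \<partial>lborel) = ennreal (\<integral>x. exp (- \<psi> x) / partition_fun \<psi> \<partial>lborel)"
    using gibbs_partition by (intro nn_integral_eq_integral) auto
  then show ?thesis using gibbs_partition by (simp add: partition_fun_def)
qed

lemma integrable_gibbs_iff:
  fixes h :: "'a \<Rightarrow> real"
  assumes [measurable]: "h \<in> borel_measurable borel"
  shows "integrable (gibbs \<psi>) h \<longleftrightarrow> integrable lborel (\<lambda>x. exp (- \<psi> x) / partition_fun \<psi> * h x)"
    "(\<integral>x. h x \<partial>gibbs \<psi>) = (\<integral>x. exp (- \<psi> x) / partition_fun \<psi> * h x \<partial>lborel)"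
  unfolding gibbs_def using gibbs_partition(2)
  by (auto simp: integrable_density integral_density)

lemma integrable_gibbs_moment: "integrable lborel (\<lambda>x. exp (- \<psi> x) / partition_fun \<psi> * norm x ^ k)"
  using integrable_divide[OF integrable_power_exp_minus[OF gibbs_measurable c low, of k], of "partition_fun \<psi>"] by (simp add: mult_ac)

lemma gibbs_prob_1: "gibbs \<psi> \<in> prob_1"
proof -
  have "prob_space (gibbs \<psi>)"
    by (rule prob_spaceI) (simp add: gibbs_def emeasure_density nn_integral_gibbs_density)
  moreover have "integrable (gibbs \<psi>) norm"
    using integrable_gibbs_moment[of 1] by (subst integrable_gibbs_iff) auto
  ultimately show ?thesis by (simp add: prob_1_def prob_measures_def gibbs_def)
qed

lemma integrable_gibbs_potential: "integrable lborel (\<lambda>x. exp (- \<psi> x) / partition_fun \<psi> * \<psi> x)"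
proof (rule Bochner_Integration.integrable_bound)
  show "integrable lborel (\<lambda>x. \<bar>\<psi> 0\<bar> * (exp (- \<psi> x) / partition_fun \<psi> * norm x ^ 0) + \<bar>D\<bar> * (exp (- \<psi> x) / partition_fun \<psi> * norm x ^ 1))"
    by (intro Bochner_Integration.integrable_add integrable_mult_right integrable_gibbs_moment)
  show "AE x in lborel. norm (exp (- \<psi> x) / partition_fun \<psi> * \<psi> x) \<le> norm (\<bar>\<psi> 0\<bar> * (exp (- \<psi> x) / partition_fun \<psi> * norm x ^ 0) + \<bar>D\<bar> * (exp (- \<psi> x) / partition_fun \<psi> * norm x ^ 1))"
  proof (intro AE_I2)
    fix x
    define e where "e = exp (- \<psi> x) / partition_fun \<psi>"
    have e: "0 \<le> e" using gibbs_partition(2) by (simp add: e_def)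
    have "\<bar>\<psi> x\<bar> \<le> \<bar>\<psi> 0\<bar> + D * norm x" using lip[of x 0] by simp
    also have "\<dots> \<le> \<bar>\<psi> 0\<bar> + \<bar>D\<bar> * norm x" by (intro add_left_mono mult_right_mono) auto
    finally have "e * \<bar>\<psi> x\<bar> \<le> e * (\<bar>\<psi> 0\<bar> + \<bar>D\<bar> * norm x)" using e by (intro mult_left_mono)
    then show "norm (exp (- \<psi> x) / partition_fun \<psi> * \<psi> x) \<le> norm (\<bar>\<psi> 0\<bar> * (exp (- \<psi> x) / partition_fun \<psi> * norm x ^ 0) + \<bar>D\<bar> * (exp (- \<psi> x) / partition_fun \<psi> * norm x ^ 1))"
      unfolding e_def[symmetric] using e by (simp add: abs_mult algebra_simps)
  qed
qed measurable

text \<open>The equality case of \<open>gibbs_inequality\<close>: the logarithm of the Gibbs density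
  is \<open>- \<psi>\<close> minus a constant, so the entropy is computed exactly.\<close>

lemma entropy_gibbs: "entropy_H (gibbs \<psi>) = ereal (- (\<integral>x. \<psi> x \<partial>gibbs \<psi>) - ln (partition_fun \<psi>))"
proof -
  define p where "p x = exp (- \<psi> x) / partition_fun \<psi>" for x
  have [measurable]: "p \<in> borel_measurable borel" unfolding p_def by measurable
  have p0: "0 < p x" for x using gibbs_partition(2) by (simp add: p_def)
  have ac: "absolutely_continuous lborel (gibbs \<psi>)"
    unfolding gibbs_def by (rule absolutely_continuousI_density) simp
  have "AE x in lborel. ennreal (p x) = RN_deriv lborel (gibbs \<psi>) x"
    by (rule sigma_finite_measure.RN_deriv_unique[OF lborel.sigma_finite_measure_axioms]) (auto simp: gibbs_def p_def)
  then have ae: "AE x in lborel. enn2real (RN_deriv lborel (gibbs \<psi>) x) = p x"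
    by eventually_elim (metis enn2real_ennreal less_imp_le p0)
  have lnp: "p x * ln (p x) = - (p x * \<psi> x) - ln (partition_fun \<psi>) * p x" for x
  proof -
    have l: "ln (p x) = - \<psi> x - ln (partition_fun \<psi>)" using gibbs_partition(2) by (simp add: p_def ln_div)
    show ?thesis unfolding l by (simp add: algebra_simps)
  qed
  have ip: "integrable lborel p" "(\<integral>x. p x \<partial>lborel) = 1"
    using gibbs_partition by (auto simp: p_def[abs_def] partition_fun_def)
  have ip\<psi>: "integrable lborel (\<lambda>x. p x * \<psi> x)" using integrable_gibbs_potential by (simp add: p_def)
  have i: "integrable lborel (\<lambda>x. p x * ln (p x))" unfolding lnp using ip ip\<psi> by auto
  have "(\<integral>x. p x * ln (p x) \<partial>lborel) = - (\<integral>x. p x * \<psi> x \<partial>lborel) - ln (partition_fun \<psi>)"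
    unfolding lnp using ip ip\<psi> by simp
  also have "(\<integral>x. p x * \<psi> x \<partial>lborel) = (\<integral>x. \<psi> x \<partial>gibbs \<psi>)" by (subst integrable_gibbs_iff) (auto simp: p_def)
  finally have val: "(\<integral>x. p x * ln (p x) \<partial>lborel) = - (\<integral>x. \<psi> x \<partial>gibbs \<psi>) - ln (partition_fun \<psi>)" .
  define P where "P = (\<integral>\<^sup>+x. ennreal (p x * ln (p x)) \<partial>lborel)"
  define N where "N = (\<integral>\<^sup>+x. ennreal (- (p x * ln (p x))) \<partial>lborel)"
  have PN: "P \<noteq> \<infinity>" "N \<noteq> \<infinity>" using i by (auto simp: real_integrable_def P_def N_def)
  have "(\<integral>\<^sup>+x. ennreal (enn2real (RN_deriv lborel (gibbs \<psi>) x) * ln (enn2real (RN_deriv lborel (gibbs \<psi>) x))) \<partial>lborel) = P"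
    unfolding P_def using ae by (intro nn_integral_cong_AE) (auto elim: eventually_mono)
  moreover have "(\<integral>\<^sup>+x. ennreal (- (enn2real (RN_deriv lborel (gibbs \<psi>) x) * ln (enn2real (RN_deriv lborel (gibbs \<psi>) x)))) \<partial>lborel) = N"
    unfolding N_def using ae by (intro nn_integral_cong_AE) (auto elim: eventually_mono)
  ultimately have "entropy_H (gibbs \<psi>) = enn2ereal P - enn2ereal N"
    using ac by (simp add: entropy_H_def Let_def)
  also have "enn2ereal P = ereal (enn2real P)" using PN by (cases P rule: ennreal_cases) auto
  also have "enn2ereal N = ereal (enn2real N)" using PN by (cases N rule: ennreal_cases) auto
  also have "ereal (enn2real P) - ereal (enn2real N) = ereal (\<integral>x. p x * ln (p x) \<partial>lborel)"
    by (simp add: real_lebesgue_integral_def[OF i] P_def N_def)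
  finally show ?thesis using val by simp
qed

end

text \<open>Weak duality bounds the energy of the Gibbs measure by
  \<open>dual_J \<mu> \<psi> f\<close>. For an absolutely continuous competitor, the transport term
  is at least the dual value of some pair \<open>(\<phi>, h)\<close>, and the entropy bound for the
  same \<open>\<phi>\<close> makes its energy at least \<open>dual_J \<mu> \<phi> h\<close>. Other
  competitors have infinite entropy.\<close>

theorem gibbs_in_M_set:
  fixes \<mu> :: "'a::euclidean_space measure"
  assumes th: "th > 0" and cen: "centered D th \<mu>" and dp: "dual_pair D \<mu> \<psi> f"
    and min: "\<And>\<psi>' f'. dual_pair D \<mu> \<psi>' f' \<Longrightarrow> dual_J \<mu> \<psi> f \<le> dual_J \<mu> \<psi>' f'"
  shows "gibbs \<psi> \<in> M_set \<mu>"
proof -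
  obtain K where K: "\<And>x. th / 2 * norm x - K \<le> \<psi> x" using dual_pair_integrable(3)[OF cen th dp] by blast
  have th2: "0 < th / 2" using th by simp
  note g = th2 K dual_pairD(2)[OF dp]
  note [measurable] = dual_pairD(6)[OF dp]
  have gp: "gibbs \<psi> \<in> prob_1" by (rule gibbs_prob_1[OF g])
  have i\<psi>: "integrable (gibbs \<psi>) \<psi>"
    using integrable_gibbs_potential[OF g] by (subst integrable_gibbs_iff[OF g]) auto
  have "transport_T (gibbs \<psi>) \<mu> \<le> ereal ((\<integral>x. \<psi> x \<partial>gibbs \<psi>) + (\<integral>y. f y \<partial>\<mu>))"
    unfolding transport_T_def
  proof (intro SUP_least, unfold ereal_less_eq)
    fix \<gamma> assume "\<gamma> \<in> couplings (gibbs \<psi>) \<mu>"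
    then have \<gamma>: "sets \<gamma> = sets borel" "prob_space \<gamma>" "distr \<gamma> borel fst = gibbs \<psi>" "distr \<gamma> borel snd = \<mu>"
      by (auto simp: couplings_def)
    note [measurable_cong] = \<gamma>(1)
    have [measurable]: "fst \<in> borel_measurable (borel :: ('a \<times> 'a) measure)" "snd \<in> borel_measurable (borel :: ('a \<times> 'a) measure)"
      by (auto intro!: borel_measurable_continuous_onI continuous_intros)
    have [measurable]: "f \<in> borel_measurable borel"
      using borel_measurable_integrable[OF dual_pairD(3)[OF dp]] by (simp add: measurable_cong_sets[OF centeredD(1)[OF cen] refl])
    have i1: "integrable \<gamma> (\<lambda>z. \<psi> (fst z))" using i\<psi> unfolding \<gamma>(3)[symmetric] by (subst (asm) integrable_distr_eq) auto
    have i2: "integrable \<gamma> (\<lambda>z. f (snd z))" using dual_pairD(3)[OF dp] unfolding \<gamma>(4)[symmetric] by (subst (asm) integrable_distr_eq) auto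
    have i3: "integrable \<gamma> (\<lambda>z. norm (fst z))"
    proof -
      have "integrable (gibbs \<psi>) norm" using gp by (simp add: prob_1_def)
      then show ?thesis unfolding \<gamma>(3)[symmetric] by (subst (asm) integrable_distr_eq) auto
    qed
    have aeD: "AE z in \<gamma>. norm (snd z) \<le> D"
      using centeredD(3)[OF cen] unfolding \<gamma>(4)[symmetric] by (subst (asm) AE_distr_iff) auto
    have "AE y in \<mu>. \<forall>x. x \<bullet> y \<le> \<psi> x + f y" by (rule dual_pairD[OF dp])
    then have "AE z in \<gamma>. \<forall>x. x \<bullet> snd z \<le> \<psi> x + f (snd z)"
      unfolding \<gamma>(4)[symmetric] by (rule AE_distrD[rotated]) measurable
    then have ae: "AE z in \<gamma>. fst z \<bullet> snd z \<le> \<psi> (fst z) + f (snd z)" by eventually_elim blast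
    have D: "0 < D" by (rule centered_D_pos[OF cen th])
    have i4: "integrable \<gamma> (\<lambda>z. fst z \<bullet> snd z)"
    proof (rule Bochner_Integration.integrable_bound[OF integrable_mult_right[OF i3, of D]])
      show "AE z in \<gamma>. norm (fst z \<bullet> snd z) \<le> norm (D * norm (fst z))" using aeD
      proof eventually_elim
        case (elim z)
        have "\<bar>fst z \<bullet> snd z\<bar> \<le> norm (fst z) * norm (snd z)" by (rule Cauchy_Schwarz_ineq2)
        also have "\<dots> \<le> norm (fst z) * D" using elim by (intro mult_left_mono) auto
        finally show ?case using D by (simp add: mult.commute)
      qed
    qed measurable
    have "(\<integral>z. fst z \<bullet> snd z \<partial>\<gamma>) \<le> (\<integral>z. \<psi> (fst z) + f (snd z) \<partial>\<gamma>)"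
      by (rule integral_mono_AE[OF i4 _ ae]) (use i1 i2 in auto)
    also have "\<dots> = (\<integral>z. \<psi> (fst z) \<partial>\<gamma>) + (\<integral>z. f (snd z) \<partial>\<gamma>)" using i1 i2 by simp
    also have "(\<integral>z. \<psi> (fst z) \<partial>\<gamma>) = (\<integral>x. \<psi> x \<partial>gibbs \<psi>)" unfolding \<gamma>(3)[symmetric] by (subst integral_distr) auto
    also have "(\<integral>z. f (snd z) \<partial>\<gamma>) = (\<integral>y. f y \<partial>\<mu>)" unfolding \<gamma>(4)[symmetric] by (subst integral_distr) auto
    finally show "(\<integral>z. fst z \<bullet> snd z \<partial>\<gamma>) \<le> (\<integral>x. \<psi> x \<partial>gibbs \<psi>) + (\<integral>y. f y \<partial>\<mu>)" .
  qed
  then have E: "energy_E \<mu> (gibbs \<psi>) \<le> ereal (dual_J \<mu> \<psi> f)"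
    unfolding energy_E_def entropy_gibbs[OF g] dual_J_def
    by (rule order_trans[OF add_left_mono]) simp
  have "ereal (dual_J \<mu> \<psi> f) \<le> energy_E \<mu> \<sigma>" if \<sigma>: "\<sigma> \<in> prob_1" for \<sigma>
  proof (cases "absolutely_continuous lborel \<sigma>")
    case True
    obtain \<phi> h where d: "dual_pair D \<mu> \<phi> h" "integrable \<sigma> \<phi>" "ereal ((\<integral>x. \<phi> x \<partial>\<sigma>) + (\<integral>y. h y \<partial>\<mu>)) \<le> transport_T \<sigma> \<mu>"
      using kantorovich_duality[OF th cen \<sigma> True] by blast
    have "ereal (- (\<integral>x. \<phi> x \<partial>\<sigma>) - ln (partition_fun \<phi>)) \<le> entropy_H \<sigma>"
      by (rule gibbs_inequality[OF \<sigma> True dual_pairD(6)[OF d(1)] d(2) dual_pair_integrable(1)[OF cen th d(1)]])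
    from add_mono[OF this d(3)] have "ereal (dual_J \<mu> \<phi> h) \<le> energy_E \<mu> \<sigma>" by (simp add: energy_E_def dual_J_def)
    moreover have "ereal (dual_J \<mu> \<psi> f) \<le> ereal (dual_J \<mu> \<phi> h)" using min[OF d(1)] by simp
    ultimately show ?thesis by (rule order_trans[rotated])
  next
    case False
    then show ?thesis by (simp add: energy_E_def entropy_H_def)
  qed
  then show ?thesis unfolding M_set_def using gp order_trans[OF E] by blast
qed

section \<open>Stability of the minimisers\<close>

text \<open>Along any coupling the difference is the mean of \<open>k (fst z) - k (snd z)\<close>.
  The Lipschitz bound and Jensen's inequality, in the form of a nonnegative variance, compare its
  square with the transport cost, and the infimum is taken at the end.\<close>

lemma integral_lipschitz_diff_le_W2:
  fixes \<mu> \<nu> :: "'a::euclidean_space measure" and k :: "'a \<Rightarrow> real"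
  assumes \<mu>: "sets \<mu> = sets borel" "prob_space \<mu>" "AE y in \<mu>. norm y \<le> D"
    and \<nu>: "sets \<nu> = sets borel" "prob_space \<nu>" "AE y in \<nu>. norm y \<le> D"
    and lip: "\<And>x y. \<bar>k x - k y\<bar> \<le> R * norm (x - y)" and R: "R > 0" and fin: "W2_sq \<mu> \<nu> \<noteq> \<infinity>"
  shows "(\<integral>y. k y \<partial>\<mu>) - (\<integral>y. k y \<partial>\<nu>) \<le> R * enn2real (W2 \<mu> \<nu>)"
proof -
  have km[measurable]: "k \<in> borel_measurable borel" by (intro borel_measurable_continuous_onI lipschitz_continuous[OF lip])
  define d where "d = (\<integral>y. k y \<partial>\<mu>) - (\<integral>y. k y \<partial>\<nu>)"
  have "ennreal ((d / R)\<^sup>2) \<le> W2_sq \<mu> \<nu>"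
    unfolding W2_sq_def
  proof (rule INF_greatest)
    fix \<gamma> assume "\<gamma> \<in> couplings \<mu> \<nu>"
    then have \<gamma>: "sets \<gamma> = sets borel" "prob_space \<gamma>" "distr \<gamma> borel fst = \<mu>" "distr \<gamma> borel snd = \<nu>"
      by (auto simp: couplings_def)
    note [measurable_cong] = \<gamma>(1)
    interpret \<gamma>: prob_space \<gamma> by fact
    have [measurable]: "fst \<in> borel_measurable (borel :: ('a \<times> 'a) measure)" "snd \<in> borel_measurable (borel :: ('a \<times> 'a) measure)"
      by (auto intro!: borel_measurable_continuous_onI continuous_intros)
    have ae: "AE z in \<gamma>. norm (fst z) \<le> D" "AE z in \<gamma>. norm (snd z) \<le> D"
      using \<mu>(3) \<nu>(3) unfolding \<gamma>(3)[symmetric] \<gamma>(4)[symmetric] by (simp_all add: AE_distr_iff)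
    have kb: "\<bar>k x\<bar> \<le> \<bar>k 0\<bar> + R * D" if "norm x \<le> D" for x
    proof -
      have "R * norm x \<le> R * D" using R that by (intro mult_left_mono) auto
      then show ?thesis using lip[of x 0] by simp
    qed
    have "integrable \<gamma> (\<lambda>z. k (fst z))"
      by (rule \<gamma>.integrable_const_bound[where B="\<bar>k 0\<bar> + R * D"]) (use ae(1) kb in \<open>auto elim!: eventually_mono\<close>)
    moreover have "integrable \<gamma> (\<lambda>z. k (snd z))"
      by (rule \<gamma>.integrable_const_bound[where B="\<bar>k 0\<bar> + R * D"]) (use ae(2) kb in \<open>auto elim!: eventually_mono\<close>)
    ultimately have i1: "integrable \<gamma> (\<lambda>z. k (fst z))" "integrable \<gamma> (\<lambda>z. k (snd z))" by blast+
    have nb: "norm (fst z - snd z) \<le> 2 * D" if "norm (fst z) \<le> D" "norm (snd z) \<le> D" for z :: "'a \<times> 'a"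
      using norm_triangle_ineq4[of "fst z" "snd z"] that by simp
    have aen: "AE z in \<gamma>. norm (fst z - snd z) \<le> 2 * D" using ae by eventually_elim (rule nb)
    have i2: "integrable \<gamma> (\<lambda>z. norm (fst z - snd z))"
      by (rule \<gamma>.integrable_const_bound[where B="2 * D"]) (use aen in auto)
    have i3: "integrable \<gamma> (\<lambda>z. (norm (fst z - snd z))\<^sup>2)"
    proof (rule \<gamma>.integrable_const_bound[where B="(2 * D)\<^sup>2"])
      show "AE z in \<gamma>. norm ((norm (fst z - snd z))\<^sup>2) \<le> (2 * D)\<^sup>2" using aen
      proof eventually_elim
        case (elim z)
        then have "(norm (fst z - snd z))\<^sup>2 \<le> (2 * D)\<^sup>2" by (intro power_mono) auto
        then show ?case by (simp only: real_norm_def abs_of_nonneg zero_le_power2)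
      qed
    qed measurable
    have "d = (\<integral>z. k (fst z) - k (snd z) \<partial>\<gamma>)"
    proof -
      have "(\<integral>y. k y \<partial>\<mu>) = (\<integral>z. k (fst z) \<partial>\<gamma>)" unfolding \<gamma>(3)[symmetric] by (subst integral_distr) auto
      moreover have "(\<integral>y. k y \<partial>\<nu>) = (\<integral>z. k (snd z) \<partial>\<gamma>)" unfolding \<gamma>(4)[symmetric] by (subst integral_distr) auto
      ultimately show ?thesis using i1 by (simp add: d_def)
    qed
    then have "\<bar>d\<bar> \<le> (\<integral>z. \<bar>k (fst z) - k (snd z)\<bar> \<partial>\<gamma>)" using integral_abs_bound by simp
    also have "\<dots> \<le> (\<integral>z. R * norm (fst z - snd z) \<partial>\<gamma>)"
      using i1 i2 by (intro integral_mono lip) auto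
    finally have "\<bar>d\<bar> / R \<le> (\<integral>z. norm (fst z - snd z) \<partial>\<gamma>)" using R by (simp add: field_simps)
    then have "(\<bar>d\<bar> / R)\<^sup>2 \<le> (\<integral>z. norm (fst z - snd z) \<partial>\<gamma>)\<^sup>2" using R by (intro power_mono) auto
    also have "\<dots> \<le> (\<integral>z. (norm (fst z - snd z))\<^sup>2 \<partial>\<gamma>)"
      using \<gamma>.variance_eq[OF i2 i3] \<gamma>.variance_positive[of "\<lambda>z. norm (fst z - snd z)"] by simp
    finally have "ennreal ((d / R)\<^sup>2) \<le> ennreal (\<integral>z. (norm (fst z - snd z))\<^sup>2 \<partial>\<gamma>)" by (simp add: ennreal_leI power_divide)
    also have "\<dots> = (\<integral>\<^sup>+z. ennreal ((norm (fst z - snd z))\<^sup>2) \<partial>\<gamma>)"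
      by (rule nn_integral_eq_integral[OF i3, symmetric]) simp
    finally show "ennreal ((d / R)\<^sup>2) \<le> (\<integral>\<^sup>+z. ennreal ((norm (fst z - snd z))\<^sup>2) \<partial>\<gamma>)" .
  qed
  also have "W2_sq \<mu> \<nu> = ennreal (enn2real (W2_sq \<mu> \<nu>))" using fin by (simp add: less_top)
  finally have "(d / R)\<^sup>2 \<le> enn2real (W2_sq \<mu> \<nu>)" by simp
  then have "\<bar>d / R\<bar> \<le> sqrt (enn2real (W2_sq \<mu> \<nu>))" by (intro real_le_rsqrt) (simp only: power2_abs)
  also have "\<dots> = enn2real (W2 \<mu> \<nu>)" using fin by (simp add: W2_def)
  finally have "d / R \<le> enn2real (W2 \<mu> \<nu>)" by (rule abs_le_D1)
  then show ?thesis using R by (simp add: d_def field_simps)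
qed

text \<open>The product measure couples points at distance at most \<open>2 * D\<close>. Finiteness
  matters because \<open>enn2real\<close> sends infinity to zero.\<close>

lemma W2_bounded_support:
  fixes \<mu> \<nu> :: "'a::euclidean_space measure"
  assumes \<mu>: "sets \<mu> = sets borel" "prob_space \<mu>" "AE y in \<mu>. norm y \<le> D"
    and \<nu>: "sets \<nu> = sets borel" "prob_space \<nu>" "AE y in \<nu>. norm y \<le> D" and D: "0 \<le> D"
  shows "W2_sq \<mu> \<nu> \<noteq> \<infinity>" "enn2real (W2 \<mu> \<nu>) \<le> 2 * D"
proof -
  interpret \<mu>: prob_space \<mu> by fact
  interpret \<nu>: prob_space \<nu> by fact
  interpret P: pair_prob_space \<mu> \<nu> ..
  define \<gamma> where "\<gamma> = \<mu> \<Otimes>\<^sub>M \<nu>"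
  have s\<gamma>: "sets \<gamma> = sets borel"
    unfolding \<gamma>_def borel_prod[symmetric] by (intro sets_pair_measure_cong \<mu> \<nu>)
  have sp: "space \<mu> = UNIV" "space \<nu> = UNIV" using \<mu>(1) \<nu>(1) by (auto dest: sets_eq_imp_space_eq)
  note [measurable_cong] = s\<gamma>
  have [measurable]: "fst \<in> borel_measurable (borel :: ('a \<times> 'a) measure)" "snd \<in> borel_measurable (borel :: ('a \<times> 'a) measure)"
    by (auto intro!: borel_measurable_continuous_onI continuous_intros)
  have d1: "distr \<gamma> borel fst = \<mu>"
  proof (rule measure_eqI)
    fix A assume "A \<in> sets (distr \<gamma> borel fst)"
    then have A: "A \<in> sets borel" by simp
    have "emeasure (distr \<gamma> borel fst) A = emeasure \<gamma> (A \<times> UNIV)"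
      using A s\<gamma> by (subst emeasure_distr) (auto intro!: arg_cong[where f="emeasure \<gamma>"] dest: sets_eq_imp_space_eq)
    also have "\<dots> = emeasure \<mu> A" unfolding \<gamma>_def
      using A \<mu>(1) \<nu>.emeasure_space_1 sp by (subst \<nu>.emeasure_pair_measure_Times) (auto simp: sets.top[of \<nu>, simplified sp])
    finally show "emeasure (distr \<gamma> borel fst) A = emeasure \<mu> A" .
  qed (simp add: \<mu>)
  have d2: "distr \<gamma> borel snd = \<nu>"
  proof (rule measure_eqI)
    fix A assume "A \<in> sets (distr \<gamma> borel snd)"
    then have A: "A \<in> sets borel" by simp
    have "emeasure (distr \<gamma> borel snd) A = emeasure \<gamma> (UNIV \<times> A)"
      using A s\<gamma> by (subst emeasure_distr) (auto intro!: arg_cong[where f="emeasure \<gamma>"] dest: sets_eq_imp_space_eq)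
    also have "\<dots> = emeasure \<nu> A" unfolding \<gamma>_def
      using A \<nu>(1) \<mu>.emeasure_space_1 sp by (subst \<nu>.emeasure_pair_measure_Times) (auto simp: sets.top[of \<mu>, simplified sp])
    finally show "emeasure (distr \<gamma> borel snd) A = emeasure \<nu> A" .
  qed (simp add: \<nu>)
  have p\<gamma>: "prob_space \<gamma>" unfolding \<gamma>_def by (rule P.prob_space_axioms)
  have "\<gamma> \<in> couplings \<mu> \<nu>" unfolding couplings_def using s\<gamma> p\<gamma> d1 d2 by simp
  then have "W2_sq \<mu> \<nu> \<le> (\<integral>\<^sup>+z. ennreal ((norm (fst z - snd z))\<^sup>2) \<partial>\<gamma>)" unfolding W2_sq_def by (rule INF_lower)
  also have "\<dots> \<le> (\<integral>\<^sup>+z. ennreal ((2 * D)\<^sup>2) \<partial>\<gamma>)"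
  proof (rule nn_integral_mono_AE)
    have ae: "AE z in \<gamma>. norm (fst z) \<le> D" "AE z in \<gamma>. norm (snd z) \<le> D"
      using \<mu>(3) \<nu>(3) unfolding d1[symmetric] d2[symmetric] by (simp_all add: AE_distr_iff)
    then show "AE z in \<gamma>. ennreal ((norm (fst z - snd z))\<^sup>2) \<le> ennreal ((2 * D)\<^sup>2)"
    proof eventually_elim
      case (elim z)
      have "norm (fst z - snd z) \<le> 2 * D" using norm_triangle_ineq4[of "fst z" "snd z"] elim by simp
      then show ?case by (intro ennreal_leI power_mono) auto
    qed
  qed
  also have "\<dots> = ennreal ((2 * D)\<^sup>2)" using p\<gamma> by (simp add: prob_space.emeasure_space_1)
  finally have le: "W2_sq \<mu> \<nu> \<le> ennreal ((2 * D)\<^sup>2)" .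
  then show fin: "W2_sq \<mu> \<nu> \<noteq> \<infinity>" by (auto simp: top_unique)
  have "enn2real (W2_sq \<mu> \<nu>) \<le> (2 * D)\<^sup>2" using enn2real_mono[OF le] by simp
  then have "sqrt (enn2real (W2_sq \<mu> \<nu>)) \<le> 2 * D" using D by (intro real_le_lsqrt) auto
  then show "enn2real (W2 \<mu> \<nu>) \<le> 2 * D" using fin by (simp add: W2_def)
qed

lemma cutoff_le_cubic:
  fixes t R :: real assumes "0 < R" "0 \<le> t" shows "max 0 (t - R) \<le> t ^ 3 / R\<^sup>2"
proof (cases "t \<le> R")
  case False
  then have "R\<^sup>2 \<le> t\<^sup>2" using assms by (intro power_mono) auto
  then have "t * R\<^sup>2 \<le> t * t\<^sup>2" using assms by (intro mult_left_mono)
  then have "t \<le> t ^ 3 / R\<^sup>2" using assms by (simp add: le_divide_eq power3_eq_cube power2_eq_square mult.assoc)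
  then show ?thesis using assms False by simp
qed (use assms in auto)

text \<open>Restricting the Legendre transform to the ball of radius \<open>R\<close> makes it \<open>R\<close>-Lipschitz, so that its integrals against \<open>\<mu>\<close> and \<open>\<nu>\<close> are comparable; the price is the cubic term.\<close>

lemma midpoint_competitor:
  fixes \<mu> \<nu> :: "'a::euclidean_space measure"
  assumes th: "th > 0" and cm: "centered D th \<mu>" and cn: "centered D th \<nu>"
    and dm: "dual_pair D \<mu> \<psi> f" and dn: "dual_pair D \<nu> \<phi> g" and R: "R > 0"
  obtains W h where "dual_pair D \<mu> W h"
    "(\<integral>y. h y \<partial>\<mu>) \<le> (\<integral>y. f y \<partial>\<mu>) / 2 + (\<integral>y. g y \<partial>\<nu>) / 2 + R * enn2real (W2 \<mu> \<nu>) / 2"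
    "\<And>x y. W ((1/2) *\<^sub>R (x + y)) \<le> \<psi> x / 2 + \<phi> y / 2 + D / R\<^sup>2 * norm y ^ 3"
proof -
  have D: "0 < D" by (rule centered_D_pos[OF cm th])
  interpret \<mu>: prob_space \<mu> by (rule centeredD[OF cm])
  interpret \<nu>: prob_space \<nu> by (rule centeredD[OF cn])
  note [measurable_cong] = centeredD(1)[OF cm] centeredD(1)[OF cn]
  define B where "B = cball (0::'a) R"
  have B: "B \<noteq> {}" "B \<subseteq> cball 0 R" using R by (auto simp: B_def)
  define k where "k y = (SUP x\<in>B. y \<bullet> x - \<phi> x)" for y
  have kbd: "\<forall>y. \<forall>x\<in>B. y \<bullet> x - \<phi> x \<le> norm y * R + D * R - \<phi> 0"
  proof (intro allI ballI)
    fix y x :: 'a assume "x \<in> B"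
    then have x: "norm x \<le> R" by (simp add: B_def)
    have "y \<bullet> x \<le> norm y * norm x" by (rule norm_cauchy_schwarz)
    also have "\<dots> \<le> norm y * R" using x by (intro mult_left_mono) auto
    finally have "y \<bullet> x \<le> norm y * R" .
    moreover have "\<phi> 0 - \<phi> x \<le> D * R"
    proof -
      have "D * norm x \<le> D * R" using D by (intro mult_left_mono x) simp
      moreover have "\<bar>\<phi> 0 - \<phi> x\<bar> \<le> D * norm x" using dual_pairD(2)[OF dn, of 0 x] by simp
      ultimately show ?thesis by linarith
    qed
    ultimately show "y \<bullet> x - \<phi> x \<le> norm y * R + D * R - \<phi> 0" by simp
  qed
  note ks = sup_affine[OF B kbd, folded k_def]
  have [measurable]: "k \<in> borel_measurable borel" by (intro borel_measurable_continuous_onI lipschitz_continuous[OF ks(4)])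
  have kb: "\<bar>k x\<bar> \<le> \<bar>k 0\<bar> + R * D" if "norm x \<le> D" for x
  proof -
    have "R * norm x \<le> R * D" using R that by (intro mult_left_mono) auto
    then show ?thesis using ks(4)[of x 0] by simp
  qed
  have "integrable \<mu> k"
    by (rule \<mu>.integrable_const_bound[where B="\<bar>k 0\<bar> + R * D"]) (use centeredD(3)[OF cm] kb in \<open>auto elim!: eventually_mono\<close>)
  moreover have "integrable \<nu> k"
    by (rule \<nu>.integrable_const_bound[where B="\<bar>k 0\<bar> + R * D"]) (use centeredD(3)[OF cn] kb in \<open>auto elim!: eventually_mono\<close>)
  ultimately have ik: "integrable \<mu> k" "integrable \<nu> k" by blast+
  have kg: "(\<integral>y. k y \<partial>\<nu>) \<le> (\<integral>y. g y \<partial>\<nu>)"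
  proof (rule integral_mono_AE[OF ik(2) dual_pairD(3)[OF dn]])
    show "AE y in \<nu>. k y \<le> g y" using dual_pairD(4)[OF dn]
    proof eventually_elim
      case (elim y)
      show ?case
      proof (rule ks(2))
        fix x
        have "x \<bullet> y \<le> \<phi> x + g y" using elim by blast
        then show "y \<bullet> x - \<phi> x \<le> g y" by (simp add: inner_commute)
      qed
    qed
  qed
  \<comment> \<open>Outside the ball, \<open>x\<close> is replaced by its radial projection
    \<open>x'\<close>. The potential and the inner product each change by at most
    \<open>D * (norm x - R)\<close>, whence the factor \<open>2\<close>.\<close>
  have cut: "x \<bullet> y - k y \<le> \<phi> x + 2 * D * max 0 (norm x - R)" if y: "norm y \<le> D" for x y
  proof (cases "norm x \<le> R")
    case True
    then have "y \<bullet> x \<le> k y + \<phi> x" by (intro ks(1)) (simp add: B_def)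
    then show ?thesis using True by (simp add: inner_commute)
  next
    case False
    define x' where "x' = (R / norm x) *\<^sub>R x"
    have nx: "0 < norm x" using False R by linarith
    have "x - x' = (1 - R / norm x) *\<^sub>R x" by (simp add: x'_def scaleR_diff_left)
    then have "norm (x - x') = \<bar>1 - R / norm x\<bar> * norm x" by simp
    also have "\<dots> = norm x - R" using False nx R by (simp add: abs_if field_simps)
    finally have nd: "norm (x - x') = norm x - R" .
    have "norm x' = R" using nx R by (simp add: x'_def)
    then have "y \<bullet> x' \<le> k y + \<phi> x'" by (intro ks(1)) (simp add: B_def)
    moreover have "\<phi> x' \<le> \<phi> x + D * (norm x - R)" using dual_pairD(2)[OF dn, of x' x] nd by (simp add: norm_minus_commute)
    moreover have "(x - x') \<bullet> y \<le> (norm x - R) * D"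
    proof -
      have "(x - x') \<bullet> y \<le> norm (x - x') * norm y" by (rule norm_cauchy_schwarz)
      also have "\<dots> \<le> (norm x - R) * D" unfolding nd using y False by (intro mult_left_mono) auto
      finally show ?thesis .
    qed
    ultimately show ?thesis using False by (simp add: inner_diff_left inner_commute max_def algebra_simps)
  qed
  define S where "S = {y. norm y \<le> D \<and> (\<forall>x. x \<bullet> y \<le> \<psi> x + f y)}"
  have AES: "AE y in \<mu>. y \<in> S" using centeredD(3)[OF cm] dual_pairD(4)[OF dm] by eventually_elim (simp add: S_def)
  have "S \<noteq> {}"
  proof
    assume "S = {}"
    then have "AE y in \<mu>. False" using AES by simp
    then show False using \<mu>.AE_False by blast
  qed
  moreover have "S \<subseteq> cball 0 D" by (auto simp: S_def)
  ultimately have S: "S \<noteq> {}" "S \<subseteq> cball 0 D" by blast+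
  define h where "h y = f y / 2 + k y / 2" for y
  define W where "W x = (SUP y\<in>S. x \<bullet> y - h y)" for x
  \<comment> \<open>The two halves of \<open>h\<close> pair with the two potentials; the factor
    \<open>2 * D\<close> from \<open>cut\<close> is halved, and the excess over \<open>R\<close> is
    bounded by the cubic term.\<close>
  have mid: "(1/2) *\<^sub>R (x + z) \<bullet> y - h y \<le> \<psi> x / 2 + \<phi> z / 2 + D / R\<^sup>2 * norm z ^ 3" if y: "y \<in> S" for x y z
  proof -
    have xy: "x \<bullet> y \<le> \<psi> x + f y" "norm y \<le> D" using y by (auto simp: S_def)
    define t where "t = D * max 0 (norm z - R)"
    have t: "t \<le> D * (norm z ^ 3 / R\<^sup>2)" unfolding t_def using R D by (intro mult_left_mono cutoff_le_cubic) auto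
    have i: "((1/2) *\<^sub>R (x + z)) \<bullet> y = (x \<bullet> y + z \<bullet> y) / 2" by (simp add: inner_add_left)
    have "z \<bullet> y - k y \<le> \<phi> z + 2 * t" using cut[OF xy(2), of z] by (simp add: t_def mult.assoc)
    then have "((1/2) *\<^sub>R (x + z)) \<bullet> y - h y \<le> \<psi> x / 2 + \<phi> z / 2 + t" unfolding h_def i using xy(1) by argo
    then show ?thesis using t by simp
  qed
  \<comment> \<open>With both points equal, \<open>mid\<close> also gives the pointwise bound that
    makes the supremum finite.\<close>
  have "\<forall>x. \<forall>y\<in>S. x \<bullet> y - h y \<le> \<psi> x / 2 + \<phi> x / 2 + D / R\<^sup>2 * norm x ^ 3"
    using mid[of _ x x for x] by (simp add: scaleR_2[symmetric])
  note Ws = sup_affine[OF S this, folded W_def]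
  show ?thesis
  proof (rule that)
    show "dual_pair D \<mu> W h"
      unfolding dual_pair_def h_def using Ws(3,4) dual_pairD(3)[OF dm] ik(1) AES by (auto elim!: eventually_mono intro: Ws(1)[unfolded h_def])
    have "(\<integral>y. h y \<partial>\<mu>) = (\<integral>y. f y \<partial>\<mu>) / 2 + (\<integral>y. k y \<partial>\<mu>) / 2"
      unfolding h_def using dual_pairD(3)[OF dm] ik(1) by simp
    moreover have "(\<integral>y. k y \<partial>\<mu>) - (\<integral>y. k y \<partial>\<nu>) \<le> R * enn2real (W2 \<mu> \<nu>)"
      using D by (intro integral_lipschitz_diff_le_W2[OF centeredD(1-3)[OF cm] centeredD(1-3)[OF cn] ks(4) R] W2_bounded_support(1)[OF centeredD(1-3)[OF cm] centeredD(1-3)[OF cn]]) auto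
    ultimately show "(\<integral>y. h y \<partial>\<mu>) \<le> (\<integral>y. f y \<partial>\<mu>) / 2 + (\<integral>y. g y \<partial>\<nu>) / 2 + R * enn2real (W2 \<mu> \<nu>) / 2"
      using kg by linarith
    show "W ((1/2) *\<^sub>R (x + y)) \<le> \<psi> x / 2 + \<phi> y / 2 + D / R\<^sup>2 * norm y ^ 3" for x y
      by (rule Ws(2)) (rule mid)
  qed
qed

text \<open>Normalising \<open>exp (- W x)\<close> by the geometric mean of the two partition
  functions, the gap in logarithms says that the resulting \<open>v\<close> has mass at most
  \<open>exp \<delta>\<close>. The bound
  \<open>exp \<delta> \<le> 1 + \<delta> * exp \<delta>\<close> then makes the excess linear in
  small \<open>\<delta>\<close>.\<close>

lemma gibbs_stability_aux:
  fixes \<psi> \<phi> W :: "'a::euclidean_space \<Rightarrow> real"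
  assumes \<psi>: "c > 0" "\<And>x. c * norm x - K \<le> \<psi> x" "\<And>x y. \<bar>\<psi> x - \<psi> y\<bar> \<le> D * norm (x - y)"
    and \<phi>: "\<And>x. c * norm x - K' \<le> \<phi> x" "\<And>x y. \<bar>\<phi> x - \<phi> y\<bar> \<le> D * norm (x - y)"
    and mom: "(\<integral>\<^sup>+x. ennreal ((1 + norm x ^ 6) * (exp (- \<psi> x) / partition_fun \<psi>)) \<partial>lborel) \<le> ennreal M"
      "(\<integral>\<^sup>+x. ennreal ((1 + norm x ^ 6) * (exp (- \<phi> x) / partition_fun \<phi>)) \<partial>lborel) \<le> ennreal M"
    and mean: "(\<integral>x. (exp (- \<psi> x) / partition_fun \<psi>) *\<^sub>R x \<partial>lborel) = 0" "(\<integral>x. (exp (- \<phi> x) / partition_fun \<phi>) *\<^sub>R x \<partial>lborel) = 0"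
    and W: "integrable lborel (\<lambda>x. exp (- W x))" and \<kappa>: "\<kappa> \<ge> 0"
      "\<And>x y. W ((1/2) *\<^sub>R (x + y)) \<le> \<psi> x / 2 + \<phi> y / 2 + \<kappa> * (norm x ^ 3 + norm y ^ 3)"
    and gap: "ln (partition_fun W) \<le> ln (partition_fun \<psi>) / 2 + ln (partition_fun \<phi>) / 2 + \<delta>" "0 \<le> \<delta>" and s: "s > 0"
  shows "W2_sq (gibbs \<psi>) (gibbs \<phi>) \<le> ennreal (8 * s * (\<delta> * exp \<delta> + \<kappa> * M) + 116 * M\<^sup>2 / s)"
proof -
  define Z Y where "Z = partition_fun \<psi>" and "Y = partition_fun \<phi>"
  note g\<psi> = \<psi> and g\<phi> = \<psi>(1) \<phi>
  have Z: "0 < Z" "0 < Y" using gibbs_partition(2)[OF g\<psi>] gibbs_partition(2)[OF g\<phi>] by (auto simp: Z_def Y_def)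
  have PW: "0 < partition_fun W" by (rule integral_exp_pos[OF W])
  have [measurable]: "\<psi> \<in> borel_measurable borel" "\<phi> \<in> borel_measurable borel"
    using gibbs_measurable[OF g\<psi>] gibbs_measurable[OF g\<phi>] by auto
  define v where "v x = exp (- W x) / sqrt (Z * Y)" for x
  have Wm: "(\<lambda>x. exp (- W x)) \<in> borel_measurable borel" using borel_measurable_integrable[OF W] by simp
  show ?thesis
    unfolding gibbs_def
  proof (rule prekopa_leindler_stability[where v=v and B="max (exp K / Z) (exp K' / Y)" and \<epsilon>="\<delta> * exp \<delta>" and \<kappa>=\<kappa>])
    have b: "exp (- h x) / P \<le> exp k / P" if "\<And>x. c * norm x - k \<le> h x" "0 < P" for h :: "'a \<Rightarrow> real" and k P x
    proof -
      have "0 \<le> c * norm x" using \<psi>(1) by simp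
      then have "- h x \<le> k" using that(1)[of x] by linarith
      then show ?thesis using that(2) by (simp add: divide_right_mono)
    qed
    show "exp (- \<psi> x) / partition_fun \<psi> \<le> max (exp K / Z) (exp K' / Y)" for x
      using b[OF \<psi>(2) Z(1), of x] by (simp add: Z_def)
    show "exp (- \<phi> x) / partition_fun \<phi> \<le> max (exp K / Z) (exp K' / Y)" for x
      using b[OF \<phi>(1) Z(2), of x] by (simp add: Y_def)
    show "v \<in> borel_measurable borel" unfolding v_def using Wm by measurable
    show "0 \<le> \<delta> * exp \<delta>" using gap by simp
    show "(\<integral>\<^sup>+x. ennreal (v x) \<partial>lborel) \<le> ennreal (1 + \<delta> * exp \<delta>)"
    proof -
      have "(\<integral>\<^sup>+x. ennreal (v x) \<partial>lborel) = ennreal (\<integral>x. v x \<partial>lborel)"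
        unfolding v_def using W Z by (intro nn_integral_eq_integral) auto
      also have "(\<integral>x. v x \<partial>lborel) = partition_fun W / sqrt (Z * Y)" by (simp add: v_def partition_fun_def)
      also have "\<dots> \<le> exp \<delta>"
      proof -
        have "ln (partition_fun W) \<le> ln (sqrt (Z * Y) * exp \<delta>)"
          using gap(1) Z by (simp add: Z_def[symmetric] Y_def[symmetric] ln_mult_pos ln_sqrt add_divide_distrib)
        then have "partition_fun W \<le> sqrt (Z * Y) * exp \<delta>" using PW Z by simp
        then show ?thesis using Z by (simp add: divide_le_eq mult.commute)
      qed
      also have "exp \<delta> \<le> 1 + \<delta> * exp \<delta>"
      proof -
        have "1 - \<delta> \<le> exp (- \<delta>)" using exp_ge_add_one_self[of "- \<delta>"] by simp
        then have "(1 - \<delta>) * exp \<delta> \<le> exp (- \<delta>) * exp \<delta>" by (intro mult_right_mono) auto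
        then show ?thesis by (simp add: exp_minus algebra_simps)
      qed
      finally show ?thesis by (simp add: ennreal_leI)
    qed
    show "sqrt (exp (- \<psi> x) / partition_fun \<psi> * (exp (- \<phi> y) / partition_fun \<phi>)) * exp (- \<kappa> * (norm x ^ 3 + norm y ^ 3)) \<le> v ((1/2) *\<^sub>R (x + y))" for x y
    proof -
      have sq: "sqrt (exp t) = exp (t / 2)" for t :: real
        by (rule real_sqrt_unique) (simp_all add: exp_double[symmetric])
      have "sqrt (exp (- \<psi> x) / Z * (exp (- \<phi> y) / Y)) = exp (- \<psi> x / 2) * exp (- \<phi> y / 2) / sqrt (Z * Y)"
        by (simp add: real_sqrt_mult real_sqrt_divide sq)
      then have "sqrt (exp (- \<psi> x) / Z * (exp (- \<phi> y) / Y)) * exp (- \<kappa> * (norm x ^ 3 + norm y ^ 3))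
         = exp (- (\<psi> x / 2 + \<phi> y / 2 + \<kappa> * (norm x ^ 3 + norm y ^ 3))) / sqrt (Z * Y)"
        by (simp add: exp_add[symmetric] algebra_simps)
      also have "\<dots> \<le> v ((1/2) *\<^sub>R (x + y))"
        unfolding v_def using \<kappa>(2)[of x y] Z by (intro divide_right_mono) auto
      finally show ?thesis by (simp add: Z_def Y_def)
    qed
    show "0 < exp (- \<psi> x) / partition_fun \<psi>" "0 < exp (- \<phi> x) / partition_fun \<phi>" for x
      using Z by (auto simp: Z_def Y_def)
  qed (use mom mean s \<kappa>(1) nn_integral_gibbs_density[OF g\<psi>] nn_integral_gibbs_density[OF g\<phi>] in auto)
qed

lemma norm_diff_power6_le: "norm (x - a) ^ 6 \<le> 64 * (norm x ^ 6 + norm (a::'a::real_normed_vector) ^ 6)"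
proof -
  define t where "t = max (norm x) (norm a)"
  have "norm (x - a) \<le> 2 * t" using norm_triangle_ineq4[of x a] by (auto simp: t_def)
  then have "norm (x - a) ^ 6 \<le> (2 * t) ^ 6" by (intro power_mono) auto
  also have "\<dots> = 64 * t ^ 6" by (simp add: power_mult_distrib)
  also have "t ^ 6 \<le> norm x ^ 6 + norm a ^ 6" by (auto simp: t_def max_def)
  finally show ?thesis by simp
qed

text \<open>The constant is fixed before the measure. The cone competitor bounds the minimal dual
  value, coercivity turns this into a bound \<open>A\<close> on the integral of \<open>f\<close>,
  and hence into a linear lower bound for the potential with the same constants for all centered
  measures.\<close>

lemma centered_gibbs_minimizer:
  assumes th: "th > 0"
  obtains M where "\<And>\<mu> :: 'a::euclidean_space measure. centered D th \<mu> \<Longrightarrow> \<exists>\<psi> f. dual_pair D \<mu> \<psi> f \<and>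
     (\<forall>\<psi>' f'. dual_pair D \<mu> \<psi>' f' \<longrightarrow> dual_J \<mu> \<psi> f \<le> dual_J \<mu> \<psi>' f') \<and>
     (\<integral>\<^sup>+x. ennreal ((1 + norm x ^ 6) * (exp (- \<psi> x) / partition_fun \<psi>)) \<partial>lborel) \<le> ennreal M \<and>
     (\<integral>x. (exp (- \<psi> x) / partition_fun \<psi>) *\<^sub>R x \<partial>lborel) = 0"
proof -
  define CD where "CD = partition_fun (\<lambda>x::'a. D * norm x)"
  define A where "A = 2 * (- ln CD + ln (partition_fun (\<lambda>x::'a. th / 4 * norm x)))"
  define I where "I = (\<integral>x. (1 + norm x ^ 6) * exp (- (th / 2 * norm x)) \<partial>(lborel::'a measure))"
  define M0 where "M0 = exp A * I / CD"
  show ?thesis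
  proof (rule that[of "64 * (M0 + M0 ^ 6)"])
    fix \<mu> :: "'a measure" assume cen: "centered D th \<mu>"
    have D: "0 < D" by (rule centered_D_pos[OF cen th])
    obtain \<psi> f where dp: "dual_pair D \<mu> \<psi> f" and z: "\<psi> 0 = 0" "\<And>x. 0 \<le> \<psi> x"
      and min: "\<And>\<psi>' f'. dual_pair D \<mu> \<psi>' f' \<Longrightarrow> dual_J \<mu> \<psi> f \<le> dual_J \<mu> \<psi>' f'"
      using dual_minimizer_exists[OF th cen] by blast
    note [measurable] = dual_pairD(6)[OF dp]
    have "dual_J \<mu> \<psi> f \<le> dual_J \<mu> (\<lambda>x. D * norm x) (\<lambda>_. 0)" using D by (intro min dual_pair_cone[OF cen]) auto
    then have "dual_J \<mu> \<psi> f \<le> - ln CD" by (simp add: dual_J_def CD_def)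
    then have fA: "(\<integral>y. f y \<partial>\<mu>) \<le> A" using dual_pair_coercive(1)[OF cen th dp z] by (simp add: A_def)
    have low: "th / 2 * norm x - A \<le> \<psi> x" for x
    proof -
      have 0: "\<psi> 0 \<le> \<psi> x" using z by simp
      show ?thesis using dual_pair_lower[OF cen dp 0] fA by linarith
    qed
    have th2: "0 < th / 2" using th by simp
    note g = th2 low dual_pairD(2)[OF dp]
    define Z where "Z = partition_fun \<psi>"
    have Z: "0 < Z" using gibbs_partition(2)[OF g] by (simp add: Z_def)
    have iD: "integrable lborel (\<lambda>x::'a. exp (- (D * norm x)))" using integrable_exp_norm[OF D] by simp
    have CD: "0 < CD" unfolding CD_def by (rule integral_exp_pos[OF iD])
    \<comment> \<open>The potential vanishes at the origin and is \<open>D\<close>-Lipschitz, so it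
      stays below the cone; this bounds the partition function from below.\<close>
    have CDZ: "CD \<le> Z"
      unfolding CD_def Z_def partition_fun_def
    proof (rule integral_mono[OF iD gibbs_partition(1)[OF g]])
      fix x
      have "\<psi> x \<le> D * norm x" using dual_pairD(2)[OF dp, of x 0] z by simp
      then show "exp (- (D * norm x)) \<le> exp (- \<psi> x)" by simp
    qed
    define p where "p x = exp (- \<psi> x) / Z" for x
    have p0: "0 \<le> p x" for x using Z by (simp add: p_def)
    have [measurable]: "p \<in> borel_measurable borel" unfolding p_def by measurable
    have ip: "integrable lborel (\<lambda>x. p x * norm x ^ k)" for k
      using integrable_gibbs_moment[OF g, of k] by (simp add: p_def Z_def)
    have p1: "(\<integral>x. p x \<partial>lborel) = 1" using Z by (simp add: p_def Z_def partition_fun_def)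
    have ip1: "integrable lborel p" using ip[of 0] by simp
    have i6: "integrable lborel (\<lambda>x. (1 + norm x ^ 6) * p x)"
      using Bochner_Integration.integrable_add[OF ip1 ip[of 6]] by (simp add: algebra_simps)
    have m0: "(\<integral>x. (1 + norm x ^ 6) * p x \<partial>lborel) \<le> M0"
    proof -
      have iI: "integrable lborel (\<lambda>x::'a. (1 + norm x ^ 6) * exp (- (th / 2 * norm x)))"
        using Bochner_Integration.integrable_add[OF integrable_power_exp_minus[of "\<lambda>x::'a. th / 2 * norm x" "th / 2" 0 0] integrable_power_exp_minus[of "\<lambda>x::'a. th / 2 * norm x" "th / 2" 0 6]] th
        by (simp add: algebra_simps)
      have "(\<integral>x. (1 + norm x ^ 6) * p x \<partial>lborel) \<le> (\<integral>x. exp A / CD * ((1 + norm x ^ 6) * exp (- (th / 2 * norm x))) \<partial>(lborel::'a measure))"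
      proof (rule integral_mono[OF i6])
        show "integrable lborel (\<lambda>x::'a. exp A / CD * ((1 + norm x ^ 6) * exp (- (th / 2 * norm x))))"
          using iI by (intro integrable_mult_right)
        fix x :: 'a
        have "p x \<le> exp (A - th / 2 * norm x) / CD"
          unfolding p_def using low[of x] CDZ CD by (intro frac_le) auto
        then have "(1 + norm x ^ 6) * p x \<le> (1 + norm x ^ 6) * (exp (A - th / 2 * norm x) / CD)" by (intro mult_left_mono) auto
        also have "\<dots> = exp A / CD * ((1 + norm x ^ 6) * exp (- (th / 2 * norm x)))"
        proof -
          have e: "exp (A - th / 2 * norm x) = exp A * exp (- (th / 2 * norm x))" by (simp add: exp_add[symmetric])
          show ?thesis unfolding e by (simp add: mult_ac)
        qed
        finally show "(1 + norm x ^ 6) * p x \<le> exp A / CD * ((1 + norm x ^ 6) * exp (- (th / 2 * norm x)))" .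
      qed
      also have "\<dots> = exp A / CD * I" by (simp only: integral_mult_right_zero I_def)
      also have "\<dots> = M0" by (simp add: M0_def)
      finally show ?thesis .
    qed
    \<comment> \<open>So far the minimum of the potential sits at the origin, as the growth bound
      requires; stability needs the barycenter there instead. The second translation keeps
      \<open>dual_J\<close> and costs the factor \<open>64 = 2 ^ 6\<close> and the term
      \<open>M0 ^ 6\<close> in the moments.\<close>
    define a where "a = (\<integral>x. p x *\<^sub>R x \<partial>lborel)"
    have ipx: "integrable lborel (\<lambda>x. p x *\<^sub>R x)"
      by (rule Bochner_Integration.integrable_bound[OF ip[of 1]]) (auto simp: p0)
    have am: "norm a \<le> M0"
    proof -
      have "norm a \<le> (\<integral>x. (1 + norm x ^ 6) * p x \<partial>lborel)"
        unfolding a_def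
      proof (rule Bochner_Integration.integral_norm_bound_integral[OF ipx i6])
        fix x :: 'a
        have "norm x ^ 1 \<le> 1 + norm x ^ 6" by (rule power_le_one_plus_power6) auto
        then have "norm x * p x \<le> (1 + norm x ^ 6) * p x" using p0[of x] by (intro mult_right_mono) auto
        moreover have "norm (p x *\<^sub>R x) = norm x * p x" using p0[of x] by simp
        ultimately show "norm (p x *\<^sub>R x) \<le> (1 + norm x ^ 6) * p x" by linarith
      qed
      then show ?thesis using m0 by simp
    qed
    define \<phi> where "\<phi> x = \<psi> (x + a) + 0" for x
    define h where "h y = f y - y \<bullet> a - 0" for y
    have dph: "dual_pair D \<mu> \<phi> h" unfolding \<phi>_def h_def by (rule dual_pair_translate(1)[OF cen dp])
    have Jh: "dual_J \<mu> \<phi> h = dual_J \<mu> \<psi> f" unfolding \<phi>_def h_def by (rule dual_J_translate[OF cen th dp])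
    have Zh: "partition_fun \<phi> = Z" unfolding \<phi>_def Z_def using partition_fun_translate[of \<psi> a 0] by simp
    have pp: "exp (- \<phi> x) / partition_fun \<phi> = p (x + a)" for x by (simp add: Zh p_def \<phi>_def)
    have "(\<integral>\<^sup>+x. ennreal ((1 + norm x ^ 6) * p (x + a)) \<partial>lborel) = (\<integral>\<^sup>+x. ennreal ((1 + norm (x - a) ^ 6) * p x) \<partial>lborel)"
      using nn_integral_lborel_translate[of "\<lambda>x. ennreal ((1 + norm (x - a) ^ 6) * p x)" a] by (simp add: add.commute)
    also have "\<dots> \<le> (\<integral>\<^sup>+x. ennreal (64 * ((1 + norm x ^ 6) * p x) + 64 * norm a ^ 6 * p x) \<partial>lborel)"
    proof (intro nn_integral_mono ennreal_leI)
      fix x :: 'a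
      have "(1 + norm (x - a) ^ 6) * p x \<le> (64 * (1 + norm x ^ 6) + 64 * norm a ^ 6) * p x"
        using norm_diff_power6_le[of x a] p0[of x] by (intro mult_right_mono) auto
      then show "(1 + norm (x - a) ^ 6) * p x \<le> 64 * ((1 + norm x ^ 6) * p x) + 64 * norm a ^ 6 * p x" by (simp add: algebra_simps)
    qed
    also have "\<dots> = ennreal (\<integral>x. 64 * ((1 + norm x ^ 6) * p x) + 64 * norm a ^ 6 * p x \<partial>lborel)"
      using i6 ip1 p0 by (intro nn_integral_eq_integral) auto
    also have "(\<integral>x. 64 * ((1 + norm x ^ 6) * p x) + 64 * norm a ^ 6 * p x \<partial>lborel) = 64 * (\<integral>x. (1 + norm x ^ 6) * p x \<partial>lborel) + 64 * norm a ^ 6"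
      using i6 ip1 p1 by simp
    also have "\<dots> \<le> 64 * (M0 + M0 ^ 6)" using m0 power_mono[OF am norm_ge_zero, of 6] by simp
    finally have mom: "(\<integral>\<^sup>+x. ennreal ((1 + norm x ^ 6) * p (x + a)) \<partial>lborel) \<le> ennreal (64 * (M0 + M0 ^ 6))" by (simp add: ennreal_leI)
    have "(\<integral>x. p (x + a) *\<^sub>R x \<partial>lborel) = (\<integral>x. p x *\<^sub>R (x - a) \<partial>lborel)"
      using integral_lborel_translate[of "\<lambda>x. p x *\<^sub>R (x - a)" a] by simp
    also have "\<dots> = (\<integral>x. p x *\<^sub>R x \<partial>lborel) - (\<integral>x. p x *\<^sub>R a \<partial>lborel)"
      using ipx ip1 by (simp add: scaleR_diff_right)
    also have "\<dots> = 0" using ip1 p1 by (simp add: a_def[symmetric])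
    finally have mean: "(\<integral>x. p (x + a) *\<^sub>R x \<partial>lborel) = 0" .
    show "\<exists>\<psi> f. dual_pair D \<mu> \<psi> f \<and> (\<forall>\<psi>' f'. dual_pair D \<mu> \<psi>' f' \<longrightarrow> dual_J \<mu> \<psi> f \<le> dual_J \<mu> \<psi>' f') \<and>
       (\<integral>\<^sup>+x. ennreal ((1 + norm x ^ 6) * (exp (- \<psi> x) / partition_fun \<psi>)) \<partial>lborel) \<le> ennreal (64 * (M0 + M0 ^ 6)) \<and>
       (\<integral>x. (exp (- \<psi> x) / partition_fun \<psi>) *\<^sub>R x \<partial>lborel) = 0"
      by (rule exI[of _ \<phi>], rule exI[of _ h], unfold pp) (use dph min Jh mom mean in auto)
  qed
qed

lemma gibbs_W2_sq_le:
  fixes \<mu> \<nu> :: "'a::euclidean_space measure"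
  assumes th: "th > 0" and cm: "centered D th \<mu>" and cn: "centered D th \<nu>"
    and dm: "dual_pair D \<mu> \<psi> f" "\<And>\<psi>' f'. dual_pair D \<mu> \<psi>' f' \<Longrightarrow> dual_J \<mu> \<psi> f \<le> dual_J \<mu> \<psi>' f'"
    and dn: "dual_pair D \<nu> \<phi> g" "\<And>\<psi>' f'. dual_pair D \<nu> \<psi>' f' \<Longrightarrow> dual_J \<nu> \<phi> g \<le> dual_J \<nu> \<psi>' f'"
    and mom: "(\<integral>\<^sup>+x. ennreal ((1 + norm x ^ 6) * (exp (- \<psi> x) / partition_fun \<psi>)) \<partial>lborel) \<le> ennreal M"
      "(\<integral>\<^sup>+x. ennreal ((1 + norm x ^ 6) * (exp (- \<phi> x) / partition_fun \<phi>)) \<partial>lborel) \<le> ennreal M"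
    and mean: "(\<integral>x. (exp (- \<psi> x) / partition_fun \<psi>) *\<^sub>R x \<partial>lborel) = 0" "(\<integral>x. (exp (- \<phi> x) / partition_fun \<phi>) *\<^sub>R x \<partial>lborel) = 0"
    and R: "R > 0" and s: "s > 0" and w: "enn2real (W2 \<mu> \<nu>) \<le> w" "enn2real (W2 \<nu> \<mu>) \<le> w"
  shows "W2_sq (gibbs \<psi>) (gibbs \<phi>) \<le> ennreal (8 * s * (R * w / 2 * exp (R * w / 2) + D / R\<^sup>2 * M) + 116 * M\<^sup>2 / s)"
proof -
  have D: "0 < D" by (rule centered_D_pos[OF cm th])
  obtain K where K: "\<And>x. th / 2 * norm x - K \<le> \<psi> x" using dual_pair_integrable(3)[OF cm th dm(1)] by blast
  obtain K' where K': "\<And>x. th / 2 * norm x - K' \<le> \<phi> x" using dual_pair_integrable(3)[OF cn th dn(1)] by blast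
  have th2: "0 < th / 2" using th by simp
  have w0: "0 \<le> w" using w(1) enn2real_nonneg[of "W2 \<mu> \<nu>"] by linarith
  \<comment> \<open>The competitor is tested for the measure with the larger dual value: the mean of
    both values does not exceed the value it has to beat, so only the transport error
    \<open>R * w / 2\<close> is left. In the other case the measures exchange roles, which puts the
    cubic term on the other variable.\<close>
  have half: "\<exists>W. integrable lborel (\<lambda>x. exp (- W x)) \<and> (\<forall>x y. W ((1/2) *\<^sub>R (x + y)) \<le> \<psi>1 x / 2 + \<psi>2 y / 2 + D / R\<^sup>2 * norm y ^ 3) \<and>
      ln (partition_fun W) \<le> ln (partition_fun \<psi>1) / 2 + ln (partition_fun \<psi>2) / 2 + R * w / 2"
    if c: "centered D th \<alpha>" "centered D th \<beta>" and d: "dual_pair D \<alpha> \<psi>1 f1" "dual_pair D \<beta> \<psi>2 f2"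
      and m: "\<And>\<psi>' f'. dual_pair D \<alpha> \<psi>' f' \<Longrightarrow> dual_J \<alpha> \<psi>1 f1 \<le> dual_J \<alpha> \<psi>' f'"
      and le: "dual_J \<beta> \<psi>2 f2 \<le> dual_J \<alpha> \<psi>1 f1" and wle: "enn2real (W2 \<alpha> \<beta>) \<le> w" for \<alpha> \<beta> :: "'a measure" and \<psi>1 \<psi>2 f1 f2
  proof -
    obtain W h where W: "dual_pair D \<alpha> W h"
      "(\<integral>y. h y \<partial>\<alpha>) \<le> (\<integral>y. f1 y \<partial>\<alpha>) / 2 + (\<integral>y. f2 y \<partial>\<beta>) / 2 + R * enn2real (W2 \<alpha> \<beta>) / 2"
      "\<And>x y. W ((1/2) *\<^sub>R (x + y)) \<le> \<psi>1 x / 2 + \<psi>2 y / 2 + D / R\<^sup>2 * norm y ^ 3"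
      using midpoint_competitor[OF th c d R] by blast
    have "R * enn2real (W2 \<alpha> \<beta>) \<le> R * w" using R wle by (intro mult_left_mono) auto
    then have "ln (partition_fun W) \<le> ln (partition_fun \<psi>1) / 2 + ln (partition_fun \<psi>2) / 2 + R * w / 2"
      using m[OF W(1)] W(2) le unfolding dual_J_def by argo
    then show ?thesis using dual_pair_integrable(1)[OF c(1) th W(1)] W(3) by blast
  qed
  have \<kappa>: "0 \<le> D / R\<^sup>2" using D by simp
  have \<delta>: "0 \<le> R * w / 2" using R w0 by simp
  have "\<exists>W. integrable lborel (\<lambda>x. exp (- W x)) \<and> (\<forall>x y. W ((1/2) *\<^sub>R (x + y)) \<le> \<psi> x / 2 + \<phi> y / 2 + D / R\<^sup>2 * (norm x ^ 3 + norm y ^ 3)) \<and>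
      ln (partition_fun W) \<le> ln (partition_fun \<psi>) / 2 + ln (partition_fun \<phi>) / 2 + R * w / 2"
  proof (cases "dual_J \<nu> \<phi> g \<le> dual_J \<mu> \<psi> f")
    case True
    obtain W where W: "integrable lborel (\<lambda>x. exp (- W x))" "\<And>x y. W ((1/2) *\<^sub>R (x + y)) \<le> \<psi> x / 2 + \<phi> y / 2 + D / R\<^sup>2 * norm y ^ 3"
      "ln (partition_fun W) \<le> ln (partition_fun \<psi>) / 2 + ln (partition_fun \<phi>) / 2 + R * w / 2"
      using half[OF cm cn dm(1) dn(1) dm(2) True w(1)] by blast
    have "W ((1/2) *\<^sub>R (x + y)) \<le> \<psi> x / 2 + \<phi> y / 2 + D / R\<^sup>2 * (norm x ^ 3 + norm y ^ 3)" for x y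
    proof -
      have "D / R\<^sup>2 * norm y ^ 3 \<le> D / R\<^sup>2 * (norm x ^ 3 + norm y ^ 3)" using \<kappa> by (intro mult_left_mono) auto
      then show ?thesis using W(2)[of x y] by linarith
    qed
    then show ?thesis using W by blast
  next
    case False
    then have le: "dual_J \<mu> \<psi> f \<le> dual_J \<nu> \<phi> g" by simp
    obtain W where W: "integrable lborel (\<lambda>x. exp (- W x))" "\<And>x y. W ((1/2) *\<^sub>R (x + y)) \<le> \<phi> x / 2 + \<psi> y / 2 + D / R\<^sup>2 * norm y ^ 3"
      "ln (partition_fun W) \<le> ln (partition_fun \<phi>) / 2 + ln (partition_fun \<psi>) / 2 + R * w / 2"
      using half[OF cn cm dn(1) dm(1) dn(2) le w(2)] by blast
    have "W ((1/2) *\<^sub>R (x + y)) \<le> \<psi> x / 2 + \<phi> y / 2 + D / R\<^sup>2 * (norm x ^ 3 + norm y ^ 3)" for x y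
    proof -
      have "D / R\<^sup>2 * norm x ^ 3 \<le> D / R\<^sup>2 * (norm x ^ 3 + norm y ^ 3)" using \<kappa> by (intro mult_left_mono) auto
      then show ?thesis using W(2)[of y x] unfolding add.commute[of y x] by linarith
    qed
    moreover have "ln (partition_fun W) \<le> ln (partition_fun \<psi>) / 2 + ln (partition_fun \<phi>) / 2 + R * w / 2" using W(3) by linarith
    ultimately show ?thesis using W(1) by blast
  qed
  then obtain W where W: "integrable lborel (\<lambda>x. exp (- W x))" "\<And>x y. W ((1/2) *\<^sub>R (x + y)) \<le> \<psi> x / 2 + \<phi> y / 2 + D / R\<^sup>2 * (norm x ^ 3 + norm y ^ 3)"
    "ln (partition_fun W) \<le> ln (partition_fun \<psi>) / 2 + ln (partition_fun \<phi>) / 2 + R * w / 2" by blast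
  show ?thesis
    by (rule gibbs_stability_aux[OF th2 K dual_pairD(2)[OF dm(1)] K' dual_pairD(2)[OF dn(1)] mom mean W(1) \<kappa> W(2,3) \<delta> s])
qed

text \<open>As the barycenter is the origin, a point \<open>y\<close> of the set is the mean of the
  differences \<open>y - z\<close>, so its norm is at most the diameter. Thus the position of the
  set does not enter the constants.\<close>

lemma K_set_centered:
  assumes "compact \<Omega>" "diameter \<Omega> = D" "\<mu> \<in> K_set \<Omega> th"
  shows "centered D th \<mu>"
proof -
  have \<mu>: "sets \<mu> = sets borel" "prob_space \<mu>" "emeasure \<mu> \<Omega> = 1" "(\<integral>y. y \<partial>\<mu>) = 0" "Theta \<mu> \<ge> th"
    using assms(3) by (auto simp: K_set_def prob_on_def prob_measures_def)
  interpret prob_space \<mu> by fact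
  note [measurable_cong] = \<mu>(1)
  have \<Omega>m: "\<Omega> \<in> sets \<mu>" using \<mu>(1) borel_closed[OF compact_imp_closed[OF assms(1)]] by simp
  have ae: "AE y in \<mu>. y \<in> \<Omega>"
    by (rule AE_in_set_eq_1[THEN iffD2, OF \<Omega>m]) (simp add: measure_def \<mu>(3))
  obtain b where b: "\<And>y. y \<in> \<Omega> \<Longrightarrow> norm y \<le> b" using compact_imp_bounded[OF assms(1)] by (auto simp: bounded_iff)
  have i: "integrable \<mu> (\<lambda>y. y)"
    by (rule integrable_const_bound[where B=b]) (use ae b in \<open>auto elim!: eventually_mono\<close>)
  have D: "norm y \<le> D" if y: "y \<in> \<Omega>" for y
  proof -
    have "y = (\<integral>z. y - z \<partial>\<mu>)" using i \<mu>(4) by (simp add: prob_space)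
    then have "norm y \<le> (\<integral>z. norm (y - z) \<partial>\<mu>)" using integral_norm_bound[of \<mu> "\<lambda>z. y - z"] by simp
    also have "\<dots> \<le> (\<integral>z. D \<partial>\<mu>)"
    proof (rule integral_mono_AE)
      show "integrable \<mu> (\<lambda>z. norm (y - z))" using i by auto
      show "AE z in \<mu>. norm (y - z) \<le> D" using ae
      proof eventually_elim
        case (elim z)
        then show ?case using diameter_bounded_bound[OF compact_imp_bounded[OF assms(1)] y elim] assms(2) by (simp add: dist_norm)
      qed
    qed auto
    finally show ?thesis by (simp add: prob_space)
  qed
  have th: "th * norm x \<le> (\<integral>y. \<bar>y \<bullet> x\<bar> \<partial>\<mu>)" for x
  proof (cases "x = 0")
    case False
    define e where "e = (1 / norm x) *\<^sub>R x"
    have e: "e \<in> sphere 0 1" using False by (simp add: e_def)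
    have "Theta \<mu> \<le> (\<integral>y. \<bar>y \<bullet> e\<bar> \<partial>\<mu>)"
      unfolding Theta_def by (rule cINF_lower[OF _ e]) (auto intro!: bdd_belowI2[of _ 0])
    then have "th * norm x \<le> (\<integral>y. \<bar>y \<bullet> e\<bar> \<partial>\<mu>) * norm x" using \<mu>(5) by (intro mult_right_mono) auto
    also have "\<dots> = (\<integral>y. \<bar>y \<bullet> e\<bar> * norm x \<partial>\<mu>)" by simp
    also have "(\<lambda>y. \<bar>y \<bullet> e\<bar> * norm x) = (\<lambda>y. \<bar>y \<bullet> x\<bar>)" using False by (simp add: e_def abs_mult)
    finally show ?thesis .
  qed simp
  show ?thesis unfolding centered_def using \<mu> th ae D by (auto elim: eventually_mono)
qed

text \<open>The target exponent is at most \<open>1/6\<close>, so the spare factor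
  \<open>w powr (1/6 - e)\<close> is bounded by a power of \<open>b\<close> with exponent at most
  one.\<close>

lemma powr_exponent_shift:
  fixes w b p :: real assumes "0 < w" "w \<le> b" "1 \<le> b" "p > 2"
  shows "w powr (1/6) \<le> b * w powr ((p - 2) / (6 * p - 4))"
proof -
  define e where "e = (p - 2) / (6 * p - 4)"
  have e: "0 \<le> e" "e \<le> 1/6" using assms by (auto simp: e_def field_simps)
  have "w powr (1/6) = w powr (1/6 - e) * w powr e" by (simp add: powr_add[symmetric])
  also have "w powr (1/6 - e) \<le> b powr (1/6 - e)" using assms e by (intro powr_mono2) auto
  also have "b powr (1/6 - e) \<le> b powr 1" using assms e by (intro powr_mono) auto
  finally show ?thesis using assms by (simp add: e_def mult_right_mono)
qed

theorem theorem4p7: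
  fixes D th :: real
  assumes "th > 0"
  shows "\<exists>A B :: real. \<forall>\<Omega> :: 'a::euclidean_space set.
           convex \<Omega> \<and> compact \<Omega> \<and> diameter \<Omega> = D \<longrightarrow>
           (\<forall>p :: real. p > 2 \<longrightarrow>
              (\<forall>\<mu>\<in>K_set \<Omega> th. \<forall>\<nu>\<in>K_set \<Omega> th.
                 dist_W2 (M_set \<mu>) (M_set \<nu>)
                   \<le> ennreal ((A + B * p) * enn2real (W2 \<mu> \<nu>) powr ((p - 2) / (6 * p - 4)))))"
proof -
  obtain M where M: "\<And>\<mu> :: 'a measure. centered D th \<mu> \<Longrightarrow> \<exists>\<psi> f. dual_pair D \<mu> \<psi> f \<and>
     (\<forall>\<psi>' f'. dual_pair D \<mu> \<psi>' f' \<longrightarrow> dual_J \<mu> \<psi> f \<le> dual_J \<mu> \<psi>' f') \<and>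
     (\<integral>\<^sup>+x. ennreal ((1 + norm x ^ 6) * (exp (- \<psi> x) / partition_fun \<psi>)) \<partial>lborel) \<le> ennreal M \<and>
     (\<integral>x. (exp (- \<psi> x) / partition_fun \<psi>) *\<^sub>R x \<partial>lborel) = 0"
    using centered_gibbs_minimizer[OF assms] by blast
  \<comment> \<open>\<open>h\<close> bounds \<open>w powr (2/3) / 2\<close>, the argument of the
    exponential after the choice of scales, through \<open>w \<le> 2 * D\<close>. The three terms of
    \<open>C\<close> come from the transport error, the cutoff error and the Gaussian
    localisation.\<close>
  define h where "h = (2 * D) powr (2/3) / 2"
  define C where "C = 4 * exp h + 8 * D * M + 116 * M\<^sup>2"
  define A where "A = sqrt C * max 1 (2 * D)"
  show ?thesis
  \<comment> \<open>The slope in \<open>p\<close> is taken to be zero: the constant obtained is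
    uniform in \<open>p\<close>, a special case of linear growth.\<close>
  proof (rule exI[of _ A], rule exI[of _ 0], intro allI impI ballI, elim conjE)
    fix \<Omega> :: "'a set" and p :: real and \<mu> \<nu>
    assume \<Omega>: "compact \<Omega>" "diameter \<Omega> = D" and p: "p > 2" and \<mu>: "\<mu> \<in> K_set \<Omega> th" and \<nu>: "\<nu> \<in> K_set \<Omega> th"
    have cm: "centered D th \<mu>" and cn: "centered D th \<nu>" using K_set_centered[OF \<Omega>] \<mu> \<nu> by auto
    have D: "0 < D" by (rule centered_D_pos[OF cm assms])
    obtain \<psi> f where dm: "dual_pair D \<mu> \<psi> f" "\<And>\<psi>' f'. dual_pair D \<mu> \<psi>' f' \<Longrightarrow> dual_J \<mu> \<psi> f \<le> dual_J \<mu> \<psi>' f'"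
      and mm: "(\<integral>\<^sup>+x. ennreal ((1 + norm x ^ 6) * (exp (- \<psi> x) / partition_fun \<psi>)) \<partial>lborel) \<le> ennreal M"
         "(\<integral>x. (exp (- \<psi> x) / partition_fun \<psi>) *\<^sub>R x \<partial>lborel) = 0"
      using M[OF cm] by blast
    obtain \<phi> g where dn: "dual_pair D \<nu> \<phi> g" "\<And>\<psi>' f'. dual_pair D \<nu> \<psi>' f' \<Longrightarrow> dual_J \<nu> \<phi> g \<le> dual_J \<nu> \<psi>' f'"
      and nn: "(\<integral>\<^sup>+x. ennreal ((1 + norm x ^ 6) * (exp (- \<phi> x) / partition_fun \<phi>)) \<partial>lborel) \<le> ennreal M"
         "(\<integral>x. (exp (- \<phi> x) / partition_fun \<phi>) *\<^sub>R x \<partial>lborel) = 0"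
      using M[OF cn] by blast
    have g1: "gibbs \<psi> \<in> M_set \<mu>" using gibbs_in_M_set[OF assms cm] dm by blast
    have g2: "gibbs \<phi> \<in> M_set \<nu>" using gibbs_in_M_set[OF assms cn] dn by blast
    \<comment> \<open>A positive density has a positive moment, while \<open>ennreal\<close> of a
      negative number is zero.\<close>
    have M0: "0 \<le> M"
    proof (rule ccontr)
      assume "\<not> 0 \<le> M"
      then have "(\<integral>\<^sup>+x. ennreal ((1 + norm x ^ 6) * (exp (- \<psi> x) / partition_fun \<psi>)) \<partial>lborel) \<le> 0" using mm(1) by (simp add: ennreal_neg)
      moreover have "0 < (\<integral>\<^sup>+x. ennreal ((1 + norm x ^ 6) * (exp (- \<psi> x) / partition_fun \<psi>)) \<partial>lborel)"
      proof (rule nn_integral_pos_real)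
        have "\<psi> \<in> borel_measurable borel" by (rule dual_pairD[OF dm(1)])
        then show "(\<lambda>x. (1 + norm x ^ 6) * (exp (- \<psi> x) / partition_fun \<psi>)) \<in> borel_measurable lborel" by simp
        show "0 < (1 + norm x ^ 6) * (exp (- \<psi> x) / partition_fun \<psi>)" for x
          using dual_pair_integrable(2)[OF cm assms dm(1)] by (intro mult_pos_pos divide_pos_pos add_pos_nonneg) auto
      qed
      ultimately show False by simp
    qed
    define w where "w = enn2real (W2 \<mu> \<nu>)"
    \<comment> \<open>Swapping the factors of a coupling. Both orders of the distance enter because
      either measure may have the larger dual value.\<close>
    have sym: "W2_sq \<beta> \<alpha> \<le> W2_sq \<alpha> \<beta>" for \<alpha> \<beta> :: "'a measure"
      unfolding W2_sq_def
    proof (rule INF_greatest)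
      fix \<gamma> assume "\<gamma> \<in> couplings \<alpha> \<beta>"
      then have \<gamma>: "sets \<gamma> = sets borel" "prob_space \<gamma>" "distr \<gamma> borel fst = \<alpha>" "distr \<gamma> borel snd = \<beta>"
        by (auto simp: couplings_def)
      note [measurable_cong] = \<gamma>(1)
      have [measurable]: "fst \<in> borel_measurable (borel :: ('a \<times> 'a) measure)" "snd \<in> borel_measurable (borel :: ('a \<times> 'a) measure)"
        by (auto intro!: borel_measurable_continuous_onI continuous_intros)
      have sw[measurable]: "(\<lambda>z. (snd z, fst z)) \<in> borel_measurable (borel :: ('a \<times> 'a) measure)"
        by (intro borel_measurable_continuous_onI continuous_intros)
      have "distr \<gamma> borel (\<lambda>z. (snd z, fst z)) \<in> couplings \<beta> \<alpha>"
        unfolding couplings_def mem_Collect_eq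
        using \<gamma> by (intro conjI prob_space.prob_space_distr[OF \<gamma>(2)]) (auto simp: distr_distr comp_def)
      then have "(INF \<gamma>\<in>couplings \<beta> \<alpha>. \<integral>\<^sup>+z. ennreal ((norm (fst z - snd z))\<^sup>2) \<partial>\<gamma>) \<le> (\<integral>\<^sup>+z. ennreal ((norm (fst z - snd z))\<^sup>2) \<partial>(distr \<gamma> borel (\<lambda>z. (snd z, fst z))))"
        by (rule INF_lower)
      also have "\<dots> = (\<integral>\<^sup>+z. ennreal ((norm (fst z - snd z))\<^sup>2) \<partial>\<gamma>)"
        by (subst nn_integral_distr) (auto simp: norm_minus_commute)
      finally show "(INF \<gamma>\<in>couplings \<beta> \<alpha>. \<integral>\<^sup>+z. ennreal ((norm (fst z - snd z))\<^sup>2) \<partial>\<gamma>) \<le> (\<integral>\<^sup>+z. ennreal ((norm (fst z - snd z))\<^sup>2) \<partial>\<gamma>)" .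
    qed
    have "W2_sq \<nu> \<mu> = W2_sq \<mu> \<nu>" using sym[of \<nu> \<mu>] sym[of \<mu> \<nu>] by (rule antisym)
    then have w': "enn2real (W2 \<nu> \<mu>) \<le> w" by (simp add: w_def W2_def)
    have w0: "0 \<le> w" by (simp add: w_def)
    have wD: "w \<le> 2 * D" unfolding w_def
      using D by (intro W2_bounded_support(2)[OF centeredD(1-3)[OF cm] centeredD(1-3)[OF cn]]) auto
    have key: "W2_sq (gibbs \<psi>) (gibbs \<phi>) \<le> ennreal (8 * s * (R * w / 2 * exp (R * w / 2) + D / R\<^sup>2 * M) + 116 * M\<^sup>2 / s)"
      if "0 < R" "0 < s" for R s
      by (rule gibbs_W2_sq_le[OF assms cm cn dm dn mm(1) nn(1) mm(2) nn(2) that eq_refl[OF w_def[symmetric]] w'])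
    have C0: "0 \<le> C" using D M0 by (simp add: C_def)
    have bound: "W2_sq (gibbs \<psi>) (gibbs \<phi>) \<le> ennreal (C * w powr (1/3))"
    proof (cases "w = 0")
      case True
      have "W2_sq (gibbs \<psi>) (gibbs \<phi>) \<le> ennreal ((8 * (D * M) + 116 * M\<^sup>2) / real (Suc n))" for n
      proof -
        define r where "r = real (Suc n)"
        have r: "0 < r" by (simp add: r_def)
        have "8 * r * (r * w / 2 * exp (r * w / 2) + D / r\<^sup>2 * M) + 116 * M\<^sup>2 / r = (8 * (D * M) + 116 * M\<^sup>2) / r"
          using r True by (simp add: power2_eq_square field_simps)
        then show ?thesis using key[OF r r] by (simp add: r_def)
      qed
      moreover have "(\<lambda>n. ennreal ((8 * (D * M) + 116 * M\<^sup>2) * (1 / real (Suc n)))) \<longlonglongrightarrow> ennreal ((8 * (D * M) + 116 * M\<^sup>2) * 0)"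
        by (intro tendsto_ennrealI tendsto_intros LIMSEQ_Suc[OF lim_1_over_n])
      ultimately have "W2_sq (gibbs \<psi>) (gibbs \<phi>) \<le> ennreal ((8 * (D * M) + 116 * M\<^sup>2) * 0)"
        by (intro LIMSEQ_le_const) auto
      then show ?thesis by (simp add: True)
    next
      case False
      then have wp: "0 < w" using w0 by simp
      \<comment> \<open>With \<open>s = R\<close> the three errors \<open>s * R * w\<close>,
        \<open>s / R^2\<close> and \<open>1 / s\<close> all equal \<open>w powr (1/3)\<close>, up to
        the constants collected in \<open>C\<close>.\<close>
      define R where "R = w powr (- (1/3))"
      have R: "0 < R" using wp by (simp add: R_def)
      have Rw: "R * w = w powr (2/3)"
      proof -
        have "R * w = w powr (- (1/3)) * w powr 1" using wp by (simp add: R_def)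
        also have "\<dots> = w powr (2/3)" by (subst powr_add[symmetric]) simp
        finally show ?thesis .
      qed
      have R2: "1 / R\<^sup>2 = w powr (2/3)"
        using wp by (simp add: R_def powr_minus power2_eq_square powr_add[symmetric] divide_simps)
      have R1: "1 / R = w powr (1/3)" using wp by (simp add: R_def powr_minus divide_simps)
      have RR: "R * w powr (2/3) = w powr (1/3)" unfolding R_def by (subst powr_add[symmetric]) simp
      have hb: "w powr (2/3) / 2 \<le> h" unfolding h_def using wp wD by (simp add: powr_mono2)
      have "8 * R * (R * w / 2 * exp (R * w / 2) + D / R\<^sup>2 * M) + 116 * M\<^sup>2 / R
         = 4 * (R * w powr (2/3)) * exp (w powr (2/3) / 2) + 8 * D * M * (R * (1 / R\<^sup>2)) + 116 * M\<^sup>2 * (1 / R)"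
        unfolding Rw by (simp add: algebra_simps)
      also have "\<dots> = w powr (1/3) * (4 * exp (w powr (2/3) / 2) + 8 * D * M + 116 * M\<^sup>2)"
        unfolding R2 RR R1 by (simp add: algebra_simps)
      also have "\<dots> \<le> w powr (1/3) * C"
        unfolding C_def using hb D M0 by (intro mult_left_mono add_mono) auto
      finally have "8 * R * (R * w / 2 * exp (R * w / 2) + D / R\<^sup>2 * M) + 116 * M\<^sup>2 / R \<le> C * w powr (1/3)" by (simp add: mult.commute)
      then show ?thesis using key[OF R R] ennreal_leI order_trans by blast
    qed
    then have fin: "W2_sq (gibbs \<psi>) (gibbs \<phi>) \<noteq> \<infinity>" by (auto simp: top_unique)
    have "enn2real (W2_sq (gibbs \<psi>) (gibbs \<phi>)) \<le> C * w powr (1/3)" using enn2real_mono[OF bound] C0 by simp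
    then have "sqrt (enn2real (W2_sq (gibbs \<psi>) (gibbs \<phi>))) \<le> sqrt (C * w powr (1/3))" by simp
    also have "\<dots> = sqrt C * w powr (1/6)"
      by (simp add: real_sqrt_mult powr_half_sqrt[symmetric] powr_powr)
    also have "\<dots> \<le> A * w powr ((p - 2) / (6 * p - 4))"
    proof (cases "w = 0")
      case False
      have "w powr (1/6) \<le> max 1 (2 * D) * w powr ((p - 2) / (6 * p - 4))"
        using False w0 wD p by (intro powr_exponent_shift) auto
      then have "sqrt C * w powr (1/6) \<le> sqrt C * (max 1 (2 * D) * w powr ((p - 2) / (6 * p - 4)))" using C0 by (intro mult_left_mono) auto
      then show ?thesis by (simp add: A_def mult.assoc)
    qed simp
    finally have fb: "sqrt (enn2real (W2_sq (gibbs \<psi>) (gibbs \<phi>))) \<le> A * w powr ((p - 2) / (6 * p - 4))" .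
    have "dist_W2 (M_set \<mu>) (M_set \<nu>) \<le> W2 (gibbs \<psi>) (gibbs \<phi>)"
      unfolding dist_W2_def by (rule INF_lower2[OF g1], rule INF_lower[OF g2])
    also have "\<dots> = ennreal (sqrt (enn2real (W2_sq (gibbs \<psi>) (gibbs \<phi>))))" using fin by (simp add: W2_def)
    also have "\<dots> \<le> ennreal ((A + 0 * p) * enn2real (W2 \<mu> \<nu>) powr ((p - 2) / (6 * p - 4)))"
      using fb by (simp add: w_def ennreal_leI)
    finally show "dist_W2 (M_set \<mu>) (M_set \<nu>) \<le> ennreal ((A + 0 * p) * enn2real (W2 \<mu> \<nu>) powr ((p - 2) / (6 * p - 4)))" .
  qed
qed

end
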